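(* Let $k$ be $\mathbb{R}$ or $\mathbb{C}$. The categories $\mathrm{Ind}(\mathrm{SNorm}_k)$, $\mathrm{Ind}(\mathrm{Norm}_k)$ and $\mathrm{Ind}(\mathrm{Ban}_k)$ are Grothendieck quasi-abelian.
   Context: $\mathrm{SNorm}_k$ is the category of semi-normed spaces over $k$, a morphism $(V,\rho_V)\to(W,\rho_W)$ being a linear map $f$ with $\rho_W\circ f\le c\,\rho_V$ for some $c>0$; $\mathrm{Norm}_k$ and $\mathrm{Ban}_k$ are its full subcategories of normed and Banach spaces. $\mathrm{Ind}(-)$ denotes the category of ind-objects. A pre-abelian category is an additive category with kernels and cokernels. A morphism $f$ in it is strict if the canonical map $\mathrm{Coim} f=\mathrm{Coker}(\ker f)\to \mathrm{Im} f=\mathrm{Ker}(\mathrm{coker} f)$ is an isomorphism. A pre-abelian category is quasi-abelian if strict monomorphisms are stable under pushout along arbitrary morphisms and strict epimorphisms are stable under pullback along arbitrary morphisms. A quasi-abelian category is Grothendieck if it is locally presentable and its class of strict monomorphisms is closed under small filtered colimits. Set-theoretic conventions: Grothendieck universes $\mathbb{U}\in\mathbb{V}\in\mathbb{W}$ are fixed; spaces are $\mathbb{U}$-small, the categories $\mathrm{SNorm}_k,\mathrm{Norm}_k,\mathrm{Ban}_k$ are large ($\mathbb{V}$-small), ind-objects are $\mathbb{V}$-small, and "small" and "locally presentable" are relative to the appropriate universe. Vopěnka's principle is assumed, ensuring that a full reflective subcategory of a locally presentable category is locally presentable. *)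

theory Defs
  imports Complex_Main "HOL-Library.FuncSet" "HOL-Algebra.Module"
    "HOL-Algebra.Algebraic_Closure_Type"
begin

unbundle cardinal_syntax

(* this notation of HOL-Algebra would reserve the identifier X *)
no_notation var (\<open>X\<index>\<close>)

section \<open>Universes\<close>

text \<open>
  Grothendieck universes containing the natural numbers correspond to uncountable strongly
  inaccessible cardinals, a set being isomorphic to an element of the universe iff its cardinality
  is smaller than that cardinal.  A universe is represented here by a type of inaccessible
  cardinality.  That one universe \<open>'u\<close> is an element of another one \<open>'v\<close> is the statement
  \<open>small TYPE('v) (UNIV :: 'u set)\<close>.
\<close>

definition small :: "'v itself \<Rightarrow> 'a set \<Rightarrow> bool" where
  "small _ A \<longleftrightarrow> |A| <o |UNIV :: 'v set|"

definition grothendieck_universe :: "'v itself \<Rightarrow> bool" where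
  "grothendieck_universe V \<longleftrightarrow>
     small V (UNIV :: nat set) \<and>
     regularCard |UNIV :: 'v set| \<and>
     (\<forall>A :: 'v set. small V A \<longrightarrow> small V (Pow A))"

section \<open>Categories, diagrams and colimits\<close>

text \<open>\<open>Cmp C g f\<close> is the composite of \<open>g\<close> after \<open>f\<close>.\<close>

record ('o, 'm) cat =
  Obj :: "'o set"
  Arr :: "'m set"
  Dom :: "'m \<Rightarrow> 'o"
  Cod :: "'m \<Rightarrow> 'o"
  Idn :: "'o \<Rightarrow> 'm"
  Cmp :: "'m \<Rightarrow> 'm \<Rightarrow> 'm"

definition arrows :: "('o, 'm) cat \<Rightarrow> 'o \<Rightarrow> 'o \<Rightarrow> 'm set" where
  "arrows C X Y = {f \<in> Arr C. Dom C f = X \<and> Cod C f = Y}"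

locale category =
  fixes C :: "('o, 'm) cat"
  assumes Dom_Obj: "f \<in> Arr C \<Longrightarrow> Dom C f \<in> Obj C"
    and Cod_Obj: "f \<in> Arr C \<Longrightarrow> Cod C f \<in> Obj C"
    and Idn_arrows: "X \<in> Obj C \<Longrightarrow> Idn C X \<in> arrows C X X"
    and Cmp_arrows: "f \<in> arrows C X Y \<Longrightarrow> g \<in> arrows C Y Z \<Longrightarrow> Cmp C g f \<in> arrows C X Z"
    and Cmp_Idn_left: "f \<in> arrows C X Y \<Longrightarrow> Cmp C (Idn C Y) f = f"
    and Cmp_Idn_right: "f \<in> arrows C X Y \<Longrightarrow> Cmp C f (Idn C X) = f"
    and Cmp_assoc: "f \<in> arrows C W X \<Longrightarrow> g \<in> arrows C X Y \<Longrightarrow> h \<in> arrows C Y Z \<Longrightarrow>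
        Cmp C h (Cmp C g f) = Cmp C (Cmp C h g) f"

definition full_subcat :: "('o, 'm) cat \<Rightarrow> ('o \<Rightarrow> bool) \<Rightarrow> ('o, 'm) cat" where
  "full_subcat C P = C\<lparr>Obj := {X \<in> Obj C. P X}, Arr := {f \<in> Arr C. P (Dom C f) \<and> P (Cod C f)}\<rparr>"

text \<open>A diagram is a functor together with its indexing category.\<close>

record ('i, 'a, 'o, 'm) diagram =
  Shape :: "('i, 'a) cat"
  DObj :: "'i \<Rightarrow> 'o"
  DArr :: "'a \<Rightarrow> 'm"

definition is_diagram :: "('o, 'm) cat \<Rightarrow> ('i, 'a, 'o, 'm) diagram \<Rightarrow> bool" where
  "is_diagram C D \<longleftrightarrow>
     category (Shape D) \<and>
     (\<forall>i \<in> Obj (Shape D). DObj D i \<in> Obj C \<and> DArr D (Idn (Shape D) i) = Idn C (DObj D i)) \<and>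
     (\<forall>a \<in> Arr (Shape D).
        DArr D a \<in> arrows C (DObj D (Dom (Shape D) a)) (DObj D (Cod (Shape D) a))) \<and>
     (\<forall>a \<in> Arr (Shape D). \<forall>b \<in> Arr (Shape D). Cod (Shape D) a = Dom (Shape D) b \<longrightarrow>
        DArr D (Cmp (Shape D) b a) = Cmp C (DArr D b) (DArr D a))"

definition is_cocone ::
    "('o, 'm) cat \<Rightarrow> ('i, 'a, 'o, 'm) diagram \<Rightarrow> 'o \<Rightarrow> ('i \<Rightarrow> 'm) \<Rightarrow> bool" where
  "is_cocone C D X \<psi> \<longleftrightarrow>
     X \<in> Obj C \<and>
     (\<forall>i \<in> Obj (Shape D). \<psi> i \<in> arrows C (DObj D i) X) \<and>
     (\<forall>a \<in> Arr (Shape D). Cmp C (\<psi> (Cod (Shape D) a)) (DArr D a) = \<psi> (Dom (Shape D) a))"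

definition is_colimit ::
    "('o, 'm) cat \<Rightarrow> ('i, 'a, 'o, 'm) diagram \<Rightarrow> 'o \<Rightarrow> ('i \<Rightarrow> 'm) \<Rightarrow> bool" where
  "is_colimit C D X \<psi> \<longleftrightarrow>
     is_cocone C D X \<psi> \<and>
     (\<forall>Y \<phi>. is_cocone C D Y \<phi> \<longrightarrow>
        (\<exists>!u. u \<in> arrows C X Y \<and> (\<forall>i \<in> Obj (Shape D). Cmp C u (\<psi> i) = \<phi> i)))"

definition filtered :: "('i, 'a) cat \<Rightarrow> bool" where
  "filtered I \<longleftrightarrow>
     category I \<and> Obj I \<noteq> {} \<and>
     (\<forall>i \<in> Obj I. \<forall>j \<in> Obj I. \<exists>l a b. a \<in> arrows I i l \<and> b \<in> arrows I j l) \<and>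
     (\<forall>i \<in> Obj I. \<forall>j \<in> Obj I. \<forall>a \<in> arrows I i j. \<forall>b \<in> arrows I i j.
        \<exists>l c. c \<in> arrows I j l \<and> Cmp I c a = Cmp I c b)"

definition small_cat :: "'v itself \<Rightarrow> ('o, 'm) cat \<Rightarrow> bool" where
  "small_cat V C \<longleftrightarrow> category C \<and> small V (Obj C) \<and> small V (Arr C)"

text \<open>
  For a filtered diagram \<open>D\<close>, the set \<open>colim_hom C D X\<close> is the filtered colimit of the sets of
  arrows from \<open>X\<close> to the \<open>DObj D j\<close>.
\<close>

definition colim_hom_rel ::
    "('o, 'm) cat \<Rightarrow> ('i, 'a, 'o, 'm) diagram \<Rightarrow> 'o \<Rightarrow> (('i \<times> 'm) \<times> ('i \<times> 'm)) set" where
  "colim_hom_rel C D X =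
     {((j, f), (l, g)). j \<in> Obj (Shape D) \<and> l \<in> Obj (Shape D) \<and>
        f \<in> arrows C X (DObj D j) \<and> g \<in> arrows C X (DObj D l) \<and>
        (\<exists>m a b. a \<in> arrows (Shape D) j m \<and> b \<in> arrows (Shape D) l m \<and>
           Cmp C (DArr D a) f = Cmp C (DArr D b) g)}"

definition colim_hom :: "('o, 'm) cat \<Rightarrow> ('i, 'a, 'o, 'm) diagram \<Rightarrow> 'o \<Rightarrow> ('i \<times> 'm) set set" where
  "colim_hom C D X =
     (SIGMA j : Obj (Shape D). arrows C X (DObj D j)) // colim_hom_rel C D X"

section \<open>Ind-objects\<close>

text \<open>
  The set of arrows from \<open>(X\<^sub>i)\<close> to \<open>(Y\<^sub>j)\<close> is the limit over \<open>i\<close> of the colimits over \<open>j\<close> of the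
  sets of arrows from \<open>X\<^sub>i\<close> to \<open>Y\<^sub>j\<close>.  Elements of the limit are compatible families of equivalence
  classes; arrows also record their domain and codomain.
\<close>

type_synonym ('v, 'o, 'm) ind_ob = "('v, 'v, 'o, 'm) diagram"

type_synonym ('v, 'o, 'm) ind_arr =
  "('v, 'o, 'm) ind_ob \<times> ('v \<Rightarrow> ('v \<times> 'm) set) \<times> ('v, 'o, 'm) ind_ob"

definition ind_obj :: "('o, 'm) cat \<Rightarrow> ('v, 'o, 'm) ind_ob \<Rightarrow> bool" where
  "ind_obj C D \<longleftrightarrow> is_diagram C D \<and> filtered (Shape D) \<and> small_cat TYPE('v) (Shape D)"

definition ind_hom ::
    "('o, 'm) cat \<Rightarrow> ('v, 'o, 'm) ind_ob \<Rightarrow> ('v, 'o, 'm) ind_ob \<Rightarrow> ('v \<Rightarrow> ('v \<times> 'm) set) set" where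
  "ind_hom C X Y =
     {\<phi> \<in> (\<Pi>\<^sub>E i \<in> Obj (Shape X). colim_hom C Y (DObj X i)).
        \<forall>a \<in> Arr (Shape X). \<forall>(j, f) \<in> \<phi> (Cod (Shape X) a).
          (j, Cmp C f (DArr X a)) \<in> \<phi> (Dom (Shape X) a)}"

definition ind_id :: "('o, 'm) cat \<Rightarrow> ('v, 'o, 'm) ind_ob \<Rightarrow> ('v \<Rightarrow> ('v \<times> 'm) set)" where
  "ind_id C X =
     (\<lambda>i \<in> Obj (Shape X). colim_hom_rel C X (DObj X i) `` {(i, Idn C (DObj X i))})"

definition ind_comp ::
    "('o, 'm) cat \<Rightarrow> ('v, 'o, 'm) ind_ob \<Rightarrow> ('v, 'o, 'm) ind_ob \<Rightarrow>
     ('v \<Rightarrow> ('v \<times> 'm) set) \<Rightarrow> ('v \<Rightarrow> ('v \<times> 'm) set) \<Rightarrow> ('v \<Rightarrow> ('v \<times> 'm) set)" where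
  "ind_comp C X Z \<gamma> \<phi> =
     (\<lambda>i \<in> Obj (Shape X). colim_hom_rel C Z (DObj X i) ``
        {(l, Cmp C g f) | j f l g. (j, f) \<in> \<phi> i \<and> (l, g) \<in> \<gamma> j})"

definition Ind :: "'v itself \<Rightarrow> ('o, 'm) cat \<Rightarrow> (('v, 'o, 'm) ind_ob, ('v, 'o, 'm) ind_arr) cat" where
  "Ind _ C =
     \<lparr>Obj = {X. ind_obj C X},
      Arr = {(X, \<phi>, Y). ind_obj C X \<and> ind_obj C Y \<and> \<phi> \<in> ind_hom C X Y},
      Dom = (\<lambda>(X, _, _). X),
      Cod = (\<lambda>(_, _, Y). Y),
      Idn = (\<lambda>X. (X, ind_id C X, X)),
      Cmp = (\<lambda>(_, \<gamma>, Z) (X, \<phi>, _). (X, ind_comp C X Z \<gamma> \<phi>, Z))\<rparr>"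

section \<open>Quasi-abelian categories\<close>

definition monic :: "('o, 'm) cat \<Rightarrow> 'm \<Rightarrow> bool" where
  "monic C f \<longleftrightarrow> f \<in> Arr C \<and>
     (\<forall>W. \<forall>g \<in> arrows C W (Dom C f). \<forall>h \<in> arrows C W (Dom C f). Cmp C f g = Cmp C f h \<longrightarrow> g = h)"

definition epic :: "('o, 'm) cat \<Rightarrow> 'm \<Rightarrow> bool" where
  "epic C f \<longleftrightarrow> f \<in> Arr C \<and>
     (\<forall>W. \<forall>g \<in> arrows C (Cod C f) W. \<forall>h \<in> arrows C (Cod C f) W. Cmp C g f = Cmp C h f \<longrightarrow> g = h)"

definition iso_arrow :: "('o, 'm) cat \<Rightarrow> 'm \<Rightarrow> bool" where
  "iso_arrow C f \<longleftrightarrow> f \<in> Arr C \<and>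
     (\<exists>g \<in> arrows C (Cod C f) (Dom C f).
        Cmp C g f = Idn C (Dom C f) \<and> Cmp C f g = Idn C (Cod C f))"

definition zero_obj :: "('o, 'm) cat \<Rightarrow> 'o \<Rightarrow> bool" where
  "zero_obj C Z \<longleftrightarrow> Z \<in> Obj C \<and>
     (\<forall>X \<in> Obj C. (\<exists>!f. f \<in> arrows C X Z) \<and> (\<exists>!f. f \<in> arrows C Z X))"

definition zero_arrow :: "('o, 'm) cat \<Rightarrow> 'm \<Rightarrow> bool" where
  "zero_arrow C f \<longleftrightarrow> f \<in> Arr C \<and>
     (\<exists>Z g h. zero_obj C Z \<and> g \<in> arrows C (Dom C f) Z \<and> h \<in> arrows C Z (Cod C f) \<and> f = Cmp C h g)"

definition is_product :: "('o, 'm) cat \<Rightarrow> 'o \<Rightarrow> 'o \<Rightarrow> 'o \<Rightarrow> 'm \<Rightarrow> 'm \<Rightarrow> bool" where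
  "is_product C X Y P p q \<longleftrightarrow>
     p \<in> arrows C P X \<and> q \<in> arrows C P Y \<and>
     (\<forall>W. \<forall>f \<in> arrows C W X. \<forall>g \<in> arrows C W Y.
        \<exists>!u. u \<in> arrows C W P \<and> Cmp C p u = f \<and> Cmp C q u = g)"

definition preadditive_structure ::
    "('o, 'm) cat \<Rightarrow> ('m \<Rightarrow> 'm \<Rightarrow> 'm) \<Rightarrow> ('o \<Rightarrow> 'o \<Rightarrow> 'm) \<Rightarrow> bool" where
  "preadditive_structure C pl nul \<longleftrightarrow>
     (\<forall>X \<in> Obj C. \<forall>Y \<in> Obj C. comm_group \<lparr>carrier = arrows C X Y, monoid.mult = pl, one = nul X Y\<rparr>) \<and>
     (\<forall>X Y Z. \<forall>f \<in> arrows C X Y. \<forall>f' \<in> arrows C X Y. \<forall>g \<in> arrows C Y Z. \<forall>g' \<in> arrows C Y Z.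
        Cmp C g (pl f f') = pl (Cmp C g f) (Cmp C g f') \<and>
        Cmp C (pl g g') f = pl (Cmp C g f) (Cmp C g' f))"

definition additive :: "('o, 'm) cat \<Rightarrow> bool" where
  "additive C \<longleftrightarrow>
     category C \<and>
     (\<exists>pl nul. preadditive_structure C pl nul) \<and>
     (\<exists>Z. zero_obj C Z) \<and>
     (\<forall>X \<in> Obj C. \<forall>Y \<in> Obj C. \<exists>P p q. is_product C X Y P p q)"

definition is_kernel :: "('o, 'm) cat \<Rightarrow> 'm \<Rightarrow> 'm \<Rightarrow> bool" where
  "is_kernel C f k \<longleftrightarrow>
     f \<in> Arr C \<and> k \<in> Arr C \<and> Cod C k = Dom C f \<and> zero_arrow C (Cmp C f k) \<and>
     (\<forall>h \<in> Arr C. Cod C h = Dom C f \<and> zero_arrow C (Cmp C f h) \<longrightarrow>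
        (\<exists>!u. u \<in> arrows C (Dom C h) (Dom C k) \<and> Cmp C k u = h))"

definition is_cokernel :: "('o, 'm) cat \<Rightarrow> 'm \<Rightarrow> 'm \<Rightarrow> bool" where
  "is_cokernel C f c \<longleftrightarrow>
     f \<in> Arr C \<and> c \<in> Arr C \<and> Dom C c = Cod C f \<and> zero_arrow C (Cmp C c f) \<and>
     (\<forall>h \<in> Arr C. Dom C h = Cod C f \<and> zero_arrow C (Cmp C h f) \<longrightarrow>
        (\<exists>!u. u \<in> arrows C (Cod C c) (Cod C h) \<and> Cmp C u c = h))"

definition pre_abelian :: "('o, 'm) cat \<Rightarrow> bool" where
  "pre_abelian C \<longleftrightarrow>
     additive C \<and> (\<forall>f \<in> Arr C. (\<exists>k. is_kernel C f k) \<and> (\<exists>c. is_cokernel C f c))"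

text \<open>
  Here \<open>p\<close> is the coimage projection, \<open>m\<close> the image inclusion, and \<open>u\<close> the canonical map from the
  coimage to the image, determined by \<open>f = m \<circ> u \<circ> p\<close>.
\<close>

definition strict :: "('o, 'm) cat \<Rightarrow> 'm \<Rightarrow> bool" where
  "strict C f \<longleftrightarrow>
     (\<exists>k p c m u. is_kernel C f k \<and> is_cokernel C k p \<and> is_cokernel C f c \<and> is_kernel C c m \<and>
        u \<in> arrows C (Cod C p) (Dom C m) \<and> Cmp C m (Cmp C u p) = f \<and> iso_arrow C u)"

definition strict_monic :: "('o, 'm) cat \<Rightarrow> 'm \<Rightarrow> bool" where
  "strict_monic C f \<longleftrightarrow> monic C f \<and> strict C f"

definition strict_epic :: "('o, 'm) cat \<Rightarrow> 'm \<Rightarrow> bool" where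
  "strict_epic C f \<longleftrightarrow> epic C f \<and> strict C f"

definition is_pushout :: "('o, 'm) cat \<Rightarrow> 'm \<Rightarrow> 'm \<Rightarrow> 'm \<Rightarrow> 'm \<Rightarrow> bool" where
  "is_pushout C f g f' g' \<longleftrightarrow>
     f \<in> Arr C \<and> g \<in> Arr C \<and> f' \<in> Arr C \<and> g' \<in> Arr C \<and>
     Dom C f = Dom C g \<and> Dom C g' = Cod C f \<and> Dom C f' = Cod C g \<and> Cod C f' = Cod C g' \<and>
     Cmp C g' f = Cmp C f' g \<and>
     (\<forall>W. \<forall>x \<in> arrows C (Cod C f) W. \<forall>y \<in> arrows C (Cod C g) W. Cmp C x f = Cmp C y g \<longrightarrow>
        (\<exists>!u. u \<in> arrows C (Cod C f') W \<and> Cmp C u g' = x \<and> Cmp C u f' = y))"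

definition is_pullback :: "('o, 'm) cat \<Rightarrow> 'm \<Rightarrow> 'm \<Rightarrow> 'm \<Rightarrow> 'm \<Rightarrow> bool" where
  "is_pullback C f g f' g' \<longleftrightarrow>
     f \<in> Arr C \<and> g \<in> Arr C \<and> f' \<in> Arr C \<and> g' \<in> Arr C \<and>
     Cod C f = Cod C g \<and> Cod C g' = Dom C f \<and> Cod C f' = Dom C g \<and> Dom C f' = Dom C g' \<and>
     Cmp C f g' = Cmp C g f' \<and>
     (\<forall>W. \<forall>x \<in> arrows C W (Dom C f). \<forall>y \<in> arrows C W (Dom C g). Cmp C f x = Cmp C g y \<longrightarrow>
        (\<exists>!u. u \<in> arrows C W (Dom C f') \<and> Cmp C g' u = x \<and> Cmp C f' u = y))"

text \<open>In both squares \<open>f'\<close> is the edge parallel to \<open>f\<close>.\<close>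

definition quasi_abelian :: "('o, 'm) cat \<Rightarrow> bool" where
  "quasi_abelian C \<longleftrightarrow>
     pre_abelian C \<and>
     (\<forall>f g f' g'. is_pushout C f g f' g' \<and> strict_monic C f \<longrightarrow> strict_monic C f') \<and>
     (\<forall>f g f' g'. is_pullback C f g f' g' \<and> strict_epic C f \<longrightarrow> strict_epic C f')"

section \<open>Locally presentable and Grothendieck categories\<close>

text \<open>
  Smallness is relative to the universe given by \<open>'v\<close>.  Every small category is isomorphic to one
  with objects and arrows in \<open>'v\<close>, so it suffices to consider diagrams with such shapes.  A small
  infinite regular cardinal is given by a relation \<open>r\<close> on \<open>'v\<close>.
\<close>

definition small_diagram :: "('o, 'm) cat \<Rightarrow> ('v, 'v, 'o, 'm) diagram \<Rightarrow> bool" where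
  "small_diagram C D \<longleftrightarrow> is_diagram C D \<and> small_cat TYPE('v) (Shape D)"

definition small_regular_cardinal :: "'v rel \<Rightarrow> bool" where
  "small_regular_cardinal r \<longleftrightarrow> Cinfinite r \<and> regularCard r \<and> r <o |UNIV :: 'v set|"

definition card_filtered :: "'v rel \<Rightarrow> ('v, 'v) cat \<Rightarrow> bool" where
  "card_filtered r I \<longleftrightarrow>
     category I \<and>
     (\<forall>D :: ('v, 'v, 'v, 'v) diagram. is_diagram I D \<and> |Arr (Shape D)| <o r \<longrightarrow>
        (\<exists>i \<psi>. is_cocone I D i \<psi>))"

text \<open>
  \<open>K\<close> is \<open>r\<close>-presentable if the functor of arrows from \<open>K\<close> preserves \<open>r\<close>-filtered colimits.  The
  canonical map sends the class of \<open>(j, f)\<close> to \<open>\<psi>\<^sub>j \<circ> f\<close>.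
\<close>

definition presentable :: "'v rel \<Rightarrow> ('o, 'm) cat \<Rightarrow> 'o \<Rightarrow> bool" where
  "presentable r C K \<longleftrightarrow>
     K \<in> Obj C \<and>
     (\<forall>(D :: ('v, 'v, 'o, 'm) diagram) X \<psi>.
        small_diagram C D \<and> card_filtered r (Shape D) \<and> is_colimit C D X \<psi> \<longrightarrow>
        bij_betw (\<lambda>c. the_elem ((\<lambda>(j, f). Cmp C (\<psi> j) f) ` c)) (colim_hom C D K) (arrows C K X))"

definition locally_presentable :: "'v itself \<Rightarrow> ('o, 'm) cat \<Rightarrow> bool" where
  "locally_presentable V C \<longleftrightarrow>
     category C \<and>
     (\<forall>X \<in> Obj C. \<forall>Y \<in> Obj C. small V (arrows C X Y)) \<and>
     (\<forall>D :: ('v, 'v, 'o, 'm) diagram. small_diagram C D \<longrightarrow> (\<exists>X \<psi>. is_colimit C D X \<psi>)) \<and>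
     (\<exists>(r :: 'v rel) S. small_regular_cardinal r \<and> small V S \<and> (\<forall>K \<in> S. presentable r C K) \<and>
        (\<forall>X \<in> Obj C. \<exists>(D :: ('v, 'v, 'o, 'm) diagram) \<psi>.
           small_diagram C D \<and> card_filtered r (Shape D) \<and> DObj D ` Obj (Shape D) \<subseteq> S \<and>
           is_colimit C D X \<psi>))"

text \<open>
  Closure under colimits is meant in the category of arrows: \<open>t\<close> is a natural transformation and
  \<open>u\<close> the arrow it induces on colimits.
\<close>

definition strict_monics_closed_filtered_colimits :: "'v itself \<Rightarrow> ('o, 'm) cat \<Rightarrow> bool" where
  "strict_monics_closed_filtered_colimits V C \<longleftrightarrow>
     (\<forall>(D :: ('v, 'v, 'o, 'm) diagram) (E :: ('v, 'v, 'o, 'm) diagram) t X \<phi> Y \<psi> u.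
        small_diagram C D \<and> small_diagram C E \<and> Shape E = Shape D \<and> filtered (Shape D) \<and>
        (\<forall>i \<in> Obj (Shape D). t i \<in> arrows C (DObj D i) (DObj E i) \<and> strict_monic C (t i)) \<and>
        (\<forall>a \<in> Arr (Shape D).
           Cmp C (t (Cod (Shape D) a)) (DArr D a) = Cmp C (DArr E a) (t (Dom (Shape D) a))) \<and>
        is_colimit C D X \<phi> \<and> is_colimit C E Y \<psi> \<and>
        u \<in> arrows C X Y \<and> (\<forall>i \<in> Obj (Shape D). Cmp C u (\<phi> i) = Cmp C (\<psi> i) (t i)) \<longrightarrow>
        strict_monic C u)"

definition grothendieck_quasi_abelian :: "'v itself \<Rightarrow> ('o, 'm) cat \<Rightarrow> bool" where
  "grothendieck_quasi_abelian V C \<longleftrightarrow>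
     quasi_abelian C \<and> locally_presentable V C \<and> strict_monics_closed_filtered_colimits V C"

section \<open>Semi-normed spaces\<close>

text \<open>
  Vector spaces are modules over the scalar field.  The multiplicative fields \<open>mult\<close> and \<open>one\<close>
  inherited by the module record, and values outside the carrier, carry no information.
\<close>

record ('k, 'u) sn_space = "('k, 'u) module" +
  seminorm :: "'u \<Rightarrow> real"

type_synonym ('k, 'u) sn_arr = "('k, 'u) sn_space \<times> ('u \<Rightarrow> 'u) \<times> ('k, 'u) sn_space"

definition seminormed :: "('k::real_normed_field, 'u) sn_space \<Rightarrow> bool" where
  "seminormed V \<longleftrightarrow>
     module (ring_of_type_algebra :: 'k ring) V \<and>
     (\<forall>x \<in> carrier V. 0 \<le> seminorm V x) \<and>
     (\<forall>c. \<forall>x \<in> carrier V. seminorm V (c \<odot>\<^bsub>V\<^esub> x) = norm c * seminorm V x) \<and>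
     (\<forall>x \<in> carrier V. \<forall>y \<in> carrier V. seminorm V (x \<oplus>\<^bsub>V\<^esub> y) \<le> seminorm V x + seminorm V y)"

definition bounded_linear_map ::
    "('k, 'u) sn_space \<Rightarrow> ('k, 'u) sn_space \<Rightarrow> ('u \<Rightarrow> 'u) \<Rightarrow> bool" where
  "bounded_linear_map V W f \<longleftrightarrow>
     f \<in> carrier V \<rightarrow>\<^sub>E carrier W \<and>
     (\<forall>x \<in> carrier V. \<forall>y \<in> carrier V. f (x \<oplus>\<^bsub>V\<^esub> y) = f x \<oplus>\<^bsub>W\<^esub> f y) \<and>
     (\<forall>c. \<forall>x \<in> carrier V. f (c \<odot>\<^bsub>V\<^esub> x) = c \<odot>\<^bsub>W\<^esub> f x) \<and>
     (\<exists>c>0. \<forall>x \<in> carrier V. seminorm W (f x) \<le> c * seminorm V x)"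

definition SNorm ::
    "'k::real_normed_field itself \<Rightarrow> 'u itself \<Rightarrow> (('k, 'u) sn_space, ('k, 'u) sn_arr) cat" where
  "SNorm _ U =
     (let S = {V. seminormed V \<and> small U (carrier V)} in
     \<lparr>Obj = S,
      Arr = {(V, f, W). V \<in> S \<and> W \<in> S \<and> bounded_linear_map V W f},
      Dom = (\<lambda>(V, _, _). V),
      Cod = (\<lambda>(_, _, W). W),
      Idn = (\<lambda>V. (V, \<lambda>x \<in> carrier V. x, V)),
      Cmp = (\<lambda>(_, g, W) (V, f, _). (V, compose (carrier V) g f, W))\<rparr>)"

definition norm_separated :: "('k, 'u) sn_space \<Rightarrow> bool" where
  "norm_separated V \<longleftrightarrow> (\<forall>x \<in> carrier V. seminorm V x = 0 \<longrightarrow> x = \<zero>\<^bsub>V\<^esub>)"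

definition norm_complete :: "('k, 'u) sn_space \<Rightarrow> bool" where
  "norm_complete V \<longleftrightarrow>
     (\<forall>s :: nat \<Rightarrow> 'u. range s \<subseteq> carrier V \<and>
        (\<forall>e>0. \<exists>N. \<forall>m\<ge>N. \<forall>n\<ge>N. seminorm V (s m \<ominus>\<^bsub>V\<^esub> s n) < e) \<longrightarrow>
        (\<exists>x \<in> carrier V. (\<lambda>n. seminorm V (s n \<ominus>\<^bsub>V\<^esub> x)) \<longlonglongrightarrow> 0))"

definition Norm ::
    "'k::real_normed_field itself \<Rightarrow> 'u itself \<Rightarrow> (('k, 'u) sn_space, ('k, 'u) sn_arr) cat" where
  "Norm K U = full_subcat (SNorm K U) norm_separated"

definition Ban ::
    "'k::real_normed_field itself \<Rightarrow> 'u itself \<Rightarrow> (('k, 'u) sn_space, ('k, 'u) sn_arr) cat" where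
  "Ban K U = full_subcat (SNorm K U) (\<lambda>V. norm_separated V \<and> norm_complete V)"

end

theory Submission
  imports Defs "HOL-Library.Countable"
begin

text \<open>
  All three categories of spaces are additive with small sets of objects and arrows.  Open surjections
  (quotient maps) are cokernels and lift weakly along arbitrary maps, and every map factors through
  the kernel of its cokernel by an epimorphism; for normed and Banach spaces the latter kernel is the
  closure of the image.  These are the only facts about \<open>C\<close> that are needed.

  An object \<open>X\<close> of \<open>Ind C\<close> is determined by its elements, the arrows from constant ind-objects to
  \<open>X\<close>, which are computed as in a filtered colimit.  The functors on \<open>C\<close> arising in this way are the
  small additive ones that send cokernels to kernels, which gives kernels and products elementwise.
  The quotient of \<open>X\<close> by a family of elements is the filtered colimit of the cokernels of the arrows
  \<open>a\<close> of \<open>C\<close>, indexed by the elements \<open>y\<close> of \<open>X\<close> such that \<open>y \<circ> a\<close> lies in the family.  Hence an arrow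
  of \<open>Ind C\<close> is a strict epimorphism iff the elements of its target lift after composition with an
  open surjection, a condition stable under pullback.  Stability of strict monomorphisms under pushout
  follows by comparison with a quotient of a product.  Elements commute with filtered colimits, so
  strict monomorphisms are closed under them and the constant ind-objects form a small set of
  finitely presentable objects generating \<open>Ind C\<close> under filtered colimits.
\<close>

section \<open>Small sets\<close>

text \<open>For small \<open>C\<close> with finite colimits, \<open>Ind C\<close> is the category of
  left exact functors on the opposite of \<open>C\<close>. Reading arrows as natural maps of
  elements avoids straightening them into levelwise form. A functor is representable once its
  category of elements is filtered: biproducts give upper bounds, and since two arrows
  \<open>f\<close>, \<open>g\<close> are equalized by the cokernel of \<open>f - g\<close>,
  additivity together with descent along cokernels is enough. The obstacle is that pointwise
  quotients violate this descent. Quotients therefore have to be assembled from cokernels inside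
  \<open>C\<close>, and one has to know which elements they kill: those that factor through the
  kernel of the cokernel of a relation \<open>a\<close>, and in the normed and Banach cases this
  kernel is the closure of the image of \<open>a\<close>. What is known on the image must be carried
  over to the closure; this is the use of the epimorphism in the factorization of \<open>a\<close>,
  and it is decisive for the injectivity of pushouts of strict monomorphisms. All tests involve a
  single arrow of \<open>C\<close> and finitely many elements, which is why they pass to filtered
  colimits.\<close>

lemma small_subset: "A \<subseteq> B ==> small V B ==> small V A"
  unfolding small_def using card_of_mono1 ordLeq_ordLess_trans by blast

lemma small_image: "small V A ==> small V (f ` A)"
  unfolding small_def using card_of_image ordLeq_ordLess_trans by blast

lemma small_inj_on:
  assumes "inj_on f A" "f ` A \<subseteq> B" "small V B"
  shows "small V A"
  using assms card_of_ordLeq[of A B] ordLeq_ordLess_trans unfolding small_def by blast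

lemma small_embedding:
  assumes "small TYPE('v) (A :: 'a set)"
  shows "\<exists>f :: 'a \<Rightarrow> 'v. inj_on f A"
  using assms card_of_ordLeq[of A "UNIV :: 'v set"] ordLess_imp_ordLeq unfolding small_def by blast

text \<open>The argument \<open>V\<close> has no content besides its type; it keeps the type
  variable \<open>'v\<close> fixed throughout the context.\<close>

locale universe =
  fixes V :: "'v itself"
  assumes universe: "grothendieck_universe TYPE('v)"
begin

lemma infinite_universe: "infinite (UNIV :: 'v set)"
  using universe card_of_ordLeq_infinite[of "UNIV :: nat set" "UNIV :: 'v set"] ordLess_imp_ordLeq
  unfolding grothendieck_universe_def small_def by blast

lemma small_finite: "finite A ==> small TYPE('v) A"
  unfolding small_def using finite_ordLess_infinite[OF card_of_Well_order card_of_Well_order]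
    infinite_universe by (metis Field_card_of)

text \<open>Regularity of an infinite cardinal amounts to stability: sums of fewer than that many
  smaller sets stay smaller. Binary products and small unions are special cases or images of such
  sums.\<close>

lemma small_Sigma:
  assumes "small TYPE('v) A" "\<And>a. a \<in> A ==> small TYPE('v) (B a)"
  shows "small TYPE('v) (Sigma A B)"
proof -
  have "stable |UNIV :: 'v set|"
    using universe regularCard_stable[OF card_of_Card_order, of "UNIV :: 'v set"] infinite_universe
    unfolding grothendieck_universe_def by (simp add: Field_card_of)
  then show ?thesis
    using assms stable_elim unfolding small_def by blast
qed

lemma small_Times: "small TYPE('v) A ==> small TYPE('v) B ==> small TYPE('v) (A \<times> B)"
  by (rule small_Sigma)

lemma small_UN:
  assumes "small TYPE('v) A" "\<And>a. a \<in> A ==> small TYPE('v) (B a)"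
  shows "small TYPE('v) (\<Union>a\<in>A. B a)"
proof -
  have "(\<Union>a\<in>A. B a) = snd ` Sigma A B" by force
  then show ?thesis using small_image[OF small_Sigma[OF assms]] by simp
qed

lemma small_Pow:
  assumes "small TYPE('v) A"
  shows "small TYPE('v) (Pow A)"
proof -
  obtain f :: "_ \<Rightarrow> 'v" where f: "inj_on f A" using small_embedding[OF assms] by blast
  have "small TYPE('v) (Pow (f ` A))"
    using universe small_image[OF assms, of f] unfolding grothendieck_universe_def by blast
  moreover have "inj_on ((`) f) (Pow A)" "(`) f ` Pow A \<subseteq> Pow (f ` A)"
    using f by (auto intro: inj_on_image_Pow)
  ultimately show ?thesis by (rule small_inj_on[rotated 2])
qed

text \<open>Graphs embed the product into the power set of a small sum, and strong inaccessibility
  keeps that power set small.\<close>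

lemma small_PiE:
  assumes "small TYPE('v) A" "\<And>a. a \<in> A ==> small TYPE('v) (B a)"
  shows "small TYPE('v) (PiE A B)"
proof (rule small_inj_on)
  show "inj_on (\<lambda>f. (\<lambda>a. (a, f a)) ` A) (PiE A B)"
  proof (rule inj_onI)
    fix f g assume fg: "f \<in> PiE A B" "g \<in> PiE A B" "(\<lambda>a. (a, f a)) ` A = (\<lambda>a. (a, g a)) ` A"
    show "f = g"
    proof (rule PiE_ext[OF fg(1,2)])
      fix a assume "a \<in> A"
      then have "(a, f a) \<in> (\<lambda>a. (a, g a)) ` A" using fg(3) by blast
      then show "f a = g a" by auto
    qed
  qed
  show "(\<lambda>f. (\<lambda>a. (a, f a)) ` A) ` PiE A B \<subseteq> Pow (Sigma A B)" by auto
qed (rule small_Pow[OF small_Sigma[OF assms]])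

end

section \<open>Preadditive categories\<close>

lemma arrows_iff: "f \<in> arrows C X Y \<longleftrightarrow> f \<in> Arr C \<and> Dom C f = X \<and> Cod C f = Y"
  by (simp add: arrows_def)

lemma Arr_arrows: "f \<in> Arr C ==> f \<in> arrows C (Dom C f) (Cod C f)"
  by (simp add: arrows_def)

context category
begin

lemma arrows_ObjD:
  assumes "f \<in> arrows C X Y"
  shows "X \<in> Obj C" "Y \<in> Obj C"
  using assms Dom_Obj Cod_Obj by (auto simp: arrows_def)

lemma Cmp_Arr:
  assumes "f \<in> Arr C" "g \<in> Arr C" "Cod C f = Dom C g"
  shows "Cmp C g f \<in> Arr C" "Dom C (Cmp C g f) = Dom C f" "Cod C (Cmp C g f) = Cod C g"
  using Cmp_arrows[of f "Dom C f" "Cod C f" g "Cod C g"] assms by (auto simp: arrows_def)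

lemma Idn_Arr:
  assumes "X \<in> Obj C"
  shows "Idn C X \<in> Arr C" "Dom C (Idn C X) = X" "Cod C (Idn C X) = X"
  using Idn_arrows[OF assms] by (auto simp: arrows_def)

lemma Cmp_assoc_Arr:
  "f \<in> Arr C ==> g \<in> Arr C ==> h \<in> Arr C ==> Cod C f = Dom C g ==> Cod C g = Dom C h ==>
   Cmp C (Cmp C h g) f = Cmp C h (Cmp C g f)"
  using Cmp_assoc[of f "Dom C f" "Cod C f" g "Cod C g" h "Cod C h"] by (auto simp: arrows_def)

lemma Cmp_Idn_Arr:
  assumes "f \<in> Arr C"
  shows "Cod C f = X ==> Cmp C (Idn C X) f = f" "Dom C f = X ==> Cmp C f (Idn C X) = f"
  using Cmp_Idn_left[of f "Dom C f" "Cod C f"] Cmp_Idn_right[of f "Dom C f" "Cod C f"] assms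
  by (auto simp: arrows_def)

lemma Cmp_cancel_mid:
  assumes "f \<in> arrows C X Y" "u \<in> arrows C Y Z" "v \<in> arrows C Z Y" "g \<in> arrows C Y W"
    "Cmp C v u = Idn C Y"
  shows "Cmp C (Cmp C g v) (Cmp C u f) = Cmp C g f"
  using Cmp_assoc[OF Cmp_arrows[OF assms(1,2)] assms(3,4)] Cmp_assoc[OF assms(1-3)]
    Cmp_Idn_left[OF assms(1)] assms(5) by simp

lemmas cat_simps = arrows_iff Cmp_Arr Idn_Arr Cmp_assoc_Arr Cmp_Idn_Arr Dom_Obj Cod_Obj

end

text \<open>Addition, negation and zero are operations on all arrows rather than on each set of
  arrows, so that for the completion they can be defined outright and then shown to satisfy these
  laws.\<close>

locale preadditive = category C for C :: "('o, 'm) cat" +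
  fixes pl :: "'m \<Rightarrow> 'm \<Rightarrow> 'm" and neg :: "'m \<Rightarrow> 'm" and nul :: "'o \<Rightarrow> 'o \<Rightarrow> 'm"
  assumes pl_arrows: "f \<in> arrows C X Y ==> g \<in> arrows C X Y ==> pl f g \<in> arrows C X Y"
    and neg_arrows: "f \<in> arrows C X Y ==> neg f \<in> arrows C X Y"
    and nul_arrows: "X \<in> Obj C ==> Y \<in> Obj C ==> nul X Y \<in> arrows C X Y"
    and pl_assoc: "f \<in> arrows C X Y ==> g \<in> arrows C X Y ==> h \<in> arrows C X Y ==>
        pl (pl f g) h = pl f (pl g h)"
    and pl_comm: "f \<in> arrows C X Y ==> g \<in> arrows C X Y ==> pl f g = pl g f"
    and pl_nul: "f \<in> arrows C X Y ==> pl f (nul X Y) = f"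
    and pl_neg: "f \<in> arrows C X Y ==> pl f (neg f) = nul X Y"
    and Cmp_pl_right: "f \<in> arrows C X Y ==> f' \<in> arrows C X Y ==> g \<in> arrows C Y Z ==>
        Cmp C g (pl f f') = pl (Cmp C g f) (Cmp C g f')"
    and Cmp_pl_left: "f \<in> arrows C X Y ==> g \<in> arrows C Y Z ==> g' \<in> arrows C Y Z ==>
        Cmp C (pl g g') f = pl (Cmp C g f) (Cmp C g' f)"
begin

lemma pl_nul_left: "f \<in> arrows C X Y ==> pl (nul X Y) f = f"
  by (metis arrows_ObjD nul_arrows pl_comm pl_nul)

lemma pl_neg_left: "f \<in> arrows C X Y ==> pl (neg f) f = nul X Y"
  by (metis neg_arrows pl_comm pl_neg)

lemma pl_cancel:
  assumes "f \<in> arrows C X Y" "g \<in> arrows C X Y" "h \<in> arrows C X Y" "pl f g = pl f h"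
  shows "g = h"
  by (metis assms neg_arrows pl_assoc pl_neg_left pl_nul_left)

text \<open>Cancels \<open>f\<close> against the sum of \<open>f\<close> and zero. Vanishing is
  proved through this criterion below because it asks only for additivity of the operation in
  question.\<close>

lemma pl_idem: "f \<in> arrows C X Y ==> pl f f = f ==> f = nul X Y"
  by (metis arrows_ObjD nul_arrows pl_cancel pl_nul)

lemma neg_unique: "f \<in> arrows C X Y ==> g \<in> arrows C X Y ==> pl f g = nul X Y ==> g = neg f"
  by (metis neg_arrows pl_cancel pl_neg)

lemma Cmp_nul_right:
  assumes "g \<in> arrows C Y Z" "X \<in> Obj C"
  shows "Cmp C g (nul X Y) = nul X Z"
proof -
  have n: "nul X Y \<in> arrows C X Y" using assms arrows_ObjD nul_arrows by blast
  show ?thesis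
    by (rule pl_idem) (use n assms(1) Cmp_arrows Cmp_pl_right[OF n n] pl_nul[OF n] in auto)
qed

lemma Cmp_nul_left:
  assumes "f \<in> arrows C X Y" "Z \<in> Obj C"
  shows "Cmp C (nul Y Z) f = nul X Z"
proof -
  have n: "nul Y Z \<in> arrows C Y Z" using assms arrows_ObjD nul_arrows by blast
  show ?thesis
    by (rule pl_idem) (use n assms(1) Cmp_arrows Cmp_pl_left[OF _ n n] pl_nul[OF n] in auto)
qed

lemma Cmp_neg_right:
  assumes f: "f \<in> arrows C X Y" and g: "g \<in> arrows C Y Z"
  shows "Cmp C g (neg f) = neg (Cmp C g f)"
proof (rule neg_unique)
  show "pl (Cmp C g f) (Cmp C g (neg f)) = nul X Z"
    using Cmp_pl_right[OF f neg_arrows[OF f] g] pl_neg[OF f] Cmp_nul_right[OF g] arrows_ObjD[OF f]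
    by simp
qed (use Cmp_arrows[OF f g] Cmp_arrows[OF neg_arrows[OF f] g] in auto)

lemma Cmp_neg_left:
  assumes f: "f \<in> arrows C X Y" and g: "g \<in> arrows C Y Z"
  shows "Cmp C (neg g) f = neg (Cmp C g f)"
proof (rule neg_unique)
  show "pl (Cmp C g f) (Cmp C (neg g) f) = nul X Z"
    using Cmp_pl_left[OF f g neg_arrows[OF g]] pl_neg[OF g] Cmp_nul_left[OF f] arrows_ObjD[OF g]
    by simp
qed (use Cmp_arrows[OF f g] Cmp_arrows[OF f neg_arrows[OF g]] in auto)

definition mi :: "'m \<Rightarrow> 'm \<Rightarrow> 'm" where
  "mi f g = pl f (neg g)"

lemma mi_arrows: "f \<in> arrows C X Y ==> g \<in> arrows C X Y ==> mi f g \<in> arrows C X Y"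
  by (simp add: mi_def neg_arrows pl_arrows)

lemma mi_eq_nul:
  "f \<in> arrows C X Y ==> g \<in> arrows C X Y ==> mi f g = nul X Y \<longleftrightarrow> f = g"
  unfolding mi_def by (metis neg_arrows pl_cancel pl_comm pl_neg)

lemma Cmp_mi_right:
  "f \<in> arrows C X Y ==> f' \<in> arrows C X Y ==> g \<in> arrows C Y Z ==>
   Cmp C g (mi f f') = mi (Cmp C g f) (Cmp C g f')"
  by (simp add: mi_def Cmp_neg_right[where Z = Z and Y = Y and X = X]
      Cmp_pl_right[where Z = Z and Y = Y and X = X] neg_arrows)

lemma Cmp_mi_left:
  "f \<in> arrows C X Y ==> g \<in> arrows C Y Z ==> g' \<in> arrows C Y Z ==>
   Cmp C (mi g g') f = mi (Cmp C g f) (Cmp C g' f)"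
  by (simp add: mi_def Cmp_neg_left[where Z = Z and Y = Y and X = X]
      Cmp_pl_left[where Z = Z and Y = Y and X = X] neg_arrows)

lemma preadditive_structure: "preadditive_structure C pl nul"
  unfolding preadditive_structure_def
proof (intro conjI ballI allI)
  fix X Y assume "X \<in> Obj C" "Y \<in> Obj C"
  then show "comm_group \<lparr>carrier = arrows C X Y, monoid.mult = pl, one = nul X Y\<rparr>"
    by (intro comm_groupI)
      (auto intro: pl_arrows nul_arrows pl_assoc pl_comm pl_nul_left dest: neg_arrows pl_neg_left)
qed (auto intro: Cmp_pl_right Cmp_pl_left)

text \<open>Stated with \<open>nul\<close>, so that it makes sense before a zero object is known to
  exist; \<open>is_cokernel_iff\<close> later identifies it with \<open>is_cokernel\<close>. The
  same holds for \<open>ker\<close>.\<close>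

definition coker :: "'m \<Rightarrow> 'm \<Rightarrow> bool" where
  "coker a q \<longleftrightarrow> a \<in> Arr C \<and> q \<in> Arr C \<and> Dom C q = Cod C a \<and>
     Cmp C q a = nul (Dom C a) (Cod C q) \<and>
     (\<forall>W. \<forall>h \<in> arrows C (Cod C a) W. Cmp C h a = nul (Dom C a) W \<longrightarrow>
        (\<exists>!u. u \<in> arrows C (Cod C q) W \<and> Cmp C u q = h))"

definition ker :: "'m \<Rightarrow> 'm \<Rightarrow> bool" where
  "ker f k \<longleftrightarrow> f \<in> Arr C \<and> k \<in> Arr C \<and> Cod C k = Dom C f \<and>
     Cmp C f k = nul (Dom C k) (Cod C f) \<and>
     (\<forall>W. \<forall>h \<in> arrows C W (Dom C f). Cmp C f h = nul W (Cod C f) \<longrightarrow>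
        (\<exists>!u. u \<in> arrows C W (Dom C k) \<and> Cmp C k u = h))"

lemma coker_epi:
  assumes "coker a q" "u \<in> arrows C (Cod C q) W" "u' \<in> arrows C (Cod C q) W" "Cmp C u q = Cmp C u' q"
  shows "u = u'"
proof -
  have q: "a \<in> arrows C (Dom C a) (Cod C a)" "q \<in> arrows C (Cod C a) (Cod C q)"
    "Cmp C q a = nul (Dom C a) (Cod C q)"
    using assms(1) by (auto simp: coker_def arrows_def)
  have "Cmp C u q \<in> arrows C (Cod C a) W" "Cmp C (Cmp C u q) a = nul (Dom C a) W"
    using q assms(2) Cmp_arrows Cmp_assoc[OF q(1) q(2) assms(2)] Cmp_nul_right arrows_ObjD
    by auto
  then have "\<exists>!w. w \<in> arrows C (Cod C q) W \<and> Cmp C w q = Cmp C u q"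
    using assms(1) by (simp add: coker_def)
  then show ?thesis using assms by metis
qed

lemma ker_mono:
  assumes "ker f k" "u \<in> arrows C W (Dom C k)" "u' \<in> arrows C W (Dom C k)" "Cmp C k u = Cmp C k u'"
  shows "u = u'"
proof -
  have k: "f \<in> arrows C (Dom C f) (Cod C f)" "k \<in> arrows C (Dom C k) (Dom C f)"
    "Cmp C f k = nul (Dom C k) (Cod C f)"
    using assms(1) by (auto simp: ker_def arrows_def)
  have "Cmp C k u \<in> arrows C W (Dom C f)" "Cmp C f (Cmp C k u) = nul W (Cod C f)"
    using k assms(2) Cmp_arrows Cmp_assoc[OF assms(2) k(2) k(1)] Cmp_nul_left arrows_ObjD
    by auto
  then have "\<exists>!w. w \<in> arrows C W (Dom C k) \<and> Cmp C k w = Cmp C k u"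
    using assms(1) by (simp add: ker_def)
  then show ?thesis using assms by metis
qed

text \<open>The identity of the codomain kills a zero arrow and hence factors through the cokernel;
  that factor is the inverse.\<close>

lemma coker_nul_iso:
  assumes "coker a q" "a = nul (Dom C a) (Cod C a)"
  shows "\<exists>s \<in> arrows C (Cod C q) (Dom C q). Cmp C s q = Idn C (Dom C q) \<and> Cmp C q s = Idn C (Cod C q)"
proof -
  have q: "a \<in> arrows C (Dom C a) (Cod C a)" "q \<in> arrows C (Cod C a) (Cod C q)" "Dom C q = Cod C a"
    using assms(1) by (auto simp: coker_def arrows_def)
  have O: "Cod C a \<in> Obj C" "Cod C q \<in> Obj C" using q arrows_ObjD by blast+
  have "Cmp C (Idn C (Cod C a)) a = nul (Dom C a) (Cod C a)"
    using assms(2) Cmp_Idn_left[OF q(1)] by simp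
  then obtain s where s: "s \<in> arrows C (Cod C q) (Cod C a)" "Cmp C s q = Idn C (Cod C a)"
    using assms(1) Idn_arrows[OF O(1)] unfolding coker_def by blast
  have "Cmp C (Cmp C q s) q = Cmp C (Idn C (Cod C q)) q"
    using s q O by (simp add: cat_simps)
  then have "Cmp C q s = Idn C (Cod C q)"
    using coker_epi[OF assms(1)] Cmp_arrows[OF s(1) q(2)] Idn_arrows[OF O(2)] by blast
  then show ?thesis using s q by auto
qed

lemma ker_nul_iso:
  assumes "ker f k" "f = nul (Dom C f) (Cod C f)"
  shows "\<exists>s \<in> arrows C (Cod C k) (Dom C k). Cmp C s k = Idn C (Dom C k) \<and> Cmp C k s = Idn C (Cod C k)"
proof -
  have k: "f \<in> arrows C (Dom C f) (Cod C f)" "k \<in> arrows C (Dom C k) (Dom C f)" "Cod C k = Dom C f"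
    using assms(1) by (auto simp: ker_def arrows_def)
  have O: "Dom C f \<in> Obj C" "Dom C k \<in> Obj C" using k arrows_ObjD by blast+
  have "Cmp C f (Idn C (Dom C f)) = nul (Dom C f) (Cod C f)"
    using assms(2) Cmp_Idn_right[OF k(1)] by simp
  then obtain s where s: "s \<in> arrows C (Dom C f) (Dom C k)" "Cmp C k s = Idn C (Dom C f)"
    using assms(1) Idn_arrows[OF O(1)] unfolding ker_def by blast
  have "Cmp C k (Cmp C s k) = Cmp C k (Idn C (Dom C k))"
    using s k O by (simp add: cat_simps flip: Cmp_assoc_Arr)
  then have "Cmp C s k = Idn C (Dom C k)"
    using ker_mono[OF assms(1)] Cmp_arrows[OF k(2) s(1)] Idn_arrows[OF O(2)] by blast
  then show ?thesis using s k by auto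
qed

lemma coker_iso_comp:
  assumes "coker a q" "u \<in> arrows C (Cod C q) Y" "v \<in> arrows C Y (Cod C q)"
    "Cmp C v u = Idn C (Cod C q)" "Cmp C u v = Idn C Y"
  shows "coker a (Cmp C u q)"
proof -
  have q: "a \<in> arrows C (Dom C a) (Cod C a)" "q \<in> arrows C (Cod C a) (Cod C q)"
    "Cmp C q a = nul (Dom C a) (Cod C q)"
    using assms(1) by (auto simp: coker_def arrows_def)
  have uq: "Cmp C u q \<in> arrows C (Cod C a) Y" using q assms Cmp_arrows by blast
  have z: "Cmp C (Cmp C u q) a = nul (Dom C a) Y"
    using Cmp_assoc[OF q(1,2) assms(2)] q Cmp_nul_right[OF assms(2)] arrows_ObjD by auto
  have "\<exists>!w. w \<in> arrows C Y W \<and> Cmp C w (Cmp C u q) = h"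
    if h: "h \<in> arrows C (Cod C a) W" "Cmp C h a = nul (Dom C a) W" for W h
  proof -
    obtain w where w: "w \<in> arrows C (Cod C q) W" "Cmp C w q = h"
      using assms(1) h unfolding coker_def by blast
    show ?thesis
    proof (intro ex1I[of _ "Cmp C w v"] conjI)
      show "Cmp C w v \<in> arrows C Y W" using w assms Cmp_arrows by blast
      show "Cmp C (Cmp C w v) (Cmp C u q) = h"
        using Cmp_cancel_mid[OF q(2) assms(2,3) w(1) assms(4)] w(2) by simp
      fix w' assume w': "w' \<in> arrows C Y W \<and> Cmp C w' (Cmp C u q) = h"
      then have "Cmp C (Cmp C w' u) q = Cmp C w q"
        using Cmp_assoc[OF q(2) assms(2)] w by auto
      then have "Cmp C w' u = w"
        using coker_epi[OF assms(1)] w' w(1) Cmp_arrows[OF assms(2)] by blast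
      then show "w' = Cmp C w v"
        using Cmp_assoc[OF assms(3,2)] Cmp_Idn_right assms(5) w' by metis
    qed
  qed
  then show ?thesis using q uq z by (simp add: coker_def arrows_def)
qed

lemma ker_iso_comp:
  assumes "ker f k" "u \<in> arrows C X (Dom C k)" "v \<in> arrows C (Dom C k) X"
    "Cmp C u v = Idn C (Dom C k)" "Cmp C v u = Idn C X"
  shows "ker f (Cmp C k u)"
proof -
  have k: "f \<in> arrows C (Dom C f) (Cod C f)" "k \<in> arrows C (Dom C k) (Dom C f)"
    "Cmp C f k = nul (Dom C k) (Cod C f)"
    using assms(1) by (auto simp: ker_def arrows_def)
  have ku: "Cmp C k u \<in> arrows C X (Dom C f)" using k assms Cmp_arrows by blast
  have z: "Cmp C f (Cmp C k u) = nul X (Cod C f)"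
    using Cmp_assoc[OF assms(2) k(2,1)] k Cmp_nul_left[OF assms(2)] arrows_ObjD by auto
  have "\<exists>!w. w \<in> arrows C W X \<and> Cmp C (Cmp C k u) w = h"
    if h: "h \<in> arrows C W (Dom C f)" "Cmp C f h = nul W (Cod C f)" for W h
  proof -
    obtain w where w: "w \<in> arrows C W (Dom C k)" "Cmp C k w = h"
      using assms(1) h unfolding ker_def by blast
    show ?thesis
    proof (intro ex1I[of _ "Cmp C v w"] conjI)
      show "Cmp C v w \<in> arrows C W X" using w assms Cmp_arrows by blast
      show "Cmp C (Cmp C k u) (Cmp C v w) = h"
        using Cmp_cancel_mid[OF w(1) assms(3,2) k(2) assms(4)] w(2) by simp
      fix w' assume w': "w' \<in> arrows C W X \<and> Cmp C (Cmp C k u) w' = h"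
      then have "Cmp C k (Cmp C u w') = Cmp C k w"
        using Cmp_assoc[OF _ assms(2) k(2)] w by auto
      then have "Cmp C u w' = w"
        using ker_mono[OF assms(1)] w' w(1) Cmp_arrows[OF _ assms(2)] by blast
      then show "w' = Cmp C v w"
        using Cmp_assoc[OF _ assms(2,3)] Cmp_Idn_left assms(5) w' by metis
    qed
  qed
  then show ?thesis using k ku z by (simp add: ker_def arrows_def)
qed

end

section \<open>Strict arrows as kernels and cokernels\<close>

locale preadditive_zero = preadditive +
  assumes ex_zero_obj: "\<exists>Z. zero_obj C Z"
begin

lemma zero_arrow_iff:
  assumes "f \<in> arrows C X Y"
  shows "zero_arrow C f \<longleftrightarrow> f = nul X Y"
proof -
  have O: "X \<in> Obj C" "Y \<in> Obj C" using assms arrows_ObjD by blast+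
  have D: "Dom C f = X" "Cod C f = Y" "f \<in> Arr C" using assms by (auto simp: arrows_def)
  have *: "Cmp C h g = nul X Y" if "zero_obj C Z" "g \<in> arrows C X Z" "h \<in> arrows C Z Y" for Z g h
  proof -
    have "g = nul X Z"
      using that O nul_arrows unfolding zero_obj_def by blast
    then show ?thesis using that Cmp_nul_right O by blast
  qed
  obtain Z where Z: "zero_obj C Z" using ex_zero_obj by blast
  have "nul X Z \<in> arrows C X Z" "nul Z Y \<in> arrows C Z Y"
    using Z O nul_arrows unfolding zero_obj_def by auto
  then show ?thesis
    unfolding zero_arrow_def D using * Z D(3) by metis
qed

lemma is_cokernel_iff: "is_cokernel C a q \<longleftrightarrow> coker a q"
proof (cases "a \<in> Arr C \<and> q \<in> Arr C \<and> Dom C q = Cod C a")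
  case True
  then have "Cmp C q a \<in> arrows C (Dom C a) (Cod C q)"
    by (simp add: cat_simps)
  moreover have "Cmp C h a \<in> arrows C (Dom C a) (Cod C h)" if "h \<in> Arr C" "Dom C h = Cod C a" for h
    using that True by (simp add: cat_simps)
  ultimately show ?thesis
    using True zero_arrow_iff[of "Cmp C q a"] zero_arrow_iff[of "Cmp C h a" for h]
    unfolding is_cokernel_def coker_def by (smt (verit) arrows_iff)
qed (auto simp: is_cokernel_def coker_def)

lemma is_kernel_iff: "is_kernel C f k \<longleftrightarrow> ker f k"
proof (cases "f \<in> Arr C \<and> k \<in> Arr C \<and> Cod C k = Dom C f")
  case True
  then have "Cmp C f k \<in> arrows C (Dom C k) (Cod C f)"
    by (simp add: cat_simps)
  moreover have "Cmp C f h \<in> arrows C (Dom C h) (Cod C f)" if "h \<in> Arr C" "Cod C h = Dom C f" for h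
    using that True by (simp add: cat_simps)
  ultimately show ?thesis
    using True zero_arrow_iff[of "Cmp C f k"] zero_arrow_iff[of "Cmp C f h" for h]
    unfolding is_kernel_def ker_def by (smt (verit) arrows_iff)
qed (auto simp: is_kernel_def ker_def)

text \<open>Since \<open>f\<close> is epic, its cokernel \<open>c\<close> is zero, so the image
  inclusion \<open>m\<close>, a kernel of \<open>c\<close>, is invertible. Then \<open>f\<close>
  differs from the coimage projection \<open>p\<close>, which is a cokernel, only by an isomorphism,
  the composite of \<open>u\<close> and \<open>m\<close>.\<close>

lemma strict_epic_imp_coker:
  assumes "strict_epic C f"
  shows "\<exists>k. coker k f"
proof -
  obtain k p c m u where *: "ker f k" "coker k p" "coker f c" "ker c m"
    "u \<in> arrows C (Cod C p) (Dom C m)" "Cmp C m (Cmp C u p) = f" "iso_arrow C u"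
    using assms unfolding strict_epic_def strict_def is_cokernel_iff is_kernel_iff by blast
  obtain u' where u': "u' \<in> arrows C (Dom C m) (Cod C p)"
    "Cmp C u' u = Idn C (Cod C p)" "Cmp C u u' = Idn C (Dom C m)"
    using *(5,7) unfolding iso_arrow_def by (auto simp: arrows_def)
  have c: "c \<in> arrows C (Cod C f) (Cod C c)" "f \<in> arrows C (Dom C f) (Cod C f)"
    "Cmp C c f = nul (Dom C f) (Cod C c)"
    using *(3) by (auto simp: coker_def arrows_def)
  have n: "nul (Cod C f) (Cod C c) \<in> arrows C (Cod C f) (Cod C c)"
    using c arrows_ObjD nul_arrows by blast
  have eq: "Cmp C c f = Cmp C (nul (Cod C f) (Cod C c)) f"
    using c Cmp_nul_left[OF c(2)] arrows_ObjD by auto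
  have "\<forall>W. \<forall>g \<in> arrows C (Cod C f) W. \<forall>h \<in> arrows C (Cod C f) W.
      Cmp C g f = Cmp C h f \<longrightarrow> g = h"
    using assms by (simp add: strict_epic_def epic_def)
  from this[rule_format, OF c(1) n eq] have "c = nul (Cod C f) (Cod C c)" .
  then have cn: "c = nul (Dom C c) (Cod C c)" using c by (auto simp: arrows_def)
  obtain m' where m': "m' \<in> arrows C (Cod C m) (Dom C m)"
    "Cmp C m' m = Idn C (Dom C m)" "Cmp C m m' = Idn C (Cod C m)"
    using ker_nul_iso[OF *(4) cn] by blast
  have m: "m \<in> arrows C (Dom C m) (Cod C m)" using *(4) by (auto simp: ker_def arrows_def)
  have p: "p \<in> arrows C (Dom C p) (Cod C p)" using *(2) by (auto simp: coker_def arrows_def)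
  have "Cmp C (Cmp C m u) p = f" using *(6) Cmp_assoc[OF p *(5) m] by simp
  moreover have "coker k (Cmp C (Cmp C m u) p)"
  proof (rule coker_iso_comp[OF *(2) Cmp_arrows[OF *(5) m] Cmp_arrows[OF m'(1) u'(1)]])
    show "Cmp C (Cmp C u' m') (Cmp C m u) = Idn C (Cod C p)"
      using Cmp_cancel_mid[OF *(5) m m'(1) u'(1) m'(2)] u'(2) by simp
    show "Cmp C (Cmp C m u) (Cmp C u' m') = Idn C (Cod C m)"
      using Cmp_cancel_mid[OF m'(1) u'(1) *(5) m u'(3)] m'(3) by simp
  qed
  ultimately show ?thesis by auto
qed

text \<open>Dually, the kernel \<open>k\<close> of a monic \<open>f\<close> is zero, the coimage
  projection \<open>p\<close> is invertible, and \<open>f\<close> is the kernel \<open>m\<close> up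
  to an isomorphism.\<close>

lemma strict_monic_imp_ker:
  assumes "strict_monic C f"
  shows "\<exists>c. ker c f"
proof -
  obtain k p c m u where *: "ker f k" "coker k p" "coker f c" "ker c m"
    "u \<in> arrows C (Cod C p) (Dom C m)" "Cmp C m (Cmp C u p) = f" "iso_arrow C u"
    using assms unfolding strict_monic_def strict_def is_cokernel_iff is_kernel_iff by blast
  obtain u' where u': "u' \<in> arrows C (Dom C m) (Cod C p)"
    "Cmp C u' u = Idn C (Cod C p)" "Cmp C u u' = Idn C (Dom C m)"
    using *(5,7) unfolding iso_arrow_def by (auto simp: arrows_def)
  have k: "k \<in> arrows C (Dom C k) (Dom C f)" "f \<in> arrows C (Dom C f) (Cod C f)"
    "Cmp C f k = nul (Dom C k) (Cod C f)"
    using *(1) by (auto simp: ker_def arrows_def)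
  have n: "nul (Dom C k) (Dom C f) \<in> arrows C (Dom C k) (Dom C f)"
    using k arrows_ObjD nul_arrows by blast
  have eq: "Cmp C f k = Cmp C f (nul (Dom C k) (Dom C f))"
    using k Cmp_nul_right[OF k(2)] arrows_ObjD by auto
  have "\<forall>W. \<forall>g \<in> arrows C W (Dom C f). \<forall>h \<in> arrows C W (Dom C f).
      Cmp C f g = Cmp C f h \<longrightarrow> g = h"
    using assms by (simp add: strict_monic_def monic_def)
  from this[rule_format, OF k(1) n eq] have "k = nul (Dom C k) (Dom C f)" .
  then have kn: "k = nul (Dom C k) (Cod C k)" using k by (auto simp: arrows_def)
  obtain p' where p': "p' \<in> arrows C (Cod C p) (Dom C p)"
    "Cmp C p' p = Idn C (Dom C p)" "Cmp C p p' = Idn C (Cod C p)"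
    using coker_nul_iso[OF *(2) kn] by blast
  have m: "m \<in> arrows C (Dom C m) (Cod C m)" using *(4) by (auto simp: ker_def arrows_def)
  have p: "p \<in> arrows C (Dom C p) (Cod C p)" using *(2) by (auto simp: coker_def arrows_def)
  have "ker c (Cmp C m (Cmp C u p))"
  proof (rule ker_iso_comp[OF *(4) Cmp_arrows[OF p *(5)] Cmp_arrows[OF u'(1) p'(1)]])
    show "Cmp C (Cmp C p' u') (Cmp C u p) = Idn C (Dom C p)"
      using Cmp_cancel_mid[OF p *(5) u'(1) p'(1) u'(2)] p'(2) by simp
    show "Cmp C (Cmp C u p) (Cmp C p' u') = Idn C (Dom C m)"
      using Cmp_cancel_mid[OF u'(1) p'(1) p *(5) p'(3)] u'(3) by simp
  qed
  then show ?thesis using *(6) by auto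
qed

text \<open>The arrow \<open>a\<close> factors through the kernel \<open>k\<close>, so whatever
  kills \<open>k\<close> kills \<open>a\<close> and descends along \<open>f\<close>.\<close>

lemma coker_ker:
  assumes "coker a f" "ker f k"
  shows "coker k f"
proof -
  have f: "f \<in> arrows C (Cod C a) (Cod C f)" "Dom C f = Cod C a" "a \<in> arrows C (Dom C a) (Cod C a)"
     "Cmp C f a = nul (Dom C a) (Cod C f)"
    using assms(1) by (auto simp: coker_def arrows_def)
  have k: "k \<in> arrows C (Dom C k) (Cod C a)" "Cmp C f k = nul (Dom C k) (Cod C f)"
    using assms(2) f by (auto simp: ker_def arrows_def)
  obtain a' where a': "a' \<in> arrows C (Dom C a) (Dom C k)" "Cmp C k a' = a"
    using assms(2) f unfolding ker_def by metis
  have "\<exists>!u. u \<in> arrows C (Cod C f) W \<and> Cmp C u f = h"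
    if h: "h \<in> arrows C (Cod C a) W" "Cmp C h k = nul (Dom C k) W" for h W
  proof -
    have "Cmp C h a = nul (Dom C a) W"
      using Cmp_assoc[OF a'(1) k(1) h(1)] a' h Cmp_nul_left[OF a'(1)] arrows_ObjD by auto
    then show ?thesis using assms(1) h unfolding coker_def by blast
  qed
  then show ?thesis using f k by (simp add: coker_def arrows_def)
qed

text \<open>The arrow \<open>b\<close> factors through the cokernel \<open>c\<close>, so whatever is
  killed by \<open>c\<close> is killed by \<open>b\<close> and lifts along \<open>f\<close>.\<close>

lemma ker_coker:
  assumes "ker b f" "coker f c"
  shows "ker c f"
proof -
  have f: "f \<in> arrows C (Dom C f) (Dom C b)" "Cod C f = Dom C b" "b \<in> arrows C (Dom C b) (Cod C b)"
     "Cmp C b f = nul (Dom C f) (Cod C b)"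
    using assms(1) by (auto simp: ker_def arrows_def)
  have c: "c \<in> arrows C (Dom C b) (Cod C c)" "Cmp C c f = nul (Dom C f) (Cod C c)"
    using assms(2) f by (auto simp: coker_def arrows_def)
  obtain b' where b': "b' \<in> arrows C (Cod C c) (Cod C b)" "Cmp C b' c = b"
    using assms(2) f unfolding coker_def by metis
  have "\<exists>!u. u \<in> arrows C W (Dom C f) \<and> Cmp C f u = h"
    if h: "h \<in> arrows C W (Dom C b)" "Cmp C c h = nul W (Cod C c)" for h W
  proof -
    have "Cmp C b h = nul W (Cod C b)"
      using Cmp_assoc[OF h(1) c(1) b'(1)] b' h Cmp_nul_right[OF b'(1)] arrows_ObjD by auto
    then show ?thesis using assms(1) h unfolding ker_def by blast
  qed
  then show ?thesis using f c by (simp add: ker_def arrows_def)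
qed

lemma iso_Idn: "X \<in> Obj C ==> iso_arrow C (Idn C X)"
  unfolding iso_arrow_def using Idn_arrows Cmp_Idn_left by (auto simp: cat_simps)

text \<open>A cokernel is epic, so the zero arrow to a zero object is a cokernel of
  \<open>f\<close>, and the identity is a kernel of that zero arrow. The comparison from coimage to
  image is then an identity.\<close>

lemma coker_imp_strict_epic:
  assumes "coker a f" "ker f k"
  shows "strict_epic C f"
proof -
  have f: "f \<in> arrows C (Dom C f) (Cod C f)"
    using assms(1) by (auto simp: coker_def arrows_def)
  have O: "Dom C f \<in> Obj C" "Cod C f \<in> Obj C" using f arrows_ObjD by blast+
  obtain Z where Z: "zero_obj C Z" "Z \<in> Obj C" using ex_zero_obj zero_obj_def by metis
  define c where "c = nul (Cod C f) Z"
  have c: "c \<in> arrows C (Cod C f) Z" using c_def nul_arrows O Z by simp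
  have "\<exists>!u. u \<in> arrows C Z W \<and> Cmp C u c = h"
    if h: "h \<in> arrows C (Cod C f) W" "Cmp C h f = nul (Dom C f) W" for W h
  proof -
    have W: "W \<in> Obj C" using h arrows_ObjD by blast
    have "Cmp C h f = Cmp C (nul (Cod C f) W) f" using h Cmp_nul_left[OF f W] by simp
    then have "h = nul (Cod C f) W" using coker_epi[OF assms(1) h(1)] nul_arrows O W by blast
    moreover have "Cmp C (nul Z W) c = nul (Cod C f) W" using Cmp_nul_left[OF c W] by simp
    moreover have "\<exists>!u. u \<in> arrows C Z W" using Z W unfolding zero_obj_def by blast
    ultimately show ?thesis using nul_arrows[OF Z(2) W] by metis
  qed
  then have cc: "coker f c"
    using c f Cmp_nul_left[OF f Z(2)] by (auto simp: coker_def arrows_def c_def)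
  have m: "ker c (Idn C (Cod C f))"
    unfolding ker_def
  proof (intro conjI allI ballI impI)
    fix W h assume "h \<in> arrows C W (Dom C c)"
    then show "\<exists>!u. u \<in> arrows C W (Dom C (Idn C (Cod C f))) \<and> Cmp C (Idn C (Cod C f)) u = h"
      using arrows_iff[of c C] c Idn_Arr[OF O(2)] Cmp_Idn_left by (metis (no_types))
  qed (use c O Cmp_Idn_right[OF c] Idn_Arr in \<open>simp_all add: arrows_iff c_def\<close>)
  have "strict C f"
    unfolding strict_def is_cokernel_iff is_kernel_iff
  proof (intro exI conjI)
    show "ker f k" "coker k f" "coker f c" "ker c (Idn C (Cod C f))"
      using assms coker_ker cc m by auto
    show "iso_arrow C (Idn C (Cod C f))" using iso_Idn O by simp
  qed (use O f Cmp_Idn_left[OF Idn_arrows] Cmp_Idn_left Cmp_Idn_right Idn_arrows Idn_Arr in simp_all)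
  moreover have "epic C f"
    unfolding epic_def using f coker_epi[OF assms(1)] by (auto simp: arrows_def)
  ultimately show ?thesis by (simp add: strict_epic_def)
qed

text \<open>The zero arrow from a zero object is a kernel of \<open>f\<close>, and the identity is a
  cokernel of it; again the comparison from coimage to image is an identity.\<close>

lemma ker_imp_strict_monic:
  assumes "ker b f" "coker f c"
  shows "strict_monic C f"
proof -
  have f: "f \<in> arrows C (Dom C f) (Cod C f)"
    using assms(1) by (auto simp: ker_def arrows_def)
  have O: "Dom C f \<in> Obj C" "Cod C f \<in> Obj C" using f arrows_ObjD by blast+
  obtain Z where Z: "zero_obj C Z" "Z \<in> Obj C" using ex_zero_obj zero_obj_def by metis
  define k where "k = nul Z (Dom C f)"
  have k: "k \<in> arrows C Z (Dom C f)" using k_def nul_arrows O Z by simp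
  have "\<exists>!u. u \<in> arrows C W Z \<and> Cmp C k u = h"
    if h: "h \<in> arrows C W (Dom C f)" "Cmp C f h = nul W (Cod C f)" for W h
  proof -
    have W: "W \<in> Obj C" using h arrows_ObjD by blast
    have "Cmp C f h = Cmp C f (nul W (Dom C f))" using h Cmp_nul_right[OF f W] by simp
    then have "h = nul W (Dom C f)" using ker_mono[OF assms(1) h(1)] nul_arrows O W by blast
    moreover have "Cmp C k (nul W Z) = nul W (Dom C f)" using Cmp_nul_right[OF k W] by simp
    moreover have "\<exists>!u. u \<in> arrows C W Z" using Z W unfolding zero_obj_def by blast
    ultimately show ?thesis using nul_arrows[OF W Z(2)] by metis
  qed
  then have cc: "ker f k"
    using k f Cmp_nul_right[OF f Z(2)] by (auto simp: ker_def arrows_def k_def)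
  have m: "coker k (Idn C (Dom C f))"
    unfolding coker_def
  proof (intro conjI allI ballI impI)
    fix W h assume "h \<in> arrows C (Cod C k) W"
    then show "\<exists>!u. u \<in> arrows C (Cod C (Idn C (Dom C f))) W \<and> Cmp C u (Idn C (Dom C f)) = h"
      using arrows_iff[of k C] k Idn_Arr[OF O(1)] Cmp_Idn_right by (metis (no_types))
  qed (use k O Cmp_Idn_left[OF k] Idn_Arr in \<open>simp_all add: arrows_iff k_def\<close>)
  have "strict C f"
    unfolding strict_def is_cokernel_iff is_kernel_iff
  proof (intro exI conjI)
    show "ker f k" "coker k (Idn C (Dom C f))" "coker f c" "ker c f"
      using assms ker_coker cc m by auto
    show "iso_arrow C (Idn C (Dom C f))" using iso_Idn O by simp
  qed (use O f Cmp_Idn_left[OF Idn_arrows] Cmp_Idn_left Cmp_Idn_right Idn_arrows Idn_Arr in simp_all)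
  moreover have "monic C f"
    unfolding monic_def using f ker_mono[OF assms(1)] by (auto simp: arrows_def)
  ultimately show ?thesis by (simp add: strict_monic_def)
qed

end

section \<open>Presentations by filtered diagrams\<close>

text \<open>
  The functor \<open>HO, H\<close> embeds \<open>C\<close> into \<open>A\<close>.  That \<open>X\<close> is presented by \<open>D\<close> means that \<open>X\<close> is the
  formal filtered colimit of \<open>D\<close>: it is the colimit of the image of \<open>D\<close>, and the arrows from the
  image of an object of \<open>C\<close> to \<open>X\<close> are computed as in a filtered colimit.
\<close>

definition presents :: "'v itself \<Rightarrow> ('o, 'm) cat \<Rightarrow> ('O, 'M) cat \<Rightarrow> ('o \<Rightarrow> 'O) \<Rightarrow> ('m \<Rightarrow> 'M) \<Rightarrow>
    ('i, 'a, 'o, 'm) diagram \<Rightarrow> 'O \<Rightarrow> ('i \<Rightarrow> 'M) \<Rightarrow> bool" where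
  "presents V C A HO H D X \<iota> \<longleftrightarrow>
     is_diagram C D \<and> filtered (Shape D) \<and> small_cat V (Shape D) \<and> X \<in> Obj A \<and>
     (\<forall>i \<in> Obj (Shape D). \<iota> i \<in> arrows A (HO (DObj D i)) X) \<and>
     (\<forall>a \<in> Arr (Shape D). Cmp A (\<iota> (Cod (Shape D) a)) (H (DArr D a)) = \<iota> (Dom (Shape D) a)) \<and>
     (\<forall>c \<in> Obj C. \<forall>x \<in> arrows A (HO c) X. \<exists>i \<in> Obj (Shape D). \<exists>f \<in> arrows C c (DObj D i).
        x = Cmp A (\<iota> i) (H f)) \<and>
     (\<forall>c. \<forall>i \<in> Obj (Shape D). \<forall>j \<in> Obj (Shape D). \<forall>f \<in> arrows C c (DObj D i).
        \<forall>g \<in> arrows C c (DObj D j). Cmp A (\<iota> i) (H f) = Cmp A (\<iota> j) (H g) \<longrightarrow>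
          (\<exists>m a b. a \<in> arrows (Shape D) i m \<and> b \<in> arrows (Shape D) j m \<and>
             Cmp C (DArr D a) f = Cmp C (DArr D b) g)) \<and>
     (\<forall>Y y. Y \<in> Obj A \<and> (\<forall>i \<in> Obj (Shape D). y i \<in> arrows A (HO (DObj D i)) Y) \<and>
        (\<forall>a \<in> Arr (Shape D). Cmp A (y (Cod (Shape D) a)) (H (DArr D a)) = y (Dom (Shape D) a)) \<longrightarrow>
          (\<exists>!\<phi>. \<phi> \<in> arrows A X Y \<and> (\<forall>i \<in> Obj (Shape D). Cmp A \<phi> (\<iota> i) = y i)))"

lemma presents_diagram: "presents V C A HO H D X \<iota> ==> is_diagram C D"
  by (simp add: presents_def)

lemma presents_filtered: "presents V C A HO H D X \<iota> ==> filtered (Shape D)"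
  by (simp add: presents_def)

lemma presents_small: "presents V C A HO H D X \<iota> ==> small_cat V (Shape D)"
  by (simp add: presents_def)

lemma presents_Obj: "presents V C A HO H D X \<iota> ==> X \<in> Obj A"
  by (simp add: presents_def)

lemma presents_arrows:
  "presents V C A HO H D X \<iota> ==> i \<in> Obj (Shape D) ==> \<iota> i \<in> arrows A (HO (DObj D i)) X"
  by (simp add: presents_def)

lemma presents_cocone:
  assumes P: "presents V C A HO H D X \<iota>" and a: "a \<in> arrows (Shape D) i j"
  shows "Cmp A (\<iota> j) (H (DArr D a)) = \<iota> i"
proof -
  have "\<forall>a \<in> Arr (Shape D). Cmp A (\<iota> (Cod (Shape D) a)) (H (DArr D a)) = \<iota> (Dom (Shape D) a)"
    using P unfolding presents_def by (elim conjE)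
  then show ?thesis using a unfolding arrows_def by blast
qed

lemma presents_factor:
  assumes "presents V C A HO H D X \<iota>" "c \<in> Obj C" "x \<in> arrows A (HO c) X"
  obtains i f where "i \<in> Obj (Shape D)" "f \<in> arrows C c (DObj D i)" "x = Cmp A (\<iota> i) (H f)"
  using assms unfolding presents_def by blast

lemma presents_eq:
  assumes "presents V C A HO H D X \<iota>" "i \<in> Obj (Shape D)" "j \<in> Obj (Shape D)"
    "f \<in> arrows C c (DObj D i)" "g \<in> arrows C c (DObj D j)" "Cmp A (\<iota> i) (H f) = Cmp A (\<iota> j) (H g)"
  obtains m a b where "a \<in> arrows (Shape D) i m" "b \<in> arrows (Shape D) j m"
    "Cmp C (DArr D a) f = Cmp C (DArr D b) g"
  using assms unfolding presents_def by blast

lemma presents_univ: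
  assumes P: "presents V C A HO H D X \<iota>" and Y: "Y \<in> Obj A"
    and y: "\<And>i. i \<in> Obj (Shape D) ==> y i \<in> arrows A (HO (DObj D i)) Y"
    and compat: "\<And>a. a \<in> Arr (Shape D) ==>
      Cmp A (y (Cod (Shape D) a)) (H (DArr D a)) = y (Dom (Shape D) a)"
  shows "\<exists>!\<phi>. \<phi> \<in> arrows A X Y \<and> (\<forall>i \<in> Obj (Shape D). Cmp A \<phi> (\<iota> i) = y i)"
proof -
  have "\<forall>Y y. Y \<in> Obj A \<and> (\<forall>i \<in> Obj (Shape D). y i \<in> arrows A (HO (DObj D i)) Y) \<and>
        (\<forall>a \<in> Arr (Shape D). Cmp A (y (Cod (Shape D) a)) (H (DArr D a)) = y (Dom (Shape D) a)) \<longrightarrow>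
          (\<exists>!\<phi>. \<phi> \<in> arrows A X Y \<and> (\<forall>i \<in> Obj (Shape D). Cmp A \<phi> (\<iota> i) = y i))"
    using P unfolding presents_def by (elim conjE)
  from this[rule_format, of Y y] show ?thesis using Y y compat by blast
qed

section \<open>Filtered diagrams\<close>

lemma filtered_category: "filtered I ==> category I"
  by (simp add: filtered_def)

lemma filtered_ub:
  "filtered I ==> i \<in> Obj I ==> j \<in> Obj I ==> \<exists>l a b. a \<in> arrows I i l \<and> b \<in> arrows I j l"
  by (simp add: filtered_def)

lemma filtered_eq:
  assumes "filtered I" "a \<in> arrows I i j" "b \<in> arrows I i j"
  shows "\<exists>l c. c \<in> arrows I j l \<and> Cmp I c a = Cmp I c b"
  using assms category.arrows_ObjD[OF filtered_category[OF assms(1)] assms(2)]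
  unfolding filtered_def by blast

text \<open>Any upper bound of \<open>m\<close> and \<open>m'\<close> will do, once followed by an
  arrow that equalizes the two composites from \<open>l\<close>. Transitivity of the relation on
  germs rests on this.\<close>

lemma filtered_span:
  assumes F: "filtered I" and "c \<in> arrows I l m" "d \<in> arrows I l m'"
  shows "\<exists>n a b. a \<in> arrows I m n \<and> b \<in> arrows I m' n \<and> Cmp I a c = Cmp I b d"
proof -
  interpret category I using F filtered_category by blast
  obtain n u v where uv: "u \<in> arrows I m n" "v \<in> arrows I m' n"
    using filtered_ub[OF F] assms arrows_ObjD by metis
  obtain k w where w: "w \<in> arrows I n k" "Cmp I w (Cmp I u c) = Cmp I w (Cmp I v d)"
    using filtered_eq[OF F Cmp_arrows[OF assms(2) uv(1)] Cmp_arrows[OF assms(3) uv(2)]] by blast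
  have "Cmp I (Cmp I w u) c = Cmp I (Cmp I w v) d"
    using w(2) Cmp_assoc[OF assms(2) uv(1) w(1)] Cmp_assoc[OF assms(3) uv(2) w(1)] by simp
  then show ?thesis using Cmp_arrows[OF uv(1) w(1)] Cmp_arrows[OF uv(2) w(1)] by blast
qed

lemma diagram_Obj: "is_diagram C D ==> i \<in> Obj (Shape D) ==> DObj D i \<in> Obj C"
  by (simp add: is_diagram_def)

lemma diagram_Idn: "is_diagram C D ==> i \<in> Obj (Shape D) ==> DArr D (Idn (Shape D) i) = Idn C (DObj D i)"
  by (simp add: is_diagram_def)

lemma diagram_arrows:
  "is_diagram C D ==> a \<in> arrows (Shape D) i j ==> DArr D a \<in> arrows C (DObj D i) (DObj D j)"
  by (auto simp: is_diagram_def arrows_def)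

lemma diagram_Cmp:
  "is_diagram C D ==> a \<in> arrows (Shape D) i j ==> b \<in> arrows (Shape D) j k ==>
   DArr D (Cmp (Shape D) b a) = Cmp C (DArr D b) (DArr D a)"
  by (auto simp: is_diagram_def arrows_def)

lemma diagram_category: "is_diagram C D ==> category (Shape D)"
  by (simp add: is_diagram_def)

text \<open>The class of \<open>(j, f)\<close> in the colimit of the sets of arrows out of
  \<open>c\<close>; it is an equivalence class in the proper sense when the shape is
  filtered.\<close>

definition germ :: "('o, 'm) cat \<Rightarrow> ('i, 'a, 'o, 'm) diagram \<Rightarrow> 'o \<Rightarrow> 'i \<Rightarrow> 'm \<Rightarrow> ('i \<times> 'm) set" where
  "germ C Y c j f = colim_hom_rel C Y c `` {(j, f)}"

lemma mem_germ_iff: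
  "(l, g) \<in> germ C Y c j f \<longleftrightarrow> j \<in> Obj (Shape Y) \<and> l \<in> Obj (Shape Y) \<and>
     f \<in> arrows C c (DObj Y j) \<and> g \<in> arrows C c (DObj Y l) \<and>
     (\<exists>m a b. a \<in> arrows (Shape Y) j m \<and> b \<in> arrows (Shape Y) l m \<and>
        Cmp C (DArr Y a) f = Cmp C (DArr Y b) g)"
  by (simp add: germ_def colim_hom_rel_def)

context category
begin

lemma colim_hom_rel_equiv:
  assumes D: "is_diagram C Y" and F: "filtered (Shape Y)"
  shows "equiv (SIGMA j : Obj (Shape Y). arrows C c (DObj Y j)) (colim_hom_rel C Y c)"
proof (rule equivI)
  interpret S: category "Shape Y" using D diagram_category by blast
  show "refl_on (SIGMA j : Obj (Shape Y). arrows C c (DObj Y j)) (colim_hom_rel C Y c)"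
    unfolding refl_on_def colim_hom_rel_def using S.Idn_arrows by fastforce
  show "colim_hom_rel C Y c \<subseteq> (SIGMA j : Obj (Shape Y). arrows C c (DObj Y j)) \<times>
      (SIGMA j : Obj (Shape Y). arrows C c (DObj Y j))"
    unfolding colim_hom_rel_def by auto
  show "sym (colim_hom_rel C Y c)"
    unfolding sym_def colim_hom_rel_def by fastforce
  show "trans (colim_hom_rel C Y c)"
  proof (rule transI)
    fix p q r assume pq: "(p, q) \<in> colim_hom_rel C Y c" and qr: "(q, r) \<in> colim_hom_rel C Y c"
    obtain j f l g k h where [simp]: "p = (j, f)" "q = (l, g)" "r = (k, h)"
      by (metis surj_pair)
    from pq obtain m a b where 1: "a \<in> arrows (Shape Y) j m" "b \<in> arrows (Shape Y) l m"
      "Cmp C (DArr Y a) f = Cmp C (DArr Y b) g"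
      and f: "f \<in> arrows C c (DObj Y j)" and g: "g \<in> arrows C c (DObj Y l)"
      and "j \<in> Obj (Shape Y)"
      by (auto simp: colim_hom_rel_def)
    from qr obtain m' a' b' where 2: "a' \<in> arrows (Shape Y) l m'" "b' \<in> arrows (Shape Y) k m'"
      "Cmp C (DArr Y a') g = Cmp C (DArr Y b') h"
      and h: "h \<in> arrows C c (DObj Y k)" and "k \<in> Obj (Shape Y)"
      by (auto simp: colim_hom_rel_def)
    \<comment> \<open>Both witnesses leave from the common index \<open>l\<close>, via
      \<open>b\<close> and \<open>a'\<close>; closing this span brings the two equations to one
      index \<open>n\<close>.\<close>
    obtain n u v where uv: "u \<in> arrows (Shape Y) m n" "v \<in> arrows (Shape Y) m' n"
      "Cmp (Shape Y) u b = Cmp (Shape Y) v a'"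
      using filtered_span[OF F 1(2) 2(1)] by blast
    have ua: "Cmp (Shape Y) u a \<in> arrows (Shape Y) j n" using 1 uv S.Cmp_arrows by blast
    have vb: "Cmp (Shape Y) v b' \<in> arrows (Shape Y) k n" using 2 uv S.Cmp_arrows by blast
    have *: "Cmp C (DArr Y (Cmp (Shape Y) u a)) f = Cmp C (DArr Y u) (Cmp C (DArr Y a) f)"
      if "a \<in> arrows (Shape Y) j m" "u \<in> arrows (Shape Y) m n" "f \<in> arrows C c (DObj Y j)"
      for a u f j m n
      using diagram_Cmp[OF D that(1,2)] Cmp_assoc[OF that(3) diagram_arrows[OF D that(1)]
          diagram_arrows[OF D that(2)]] by simp
    have "Cmp C (DArr Y (Cmp (Shape Y) u a)) f = Cmp C (DArr Y (Cmp (Shape Y) v b')) h"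
      using *[OF 1(1) uv(1) f] *[OF 2(2) uv(2) h] *[OF 1(2) uv(1) g] *[OF 2(1) uv(2) g]
        1(3) 2(3) uv(3) by simp
    then show "(p, r) \<in> colim_hom_rel C Y c"
      using ua vb f h \<open>j \<in> Obj (Shape Y)\<close> \<open>k \<in> Obj (Shape Y)\<close>
      unfolding colim_hom_rel_def by auto
  qed
qed

lemma germ_eq_iff:
  assumes "is_diagram C Y" "filtered (Shape Y)"
    "j \<in> Obj (Shape Y)" "f \<in> arrows C c (DObj Y j)" "l \<in> Obj (Shape Y)" "g \<in> arrows C c (DObj Y l)"
  shows "germ C Y c j f = germ C Y c l g \<longleftrightarrow>
     (\<exists>m a b. a \<in> arrows (Shape Y) j m \<and> b \<in> arrows (Shape Y) l m \<and>
        Cmp C (DArr Y a) f = Cmp C (DArr Y b) g)"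
  using eq_equiv_class_iff[OF colim_hom_rel_equiv[OF assms(1,2), of c], of "(j, f)" "(l, g)"] assms(3-)
  unfolding germ_def by (auto simp: colim_hom_rel_def)

lemma germ_eq_mem:
  assumes "is_diagram C Y" "filtered (Shape Y)" "(l, g) \<in> germ C Y c j f"
  shows "germ C Y c j f = germ C Y c l g"
  using equiv_class_eq[OF colim_hom_rel_equiv[OF assms(1,2), of c]] assms(3)
  unfolding germ_def by auto

lemma germ_self:
  assumes "is_diagram C Y" "filtered (Shape Y)" "j \<in> Obj (Shape Y)" "f \<in> arrows C c (DObj Y j)"
  shows "(j, f) \<in> germ C Y c j f"
  using equiv_class_self[OF colim_hom_rel_equiv[OF assms(1,2), of c]] assms(3,4)
  unfolding germ_def by auto

lemma colim_hom_iff: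
  "\<kappa> \<in> colim_hom C Y c \<longleftrightarrow>
     (\<exists>j \<in> Obj (Shape Y). \<exists>f \<in> arrows C c (DObj Y j). \<kappa> = germ C Y c j f)"
  unfolding colim_hom_def quotient_def germ_def by fastforce

lemma germ_DArr:
  assumes D: "is_diagram C Y" and F: "filtered (Shape Y)"
    and f: "f \<in> arrows C c (DObj Y i)" and a: "a \<in> arrows (Shape Y) i j"
  shows "germ C Y c i f = germ C Y c j (Cmp C (DArr Y a) f)"
proof -
  interpret S: category "Shape Y" using D diagram_category by blast
  have O: "i \<in> Obj (Shape Y)" "j \<in> Obj (Shape Y)" using S.arrows_ObjD a by blast+
  have g: "Cmp C (DArr Y a) f \<in> arrows C c (DObj Y j)"
    using Cmp_arrows[OF f diagram_arrows[OF D a]] .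
  have "Cmp C (DArr Y (Idn (Shape Y) j)) (Cmp C (DArr Y a) f) = Cmp C (DArr Y a) f"
    using diagram_Idn[OF D O(2)] Cmp_Idn_left[OF g] by simp
  then show ?thesis
    using germ_eq_iff[OF D F O(1) f O(2) g] a S.Idn_arrows[OF O(2)] by metis
qed

lemma germ_precomp:
  assumes D: "is_diagram C Y" and F: "filtered (Shape Y)"
    and "j \<in> Obj (Shape Y)" "f \<in> arrows C c (DObj Y j)" "l \<in> Obj (Shape Y)" "g \<in> arrows C c (DObj Y l)"
    and "germ C Y c j f = germ C Y c l g" and h: "h \<in> arrows C d c"
  shows "germ C Y d j (Cmp C f h) = germ C Y d l (Cmp C g h)"
proof -
  obtain m a b where ab: "a \<in> arrows (Shape Y) j m" "b \<in> arrows (Shape Y) l m"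
     "Cmp C (DArr Y a) f = Cmp C (DArr Y b) g"
    using germ_eq_iff[OF assms(1-6)] assms(7) by blast
  have "Cmp C (DArr Y a) (Cmp C f h) = Cmp C (DArr Y b) (Cmp C g h)"
    using Cmp_assoc[OF h assms(4) diagram_arrows[OF D ab(1)]]
      Cmp_assoc[OF h assms(6) diagram_arrows[OF D ab(2)]] ab(3) by simp
  then show ?thesis
    using germ_eq_iff[OF D F assms(3) Cmp_arrows[OF h assms(4)] assms(5) Cmp_arrows[OF h assms(6)]]
      ab by blast
qed

section \<open>The category of ind-objects\<close>

lemma ind_objD:
  assumes "ind_obj C X"
  shows "is_diagram C X" "filtered (Shape X)" "category (Shape X)"
  using assms diagram_category by (auto simp: ind_obj_def)

lemma ind_hom_germ:
  assumes "\<phi> \<in> ind_hom C X Y" "i \<in> Obj (Shape X)"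
  obtains j f where "j \<in> Obj (Shape Y)" "f \<in> arrows C (DObj X i) (DObj Y j)"
    "\<phi> i = germ C Y (DObj X i) j f"
proof -
  have "\<phi> i \<in> colim_hom C Y (DObj X i)"
    using assms by (auto simp: ind_hom_def)
  then show ?thesis using that unfolding colim_hom_iff by blast
qed

lemma ind_hom_compat:
  assumes X: "ind_obj C X" and Y: "ind_obj C Y" and \<phi>: "\<phi> \<in> ind_hom C X Y"
    and a: "a \<in> arrows (Shape X) i i'"
    and j: "j \<in> Obj (Shape Y)" and f: "f \<in> arrows C (DObj X i') (DObj Y j)"
    and eq: "\<phi> i' = germ C Y (DObj X i') j f"
  shows "\<phi> i = germ C Y (DObj X i) j (Cmp C f (DArr X a))"
proof -
  have i: "i \<in> Obj (Shape X)" using category.arrows_ObjD[OF ind_objD(3)[OF X] a] by blast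
  have "(j, f) \<in> \<phi> i'" using eq germ_self[OF ind_objD(1,2)[OF Y] j f] by simp
  then have "(j, Cmp C f (DArr X a)) \<in> \<phi> i" using \<phi> a unfolding ind_hom_def arrows_def by auto
  moreover obtain l g where "\<phi> i = germ C Y (DObj X i) l g" using ind_hom_germ[OF \<phi> i] .
  ultimately show ?thesis using germ_eq_mem[OF ind_objD(1,2)[OF Y]] by metis
qed

text \<open>Membership in \<open>ind_hom\<close> asks for compatibility on every representative of a
  germ. Germs are respected by precomposition, so one representative for each arrow of the shape
  settles it.\<close>

lemma ind_homI:
  assumes X: "ind_obj C X" and Y: "ind_obj C Y" and ext: "\<phi> \<in> extensional (Obj (Shape X))"
    and germs: "\<And>i. i \<in> Obj (Shape X) ==> \<exists>j \<in> Obj (Shape Y). \<exists>f \<in> arrows C (DObj X i) (DObj Y j).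
      \<phi> i = germ C Y (DObj X i) j f"
    and compat: "\<And>a i i'. a \<in> arrows (Shape X) i i' ==>
      \<exists>j \<in> Obj (Shape Y). \<exists>f \<in> arrows C (DObj X i') (DObj Y j).
        \<phi> i' = germ C Y (DObj X i') j f \<and> \<phi> i = germ C Y (DObj X i) j (Cmp C f (DArr X a))"
  shows "\<phi> \<in> ind_hom C X Y"
  unfolding ind_hom_def
proof (rule CollectI, rule conjI)
  show "\<phi> \<in> (\<Pi>\<^sub>E i \<in> Obj (Shape X). colim_hom C Y (DObj X i))"
    using ext germs by (intro PiE_I) (simp_all add: colim_hom_iff extensional_def)
  show "\<forall>a \<in> Arr (Shape X). \<forall>(j, f) \<in> \<phi> (Cod (Shape X) a).
      (j, Cmp C f (DArr X a)) \<in> \<phi> (Dom (Shape X) a)"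
  proof (rule ballI, clarify)
    fix a k h assume 2: "a \<in> Arr (Shape X)" "(k, h) \<in> \<phi> (Cod (Shape X) a)"
    let ?i = "Dom (Shape X) a" and ?i' = "Cod (Shape X) a"
    note DF = ind_objD(1,2)[OF Y]
    have a: "a \<in> arrows (Shape X) ?i ?i'" using 2 by (simp add: arrows_def)
    obtain j f where jf: "j \<in> Obj (Shape Y)" "f \<in> arrows C (DObj X ?i') (DObj Y j)"
      "\<phi> ?i' = germ C Y (DObj X ?i') j f" "\<phi> ?i = germ C Y (DObj X ?i) j (Cmp C f (DArr X a))"
      using compat[OF a] by blast
    have kh: "k \<in> Obj (Shape Y)" "h \<in> arrows C (DObj X ?i') (DObj Y k)"
      using 2 jf(3) mem_germ_iff by metis+
    have "germ C Y (DObj X ?i') j f = germ C Y (DObj X ?i') k h"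
      using germ_eq_mem[OF DF] 2 jf(3) by metis
    then have "germ C Y (DObj X ?i) j (Cmp C f (DArr X a)) = germ C Y (DObj X ?i) k (Cmp C h (DArr X a))"
      using germ_precomp[OF DF jf(1,2) kh] diagram_arrows[OF ind_objD(1)[OF X] a] by blast
    then show "(k, Cmp C h (DArr X a)) \<in> \<phi> (Dom (Shape X) a)"
      using germ_self[OF DF kh(1)] jf(4) Cmp_arrows[OF diagram_arrows[OF ind_objD(1)[OF X] a] kh(2)]
      by metis
  qed
qed

text \<open>The definition of \<open>ind_comp\<close> unites the germs of all composites of
  representatives. All of them coincide, so composites can be computed from one chosen
  representative at each stage.\<close>

lemma ind_comp_germ:
  assumes X: "ind_obj C X" and Y: "ind_obj C Y" and Z: "ind_obj C Z"
    and \<phi>: "\<phi> \<in> ind_hom C X Y" and \<gamma>: "\<gamma> \<in> ind_hom C Y Z" and i: "i \<in> Obj (Shape X)"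
    and jf: "j \<in> Obj (Shape Y)" "f \<in> arrows C (DObj X i) (DObj Y j)" "\<phi> i = germ C Y (DObj X i) j f"
    and lg: "l \<in> Obj (Shape Z)" "g \<in> arrows C (DObj Y j) (DObj Z l)" "\<gamma> j = germ C Z (DObj Y j) l g"
  shows "ind_comp C X Z \<gamma> \<phi> i = germ C Z (DObj X i) l (Cmp C g f)"
proof -
  let ?c = "DObj X i"
  note DZ = ind_objD(1,2)[OF Z] and DY = ind_objD(1,2)[OF Y]
  let ?S = "{(l, Cmp C g f) | j f l g. (j, f) \<in> \<phi> i \<and> (l, g) \<in> \<gamma> j}"
  have all: "germ C Z ?c l' (Cmp C g' f') = germ C Z ?c l (Cmp C g f)"
    if mem: "(j', f') \<in> \<phi> i" "(l', g') \<in> \<gamma> j'" for j' f' l' g'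
  proof -
    obtain m a b where m: "j' \<in> Obj (Shape Y)" "f' \<in> arrows C ?c (DObj Y j')"
       "a \<in> arrows (Shape Y) j m" "b \<in> arrows (Shape Y) j' m"
       "Cmp C (DArr Y a) f = Cmp C (DArr Y b) f'"
      using mem(1) unfolding jf(3) mem_germ_iff by blast
    have mO: "m \<in> Obj (Shape Y)" using m(3) category.arrows_ObjD[OF ind_objD(3)[OF Y]] by blast
    obtain n k where nk: "n \<in> Obj (Shape Z)" "k \<in> arrows C (DObj Y m) (DObj Z n)"
      "\<gamma> m = germ C Z (DObj Y m) n k"
      using ind_hom_germ[OF \<gamma> mO] .
    have aA: "DArr Y a \<in> arrows C (DObj Y j) (DObj Y m)" "DArr Y b \<in> arrows C (DObj Y j') (DObj Y m)"
      using diagram_arrows[OF DY(1)] m by blast+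
    \<comment> \<open>The representatives \<open>f\<close> and \<open>f'\<close> agree at the later
      index \<open>m\<close>. Restricting the value of \<open>\<gamma>\<close> at \<open>m\<close>
      along \<open>a\<close> and along \<open>b\<close> computes its values at \<open>j\<close> and
      \<open>j'\<close> from one arrow \<open>k\<close>.\<close>
    have 1: "\<gamma> j = germ C Z (DObj Y j) n (Cmp C k (DArr Y a))"
      using ind_hom_compat[OF Y Z \<gamma> m(3) nk] .
    have 2: "\<gamma> j' = germ C Z (DObj Y j') n (Cmp C k (DArr Y b))"
      using ind_hom_compat[OF Y Z \<gamma> m(4) nk] .
    have lg': "l' \<in> Obj (Shape Z)" "g' \<in> arrows C (DObj Y j') (DObj Z l')"
      using mem(2) 2 mem_germ_iff by metis+
    have 3: "germ C Z (DObj Y j') n (Cmp C k (DArr Y b)) = germ C Z (DObj Y j') l' g'"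
      using germ_eq_mem[OF DZ] mem(2) 2 by metis
    have "germ C Z ?c l' (Cmp C g' f') = germ C Z ?c n (Cmp C (Cmp C k (DArr Y b)) f')"
      using germ_precomp[OF DZ nk(1) Cmp_arrows[OF aA(2) nk(2)] lg' 3 m(2)] by simp
    also have "\<dots> = germ C Z ?c n (Cmp C (Cmp C k (DArr Y a)) f)"
      using Cmp_assoc[OF m(2) aA(2) nk(2)] Cmp_assoc[OF jf(2) aA(1) nk(2)] m(5) by simp
    also have "\<dots> = germ C Z ?c l (Cmp C g f)"
      using germ_precomp[OF DZ nk(1) Cmp_arrows[OF aA(1) nk(2)] lg(1,2) _ jf(2)] 1 lg(3) by simp
    finally show ?thesis .
  qed
  have "(j, f) \<in> \<phi> i" "(l, g) \<in> \<gamma> j"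
    using germ_self[OF DY jf(1,2)] germ_self[OF DZ lg(1,2)] jf(3) lg(3) by simp_all
  then have self: "(l, Cmp C g f) \<in> ?S" by blast
  have "colim_hom_rel C Z ?c `` ?S = (\<Union>(k, h) \<in> ?S. germ C Z ?c k h)"
    unfolding germ_def by blast
  also have "\<dots> = germ C Z ?c l (Cmp C g f)"
  proof (intro equalityI subsetI)
    fix x assume "x \<in> (\<Union>(k, h) \<in> ?S. germ C Z ?c k h)"
    then obtain j' f' l' g' where "(j', f') \<in> \<phi> i" "(l', g') \<in> \<gamma> j'"
      "x \<in> germ C Z ?c l' (Cmp C g' f')" by blast
    then show "x \<in> germ C Z ?c l (Cmp C g f)" using all by blast
  next
    fix x assume "x \<in> germ C Z ?c l (Cmp C g f)"
    then show "x \<in> (\<Union>(k, h) \<in> ?S. germ C Z ?c k h)" using self by blast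
  qed
  finally show ?thesis using i unfolding ind_comp_def by simp
qed

lemma ind_comp_ind_hom:
  assumes X: "ind_obj C X" and Y: "ind_obj C Y" and Z: "ind_obj C Z"
    and \<phi>: "\<phi> \<in> ind_hom C X Y" and \<gamma>: "\<gamma> \<in> ind_hom C Y Z"
  shows "ind_comp C X Z \<gamma> \<phi> \<in> ind_hom C X Z"
proof (rule ind_homI[OF X Z])
  show "ind_comp C X Z \<gamma> \<phi> \<in> extensional (Obj (Shape X))"
    unfolding ind_comp_def by (rule restrict_extensional)
  fix i assume i: "i \<in> Obj (Shape X)"
  obtain j f where jf: "j \<in> Obj (Shape Y)" "f \<in> arrows C (DObj X i) (DObj Y j)"
    "\<phi> i = germ C Y (DObj X i) j f" using ind_hom_germ[OF \<phi> i] .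
  obtain l g where lg: "l \<in> Obj (Shape Z)" "g \<in> arrows C (DObj Y j) (DObj Z l)"
    "\<gamma> j = germ C Z (DObj Y j) l g" using ind_hom_germ[OF \<gamma> jf(1)] .
  show "\<exists>j\<in>Obj (Shape Z). \<exists>f\<in>arrows C (DObj X i) (DObj Z j). ind_comp C X Z \<gamma> \<phi> i = germ C Z (DObj X i) j f"
    using ind_comp_germ[OF assms i jf lg] lg Cmp_arrows[OF jf(2) lg(2)] by blast
next
  fix a i' i assume a: "a \<in> arrows (Shape X) i' i"
  have i: "i \<in> Obj (Shape X)" "i' \<in> Obj (Shape X)"
    using a category.arrows_ObjD[OF ind_objD(3)[OF X]] by blast+
  have aA: "DArr X a \<in> arrows C (DObj X i') (DObj X i)" using diagram_arrows[OF ind_objD(1)[OF X] a] .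
  obtain j f where jf: "j \<in> Obj (Shape Y)" "f \<in> arrows C (DObj X i) (DObj Y j)"
    "\<phi> i = germ C Y (DObj X i) j f" using ind_hom_germ[OF \<phi> i(1)] .
  obtain l g where lg: "l \<in> Obj (Shape Z)" "g \<in> arrows C (DObj Y j) (DObj Z l)"
    "\<gamma> j = germ C Z (DObj Y j) l g" using ind_hom_germ[OF \<gamma> jf(1)] .
  have "ind_comp C X Z \<gamma> \<phi> i' = germ C Z (DObj X i') l (Cmp C (Cmp C g f) (DArr X a))"
    using ind_comp_germ[OF assms i(2) jf(1) Cmp_arrows[OF aA jf(2)] ind_hom_compat[OF X Y \<phi> a jf] lg]
      Cmp_assoc[OF aA jf(2) lg(2)] by simp
  then show "\<exists>j\<in>Obj (Shape Z). \<exists>f\<in>arrows C (DObj X i) (DObj Z j).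
      ind_comp C X Z \<gamma> \<phi> i = germ C Z (DObj X i) j f \<and>
      ind_comp C X Z \<gamma> \<phi> i' = germ C Z (DObj X i') j (Cmp C f (DArr X a))"
    using ind_comp_germ[OF assms i(1) jf lg] lg Cmp_arrows[OF jf(2) lg(2)] by blast
qed

lemma ind_id_germ: "i \<in> Obj (Shape X) ==> ind_id C X i = germ C X (DObj X i) i (Idn C (DObj X i))"
  by (simp add: ind_id_def germ_def)

lemma ind_id_ind_hom:
  assumes X: "ind_obj C X"
  shows "ind_id C X \<in> ind_hom C X X"
proof (rule ind_homI[OF X X])
  show "ind_id C X \<in> extensional (Obj (Shape X))"
    unfolding ind_id_def by (rule restrict_extensional)
  fix i assume i: "i \<in> Obj (Shape X)"
  show "\<exists>j\<in>Obj (Shape X). \<exists>f\<in>arrows C (DObj X i) (DObj X j). ind_id C X i = germ C X (DObj X i) j f"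
    using ind_id_germ[OF i] Idn_arrows[OF diagram_Obj[OF ind_objD(1)[OF X] i]] i by metis
next
  fix a i' i assume a: "a \<in> arrows (Shape X) i' i"
  have i: "i \<in> Obj (Shape X)" "i' \<in> Obj (Shape X)"
    using a category.arrows_ObjD[OF ind_objD(3)[OF X]] by blast+
  have O: "DObj X i \<in> Obj C" "DObj X i' \<in> Obj C" using i diagram_Obj[OF ind_objD(1)[OF X]] by auto
  have aA: "DArr X a \<in> arrows C (DObj X i') (DObj X i)" using diagram_arrows[OF ind_objD(1)[OF X] a] .
  have "ind_id C X i' = germ C X (DObj X i') i (Cmp C (Idn C (DObj X i)) (DArr X a))"
    using germ_DArr[OF ind_objD(1,2)[OF X] Idn_arrows[OF O(2)] a] Cmp_Idn_left[OF aA]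
      Cmp_Idn_right[OF aA] ind_id_germ[OF i(2)] by simp
  then show "\<exists>j\<in>Obj (Shape X). \<exists>f\<in>arrows C (DObj X i) (DObj X j).
      ind_id C X i = germ C X (DObj X i) j f \<and> ind_id C X i' = germ C X (DObj X i') j (Cmp C f (DArr X a))"
    using ind_id_germ[OF i(1)] Idn_arrows[OF O(1)] i(1) by blast
qed

lemma Ind_simps:
  "Obj (Ind V C) = {X. ind_obj C X}"
  "Arr (Ind V C) = {(X, \<phi>, Y). ind_obj C X \<and> ind_obj C Y \<and> \<phi> \<in> ind_hom C X Y}"
  "Dom (Ind V C) (X, \<phi>, Y) = X"
  "Cod (Ind V C) (X, \<phi>, Y) = Y"
  "Idn (Ind V C) X = (X, ind_id C X, X)"
  "Cmp (Ind V C) (Y', \<gamma>, Z) (X, \<phi>, Y) = (X, ind_comp C X Z \<gamma> \<phi>, Z)"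
  by (simp_all add: Ind_def)

lemma Ind_arrows_iff:
  "f \<in> arrows (Ind V C) X Y \<longleftrightarrow> (\<exists>\<phi>. f = (X, \<phi>, Y) \<and> ind_obj C X \<and> ind_obj C Y \<and> \<phi> \<in> ind_hom C X Y)"
  by (cases f) (auto simp: arrows_def Ind_simps)

lemma ind_hom_ext:
  assumes "\<phi> \<in> ind_hom C X Y" "\<psi> \<in> ind_hom C X Y" "\<And>i. i \<in> Obj (Shape X) ==> \<phi> i = \<psi> i"
  shows "\<phi> = \<psi>"
  using assms by (intro PiE_ext[of \<phi> "Obj (Shape X)" "\<lambda>i. colim_hom C Y (DObj X i)"])
    (auto simp: ind_hom_def)

lemma category_Ind: "category (Ind V C)"
proof
  fix f assume "f \<in> Arr (Ind V C)"
  then show "Dom (Ind V C) f \<in> Obj (Ind V C)" "Cod (Ind V C) f \<in> Obj (Ind V C)"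
    by (auto simp: Ind_simps)
next
  fix X assume "X \<in> Obj (Ind V C)"
  then show "Idn (Ind V C) X \<in> arrows (Ind V C) X X"
    using ind_id_ind_hom by (auto simp: Ind_simps Ind_arrows_iff)
next
  fix f g X Y Z assume "f \<in> arrows (Ind V C) X Y" "g \<in> arrows (Ind V C) Y Z"
  then show "Cmp (Ind V C) g f \<in> arrows (Ind V C) X Z"
    using ind_comp_ind_hom by (auto simp: Ind_simps Ind_arrows_iff)
next
  fix f X Y assume "f \<in> arrows (Ind V C) X Y"
  then obtain \<phi> where f: "f = (X, \<phi>, Y)" and X: "ind_obj C X" and Y: "ind_obj C Y"
    and \<phi>: "\<phi> \<in> ind_hom C X Y" unfolding Ind_arrows_iff by blast
  have "ind_comp C X Y (ind_id C Y) \<phi> = \<phi>"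
  proof (rule ind_hom_ext[OF ind_comp_ind_hom[OF X Y Y \<phi> ind_id_ind_hom[OF Y]] \<phi>])
    fix i assume i: "i \<in> Obj (Shape X)"
    obtain j f where jf: "j \<in> Obj (Shape Y)" "f \<in> arrows C (DObj X i) (DObj Y j)"
      "\<phi> i = germ C Y (DObj X i) j f" using ind_hom_germ[OF \<phi> i] .
    show "ind_comp C X Y (ind_id C Y) \<phi> i = \<phi> i"
      using ind_comp_germ[OF X Y Y \<phi> ind_id_ind_hom[OF Y] i jf jf(1)
          Idn_arrows[OF diagram_Obj[OF ind_objD(1)[OF Y] jf(1)]] ind_id_germ[OF jf(1)]]
        Cmp_Idn_left[OF jf(2)] jf(3) by simp
  qed
  then show "Cmp (Ind V C) (Idn (Ind V C) Y) f = f" using f by (simp add: Ind_simps)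
  have "ind_comp C X Y \<phi> (ind_id C X) = \<phi>"
  proof (rule ind_hom_ext[OF ind_comp_ind_hom[OF X X Y ind_id_ind_hom[OF X] \<phi>] \<phi>])
    fix i assume i: "i \<in> Obj (Shape X)"
    obtain j f where jf: "j \<in> Obj (Shape Y)" "f \<in> arrows C (DObj X i) (DObj Y j)"
      "\<phi> i = germ C Y (DObj X i) j f" using ind_hom_germ[OF \<phi> i] .
    show "ind_comp C X Y \<phi> (ind_id C X) i = \<phi> i"
      using ind_comp_germ[OF X X Y ind_id_ind_hom[OF X] \<phi> i i
          Idn_arrows[OF diagram_Obj[OF ind_objD(1)[OF X] i]] ind_id_germ[OF i] jf]
        Cmp_Idn_right[OF jf(2)] jf(3) by simp
  qed
  then show "Cmp (Ind V C) f (Idn (Ind V C) X) = f" using f by (simp add: Ind_simps)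
next
  fix f g h W X Y Z
  assume "f \<in> arrows (Ind V C) W X" "g \<in> arrows (Ind V C) X Y" "h \<in> arrows (Ind V C) Y Z"
  then obtain \<phi> \<gamma> \<eta> where fgh: "f = (W, \<phi>, X)" "g = (X, \<gamma>, Y)" "h = (Y, \<eta>, Z)"
    and W: "ind_obj C W" and X: "ind_obj C X" and Y: "ind_obj C Y" and Z: "ind_obj C Z"
    and \<phi>: "\<phi> \<in> ind_hom C W X" and \<gamma>: "\<gamma> \<in> ind_hom C X Y" and \<eta>: "\<eta> \<in> ind_hom C Y Z"
    unfolding Ind_arrows_iff by blast
  note \<gamma>\<phi> = ind_comp_ind_hom[OF W X Y \<phi> \<gamma>] and \<eta>\<gamma> = ind_comp_ind_hom[OF X Y Z \<gamma> \<eta>]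
  have "ind_comp C W Z \<eta> (ind_comp C W Y \<gamma> \<phi>) = ind_comp C W Z (ind_comp C X Z \<eta> \<gamma>) \<phi>"
  proof (rule ind_hom_ext[OF ind_comp_ind_hom[OF W Y Z \<gamma>\<phi> \<eta>] ind_comp_ind_hom[OF W X Z \<phi> \<eta>\<gamma>]])
    fix i assume i: "i \<in> Obj (Shape W)"
    obtain j f where jf: "j \<in> Obj (Shape X)" "f \<in> arrows C (DObj W i) (DObj X j)"
      "\<phi> i = germ C X (DObj W i) j f" using ind_hom_germ[OF \<phi> i] .
    obtain k g where kg: "k \<in> Obj (Shape Y)" "g \<in> arrows C (DObj X j) (DObj Y k)"
      "\<gamma> j = germ C Y (DObj X j) k g" using ind_hom_germ[OF \<gamma> jf(1)] .
    obtain l h where lh: "l \<in> Obj (Shape Z)" "h \<in> arrows C (DObj Y k) (DObj Z l)"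
      "\<eta> k = germ C Z (DObj Y k) l h" using ind_hom_germ[OF \<eta> kg(1)] .
    show "ind_comp C W Z \<eta> (ind_comp C W Y \<gamma> \<phi>) i = ind_comp C W Z (ind_comp C X Z \<eta> \<gamma>) \<phi> i"
      using ind_comp_germ[OF W Y Z \<gamma>\<phi> \<eta> i kg(1) Cmp_arrows[OF jf(2) kg(2)]
          ind_comp_germ[OF W X Y \<phi> \<gamma> i jf kg] lh]
        ind_comp_germ[OF W X Z \<phi> \<eta>\<gamma> i jf lh(1) Cmp_arrows[OF kg(2) lh(2)]
          ind_comp_germ[OF X Y Z \<gamma> \<eta> jf(1) kg lh]]
        Cmp_assoc[OF jf(2) kg(2) lh(2)] by simp
  qed
  then show "Cmp (Ind V C) h (Cmp (Ind V C) g f) = Cmp (Ind V C) (Cmp (Ind V C) h g) f"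
    using fgh by (simp add: Ind_simps)
qed

end

section \<open>Objects as constant diagrams\<close>

text \<open>Any element of \<open>'v\<close> could serve as the only object and the only arrow of
  the shape; \<open>undefined\<close> merely names one.\<close>

definition const_diagram :: "('o, 'm) cat \<Rightarrow> 'o \<Rightarrow> ('v, 'v, 'o, 'm) diagram" where
  "const_diagram C c =
     \<lparr>Shape = \<lparr>Obj = {undefined}, Arr = {undefined}, Dom = \<lambda>_. undefined, Cod = \<lambda>_. undefined,
        Idn = \<lambda>_. undefined, Cmp = \<lambda>_ _. undefined\<rparr>,
      DObj = \<lambda>_. c, DArr = \<lambda>_. Idn C c\<rparr>"

text \<open>A family over a one-point shape is a single germ \<open>\<kappa>\<close>. Restricting it
  to the point makes it extensional, as \<open>ind_hom\<close> demands, and hence determined by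
  \<open>\<kappa>\<close>.\<close>

definition element :: "('o, 'm) cat \<Rightarrow> ('v, 'o, 'm) ind_ob \<Rightarrow> 'o \<Rightarrow> ('v \<times> 'm) set \<Rightarrow> ('v, 'o, 'm) ind_arr" where
  "element C X c \<kappa> = (const_diagram C c, \<lambda>i \<in> {undefined}. \<kappa>, X)"

definition const_arrow :: "('o, 'm) cat \<Rightarrow> 'm \<Rightarrow> ('v, 'o, 'm) ind_arr" where
  "const_arrow C f = element C (const_diagram C (Cod C f)) (Dom C f)
     (germ C (const_diagram C (Cod C f)) (Dom C f) undefined f)"

definition ind_incl :: "('o, 'm) cat \<Rightarrow> ('v, 'o, 'm) ind_ob \<Rightarrow> 'v \<Rightarrow> ('v, 'o, 'm) ind_arr" where
  "ind_incl C X i = element C X (DObj X i) (germ C X (DObj X i) i (Idn C (DObj X i)))"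

lemma const_diagram_simps:
  "Obj (Shape (const_diagram C c)) = {undefined}"
  "Arr (Shape (const_diagram C c)) = {undefined}"
  "DObj (const_diagram C c) i = c"
  "DArr (const_diagram C c) a = Idn C c"
  "a \<in> arrows (Shape (const_diagram C c)) i j \<longleftrightarrow> a = undefined \<and> i = undefined \<and> j = undefined"
  by (auto simp: const_diagram_def arrows_def)

lemma element_inject: "element C X c \<kappa> = element C X c \<kappa>' \<longleftrightarrow> \<kappa> = \<kappa>'"
  unfolding element_def by (metis prod.inject restrict_apply' singletonI)

locale ind_category = category C + universe V
  for C :: "('o, 'm) cat" and V :: "'v itself"
begin

abbreviation A :: "(('v, 'o, 'm) ind_ob, ('v, 'o, 'm) ind_arr) cat" where
  "A \<equiv> Ind TYPE('v) C"

abbreviation K :: "'o \<Rightarrow> ('v, 'o, 'm) ind_ob" where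
  "K \<equiv> const_diagram C"

abbreviation KA :: "'m \<Rightarrow> ('v, 'o, 'm) ind_arr" where
  "KA \<equiv> const_arrow C"

lemma ind_obj_const:
  assumes "c \<in> Obj C"
  shows "ind_obj C (K c)"
proof -
  have cat: "category (Shape (K c))"
    unfolding const_diagram_def by unfold_locales (auto simp: arrows_def)
  have "is_diagram C (K c)"
    using cat Idn_arrows[OF assms] Cmp_Idn_left[OF Idn_arrows[OF assms]] assms
    by (simp add: is_diagram_def const_diagram_simps)
  moreover have "filtered (Shape (K c))"
    using cat unfolding filtered_def const_diagram_simps by (simp add: const_diagram_def arrows_def)
  ultimately show ?thesis
    using cat by (simp add: ind_obj_def small_cat_def const_diagram_simps small_finite)
qed

text \<open>Over a one-point shape the limit in the definition of arrows is trivial and only the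
  colimit of the sets of arrows remains.\<close>

lemma element_arrows_iff:
  assumes c: "c \<in> Obj C" and X: "ind_obj C X"
  shows "x \<in> arrows A (K c) X \<longleftrightarrow> (\<exists>\<kappa> \<in> colim_hom C X c. x = element C X c \<kappa>)"
proof
  assume "x \<in> arrows A (K c) X"
  then obtain \<phi> where \<phi>: "x = (K c, \<phi>, X)" "\<phi> \<in> ind_hom C (K c) X"
    unfolding Ind_arrows_iff by blast
  then have "\<phi> \<in> (\<Pi>\<^sub>E i \<in> {undefined}. colim_hom C X c)"
    by (auto simp: ind_hom_def const_diagram_simps)
  then have "\<phi> undefined \<in> colim_hom C X c" "\<phi> = (\<lambda>i \<in> {undefined}. \<phi> undefined)"
    by (auto simp: PiE_def extensional_def restrict_def fun_eq_iff)
  then show "\<exists>\<kappa> \<in> colim_hom C X c. x = element C X c \<kappa>"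
    using \<phi>(1) unfolding element_def by metis
next
  assume "\<exists>\<kappa> \<in> colim_hom C X c. x = element C X c \<kappa>"
  then obtain \<kappa> where \<kappa>: "\<kappa> \<in> colim_hom C X c" "x = element C X c \<kappa>" by blast
  obtain j f where jf: "j \<in> Obj (Shape X)" "f \<in> arrows C c (DObj X j)" "\<kappa> = germ C X c j f"
    using \<kappa>(1) unfolding colim_hom_iff by blast
  have "(\<lambda>i \<in> {undefined}. \<kappa>) \<in> ind_hom C (K c) X"
    by (rule ind_homI[OF ind_obj_const[OF c] X])
      (use jf Cmp_Idn_right[OF jf(2)] in \<open>force simp: const_diagram_simps\<close>)+
  then show "x \<in> arrows A (K c) X"
    using \<kappa> X ind_obj_const[OF c] by (simp add: Ind_arrows_iff element_def)
qed

lemma element_germ_arrows: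
  assumes "c \<in> Obj C" "ind_obj C X" "j \<in> Obj (Shape X)" "f \<in> arrows C c (DObj X j)"
  shows "element C X c (germ C X c j f) \<in> arrows A (K c) X"
  using assms element_arrows_iff colim_hom_iff by metis

lemma Cmp_element:
  assumes c: "c \<in> Obj C" and X: "ind_obj C X" and Y: "ind_obj C Y" and \<phi>: "\<phi> \<in> ind_hom C X Y"
    and jf: "j \<in> Obj (Shape X)" "f \<in> arrows C c (DObj X j)"
    and lg: "l \<in> Obj (Shape Y)" "g \<in> arrows C (DObj X j) (DObj Y l)" "\<phi> j = germ C Y (DObj X j) l g"
  shows "Cmp A (X, \<phi>, Y) (element C X c (germ C X c j f)) = element C Y c (germ C Y c l (Cmp C g f))"
proof -
  let ?x = "\<lambda>i \<in> {undefined :: 'v}. germ C X c j f"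
  have x: "?x \<in> ind_hom C (K c) X"
    using element_germ_arrows[OF c X jf] by (simp add: element_def Ind_arrows_iff)
  have "ind_comp C (K c) Y \<phi> ?x undefined = germ C Y c l (Cmp C g f)"
    using ind_comp_germ[OF ind_obj_const[OF c] X Y x \<phi> _ jf(1) _ _ lg] jf
    by (simp add: const_diagram_simps)
  then have "ind_comp C (K c) Y \<phi> ?x = (\<lambda>i \<in> {undefined}. germ C Y c l (Cmp C g f))"
    by (simp add: ind_comp_def const_diagram_simps restrict_def fun_eq_iff)
  then show ?thesis by (simp add: element_def Ind_simps)
qed

lemma element_comp_const_arrow:
  assumes X: "ind_obj C X" and f: "f \<in> arrows C c d"
    and jg: "j \<in> Obj (Shape X)" "g \<in> arrows C d (DObj X j)"
  shows "Cmp A (element C X d (germ C X d j g)) (KA f) = element C X c (germ C X c j (Cmp C g f))"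
proof -
  have O: "c \<in> Obj C" "d \<in> Obj C" using f arrows_ObjD by blast+
  let ?x = "\<lambda>i \<in> {undefined :: 'v}. germ C X d j g"
  have x: "?x \<in> ind_hom C (K d) X"
    using element_germ_arrows[OF O(2) X jg] by (simp add: element_def Ind_arrows_iff)
  have "Cmp A (K d, ?x, X) (element C (K d) c (germ C (K d) c undefined f)) =
      element C X c (germ C X c j (Cmp C g f))"
    by (rule Cmp_element[OF O(1) ind_obj_const[OF O(2)] X x])
      (use f jg in \<open>auto simp: const_diagram_simps\<close>)
  then show ?thesis
    using f by (simp add: const_arrow_def element_def arrows_iff)
qed

lemma const_arrow_arrows:
  assumes f: "f \<in> arrows C c d"
  shows "KA f \<in> arrows A (K c) (K d)"
  using element_germ_arrows[of c "K d" undefined f] ind_obj_const f arrows_ObjD[OF f]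
  by (simp add: const_arrow_def const_diagram_simps arrows_iff[of f])

lemma const_arrow_Cmp:
  assumes f: "f \<in> arrows C b c" and g: "g \<in> arrows C c d"
  shows "KA (Cmp C g f) = Cmp A (KA g) (KA f)"
  using element_comp_const_arrow[OF ind_obj_const f, of d undefined g] g arrows_ObjD[OF g]
    Cmp_arrows[OF f g]
  by (simp add: const_diagram_simps arrows_iff const_arrow_def[of C g] const_arrow_def[of C "Cmp C g f"])

lemma const_arrow_Idn:
  assumes c: "c \<in> Obj C"
  shows "KA (Idn C c) = Idn A (K c)"
  using Idn_Arr[OF c]
  by (simp add: const_arrow_def element_def Ind_simps ind_id_def germ_def const_diagram_simps
      restrict_def fun_eq_iff)

text \<open>This is the bridge from the concrete arrows of \<open>Ind\<close> to the abstract
  treatment below: an ind-object is the formal colimit of its own diagram, with the germs of the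
  identities as cocone.\<close>

lemma presents_self:
  assumes X: "ind_obj C X"
  shows "presents TYPE('v) C A K KA X X (ind_incl C X)"
proof -
  note DX = ind_objD[OF X]
  have O: "DObj X i \<in> Obj C" if "i \<in> Obj (Shape X)" for i using diagram_Obj[OF DX(1) that] .
  have incl: "ind_incl C X i \<in> arrows A (K (DObj X i)) X" if "i \<in> Obj (Shape X)" for i
    unfolding ind_incl_def using element_germ_arrows[OF O[OF that] X that Idn_arrows[OF O[OF that]]] .
  have inclf: "Cmp A (ind_incl C X i) (KA f) = element C X c (germ C X c i f)"
    if "i \<in> Obj (Shape X)" "f \<in> arrows C c (DObj X i)" for i f c
    unfolding ind_incl_def
    using element_comp_const_arrow[OF X that(2,1) Idn_arrows[OF O[OF that(1)]]]
      Cmp_Idn_left[OF that(2)] by simp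
  show ?thesis
    unfolding presents_def
  proof (intro conjI ballI allI impI)
    show "is_diagram C X" "filtered (Shape X)" "small_cat TYPE('v) (Shape X)" "X \<in> Obj A"
      using X by (auto simp: ind_obj_def Ind_simps)
    show "ind_incl C X i \<in> arrows A (K (DObj X i)) X" if "i \<in> Obj (Shape X)" for i
      using incl that .
  next
    fix a assume "a \<in> Arr (Shape X)"
    then have a: "a \<in> arrows (Shape X) (Dom (Shape X) a) (Cod (Shape X) a)" by (rule Arr_arrows)
    then have I: "Dom (Shape X) a \<in> Obj (Shape X)" "Cod (Shape X) a \<in> Obj (Shape X)"
      using category.arrows_ObjD[OF DX(3)] by blast+
    have aA: "DArr X a \<in> arrows C (DObj X (Dom (Shape X) a)) (DObj X (Cod (Shape X) a))"
      using diagram_arrows[OF DX(1) a] .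
    show "Cmp A (ind_incl C X (Cod (Shape X) a)) (KA (DArr X a)) = ind_incl C X (Dom (Shape X) a)"
      unfolding inclf[OF I(2) aA] unfolding ind_incl_def
      using germ_DArr[OF DX(1,2) Idn_arrows[OF O[OF I(1)]] a] Cmp_Idn_right[OF aA] by simp
  next
    fix c x assume "c \<in> Obj C" "x \<in> arrows A (K c) X"
    then show "\<exists>i\<in>Obj (Shape X). \<exists>f\<in>arrows C c (DObj X i). x = Cmp A (ind_incl C X i) (KA f)"
      using element_arrows_iff[OF _ X] colim_hom_iff inclf by metis
  next
    fix c i j f g
    assume *: "i \<in> Obj (Shape X)" "j \<in> Obj (Shape X)" "f \<in> arrows C c (DObj X i)"
      "g \<in> arrows C c (DObj X j)" "Cmp A (ind_incl C X i) (KA f) = Cmp A (ind_incl C X j) (KA g)"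
    then have "germ C X c i f = germ C X c j g"
      by (simp add: inclf element_inject)
    then show "\<exists>m a b. a \<in> arrows (Shape X) i m \<and> b \<in> arrows (Shape X) j m \<and>
        Cmp C (DArr X a) f = Cmp C (DArr X b) g"
      using germ_eq_iff[OF DX(1,2) *(1,3,2,4)] by blast
  next
    fix Y y
    assume "Y \<in> Obj A \<and> (\<forall>i\<in>Obj (Shape X). y i \<in> arrows A (K (DObj X i)) Y) \<and>
      (\<forall>a\<in>Arr (Shape X). Cmp A (y (Cod (Shape X) a)) (KA (DArr X a)) = y (Dom (Shape X) a))"
    then have Y: "ind_obj C Y" and y: "\<And>i. i \<in> Obj (Shape X) ==> y i \<in> arrows A (K (DObj X i)) Y"
      and compat: "\<And>a. a \<in> Arr (Shape X) ==>
        Cmp A (y (Cod (Shape X) a)) (KA (DArr X a)) = y (Dom (Shape X) a)"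
      by (auto simp: Ind_simps)
    \<comment> \<open>Each member of the cocone \<open>y\<close> carries exactly one germ, and these
      germs together are the arrow out of \<open>X\<close>; the cocone condition becomes
      compatibility.\<close>
    have "\<forall>i \<in> Obj (Shape X). \<exists>\<kappa>. \<kappa> \<in> colim_hom C Y (DObj X i) \<and> y i = element C Y (DObj X i) \<kappa>"
      using y element_arrows_iff[OF O Y] by blast
    then obtain \<kappa> where \<kappa>: "\<And>i. i \<in> Obj (Shape X) ==> \<kappa> i \<in> colim_hom C Y (DObj X i)"
      "\<And>i. i \<in> Obj (Shape X) ==> y i = element C Y (DObj X i) (\<kappa> i)"
      by metis
    define \<phi> where "\<phi> = (\<lambda>i \<in> Obj (Shape X). \<kappa> i)"
    have \<phi>: "\<phi> \<in> ind_hom C X Y"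
    proof (rule ind_homI[OF X Y])
      show "\<phi> \<in> extensional (Obj (Shape X))" by (simp add: \<phi>_def)
      show "\<exists>j\<in>Obj (Shape Y). \<exists>f\<in>arrows C (DObj X i) (DObj Y j). \<phi> i = germ C Y (DObj X i) j f"
        if "i \<in> Obj (Shape X)" for i
        using \<kappa>(1)[OF that, unfolded colim_hom_iff] that by (simp add: \<phi>_def)
    next
      fix a i i' assume a: "a \<in> arrows (Shape X) i i'"
      have I: "i \<in> Obj (Shape X)" "i' \<in> Obj (Shape X)"
        using a category.arrows_ObjD[OF DX(3)] by blast+
      obtain j f where jf: "j \<in> Obj (Shape Y)" "f \<in> arrows C (DObj X i') (DObj Y j)"
        "\<kappa> i' = germ C Y (DObj X i') j f" using \<kappa>(1)[OF I(2)] unfolding colim_hom_iff by blast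
      have "element C Y (DObj X i) (\<kappa> i) = Cmp A (element C Y (DObj X i') (\<kappa> i')) (KA (DArr X a))"
        using compat[of a] a \<kappa>(2) I by (simp add: arrows_iff)
      also have "\<dots> = element C Y (DObj X i) (germ C Y (DObj X i) j (Cmp C f (DArr X a)))"
        using element_comp_const_arrow[OF Y diagram_arrows[OF DX(1) a] jf(1,2)] jf(3) by simp
      finally show "\<exists>j\<in>Obj (Shape Y). \<exists>f\<in>arrows C (DObj X i') (DObj Y j).
         \<phi> i' = germ C Y (DObj X i') j f \<and> \<phi> i = germ C Y (DObj X i) j (Cmp C f (DArr X a))"
        using jf I by (auto simp: \<phi>_def element_inject)
    qed
    have comp: "Cmp A (X, \<psi>, Y) (ind_incl C X i) = element C Y (DObj X i) (\<psi> i)"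
      if \<psi>: "\<psi> \<in> ind_hom C X Y" and i: "i \<in> Obj (Shape X)" for \<psi> i
    proof -
      obtain l g where lg: "l \<in> Obj (Shape Y)" "g \<in> arrows C (DObj X i) (DObj Y l)"
        "\<psi> i = germ C Y (DObj X i) l g" using ind_hom_germ[OF \<psi> i] .
      show ?thesis
        unfolding ind_incl_def
        using Cmp_element[OF O[OF i] X Y \<psi> i Idn_arrows[OF O[OF i]] lg]
          Cmp_Idn_right[OF lg(2)] lg(3) by simp
    qed
    show "\<exists>!\<phi>. \<phi> \<in> arrows A X Y \<and> (\<forall>i\<in>Obj (Shape X). Cmp A \<phi> (ind_incl C X i) = y i)"
    proof (rule ex1I[of _ "(X, \<phi>, Y)"])
      show "(X, \<phi>, Y) \<in> arrows A X Y \<and> (\<forall>i\<in>Obj (Shape X). Cmp A (X, \<phi>, Y) (ind_incl C X i) = y i)"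
        using \<phi> X Y comp[OF \<phi>] \<kappa>(2) by (auto simp: Ind_arrows_iff \<phi>_def)
      fix \<psi>' assume *: "\<psi>' \<in> arrows A X Y \<and> (\<forall>i\<in>Obj (Shape X). Cmp A \<psi>' (ind_incl C X i) = y i)"
      then obtain \<psi> where \<psi>: "\<psi>' = (X, \<psi>, Y)" "\<psi> \<in> ind_hom C X Y" by (auto simp: Ind_arrows_iff)
      have "\<psi> = \<phi>"
      proof (rule ind_hom_ext[OF \<psi>(2) \<phi>])
        fix i assume i: "i \<in> Obj (Shape X)"
        then have "element C Y (DObj X i) (\<psi> i) = element C Y (DObj X i) (\<kappa> i)"
          using * \<psi>(1) comp[OF \<psi>(2) i] \<kappa>(2)[OF i] by auto
        then show "\<psi> i = \<phi> i" using i by (simp add: element_inject \<phi>_def)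
      qed
      then show "\<psi>' = (X, \<phi>, Y)" using \<psi>(1) by simp
    qed
  qed
qed

end

section \<open>Encoding small diagrams in the universe\<close>

text \<open>Later shapes consist of elements, arrows and tuples of these, whose types differ from
  \<open>'v\<close>. Injections of the objects and of the arrows into \<open>'v\<close> give an
  isomorphic shape of the type over which ind-objects are formed.\<close>

definition encode :: "('i \<Rightarrow> 'v) \<Rightarrow> ('a \<Rightarrow> 'v) \<Rightarrow> ('i, 'a, 'o, 'm) diagram \<Rightarrow> ('v, 'v, 'o, 'm) diagram" where
  "encode eo ea D =
    (let S = Shape D; do = inv_into (Obj S) eo; da = inv_into (Arr S) ea in
     \<lparr>Shape = \<lparr>Obj = eo ` Obj S, Arr = ea ` Arr S, Dom = \<lambda>a. eo (Dom S (da a)),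
        Cod = \<lambda>a. eo (Cod S (da a)), Idn = \<lambda>i. ea (Idn S (do i)),
        Cmp = \<lambda>g f. ea (Cmp S (da g) (da f))\<rparr>,
      DObj = \<lambda>i. DObj D (do i), DArr = \<lambda>a. DArr D (da a)\<rparr>)"

locale encoding =
  fixes D :: "('i, 'a, 'o, 'm) diagram" and eo :: "'i \<Rightarrow> 'v" and ea :: "'a \<Rightarrow> 'v"
    and C :: "('o, 'm) cat"
  assumes diagram: "is_diagram C D"
    and eo: "inj_on eo (Obj (Shape D))" and ea: "inj_on ea (Arr (Shape D))"
begin

sublocale S: category "Shape D" using diagram by (simp add: is_diagram_def)

abbreviation "S' \<equiv> Shape (encode eo ea D)"

lemma encode_simps:
  "Obj S' = eo ` Obj (Shape D)" "Arr S' = ea ` Arr (Shape D)"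
  "a \<in> Arr (Shape D) ==> Dom S' (ea a) = eo (Dom (Shape D) a)"
  "a \<in> Arr (Shape D) ==> Cod S' (ea a) = eo (Cod (Shape D) a)"
  "i \<in> Obj (Shape D) ==> Idn S' (eo i) = ea (Idn (Shape D) i)"
  "a \<in> Arr (Shape D) ==> b \<in> Arr (Shape D) ==> Cmp S' (ea b) (ea a) = ea (Cmp (Shape D) b a)"
  "i \<in> Obj (Shape D) ==> DObj (encode eo ea D) (eo i) = DObj D i"
  "a \<in> Arr (Shape D) ==> DArr (encode eo ea D) (ea a) = DArr D a"
  using eo ea by (simp_all add: encode_def Let_def)

lemma encode_arrows:
  "i \<in> Obj (Shape D) ==> j \<in> Obj (Shape D) ==> arrows S' (eo i) (eo j) = ea ` arrows (Shape D) i j"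
  using eo S.Dom_Obj S.Cod_Obj by (fastforce simp: arrows_def encode_simps inj_on_eq_iff)

lemma encode_arrowsE:
  assumes "f \<in> arrows S' x y"
  obtains a i j where "f = ea a" "x = eo i" "y = eo j" "a \<in> arrows (Shape D) i j"
    "i \<in> Obj (Shape D)" "j \<in> Obj (Shape D)"
proof -
  have "f \<in> ea ` Arr (Shape D)" using assms by (simp add: arrows_def encode_simps)
  then obtain a where a: "f = ea a" "a \<in> Arr (Shape D)" by blast
  show ?thesis
    using that[OF a(1) _ _ Arr_arrows[OF a(2)]] assms a S.Dom_Obj S.Cod_Obj
    by (auto simp: arrows_def encode_simps)
qed

lemma category_encode: "category S'"
proof
  fix f assume "f \<in> Arr S'"
  then show "Dom S' f \<in> Obj S'" "Cod S' f \<in> Obj S'"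
    using S.Dom_Obj S.Cod_Obj by (auto simp: encode_simps)
next
  fix X assume "X \<in> Obj S'"
  then show "Idn S' X \<in> arrows S' X X"
    using S.Idn_arrows by (auto simp: encode_simps encode_arrows)
next
  fix f g X Y Z assume "f \<in> arrows S' X Y" "g \<in> arrows S' Y Z"
  then obtain a i j b j' k where *: "f = ea a" "X = eo i" "Y = eo j" "a \<in> arrows (Shape D) i j"
      "g = ea b" "Y = eo j'" "Z = eo k" "b \<in> arrows (Shape D) j' k"
    by (elim encode_arrowsE) blast
  have "j = j'" using * eo S.arrows_ObjD by (metis inj_onD)
  then have "Cmp (Shape D) b a \<in> arrows (Shape D) i k" using * S.Cmp_arrows by blast
  then show "Cmp S' g f \<in> arrows S' X Z"
    using * S.arrows_ObjD encode_arrows[of i k] by (auto simp: encode_simps arrows_iff)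
next
  fix f X Y assume "f \<in> arrows S' X Y"
  then obtain a i j where *: "f = ea a" "X = eo i" "Y = eo j" "a \<in> arrows (Shape D) i j"
    "i \<in> Obj (Shape D)" "j \<in> Obj (Shape D)"
    by (elim encode_arrowsE) blast
  have **: "a \<in> Arr (Shape D)" "Idn (Shape D) j \<in> Arr (Shape D)" "Idn (Shape D) i \<in> Arr (Shape D)"
    using * S.Idn_Arr by (auto simp: arrows_iff)
  show "Cmp S' (Idn S' Y) f = f" "Cmp S' f (Idn S' X) = f"
    using * ** S.Cmp_Idn_left[OF *(4)] S.Cmp_Idn_right[OF *(4)] by (simp_all add: encode_simps)
next
  fix f g h W X Y Z assume "f \<in> arrows S' W X" "g \<in> arrows S' X Y" "h \<in> arrows S' Y Z"
  then obtain a i j b j' k c k' l where *: "f = ea a" "W = eo i" "X = eo j" "a \<in> arrows (Shape D) i j"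
      "g = ea b" "X = eo j'" "Y = eo k" "b \<in> arrows (Shape D) j' k"
      "h = ea c" "Y = eo k'" "Z = eo l" "c \<in> arrows (Shape D) k' l"
    by (elim encode_arrowsE) blast
  have "j = j'" "k = k'" using * eo S.arrows_ObjD by (metis inj_onD)+
  then have **: "b \<in> arrows (Shape D) j k" "c \<in> arrows (Shape D) k l" using * by auto
  have A: "a \<in> Arr (Shape D)" "b \<in> Arr (Shape D)" "c \<in> Arr (Shape D)"
    using * by (auto simp: arrows_iff)
  show "Cmp S' h (Cmp S' g f) = Cmp S' (Cmp S' h g) f"
    using S.Cmp_assoc[OF *(4) **] S.Cmp_arrows[OF *(4) **(1)] S.Cmp_arrows[OF **]
    unfolding *(1,5,9) arrows_iff by (simp add: encode_simps A)
qed

lemma diagram_encode: "is_diagram C (encode eo ea D)"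
  unfolding is_diagram_def
proof (intro conjI ballI impI)
  show "category S'" by (rule category_encode)
  fix i assume "i \<in> Obj S'"
  then obtain i' where i': "i = eo i'" "i' \<in> Obj (Shape D)" by (auto simp: encode_simps)
  show "DObj (encode eo ea D) i \<in> Obj C"
    "DArr (encode eo ea D) (Idn S' i) = Idn C (DObj (encode eo ea D) i)"
    using i' diagram_Obj[OF diagram] diagram_Idn[OF diagram] S.Idn_Arr by (simp_all add: encode_simps)
next
  fix a assume "a \<in> Arr S'"
  then obtain a' where a': "a = ea a'" "a' \<in> Arr (Shape D)" by (auto simp: encode_simps)
  show "DArr (encode eo ea D) a
       \<in> arrows C (DObj (encode eo ea D) (Dom S' a)) (DObj (encode eo ea D) (Cod S' a))"
    using a' diagram_arrows[OF diagram Arr_arrows[OF a'(2)]] S.Dom_Obj S.Cod_Obj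
    by (simp add: encode_simps)
  fix b assume "b \<in> Arr S'" and eq: "Cod S' a = Dom S' b"
  then obtain b' where b': "b = ea b'" "b' \<in> Arr (Shape D)" by (auto simp: encode_simps)
  have "Cod (Shape D) a' = Dom (Shape D) b'"
    using eq a' b' eo S.Dom_Obj S.Cod_Obj by (auto simp: encode_simps inj_on_eq_iff)
  then show "DArr (encode eo ea D) (Cmp S' b a) = Cmp C (DArr (encode eo ea D) b) (DArr (encode eo ea D) a)"
    using a' b' S.Cmp_Arr diagram_Cmp[OF diagram Arr_arrows[OF a'(2)]] Arr_arrows[OF b'(2)]
    by (simp add: encode_simps)
qed

lemma filtered_encode:
  assumes F: "filtered (Shape D)"
  shows "filtered S'"
  unfolding filtered_def
proof (intro conjI ballI)
  show "category S'" by (rule category_encode)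
  show "Obj S' \<noteq> {}" using F by (simp add: encode_simps filtered_def)
  fix i j assume "i \<in> Obj S'" "j \<in> Obj S'"
  then obtain i' j' where ij: "i = eo i'" "i' \<in> Obj (Shape D)" "j = eo j'" "j' \<in> Obj (Shape D)"
    by (auto simp: encode_simps)
  obtain l a b where "a \<in> arrows (Shape D) i' l" "b \<in> arrows (Shape D) j' l"
    using filtered_ub[OF F ij(2,4)] by blast
  then show "\<exists>l a b. a \<in> arrows S' i l \<and> b \<in> arrows S' j l"
    using ij encode_arrows S.arrows_ObjD by blast
  fix a b assume "a \<in> arrows S' i j" "b \<in> arrows S' i j"
  then obtain a' b' where ab: "a = ea a'" "a' \<in> arrows (Shape D) i' j'"
    "b = ea b'" "b' \<in> arrows (Shape D) i' j'"
    using ij encode_arrows by auto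
  obtain l c where c: "c \<in> arrows (Shape D) j' l" "Cmp (Shape D) c a' = Cmp (Shape D) c b'"
    using filtered_eq[OF F ab(2,4)] by blast
  have "ea c \<in> arrows S' j (eo l)" using c(1) ij encode_arrows S.arrows_ObjD by blast
  moreover have "Cmp S' (ea c) a = Cmp S' (ea c) b" using ab c by (simp add: encode_simps arrows_iff)
  ultimately show "\<exists>l c. c \<in> arrows S' j l \<and> Cmp S' c a = Cmp S' c b" by blast
qed

lemma presents_decode:
  assumes P: "presents V C A HO H (encode eo ea D) X \<iota>"
    and F: "filtered (Shape D)" and small: "small_cat V (Shape D)"
  shows "presents V C A HO H D X (\<lambda>i. \<iota> (eo i))"
  unfolding presents_def
proof (intro conjI ballI allI impI)
  note P' = P[unfolded presents_def]
  show "is_diagram C D" "filtered (Shape D)" "small_cat V (Shape D)" using diagram F small by auto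
  show "X \<in> Obj A" using P' by blast
  show "\<iota> (eo i) \<in> arrows A (HO (DObj D i)) X" if "i \<in> Obj (Shape D)" for i
    using P' that encode_simps(1,7) by (metis imageI)
  show "Cmp A (\<iota> (eo (Cod (Shape D) a))) (H (DArr D a)) = \<iota> (eo (Dom (Shape D) a))"
    if "a \<in> Arr (Shape D)" for a
    using P' that encode_simps(2-4,8) by (metis imageI)
  fix c
  show "\<exists>i\<in>Obj (Shape D). \<exists>f\<in>arrows C c (DObj D i). x = Cmp A (\<iota> (eo i)) (H f)"
    if "c \<in> Obj C" "x \<in> arrows A (HO c) X" for x
  proof -
    have "\<exists>i\<in>Obj S'. \<exists>f\<in>arrows C c (DObj (encode eo ea D) i). x = Cmp A (\<iota> i) (H f)"
      using P' that by blast
    then show ?thesis by (auto simp: encode_simps)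
  qed
  fix i j f g
  assume ij: "i \<in> Obj (Shape D)" "j \<in> Obj (Shape D)" "f \<in> arrows C c (DObj D i)"
    "g \<in> arrows C c (DObj D j)" "Cmp A (\<iota> (eo i)) (H f) = Cmp A (\<iota> (eo j)) (H g)"
  have "\<forall>c. \<forall>i \<in> Obj S'. \<forall>j \<in> Obj S'. \<forall>f \<in> arrows C c (DObj (encode eo ea D) i).
        \<forall>g \<in> arrows C c (DObj (encode eo ea D) j). Cmp A (\<iota> i) (H f) = Cmp A (\<iota> j) (H g) \<longrightarrow>
          (\<exists>m a b. a \<in> arrows S' i m \<and> b \<in> arrows S' j m \<and>
             Cmp C (DArr (encode eo ea D) a) f = Cmp C (DArr (encode eo ea D) b) g)"
    using P' by blast
  from this[rule_format, of "eo i" "eo j" f c g]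
  obtain m a b where ab: "a \<in> arrows S' (eo i) m" "b \<in> arrows S' (eo j) m"
     "Cmp C (DArr (encode eo ea D) a) f = Cmp C (DArr (encode eo ea D) b) g"
    using ij by (auto simp: encode_simps)
  have "m \<in> Obj S'" using ab(1) category.arrows_ObjD[OF category_encode] by blast
  then obtain m' where m': "m = eo m'" "m' \<in> Obj (Shape D)" by (auto simp: encode_simps)
  obtain a' b' where "a = ea a'" "a' \<in> arrows (Shape D) i m'" "b = ea b'" "b' \<in> arrows (Shape D) j m'"
    using ab(1,2) m' ij encode_arrows by auto
  then show "\<exists>m a b. a \<in> arrows (Shape D) i m \<and> b \<in> arrows (Shape D) j m \<and>
      Cmp C (DArr D a) f = Cmp C (DArr D b) g"
    using ab(3) by (auto simp: encode_simps arrows_iff)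
next
  note P' = P[unfolded presents_def]
  fix Y y
  assume *: "Y \<in> Obj A \<and> (\<forall>i\<in>Obj (Shape D). y i \<in> arrows A (HO (DObj D i)) Y) \<and>
      (\<forall>a\<in>Arr (Shape D). Cmp A (y (Cod (Shape D) a)) (H (DArr D a)) = y (Dom (Shape D) a))"
  let ?y = "\<lambda>i. y (inv_into (Obj (Shape D)) eo i)"
  have "\<exists>!\<phi>. \<phi> \<in> arrows A X Y \<and> (\<forall>i\<in>Obj S'. Cmp A \<phi> (\<iota> i) = ?y i)"
    by (rule presents_univ[OF P]) (use * eo S.Dom_Obj S.Cod_Obj in \<open>auto simp: encode_simps\<close>)
  then show "\<exists>!\<phi>. \<phi> \<in> arrows A X Y \<and> (\<forall>i\<in>Obj (Shape D). Cmp A \<phi> (\<iota> (eo i)) = y i)"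
    using eo by (simp add: encode_simps)
qed

end

section \<open>Categories of triples\<close>

text \<open>Arrows carry their endpoints because the same label can lie in many of the sets
  \<open>hm k l\<close>; in the applications the labels are arrows of \<open>C\<close>, possibly
  paired with an arrow of a shape, and the objects are elements lying over objects of
  \<open>C\<close>.\<close>

definition triple_cat ::
    "'k set \<Rightarrow> ('k \<Rightarrow> 'k \<Rightarrow> 'g set) \<Rightarrow> ('k \<Rightarrow> 'g) \<Rightarrow> ('g \<Rightarrow> 'g \<Rightarrow> 'g) \<Rightarrow> ('k, 'k \<times> 'g \<times> 'k) cat" where
  "triple_cat Ob hm idt cmp =
     \<lparr>Obj = Ob, Arr = {(k, g, k'). k \<in> Ob \<and> k' \<in> Ob \<and> g \<in> hm k k'},
      Dom = fst, Cod = (\<lambda>(_, _, k'). k'), Idn = (\<lambda>k. (k, idt k, k)),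
      Cmp = (\<lambda>(_, h, k'') (k, g, _). (k, cmp h g, k''))\<rparr>"

locale triples =
  fixes Ob :: "'k set" and hm :: "'k \<Rightarrow> 'k \<Rightarrow> 'g set" and idt :: "'k \<Rightarrow> 'g" and cmp :: "'g \<Rightarrow> 'g \<Rightarrow> 'g"
  assumes idt: "k \<in> Ob ==> idt k \<in> hm k k"
    and cmp: "g \<in> hm k l ==> h \<in> hm l m ==> k \<in> Ob ==> l \<in> Ob ==> m \<in> Ob ==> cmp h g \<in> hm k m"
    and cmp_idt: "g \<in> hm k l ==> k \<in> Ob ==> l \<in> Ob ==> cmp g (idt k) = g \<and> cmp (idt l) g = g"
    and cmp_assoc: "g \<in> hm k l ==> h \<in> hm l m ==> i \<in> hm m n ==>
      k \<in> Ob ==> l \<in> Ob ==> m \<in> Ob ==> n \<in> Ob ==> cmp i (cmp h g) = cmp (cmp i h) g"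
begin

abbreviation "T \<equiv> triple_cat Ob hm idt cmp"

lemma Obj_triple [simp]: "Obj T = Ob"
  by (simp add: triple_cat_def)

lemma triple_arrows_iff:
  "t \<in> arrows T k l \<longleftrightarrow> k \<in> Ob \<and> l \<in> Ob \<and> (\<exists>g \<in> hm k l. t = (k, g, l))"
  by (cases t) (auto simp: triple_cat_def arrows_def)

lemma Cmp_triple [simp]: "Cmp T (l', h, m) (k, g, l) = (k, cmp h g, m)"
  by (simp add: triple_cat_def)

lemma Idn_triple [simp]: "Idn T k = (k, idt k, k)"
  by (simp add: triple_cat_def)

lemma category_triple: "category T"
proof
  show "f \<in> Arr T ==> Dom T f \<in> Obj T" "f \<in> Arr T ==> Cod T f \<in> Obj T" for f
    by (auto simp: triple_cat_def)
qed (use idt cmp cmp_idt cmp_assoc in \<open>auto simp: triple_arrows_iff\<close>)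

lemma small_triple:
  assumes U: "universe TYPE('v)" and Ob: "small TYPE('v) Ob"
    and hm: "\<And>k l. k \<in> Ob ==> l \<in> Ob ==> small TYPE('v) (hm k l)"
  shows "small_cat TYPE('v) T"
proof -
  interpret universe "TYPE('v)" by (rule U)
  have "small TYPE('v) (\<Union>k \<in> Ob. \<Union>l \<in> Ob. {k} \<times> hm k l \<times> {l})"
    by (intro small_UN small_Times small_finite hm Ob) auto
  moreover have "Arr T = (\<Union>k \<in> Ob. \<Union>l \<in> Ob. {k} \<times> hm k l \<times> {l})"
    by (auto simp: triple_cat_def)
  ultimately show ?thesis
    using category_triple Ob by (simp add: small_cat_def)
qed

lemma filtered_triple:
  assumes "Ob \<noteq> {}"
    and ub: "\<And>k l. k \<in> Ob ==> l \<in> Ob ==> \<exists>m \<in> Ob. hm k m \<noteq> {} \<and> hm l m \<noteq> {}"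
    and eq: "\<And>k l f g. k \<in> Ob ==> l \<in> Ob ==> f \<in> hm k l ==> g \<in> hm k l ==>
      \<exists>m \<in> Ob. \<exists>h \<in> hm l m. cmp h f = cmp h g"
  shows "filtered T"
  unfolding filtered_def
proof (intro conjI ballI category_triple)
  show "Obj T \<noteq> {}" using assms(1) by simp
  fix k l assume kl: "k \<in> Obj T" "l \<in> Obj T"
  show "\<exists>m a b. a \<in> arrows T k m \<and> b \<in> arrows T l m"
    using ub kl unfolding triple_arrows_iff by fastforce
  fix a b assume "a \<in> arrows T k l" "b \<in> arrows T k l"
  then show "\<exists>m c. c \<in> arrows T l m \<and> Cmp T c a = Cmp T c b"
    using eq unfolding triple_arrows_iff by fastforce
qed

lemma diagram_triple:
  assumes "\<And>k. k \<in> Ob ==> F k \<in> Obj C"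
    and "\<And>k l g. k \<in> Ob ==> l \<in> Ob ==> g \<in> hm k l ==> FA (k, g, l) \<in> arrows C (F k) (F l)"
    and "\<And>k. k \<in> Ob ==> FA (k, idt k, k) = Idn C (F k)"
    and "\<And>k l m g h. k \<in> Ob ==> l \<in> Ob ==> m \<in> Ob ==> g \<in> hm k l ==> h \<in> hm l m ==>
      FA (k, cmp h g, m) = Cmp C (FA (l, h, m)) (FA (k, g, l))"
  shows "is_diagram C \<lparr>Shape = T, DObj = F, DArr = FA\<rparr>"
proof -
  have *: "\<exists>k g l. a = (k, g, l) \<and> k \<in> Ob \<and> l \<in> Ob \<and> g \<in> hm k l \<and> Dom T a = k \<and> Cod T a = l"
    if "a \<in> Arr T" for a
    using that by (auto simp: triple_cat_def)
  show ?thesis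
    unfolding is_diagram_def diagram.simps Obj_triple Idn_triple
  proof (intro conjI ballI impI category_triple)
    fix a assume "a \<in> Arr T"
    from *[OF this] obtain k g l where a: "a = (k, g, l)" "k \<in> Ob" "l \<in> Ob" "g \<in> hm k l"
      "Dom T a = k" "Cod T a = l" by blast
    show "FA a \<in> arrows C (F (Dom T a)) (F (Cod T a))" using assms(2) a by simp
    fix b assume "b \<in> Arr T" and eq: "Cod T a = Dom T b"
    from *[OF this(1)] obtain k' h m where b: "b = (k', h, m)" "k' \<in> Ob" "m \<in> Ob" "h \<in> hm k' m"
      "Dom T b = k'" by blast
    then show "FA (Cmp T b a) = Cmp C (FA b) (FA a)" using assms(4) a eq by simp
  qed (use assms in auto)
qed

end

section \<open>The base category and its completion\<close>

text \<open>
  The arrows in \<open>SE\<close> play the role of the strict epimorphisms.  The last part of assumption \<open>cok\<close>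
  describes the image of \<open>a\<close> as the kernel \<open>j\<close> of its cokernel \<open>q\<close>.
\<close>

locale base_category = preadditive C pl neg nul
  for C :: "('o, 'm) cat" and pl neg nul +
  fixes SE :: "'m \<Rightarrow> bool"
  assumes ex_zero: "\<exists>Z \<in> Obj C. Idn C Z = nul Z Z"
    and biprod: "X \<in> Obj C ==> Y \<in> Obj C ==>
      \<exists>P. \<exists>i \<in> arrows C X P. \<exists>j \<in> arrows C Y P. \<exists>p \<in> arrows C P X. \<exists>q \<in> arrows C P Y.
        Cmp C p i = Idn C X \<and> Cmp C q j = Idn C Y \<and> Cmp C p j = nul Y X \<and> Cmp C q i = nul X Y"
    and cok: "a \<in> arrows C X Y ==> \<exists>q. coker a q \<and> SE q \<and>
      (\<exists>I. \<exists>e \<in> arrows C X I. \<exists>j \<in> arrows C I Y. Cmp C j e = a \<and> Cmp C q j = nul I (Cod C q) \<and>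
         (\<forall>W. \<forall>u \<in> arrows C I W. Cmp C u e = nul X W \<longrightarrow> u = nul I W) \<and>
         (\<forall>W. \<forall>g \<in> arrows C W Y. Cmp C q g = nul W (Cod C q) \<longrightarrow>
            (\<exists>g' \<in> arrows C W I. g = Cmp C j g')))"
    and SE_coker: "SE e ==> \<exists>a. coker a e"
    and SE_pullback: "SE e ==> e \<in> arrows C B D ==> g \<in> arrows C D' D ==>
      \<exists>B' e' g'. SE e' \<and> e' \<in> arrows C B' D' \<and> g' \<in> arrows C B' B \<and> Cmp C e g' = Cmp C g e'"

text \<open>The category \<open>A\<close> stays abstract: presentations of its objects by filtered
  diagrams in \<open>C\<close> are the only access to its arrows, and the description by limits of
  colimits does not enter. It becomes \<open>Ind\<close> through
  \<open>presents_self\<close>.\<close>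

locale completion = base_category C pl neg nul SE + universe V + A: category A
  for C :: "('o, 'm) cat" and pl neg nul SE and V :: "'v itself" and A :: "('O, 'M) cat" +
  fixes HO :: "'o \<Rightarrow> 'O" and H :: "'m \<Rightarrow> 'M"
  assumes small_Obj: "small TYPE('v) (Obj C)" and small_Arr: "small TYPE('v) (Arr C)"
    and H_arrows: "f \<in> arrows C c d ==> H f \<in> arrows A (HO c) (HO d)"
    and H_Cmp: "f \<in> arrows C b c ==> g \<in> arrows C c d ==> H (Cmp C g f) = Cmp A (H g) (H f)"
    and H_Idn: "c \<in> Obj C ==> H (Idn C c) = Idn A (HO c)"
    and presented: "X \<in> Obj A ==>
      \<exists>(D :: ('v, 'v, 'o, 'm) diagram) \<iota>. presents TYPE('v) C A HO H D X \<iota>"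
    and realized_universe: "is_diagram C D ==> filtered (Shape D) ==> small_cat TYPE('v) (Shape D) ==>
      \<exists>X \<iota>. presents TYPE('v) C A HO H (D :: ('v, 'v, 'o, 'm) diagram) X \<iota>"
begin

abbreviation cmpC (infixl "\<bullet>" 70) where "g \<bullet> f \<equiv> Cmp C g f"
abbreviation cmpA (infixl "\<cdot>" 70) where "g \<cdot> f \<equiv> Cmp A g f"
abbreviation act (infixl "\<star>" 70) where "x \<star> g \<equiv> Cmp A x (H g)"
abbreviation el where "el X c \<equiv> arrows A (HO c) X"

text \<open>Extends \<open>realized_universe\<close> to shapes over arbitrary types, by encoding the
  shape in \<open>'v\<close> and transporting the presentation back.\<close>

lemma realized:
  fixes D :: "('i, 'a, 'o, 'm) diagram"
  assumes D: "is_diagram C D" and F: "filtered (Shape D)" and small: "small_cat TYPE('v) (Shape D)"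
  shows "\<exists>X \<iota>. presents TYPE('v) C A HO H D X \<iota>"
proof -
  obtain eo :: "'i \<Rightarrow> 'v" where eo: "inj_on eo (Obj (Shape D))"
    using small small_embedding unfolding small_cat_def by blast
  obtain ea :: "'a \<Rightarrow> 'v" where ea: "inj_on ea (Arr (Shape D))"
    using small small_embedding unfolding small_cat_def by blast
  interpret E: encoding D eo ea C using D eo ea by unfold_locales
  have "small_cat TYPE('v) E.S'"
    using E.category_encode small by (simp add: small_cat_def E.encode_simps small_image)
  then obtain X \<iota> where P: "presents TYPE('v) C A HO H (encode eo ea D) X \<iota>"
    using realized_universe[OF E.diagram_encode E.filtered_encode[OF F]] by blast
  show ?thesis using E.presents_decode[OF P F small] by blast
qed

lemma HO_Obj: "c \<in> Obj C ==> HO c \<in> Obj A"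
  using H_arrows[OF Idn_arrows] A.arrows_ObjD by blast

lemma act_el: "x \<in> el X c ==> g \<in> arrows C d c ==> x \<star> g \<in> el X d"
  using A.Cmp_arrows H_arrows by blast

lemma act_act:
  assumes "x \<in> el X c" "g \<in> arrows C d c" "h \<in> arrows C e d"
  shows "x \<star> g \<star> h = x \<star> (g \<bullet> h)"
  using A.Cmp_assoc[OF H_arrows[OF assms(3)] H_arrows[OF assms(2)] assms(1)]
    H_Cmp[OF assms(3,2)] by simp

lemma act_Idn: "c \<in> Obj C ==> x \<in> el X c ==> x \<star> Idn C c = x"
  using A.Cmp_Idn_right H_Idn by simp

lemma cmp_act:
  assumes "\<phi> \<in> arrows A X Y" "x \<in> el X c" "g \<in> arrows C d c"
  shows "\<phi> \<cdot> (x \<star> g) = \<phi> \<cdot> x \<star> g"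
  using A.Cmp_assoc[OF H_arrows[OF assms(3)] assms(2,1)] .

text \<open>The members of a presenting cocone are elements themselves, and they determine an
  arrow.\<close>

lemma arrow_eqI:
  assumes "\<phi> \<in> arrows A X Y" "\<psi> \<in> arrows A X Y"
    and eq: "\<And>c x. c \<in> Obj C ==> x \<in> el X c ==> \<phi> \<cdot> x = \<psi> \<cdot> x"
  shows "\<phi> = \<psi>"
proof -
  have X: "X \<in> Obj A" and Y: "Y \<in> Obj A" using A.arrows_ObjD[OF assms(1)] by auto
  obtain D :: "('v, 'v, 'o, 'm) diagram" and \<iota> where P: "presents TYPE('v) C A HO H D X \<iota>"
    using presented[OF X] by blast
  note \<iota> = presents_arrows[OF P]
  have "\<exists>!\<chi>. \<chi> \<in> arrows A X Y \<and> (\<forall>i \<in> Obj (Shape D). \<chi> \<cdot> \<iota> i = \<phi> \<cdot> \<iota> i)"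
  proof (rule presents_univ[OF P Y])
    show "\<phi> \<cdot> \<iota> i \<in> el Y (DObj D i)" if "i \<in> Obj (Shape D)" for i
      using \<iota>[OF that] assms(1) A.Cmp_arrows by blast
    fix a assume "a \<in> Arr (Shape D)"
    then have a: "a \<in> arrows (Shape D) (Dom (Shape D) a) (Cod (Shape D) a)" by (rule Arr_arrows)
    have "Cod (Shape D) a \<in> Obj (Shape D)"
      using a category.arrows_ObjD[OF diagram_category[OF presents_diagram[OF P]]] by blast
    from cmp_act[OF assms(1) \<iota>[OF this] diagram_arrows[OF presents_diagram[OF P] a]]
    show "\<phi> \<cdot> \<iota> (Cod (Shape D) a) \<star> DArr D a = \<phi> \<cdot> \<iota> (Dom (Shape D) a)"
      using presents_cocone[OF P a] by simp
  qed
  moreover have "\<psi> \<cdot> \<iota> i = \<phi> \<cdot> \<iota> i" if "i \<in> Obj (Shape D)" for i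
    using eq[OF diagram_Obj[OF presents_diagram[OF P] that] \<iota>[OF that]] by simp
  ultimately show ?thesis using assms(1,2) by blast
qed

text \<open>The values of \<open>\<eta>\<close> on a presenting cocone form a cocone by naturality
  and induce an arrow. Every element factors through the cocone, so naturality gives the formula
  everywhere. With \<open>arrow_eqI\<close> this makes \<open>A\<close> a full subcategory of the
  contravariant functors on \<open>C\<close>.\<close>

lemma arrow_ex:
  assumes X: "X \<in> Obj A" and Y: "Y \<in> Obj A"
    and \<eta>: "\<And>c x. c \<in> Obj C ==> x \<in> el X c ==> \<eta> c x \<in> el Y c"
    and nat: "\<And>c d x g. g \<in> arrows C d c ==> x \<in> el X c ==> \<eta> d (x \<star> g) = \<eta> c x \<star> g"
  shows "\<exists>\<phi> \<in> arrows A X Y. \<forall>c \<in> Obj C. \<forall>x \<in> el X c. \<phi> \<cdot> x = \<eta> c x"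
proof -
  obtain D :: "('v, 'v, 'o, 'm) diagram" and \<iota> where P: "presents TYPE('v) C A HO H D X \<iota>"
    using presented[OF X] by blast
  note \<iota> = presents_arrows[OF P] and DD = presents_diagram[OF P]
  have O: "DObj D i \<in> Obj C" if "i \<in> Obj (Shape D)" for i using diagram_Obj[OF DD that] .
  have "\<exists>!\<chi>. \<chi> \<in> arrows A X Y \<and> (\<forall>i \<in> Obj (Shape D). \<chi> \<cdot> \<iota> i = \<eta> (DObj D i) (\<iota> i))"
  proof (rule presents_univ[OF P Y])
    show "\<eta> (DObj D i) (\<iota> i) \<in> el Y (DObj D i)" if "i \<in> Obj (Shape D)" for i
      using \<eta>[OF O[OF that] \<iota>[OF that]] .
    fix a assume "a \<in> Arr (Shape D)"
    then have a: "a \<in> arrows (Shape D) (Dom (Shape D) a) (Cod (Shape D) a)" by (rule Arr_arrows)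
    have "Cod (Shape D) a \<in> Obj (Shape D)"
      using a category.arrows_ObjD[OF diagram_category[OF DD]] by blast
    from nat[OF diagram_arrows[OF DD a] \<iota>[OF this]]
    show "\<eta> (DObj D (Cod (Shape D) a)) (\<iota> (Cod (Shape D) a)) \<star> DArr D a =
        \<eta> (DObj D (Dom (Shape D) a)) (\<iota> (Dom (Shape D) a))"
      using presents_cocone[OF P a] by simp
  qed
  then obtain \<phi> where \<phi>: "\<phi> \<in> arrows A X Y"
    "\<And>i. i \<in> Obj (Shape D) ==> \<phi> \<cdot> \<iota> i = \<eta> (DObj D i) (\<iota> i)" by blast
  have "\<phi> \<cdot> x = \<eta> c x" if x: "c \<in> Obj C" "x \<in> el X c" for c x
  proof -
    obtain i f where f: "i \<in> Obj (Shape D)" "f \<in> arrows C c (DObj D i)" "x = \<iota> i \<star> f"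
      using presents_factor[OF P x] .
    show ?thesis
      using cmp_act[OF \<phi>(1) \<iota>[OF f(1)] f(2)] \<phi>(2)[OF f(1)] nat[OF f(2) \<iota>[OF f(1)]] f(3) by simp
  qed
  then show ?thesis using \<phi>(1) by blast
qed

text \<open>Together with \<open>equalize\<close> this says that the elements of \<open>X\<close>
  form a filtered category; \<open>representable\<close> is the converse.\<close>

lemma common:
  assumes X: "X \<in> Obj A" and "c \<in> Obj C" "c' \<in> Obj C" "x \<in> el X c" "y \<in> el X c'"
  obtains d w f g where "d \<in> Obj C" "w \<in> el X d" "f \<in> arrows C c d" "g \<in> arrows C c' d"
    "x = w \<star> f" "y = w \<star> g"
proof -
  obtain D :: "('v, 'v, 'o, 'm) diagram" and \<iota> where P: "presents TYPE('v) C A HO H D X \<iota>"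
    using presented[OF X] by blast
  note \<iota> = presents_arrows[OF P] and DD = presents_diagram[OF P]
  obtain i f where f: "i \<in> Obj (Shape D)" "f \<in> arrows C c (DObj D i)" "x = \<iota> i \<star> f"
    using presents_factor[OF P assms(2,4)] .
  obtain j g where g: "j \<in> Obj (Shape D)" "g \<in> arrows C c' (DObj D j)" "y = \<iota> j \<star> g"
    using presents_factor[OF P assms(3,5)] .
  obtain l a b where ab: "a \<in> arrows (Shape D) i l" "b \<in> arrows (Shape D) j l"
    using filtered_ub[OF presents_filtered[OF P] f(1) g(1)] by blast
  have l: "l \<in> Obj (Shape D)" using ab category.arrows_ObjD[OF diagram_category[OF DD]] by blast
  have aA: "DArr D a \<in> arrows C (DObj D i) (DObj D l)" "DArr D b \<in> arrows C (DObj D j) (DObj D l)"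
    using ab diagram_arrows[OF DD] by blast+
  show thesis
  proof (rule that)
    show "x = \<iota> l \<star> (DArr D a \<bullet> f)"
      using act_act[OF \<iota>[OF l] aA(1) f(2)] presents_cocone[OF P ab(1)] f(3) by simp
    show "y = \<iota> l \<star> (DArr D b \<bullet> g)"
      using act_act[OF \<iota>[OF l] aA(2) g(2)] presents_cocone[OF P ab(2)] g(3) by simp
  qed (use l \<iota> diagram_Obj[OF DD] Cmp_arrows f g aA in blast)+
qed

lemma equalize:
  assumes "w \<in> el X d" "d \<in> Obj C" "f \<in> arrows C c d" "g \<in> arrows C c d" "w \<star> f = w \<star> g"
  obtains d' u w' where "u \<in> arrows C d d'" "w' \<in> el X d'" "w = w' \<star> u" "u \<bullet> f = u \<bullet> g"
proof -
  have X: "X \<in> Obj A" using assms A.arrows_ObjD by blast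
  obtain D :: "('v, 'v, 'o, 'm) diagram" and \<iota> where P: "presents TYPE('v) C A HO H D X \<iota>"
    using presented[OF X] by blast
  note \<iota> = presents_arrows[OF P] and DD = presents_diagram[OF P]
  interpret S: category "Shape D" using diagram_category[OF DD] .
  obtain i k where k: "i \<in> Obj (Shape D)" "k \<in> arrows C d (DObj D i)" "w = \<iota> i \<star> k"
    using presents_factor[OF P assms(2,1)] .
  have "\<iota> i \<star> (k \<bullet> f) = \<iota> i \<star> (k \<bullet> g)"
    using act_act[OF \<iota>[OF k(1)] k(2)] assms k(3) by metis
  then obtain m a b where ab: "a \<in> arrows (Shape D) i m" "b \<in> arrows (Shape D) i m"
    "DArr D a \<bullet> (k \<bullet> f) = DArr D b \<bullet> (k \<bullet> g)"
    using presents_eq[OF P k(1) k(1) Cmp_arrows[OF assms(3) k(2)] Cmp_arrows[OF assms(4) k(2)]] by blast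
  \<comment> \<open>The two composites meet along arrows \<open>a\<close> and \<open>b\<close> of
    the shape that may differ; \<open>v\<close> makes these equal.\<close>
  obtain l v where v: "v \<in> arrows (Shape D) m l" "Cmp (Shape D) v a = Cmp (Shape D) v b"
    using filtered_eq[OF presents_filtered[OF P] ab(1,2)] by blast
  have l: "l \<in> Obj (Shape D)" using v S.arrows_ObjD by blast
  let ?u = "DArr D (Cmp (Shape D) v a) \<bullet> k"
  have va: "DArr D (Cmp (Shape D) v a) \<in> arrows C (DObj D i) (DObj D l)"
    using S.Cmp_arrows[OF ab(1) v(1)] diagram_arrows[OF DD] by blast
  have *: "DArr D (Cmp (Shape D) v e) \<bullet> k \<bullet> h = DArr D v \<bullet> (DArr D e \<bullet> (k \<bullet> h))"
    if e: "e \<in> arrows (Shape D) i m" and h: "h \<in> arrows C c d" for e h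
    using diagram_Cmp[OF DD e v(1)] diagram_arrows[OF DD e] diagram_arrows[OF DD v(1)] h k(2)
    by (simp add: cat_simps)
  show thesis
  proof (rule that)
    show "?u \<in> arrows C d (DObj D l)" using Cmp_arrows[OF k(2) va] .
    show "\<iota> l \<in> el X (DObj D l)" using \<iota>[OF l] .
    show "w = \<iota> l \<star> ?u"
      using act_act[OF \<iota>[OF l] va k(2)] presents_cocone[OF P S.Cmp_arrows[OF ab(1) v(1)]] k(3) by simp
    show "?u \<bullet> f = ?u \<bullet> g"
      using *[OF ab(1) assms(3)] *[OF ab(2) assms(4)] v(2) ab(3) by simp
  qed
qed

lemma el_nonempty:
  assumes X: "X \<in> Obj A"
  obtains c x where "c \<in> Obj C" "x \<in> el X c"
proof -
  obtain D :: "('v, 'v, 'o, 'm) diagram" and \<iota> where P: "presents TYPE('v) C A HO H D X \<iota>"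
    using presented[OF X] by blast
  obtain i where "i \<in> Obj (Shape D)" using presents_filtered[OF P] by (auto simp: filtered_def)
  then show thesis
    using that diagram_Obj[OF presents_diagram[OF P]] presents_arrows[OF P] by blast
qed

lemma small_arrows: "small TYPE('v) (arrows C c d)"
  using small_subset[OF _ small_Arr] by (auto simp: arrows_def)

lemma small_el:
  assumes X: "X \<in> Obj A" and c: "c \<in> Obj C"
  shows "small TYPE('v) (el X c)"
proof -
  obtain D :: "('v, 'v, 'o, 'm) diagram" and \<iota> where P: "presents TYPE('v) C A HO H D X \<iota>"
    using presented[OF X] by blast
  have "el X c \<subseteq> (\<lambda>(i, f). \<iota> i \<star> f) ` (Obj (Shape D) \<times> Arr C)"
  proof
    fix x assume "x \<in> el X c"
    from presents_factor[OF P c this] obtain i f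
      where "i \<in> Obj (Shape D)" "f \<in> arrows C c (DObj D i)" "x = \<iota> i \<star> f" .
    then show "x \<in> (\<lambda>(i, f). \<iota> i \<star> f) ` (Obj (Shape D) \<times> Arr C)"
      by (intro image_eqI[of _ _ "(i, f)"]) (auto simp: arrows_def)
  qed
  moreover have "small TYPE('v) (Obj (Shape D) \<times> Arr C)"
    using presents_small[OF P] small_Arr by (intro small_Times) (auto simp: small_cat_def)
  ultimately show ?thesis using small_subset small_image by blast
qed

text \<open>An arrow is determined by its values on a presenting cocone, which form a small family
  of elements of \<open>Y\<close>.\<close>

lemma small_hom:
  assumes X: "X \<in> Obj A" and Y: "Y \<in> Obj A"
  shows "small TYPE('v) (arrows A X Y)"
proof -
  obtain D :: "('v, 'v, 'o, 'm) diagram" and \<iota> where P: "presents TYPE('v) C A HO H D X \<iota>"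
    using presented[OF X] by blast
  let ?r = "\<lambda>\<phi>. \<lambda>i \<in> Obj (Shape D). \<phi> \<cdot> \<iota> i"
  show ?thesis
  proof (rule small_inj_on)
    show "inj_on ?r (arrows A X Y)"
    proof (rule inj_onI)
      fix \<phi> \<psi> assume *: "\<phi> \<in> arrows A X Y" "\<psi> \<in> arrows A X Y" "?r \<phi> = ?r \<psi>"
      have eq: "\<phi> \<cdot> \<iota> i = \<psi> \<cdot> \<iota> i" if "i \<in> Obj (Shape D)" for i
        using fun_cong[OF *(3), of i] that by simp
      show "\<phi> = \<psi>"
      proof (rule arrow_eqI[OF *(1,2)])
        fix c x assume "c \<in> Obj C" "x \<in> el X c"
        then obtain i f where "i \<in> Obj (Shape D)" "f \<in> arrows C c (DObj D i)" "x = \<iota> i \<star> f"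
          using presents_factor[OF P] by metis
        then show "\<phi> \<cdot> x = \<psi> \<cdot> x"
          using cmp_act[OF *(1)] cmp_act[OF *(2)] presents_arrows[OF P] eq by metis
      qed
    qed
    show "?r ` arrows A X Y \<subseteq> (\<Pi>\<^sub>E i \<in> Obj (Shape D). el Y (DObj D i))"
      by (intro image_subsetI PiE_I) (use A.Cmp_arrows[OF presents_arrows[OF P]] in auto)
    show "small TYPE('v) (\<Pi>\<^sub>E i \<in> Obj (Shape D). el Y (DObj D i))"
      using presents_small[OF P] small_el[OF Y diagram_Obj[OF presents_diagram[OF P]]]
      by (intro small_PiE) (auto simp: small_cat_def)
  qed
qed

text \<open>A functor is the colimit of the representable functors indexed by its category of
  elements. When this category is small and filtered, realizing its projection to \<open>C\<close>
  gives the object \<open>X\<close>.\<close>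

lemma representable:
  fixes F :: "'o \<Rightarrow> 'w set" and rs :: "'w \<Rightarrow> 'm \<Rightarrow> 'w"
  assumes small: "\<And>c. c \<in> Obj C ==> small TYPE('v) (F c)"
    and rs: "\<And>c d g x. g \<in> arrows C d c ==> x \<in> F c ==> rs x g \<in> F d"
    and rs_Idn: "\<And>c x. c \<in> Obj C ==> x \<in> F c ==> rs x (Idn C c) = x"
    and rs_Cmp: "\<And>c d e g h x. g \<in> arrows C d c ==> h \<in> arrows C e d ==> x \<in> F c ==>
      rs (rs x g) h = rs x (g \<bullet> h)"
    and nonempty: "\<exists>c \<in> Obj C. F c \<noteq> {}"
    and ub: "\<And>c d x y. c \<in> Obj C ==> d \<in> Obj C ==> x \<in> F c ==> y \<in> F d ==>
      \<exists>e \<in> Obj C. \<exists>z \<in> F e. \<exists>f \<in> arrows C c e. \<exists>g \<in> arrows C d e. x = rs z f \<and> y = rs z g"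
    and eq: "\<And>c d z f g. z \<in> F d ==> f \<in> arrows C c d ==> g \<in> arrows C c d ==> rs z f = rs z g ==>
      \<exists>e u w. u \<in> arrows C d e \<and> w \<in> F e \<and> z = rs w u \<and> u \<bullet> f = u \<bullet> g"
  shows "\<exists>X \<theta>. X \<in> Obj A \<and> (\<forall>c \<in> Obj C. bij_betw (\<theta> c) (F c) (el X c)) \<and>
    (\<forall>c d g x. g \<in> arrows C d c \<longrightarrow> x \<in> F c \<longrightarrow> \<theta> d (rs x g) = \<theta> c x \<star> g)"
proof -
  let ?Ob = "Sigma (Obj C) F"
  let ?hm = "\<lambda>(c, x) (d, y). {g \<in> arrows C c d. x = rs y g}"
  interpret T: triples ?Ob ?hm "\<lambda>(c, x). Idn C c" "Cmp C"
    by unfold_locales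
      (auto simp: rs_Idn Idn_arrows rs_Cmp Cmp_arrows Cmp_Idn_left Cmp_Idn_right intro: Cmp_assoc)
  let ?D = "\<lparr>Shape = T.T, DObj = fst, DArr = (\<lambda>(_, g, _). g)\<rparr> :: ('o \<times> 'w, _, 'o, 'm) diagram"
  have D: "is_diagram C ?D" by (rule T.diagram_triple) auto
  have F: "filtered (Shape ?D)"
    unfolding diagram.simps
  proof (rule T.filtered_triple)
    show "?Ob \<noteq> {}" using nonempty by auto
    show "\<exists>m\<in>?Ob. ?hm k m \<noteq> {} \<and> ?hm l m \<noteq> {}" if "k \<in> ?Ob" "l \<in> ?Ob" for k l
      using ub that by (auto simp: ex_in_conv[symmetric]) blast
    show "\<exists>m\<in>?Ob. \<exists>h\<in>?hm l m. h \<bullet> f = h \<bullet> g"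
      if kl: "k \<in> ?Ob" "l \<in> ?Ob" and fg: "f \<in> ?hm k l" "g \<in> ?hm k l" for k l f g
    proof -
      obtain c x d z where [simp]: "k = (c, x)" "l = (d, z)" by (cases k, cases l)
      obtain e u w where u: "u \<in> arrows C d e" "w \<in> F e" "z = rs w u" "u \<bullet> f = u \<bullet> g"
        using eq[of z d f c g] kl fg by auto
      then have "(e, w) \<in> ?Ob" using arrows_ObjD by auto
      then show ?thesis using u by auto
    qed
  qed
  have small_T: "small_cat TYPE('v) (Shape ?D)"
    unfolding diagram.simps
  proof (rule T.small_triple)
    show "universe TYPE('v)" by unfold_locales
    show "small TYPE('v) ?Ob" using small_Sigma[OF small_Obj small] .
    show "small TYPE('v) (?hm k l)" for k l
      using small_subset[OF _ small_arrows[of "fst k" "fst l"]] by (auto split: prod.splits)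
  qed
  obtain X \<iota> where P: "presents TYPE('v) C A HO H ?D X \<iota>" using realized[OF D F small_T] by blast
  define \<theta> where "\<theta> c x = \<iota> (c, x)" for c x
  have \<iota>: "\<iota> (c, x) \<in> el X c" if "c \<in> Obj C" "x \<in> F c" for c x
    using presents_arrows[OF P, of "(c, x)"] that by simp
  have nat: "\<theta> d (rs x g) = \<theta> c x \<star> g" if "g \<in> arrows C d c" "x \<in> F c" for c d g x
  proof -
    have "((d, rs x g), g, (c, x)) \<in> arrows (Shape ?D) (d, rs x g) (c, x)"
      using that rs[OF that] arrows_ObjD[OF that(1)] by (simp add: T.triple_arrows_iff)
    from presents_cocone[OF P this] show ?thesis by (simp add: \<theta>_def)
  qed
  have "bij_betw (\<theta> c) (F c) (el X c)" if c: "c \<in> Obj C" for c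
  proof (rule bij_betwI')
    fix x assume x: "x \<in> F c"
    then show "\<theta> c x \<in> el X c" using \<iota> c by (simp add: \<theta>_def)
    fix y assume y: "y \<in> F c"
    show "\<theta> c x = \<theta> c y \<longleftrightarrow> x = y"
    proof
      assume "\<theta> c x = \<theta> c y"
      then have 0: "\<iota> (c, x) \<star> Idn C c = \<iota> (c, y) \<star> Idn C c" by (simp add: \<theta>_def)
      have 1: "(c, x) \<in> Obj (Shape ?D)" "(c, y) \<in> Obj (Shape ?D)"
        "Idn C c \<in> arrows C c (DObj ?D (c, x))" "Idn C c \<in> arrows C c (DObj ?D (c, y))"
        using c x y Idn_arrows[OF c] by auto
      obtain m a b where "a \<in> arrows (Shape ?D) (c, x) m" "b \<in> arrows (Shape ?D) (c, y) m"
        "DArr ?D a \<bullet> Idn C c = DArr ?D b \<bullet> Idn C c"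
        by (rule presents_eq[OF P 1 0])
      \<comment> \<open>The labels of \<open>a\<close> and \<open>b\<close> are now one arrow
        \<open>g\<close> into the same element \<open>z\<close>, so both \<open>x\<close> and
        \<open>y\<close> are \<open>rs z g\<close>.\<close>
      then show "x = y"
        using Cmp_Idn_right by (auto simp: T.triple_arrows_iff split: prod.splits)
    qed simp
  next
    fix z assume z: "z \<in> el X c"
    obtain k f where kf: "k \<in> Obj (Shape ?D)" "f \<in> arrows C c (DObj ?D k)" "z = \<iota> k \<star> f"
      using presents_factor[OF P c z] .
    then obtain d y where "k = (d, y)" "d \<in> Obj C" "y \<in> F d" by auto
    then show "\<exists>x \<in> F c. z = \<theta> c x"
      using nat[of f c d y] kf rs[of f c d y]
      by (intro bexI[of _ "rs y f"]) (auto simp: \<theta>_def)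
  qed
  then show ?thesis using presents_Obj[OF P] nat by blast
qed

section \<open>Addition of arrows\<close>

text \<open>Makes addition by representatives well defined: two ways of writing a pair of elements
  over different stages agree once both stages are mapped into a common one.\<close>

lemma refine:
  assumes w: "w \<in> el X d" and w': "w' \<in> el X d'"
    and f: "f \<in> arrows C c d" and g: "g \<in> arrows C c d"
    and f': "f' \<in> arrows C c d'" and g': "g' \<in> arrows C c d'"
    and eqs: "w \<star> f = w' \<star> f'" "w \<star> g = w' \<star> g'"
  obtains e v p p' where "v \<in> el X e" "p \<in> arrows C d e" "p' \<in> arrows C d' e"
    "w = v \<star> p" "w' = v \<star> p'" "p \<bullet> f = p' \<bullet> f'" "p \<bullet> g = p' \<bullet> g'"
proof -
  have X: "X \<in> Obj A" using w A.arrows_ObjD by blast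
  have O: "d \<in> Obj C" "d' \<in> Obj C" using f f' arrows_ObjD by blast+
  obtain e1 v1 a b where 1: "e1 \<in> Obj C" "v1 \<in> el X e1" "a \<in> arrows C d e1" "b \<in> arrows C d' e1"
    "w = v1 \<star> a" "w' = v1 \<star> b"
    using common[OF X O w w'] .
  have "v1 \<star> (a \<bullet> f) = v1 \<star> (b \<bullet> f')"
    using act_act[OF 1(2,3) f] act_act[OF 1(2,4) f'] eqs(1) 1(5,6) by simp
  then obtain e2 u v2 where 2: "u \<in> arrows C e1 e2" "v2 \<in> el X e2" "v1 = v2 \<star> u"
    "u \<bullet> (a \<bullet> f) = u \<bullet> (b \<bullet> f')"
    using equalize[OF 1(2,1) Cmp_arrows[OF f 1(3)] Cmp_arrows[OF f' 1(4)]] by blast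
  have e2: "e2 \<in> Obj C" using 2 arrows_ObjD by blast
  note ag = Cmp_arrows[OF g 1(3)] and bg = Cmp_arrows[OF g' 1(4)]
  \<comment> \<open>The second equation is forced only after the first; composing with a further
    arrow \<open>t\<close> does not destroy the first.\<close>
  have "v1 \<star> (a \<bullet> g) = v1 \<star> (b \<bullet> g')"
    using act_act[OF 1(2,3) g] act_act[OF 1(2,4) g'] eqs(2) 1(5,6) by simp
  then have "v2 \<star> (u \<bullet> (a \<bullet> g)) = v2 \<star> (u \<bullet> (b \<bullet> g'))"
    using act_act[OF 2(2,1) ag] act_act[OF 2(2,1) bg] 2(3) by simp
  then obtain e3 t v3 where 3: "t \<in> arrows C e2 e3" "v3 \<in> el X e3" "v2 = v3 \<star> t"
    "t \<bullet> (u \<bullet> (a \<bullet> g)) = t \<bullet> (u \<bullet> (b \<bullet> g'))"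
    using equalize[OF 2(2) e2 Cmp_arrows[OF ag 2(1)] Cmp_arrows[OF bg 2(1)]] by blast
  note ua = Cmp_arrows[OF 1(3) 2(1)] and ub = Cmp_arrows[OF 1(4) 2(1)]
  have assoc: "t \<bullet> (u \<bullet> a) \<bullet> h = t \<bullet> (u \<bullet> (a \<bullet> h))"
    if "a \<in> arrows C d e1" "h \<in> arrows C c d" for a h d
    using that 2(1) 3(1) by (simp add: cat_simps)
  show thesis
  proof (rule that)
    show "w = v3 \<star> (t \<bullet> (u \<bullet> a))"
      using act_act[OF 3(2,1) ua] act_act[OF 2(2,1) 1(3)] 1(5) 2(3) 3(3) by simp
    show "w' = v3 \<star> (t \<bullet> (u \<bullet> b))"
      using act_act[OF 3(2,1) ub] act_act[OF 2(2,1) 1(4)] 1(6) 2(3) 3(3) by simp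
    show "t \<bullet> (u \<bullet> a) \<bullet> f = t \<bullet> (u \<bullet> b) \<bullet> f'"
      using assoc[OF 1(3) f] assoc[OF 1(4) f'] 2(4) by simp
    show "t \<bullet> (u \<bullet> a) \<bullet> g = t \<bullet> (u \<bullet> b) \<bullet> g'"
      using assoc[OF 1(3) g] assoc[OF 1(4) g'] 3(4) by simp
  qed (use 3 Cmp_arrows[OF ua 3(1)] Cmp_arrows[OF ub 3(1)] in auto)
qed

lemma common3:
  assumes X: "X \<in> Obj A" and c: "c \<in> Obj C" and "x \<in> el X c" "y \<in> el X c" "z \<in> el X c"
  obtains d w f g h where "d \<in> Obj C" "w \<in> el X d" "f \<in> arrows C c d" "g \<in> arrows C c d" "h \<in> arrows C c d"
    "x = w \<star> f" "y = w \<star> g" "z = w \<star> h"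
proof -
  obtain d w f g where 1: "d \<in> Obj C" "w \<in> el X d" "f \<in> arrows C c d" "g \<in> arrows C c d"
    "x = w \<star> f" "y = w \<star> g" using common[OF X c c assms(3,4)] .
  obtain e v p h where 2: "e \<in> Obj C" "v \<in> el X e" "p \<in> arrows C d e" "h \<in> arrows C c e"
    "w = v \<star> p" "z = v \<star> h" using common[OF X 1(1) c 1(2) assms(5)] .
  show thesis
    by (rule that[OF 2(1,2) Cmp_arrows[OF 1(3) 2(3)] Cmp_arrows[OF 1(4) 2(3)] 2(4)])
      (use act_act[OF 2(2,3)] 1 2 in auto)
qed

text \<open>Two elements at \<open>c\<close> come from arrows into a common stage \<open>d\<close>,
  and the sum is taken in \<open>C\<close> there. By \<open>refine\<close> the outcome does not
  depend on the stage.\<close>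

definition adde :: "'O \<Rightarrow> 'o \<Rightarrow> 'M \<Rightarrow> 'M \<Rightarrow> 'M" where
  "adde X c x y = (THE z. \<exists>d w f g. w \<in> el X d \<and> f \<in> arrows C c d \<and> g \<in> arrows C c d \<and>
     x = w \<star> f \<and> y = w \<star> g \<and> z = w \<star> pl f g)"

definition nege :: "'O \<Rightarrow> 'o \<Rightarrow> 'M \<Rightarrow> 'M" where
  "nege X c x = (THE z. \<exists>d w f. w \<in> el X d \<and> f \<in> arrows C c d \<and> x = w \<star> f \<and> z = w \<star> neg f)"

definition zere :: "'O \<Rightarrow> 'o \<Rightarrow> 'M" where
  "zere X c = (THE z. \<exists>d w. d \<in> Obj C \<and> w \<in> el X d \<and> z = w \<star> nul c d)"

lemma adde_eq:
  assumes w: "w \<in> el X d" and f: "f \<in> arrows C c d" and g: "g \<in> arrows C c d"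
  shows "adde X c (w \<star> f) (w \<star> g) = w \<star> pl f g"
  unfolding adde_def
proof (rule the_equality)
  fix z assume "\<exists>d' w' f' g'. w' \<in> el X d' \<and> f' \<in> arrows C c d' \<and> g' \<in> arrows C c d' \<and>
     w \<star> f = w' \<star> f' \<and> w \<star> g = w' \<star> g' \<and> z = w' \<star> pl f' g'"
  then obtain d' w' f' g' where *: "w' \<in> el X d'" "f' \<in> arrows C c d'" "g' \<in> arrows C c d'"
     "w \<star> f = w' \<star> f'" "w \<star> g = w' \<star> g'" "z = w' \<star> pl f' g'" by blast
  obtain e v p p' where v: "v \<in> el X e" "p \<in> arrows C d e" "p' \<in> arrows C d' e"
    "w = v \<star> p" "w' = v \<star> p'" "p \<bullet> f = p' \<bullet> f'" "p \<bullet> g = p' \<bullet> g'"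
    using refine[OF w *(1) f g *(2-5)] .
  show "z = w \<star> pl f g"
    using *(6) v act_act[OF v(1,2) pl_arrows[OF f g]] act_act[OF v(1,3) pl_arrows[OF *(2,3)]]
      Cmp_pl_right[OF f g v(2)] Cmp_pl_right[OF *(2,3) v(3)] by simp
qed (use assms in blast)

lemma nege_eq:
  assumes w: "w \<in> el X d" and f: "f \<in> arrows C c d"
  shows "nege X c (w \<star> f) = w \<star> neg f"
  unfolding nege_def
proof (rule the_equality)
  fix z assume "\<exists>d' w' f'. w' \<in> el X d' \<and> f' \<in> arrows C c d' \<and> w \<star> f = w' \<star> f' \<and> z = w' \<star> neg f'"
  then obtain d' w' f' where *: "w' \<in> el X d'" "f' \<in> arrows C c d'"
     "w \<star> f = w' \<star> f'" "z = w' \<star> neg f'" by blast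
  obtain e v p p' where v: "v \<in> el X e" "p \<in> arrows C d e" "p' \<in> arrows C d' e"
    "w = v \<star> p" "w' = v \<star> p'" "p \<bullet> f = p' \<bullet> f'" "p \<bullet> f = p' \<bullet> f'"
    using refine[OF w *(1) f f *(2,2,3,3)] .
  show "z = w \<star> neg f"
    using *(4) v act_act[OF v(1,2) neg_arrows[OF f]] act_act[OF v(1,3) neg_arrows[OF *(2)]]
      Cmp_neg_right[OF f v(2)] Cmp_neg_right[OF *(2) v(3)] by simp
qed (use assms in blast)

text \<open>Any two stages map into a common one, where both zero arrows become the same zero
  arrow.\<close>

lemma zere_eq:
  assumes w: "w \<in> el X d" and c: "c \<in> Obj C" and d: "d \<in> Obj C"
  shows "w \<star> nul c d = zere X c"
  unfolding zere_def
proof (rule the_equality[symmetric])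
  fix z assume "\<exists>d' w'. d' \<in> Obj C \<and> w' \<in> el X d' \<and> z = w' \<star> nul c d'"
  then obtain d' w' where *: "w' \<in> el X d'" "z = w' \<star> nul c d'" "d' \<in> Obj C" by blast
  have X: "X \<in> Obj A" using w A.arrows_ObjD by blast
  obtain e v p p' where v: "e \<in> Obj C" "v \<in> el X e" "p \<in> arrows C d e" "p' \<in> arrows C d' e"
    "w = v \<star> p" "w' = v \<star> p'"
    using common[OF X d *(3) w *(1)] .
  show "z = w \<star> nul c d"
    using *(2) v(5,6) act_act[OF v(2,3) nul_arrows[OF c d]] act_act[OF v(2,4) nul_arrows[OF c *(3)]]
      Cmp_nul_right[OF v(3) c] Cmp_nul_right[OF v(4) c] by simp
qed (use assms in blast)

lemma zere_el:
  assumes X: "X \<in> Obj A" and c: "c \<in> Obj C"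
  shows "zere X c \<in> el X c"
proof -
  obtain d w where "d \<in> Obj C" "w \<in> el X d" using el_nonempty[OF X] .
  then show ?thesis using zere_eq act_el nul_arrows c by metis
qed

lemma adde_laws:
  assumes X: "X \<in> Obj A" and c: "c \<in> Obj C" and x: "x \<in> el X c" and y: "y \<in> el X c" and z: "z \<in> el X c"
  shows "adde X c x y \<in> el X c" "adde X c (adde X c x y) z = adde X c x (adde X c y z)"
    "adde X c x y = adde X c y x" "adde X c x (zere X c) = x"
    "nege X c x \<in> el X c" "adde X c x (nege X c x) = zere X c"
    "g \<in> arrows C b c ==> adde X b (x \<star> g) (y \<star> g) = adde X c x y \<star> g"
    "g \<in> arrows C b c ==> nege X b (x \<star> g) = nege X c x \<star> g"
    "g \<in> arrows C b c ==> zere X c \<star> g = zere X b"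
    "\<phi> \<in> arrows A X Y ==> \<phi> \<cdot> adde X c x y = adde Y c (\<phi> \<cdot> x) (\<phi> \<cdot> y)"
proof -
  obtain d w f g h where w: "d \<in> Obj C" "w \<in> el X d" "f \<in> arrows C c d" "g \<in> arrows C c d"
    "h \<in> arrows C c d" and [simp]: "x = w \<star> f" "y = w \<star> g" "z = w \<star> h"
    using common3[OF X c x y z] .
  note eqs = adde_eq[OF w(2)] nege_eq[OF w(2)] pl_arrows[of _ c d] neg_arrows[of _ c d] w
  show "adde X c x y \<in> el X c" "nege X c x \<in> el X c"
    using act_el[OF w(2)] by (auto simp: eqs)
  show "adde X c (adde X c x y) z = adde X c x (adde X c y z)" "adde X c x y = adde X c y x"
    using pl_assoc[OF w(3,4,5)] pl_comm[OF w(3,4)] by (simp_all add: eqs)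
  have z: "zere X c = w \<star> nul c d" using zere_eq[OF w(2) c w(1)] by simp
  show "adde X c x (zere X c) = x" "adde X c x (nege X c x) = zere X c"
    using pl_nul[OF w(3)] pl_neg[OF w(3)] nul_arrows[OF c w(1)] by (simp_all add: eqs z)
  show "adde X b (x \<star> k) (y \<star> k) = adde X c x y \<star> k" if k: "k \<in> arrows C b c" for k
    using k act_act[OF w(2) _ k] adde_eq[OF w(2) Cmp_arrows[OF k w(3)] Cmp_arrows[OF k w(4)]]
      Cmp_pl_left[OF k w(3,4)] by (simp add: eqs)
  show "nege X b (x \<star> k) = nege X c x \<star> k" if k: "k \<in> arrows C b c" for k
    using k act_act[OF w(2) _ k] nege_eq[OF w(2) Cmp_arrows[OF k w(3)]]
      Cmp_neg_left[OF k w(3)] by (simp add: eqs)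
  show "zere X c \<star> k = zere X b" if k: "k \<in> arrows C b c" for k
    using act_act[OF w(2) nul_arrows[OF c w(1)] k] Cmp_nul_left[OF k w(1)]
      zere_eq[OF w(2) arrows_ObjD(1)[OF k] w(1)] z by metis
  show "\<phi> \<cdot> adde X c x y = adde Y c (\<phi> \<cdot> x) (\<phi> \<cdot> y)" if \<phi>: "\<phi> \<in> arrows A X Y" for \<phi>
    using cmp_act[OF \<phi> w(2) w(3)] cmp_act[OF \<phi> w(2) w(4)] cmp_act[OF \<phi> w(2) pl_arrows[OF w(3,4)]]
      adde_eq[OF A.Cmp_arrows[OF w(2) \<phi>] w(3,4)] by (simp add: eqs)
qed

text \<open>The endpoints are read off \<open>\<phi>\<close>, since \<open>preadditive\<close>
  provides for operations on bare arrows.\<close>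

definition plA :: "'M \<Rightarrow> 'M \<Rightarrow> 'M" where
  "plA \<phi> \<psi> = (THE \<chi>. \<chi> \<in> arrows A (Dom A \<phi>) (Cod A \<phi>) \<and>
     (\<forall>c \<in> Obj C. \<forall>x \<in> el (Dom A \<phi>) c. \<chi> \<cdot> x = adde (Cod A \<phi>) c (\<phi> \<cdot> x) (\<psi> \<cdot> x)))"

definition negA :: "'M \<Rightarrow> 'M" where
  "negA \<phi> = (THE \<chi>. \<chi> \<in> arrows A (Dom A \<phi>) (Cod A \<phi>) \<and>
     (\<forall>c \<in> Obj C. \<forall>x \<in> el (Dom A \<phi>) c. \<chi> \<cdot> x = nege (Cod A \<phi>) c (\<phi> \<cdot> x)))"

definition nulA :: "'O \<Rightarrow> 'O \<Rightarrow> 'M" where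
  "nulA X Y = (THE \<chi>. \<chi> \<in> arrows A X Y \<and> (\<forall>c \<in> Obj C. \<forall>x \<in> el X c. \<chi> \<cdot> x = zere Y c))"

lemma the_arrow:
  assumes X: "X \<in> Obj A" and Y: "Y \<in> Obj A"
    and \<eta>: "\<And>c x. c \<in> Obj C ==> x \<in> el X c ==> \<eta> c x \<in> el Y c"
    and nat: "\<And>c d x g. g \<in> arrows C d c ==> x \<in> el X c ==> \<eta> d (x \<star> g) = \<eta> c x \<star> g"
    and \<phi>: "\<phi> = (THE \<chi>. \<chi> \<in> arrows A X Y \<and> (\<forall>c \<in> Obj C. \<forall>x \<in> el X c. \<chi> \<cdot> x = \<eta> c x))"
  shows "\<phi> \<in> arrows A X Y \<and> (\<forall>c \<in> Obj C. \<forall>x \<in> el X c. \<phi> \<cdot> x = \<eta> c x)"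
proof -
  have "\<exists>!\<chi>. \<chi> \<in> arrows A X Y \<and> (\<forall>c \<in> Obj C. \<forall>x \<in> el X c. \<chi> \<cdot> x = \<eta> c x)"
  proof -
    obtain \<chi> where \<chi>: "\<chi> \<in> arrows A X Y" "\<forall>c \<in> Obj C. \<forall>x \<in> el X c. \<chi> \<cdot> x = \<eta> c x"
      using arrow_ex[OF X Y \<eta> nat] by blast
    show ?thesis
    proof (rule ex1I[of _ \<chi>])
      fix \<chi>' assume *: "\<chi>' \<in> arrows A X Y \<and> (\<forall>c \<in> Obj C. \<forall>x \<in> el X c. \<chi>' \<cdot> x = \<eta> c x)"
      show "\<chi>' = \<chi>" by (rule arrow_eqI[OF conjunct1[OF *] \<chi>(1)]) (use * \<chi>(2) in simp)
    qed (use \<chi> in blast)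
  qed
  from theI'[OF this] show ?thesis unfolding \<phi> .
qed

lemma plA:
  assumes \<phi>: "\<phi> \<in> arrows A X Y" and \<psi>: "\<psi> \<in> arrows A X Y"
  shows "plA \<phi> \<psi> \<in> arrows A X Y"
    "\<And>c x. c \<in> Obj C ==> x \<in> el X c ==> plA \<phi> \<psi> \<cdot> x = adde Y c (\<phi> \<cdot> x) (\<psi> \<cdot> x)"
proof -
  have O: "X \<in> Obj A" "Y \<in> Obj A" using A.arrows_ObjD[OF \<phi>] by auto
  have *: "\<phi> \<cdot> x \<in> el Y c" "\<psi> \<cdot> x \<in> el Y c" if "x \<in> el X c" for c x
    using A.Cmp_arrows[OF that] \<phi> \<psi> by blast+
  have "plA \<phi> \<psi> = (THE \<chi>. \<chi> \<in> arrows A X Y \<and>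
     (\<forall>c \<in> Obj C. \<forall>x \<in> el X c. \<chi> \<cdot> x = adde Y c (\<phi> \<cdot> x) (\<psi> \<cdot> x)))"
    using \<phi> by (simp add: plA_def arrows_iff)
  then have "plA \<phi> \<psi> \<in> arrows A X Y \<and>
      (\<forall>c \<in> Obj C. \<forall>x \<in> el X c. plA \<phi> \<psi> \<cdot> x = adde Y c (\<phi> \<cdot> x) (\<psi> \<cdot> x))"
  proof (rule the_arrow[OF O, rotated 2])
    show "adde Y c (\<phi> \<cdot> x) (\<psi> \<cdot> x) \<in> el Y c" if "c \<in> Obj C" "x \<in> el X c" for c x
      using adde_laws(1)[OF O(2) that(1) *[OF that(2)] *(1)[OF that(2)]] .
    fix c d x g assume g: "g \<in> arrows C d c" and x: "x \<in> el X c"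
    show "adde Y d (\<phi> \<cdot> (x \<star> g)) (\<psi> \<cdot> (x \<star> g)) = adde Y c (\<phi> \<cdot> x) (\<psi> \<cdot> x) \<star> g"
      using adde_laws(7)[OF O(2) arrows_ObjD(2)[OF g] *[OF x] *(1)[OF x] g] cmp_act[OF _ x g] \<phi> \<psi>
      by simp
  qed
  then show "plA \<phi> \<psi> \<in> arrows A X Y"
    "\<And>c x. c \<in> Obj C ==> x \<in> el X c ==> plA \<phi> \<psi> \<cdot> x = adde Y c (\<phi> \<cdot> x) (\<psi> \<cdot> x)" by auto
qed

lemma negA:
  assumes \<phi>: "\<phi> \<in> arrows A X Y"
  shows "negA \<phi> \<in> arrows A X Y"
    "\<And>c x. c \<in> Obj C ==> x \<in> el X c ==> negA \<phi> \<cdot> x = nege Y c (\<phi> \<cdot> x)"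
proof -
  have O: "X \<in> Obj A" "Y \<in> Obj A" using A.arrows_ObjD[OF \<phi>] by auto
  have *: "\<phi> \<cdot> x \<in> el Y c" if "x \<in> el X c" for c x
    using A.Cmp_arrows[OF that] \<phi> by blast
  have "negA \<phi> = (THE \<chi>. \<chi> \<in> arrows A X Y \<and> (\<forall>c \<in> Obj C. \<forall>x \<in> el X c. \<chi> \<cdot> x = nege Y c (\<phi> \<cdot> x)))"
    using \<phi> by (simp add: negA_def arrows_iff)
  then have "negA \<phi> \<in> arrows A X Y \<and> (\<forall>c \<in> Obj C. \<forall>x \<in> el X c. negA \<phi> \<cdot> x = nege Y c (\<phi> \<cdot> x))"
  proof (rule the_arrow[OF O, rotated 2])
    show "nege Y c (\<phi> \<cdot> x) \<in> el Y c" if "c \<in> Obj C" "x \<in> el X c" for c x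
      using adde_laws(5)[OF O(2) that(1) *[OF that(2)] *[OF that(2)] *[OF that(2)]] .
    fix c d x g assume g: "g \<in> arrows C d c" and x: "x \<in> el X c"
    show "nege Y d (\<phi> \<cdot> (x \<star> g)) = nege Y c (\<phi> \<cdot> x) \<star> g"
      using adde_laws(8)[OF O(2) arrows_ObjD(2)[OF g] *[OF x] *[OF x] *[OF x] g] cmp_act[OF \<phi> x g]
      by simp
  qed
  then show "negA \<phi> \<in> arrows A X Y"
    "\<And>c x. c \<in> Obj C ==> x \<in> el X c ==> negA \<phi> \<cdot> x = nege Y c (\<phi> \<cdot> x)" by auto
qed

lemma nulA:
  assumes O: "X \<in> Obj A" "Y \<in> Obj A"
  shows "nulA X Y \<in> arrows A X Y" "\<And>c x. c \<in> Obj C ==> x \<in> el X c ==> nulA X Y \<cdot> x = zere Y c"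
proof -
  have "nulA X Y \<in> arrows A X Y \<and> (\<forall>c \<in> Obj C. \<forall>x \<in> el X c. nulA X Y \<cdot> x = zere Y c)"
  proof (rule the_arrow[OF O, rotated 2])
    show "nulA X Y = (THE \<chi>. \<chi> \<in> arrows A X Y \<and> (\<forall>c \<in> Obj C. \<forall>x \<in> el X c. \<chi> \<cdot> x = zere Y c))"
      by (simp add: nulA_def)
    show "zere Y c \<in> el Y c" if "c \<in> Obj C" for c using zere_el[OF O(2) that] .
    fix c d g assume g: "g \<in> arrows C d c"
    have c: "c \<in> Obj C" using arrows_ObjD[OF g] by auto
    show "zere Y d = zere Y c \<star> g"
      using adde_laws(9)[OF O(2) c zere_el[OF O(2) c] zere_el[OF O(2) c] zere_el[OF O(2) c] g] by simp
  qed
  then show "nulA X Y \<in> arrows A X Y"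
    "\<And>c x. c \<in> Obj C ==> x \<in> el X c ==> nulA X Y \<cdot> x = zere Y c" by auto
qed

sublocale AP: preadditive A plA negA nulA
proof
  fix f g X Y assume f: "f \<in> arrows A X Y" and g: "g \<in> arrows A X Y"
  show "plA f g \<in> arrows A X Y" using plA(1)[OF f g] .
  have Y: "Y \<in> Obj A" using A.arrows_ObjD f by blast
  have fg: "f \<cdot> x \<in> el Y c" "g \<cdot> x \<in> el Y c" if "x \<in> el X c" for c x
    using A.Cmp_arrows[OF that] f g by blast+
  show "plA f g = plA g f"
  proof (rule arrow_eqI[OF plA(1)[OF f g] plA(1)[OF g f]])
    fix c x assume x: "c \<in> Obj C" "x \<in> el X c"
    show "plA f g \<cdot> x = plA g f \<cdot> x"
      using adde_laws(3)[OF Y x(1) fg[OF x(2)] fg(1)[OF x(2)]] plA(2)[OF f g x] plA(2)[OF g f x] by simp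
  qed
  fix h assume h: "h \<in> arrows A X Y"
  have hx: "h \<cdot> x \<in> el Y c" if "x \<in> el X c" for c x using A.Cmp_arrows[OF that h] .
  show "plA (plA f g) h = plA f (plA g h)"
  proof (rule arrow_eqI[OF plA(1)[OF plA(1)[OF f g] h] plA(1)[OF f plA(1)[OF g h]]])
    fix c x assume x: "c \<in> Obj C" "x \<in> el X c"
    show "plA (plA f g) h \<cdot> x = plA f (plA g h) \<cdot> x"
      using adde_laws(2)[OF Y x(1) fg[OF x(2)] hx[OF x(2)]] plA(2)[OF f g x] plA(2)[OF g h x]
        plA(2)[OF plA(1)[OF f g] h x] plA(2)[OF f plA(1)[OF g h] x] by simp
  qed
next
  fix f X Y assume f: "f \<in> arrows A X Y"
  show "negA f \<in> arrows A X Y" using negA(1)[OF f] .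
  have X: "X \<in> Obj A" and Y: "Y \<in> Obj A" using A.arrows_ObjD f by blast+
  have fx: "f \<cdot> x \<in> el Y c" if "x \<in> el X c" for c x using A.Cmp_arrows[OF that f] .
  show "plA f (nulA X Y) = f"
  proof (rule arrow_eqI[OF plA(1)[OF f nulA(1)[OF X Y]] f])
    fix c x assume x: "c \<in> Obj C" "x \<in> el X c"
    show "plA f (nulA X Y) \<cdot> x = f \<cdot> x"
      using adde_laws(4)[OF Y x(1) fx[OF x(2)] fx[OF x(2)] fx[OF x(2)]]
        plA(2)[OF f nulA(1)[OF X Y] x] nulA(2)[OF X Y x] by simp
  qed
  show "plA f (negA f) = nulA X Y"
  proof (rule arrow_eqI[OF plA(1)[OF f negA(1)[OF f]] nulA(1)[OF X Y]])
    fix c x assume x: "c \<in> Obj C" "x \<in> el X c"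
    show "plA f (negA f) \<cdot> x = nulA X Y \<cdot> x"
      using adde_laws(6)[OF Y x(1) fx[OF x(2)] fx[OF x(2)] fx[OF x(2)]]
        plA(2)[OF f negA(1)[OF f] x] negA(2)[OF f x] nulA(2)[OF X Y x] by simp
  qed
next
  fix X Y assume "X \<in> Obj A" "Y \<in> Obj A"
  then show "nulA X Y \<in> arrows A X Y" by (rule nulA(1))
next
  fix f f' g X Y Z assume f: "f \<in> arrows A X Y" "f' \<in> arrows A X Y" and g: "g \<in> arrows A Y Z"
  have Y: "Y \<in> Obj A" using A.arrows_ObjD g by blast
  show "g \<cdot> plA f f' = plA (g \<cdot> f) (g \<cdot> f')"
  proof (rule arrow_eqI[OF A.Cmp_arrows[OF plA(1)[OF f] g]
        plA(1)[OF A.Cmp_arrows[OF f(1) g] A.Cmp_arrows[OF f(2) g]]])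
    fix c x assume x: "c \<in> Obj C" "x \<in> el X c"
    have fx: "f \<cdot> x \<in> el Y c" "f' \<cdot> x \<in> el Y c" using A.Cmp_arrows[OF x(2)] f by blast+
    show "g \<cdot> plA f f' \<cdot> x = plA (g \<cdot> f) (g \<cdot> f') \<cdot> x"
      using A.Cmp_assoc[OF x(2) plA(1)[OF f] g] plA(2)[OF f x] adde_laws(10)[OF Y x(1) fx fx(1) g]
        plA(2)[OF A.Cmp_arrows[OF f(1) g] A.Cmp_arrows[OF f(2) g] x]
        A.Cmp_assoc[OF x(2) f(1) g] A.Cmp_assoc[OF x(2) f(2) g] by simp
  qed
next
  fix f g g' X Y Z assume f: "f \<in> arrows A X Y" and g: "g \<in> arrows A Y Z" "g' \<in> arrows A Y Z"
  show "plA g g' \<cdot> f = plA (g \<cdot> f) (g' \<cdot> f)"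
  proof (rule arrow_eqI[OF A.Cmp_arrows[OF f plA(1)[OF g]]
        plA(1)[OF A.Cmp_arrows[OF f g(1)] A.Cmp_arrows[OF f g(2)]]])
    fix c x assume x: "c \<in> Obj C" "x \<in> el X c"
    have fx: "f \<cdot> x \<in> el Y c" using A.Cmp_arrows[OF x(2) f] .
    show "plA g g' \<cdot> f \<cdot> x = plA (g \<cdot> f) (g' \<cdot> f) \<cdot> x"
      using A.Cmp_assoc[OF x(2) f plA(1)[OF g]] plA(2)[OF g x(1) fx]
        plA(2)[OF A.Cmp_arrows[OF f g(1)] A.Cmp_arrows[OF f g(2)] x]
        A.Cmp_assoc[OF x(2) f g(1)] A.Cmp_assoc[OF x(2) f g(2)] by simp
  qed
qed

text \<open>Evaluation at the identity of \<open>HO c\<close>, itself an element, turns the addition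
  of arrows into that of representatives.\<close>

lemma plA_el:
  assumes c: "c \<in> Obj C" and x: "x \<in> el X c" and y: "y \<in> el X c"
  shows "plA x y = adde X c x y"
  using plA(2)[OF x y c A.Idn_arrows[OF HO_Obj[OF c]]] A.Cmp_Idn_right[OF plA(1)[OF x y]]
    A.Cmp_Idn_right[OF x] A.Cmp_Idn_right[OF y] by simp

abbreviation zer where "zer X c \<equiv> nulA (HO c) X"

lemma zer_el: "X \<in> Obj A ==> c \<in> Obj C ==> zer X c \<in> el X c"
  using HO_Obj AP.nul_arrows by blast

lemma H_pl:
  assumes "f \<in> arrows C c d" "g \<in> arrows C c d"
  shows "H (pl f g) = plA (H f) (H g)"
proof -
  have O: "c \<in> Obj C" "d \<in> Obj C" using arrows_ObjD[OF assms(1)] by auto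
  let ?i = "Idn A (HO d)"
  have i: "?i \<in> el (HO d) d" using A.Idn_arrows[OF HO_Obj[OF O(2)]] .
  have "?i \<star> k = H k" if "k \<in> arrows C c d" for k using A.Cmp_Idn_left[OF H_arrows[OF that]] .
  then show ?thesis
    using adde_eq[OF i assms] plA_el[OF O(1) H_arrows[OF assms(1)] H_arrows[OF assms(2)]]
      pl_arrows[OF assms] assms by simp
qed

lemma act_pl:
  "w \<in> el X d ==> f \<in> arrows C c d ==> g \<in> arrows C c d ==> w \<star> pl f g = plA (w \<star> f) (w \<star> g)"
  using AP.Cmp_pl_right[OF H_arrows H_arrows] H_pl by simp

lemma act_nul:
  assumes w: "w \<in> el X d" and c: "c \<in> Obj C" and d: "d \<in> Obj C"
  shows "w \<star> nul c d = zer X c"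
proof (rule AP.pl_idem)
  have n: "nul c d \<in> arrows C c d" using nul_arrows[OF c d] .
  show "w \<star> nul c d \<in> el X c" using act_el[OF w n] .
  show "plA (w \<star> nul c d) (w \<star> nul c d) = w \<star> nul c d" using act_pl[OF w n n] pl_nul[OF n] by simp
qed

lemma pl_act:
  "x \<in> el X d ==> y \<in> el X d ==> f \<in> arrows C c d ==> plA x y \<star> f = plA (x \<star> f) (y \<star> f)"
  using AP.Cmp_pl_left[OF H_arrows] .

lemma mi_act:
  "x \<in> el X d ==> y \<in> el X d ==> f \<in> arrows C c d ==> AP.mi x y \<star> f = AP.mi (x \<star> f) (y \<star> f)"
  using AP.Cmp_mi_left[OF H_arrows] .

lemma zer_act: "X \<in> Obj A ==> f \<in> arrows C c d ==> zer X d \<star> f = zer X c"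
  using AP.Cmp_nul_left[OF H_arrows] .

lemma cmp_zer: "\<phi> \<in> arrows A X Y ==> c \<in> Obj C ==> \<phi> \<cdot> zer X c = zer Y c"
  using AP.Cmp_nul_right HO_Obj by blast

lemma act_mi:
  assumes w: "w \<in> el X d" and f: "f \<in> arrows C c d" and g: "g \<in> arrows C c d"
  shows "w \<star> mi f g = AP.mi (w \<star> f) (w \<star> g)"
proof -
  have O: "c \<in> Obj C" "d \<in> Obj C" using arrows_ObjD[OF f] by auto
  have "w \<star> neg g = negA (w \<star> g)"
    by (rule AP.neg_unique[OF act_el[OF w g] act_el[OF w neg_arrows[OF g]]])
      (use act_pl[OF w g neg_arrows[OF g]] pl_neg[OF g] act_nul[OF w O] in simp)
  then show ?thesis
    using act_pl[OF w f neg_arrows[OF g]] by (simp add: mi_def AP.mi_def)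
qed

text \<open>Left exactness of elements. Vanishing of \<open>y \<star> a\<close> is already visible
  at some stage \<open>u\<close> of \<open>y\<close>, where the universal property of the cokernel
  applies.\<close>

lemma el_coker:
  assumes q: "coker a q" and y: "y \<in> el X (Cod C a)" and 0: "y \<star> a = zer X (Dom C a)"
  shows "\<exists>w \<in> el X (Cod C q). y = w \<star> q"
proof -
  have a: "a \<in> arrows C (Dom C a) (Cod C a)" "q \<in> arrows C (Cod C a) (Cod C q)"
    using q by (auto simp: coker_def arrows_iff)
  have O: "Dom C a \<in> Obj C" "Cod C a \<in> Obj C" using arrows_ObjD[OF a(1)] by auto
  have n: "nul (Dom C a) (Cod C a) \<in> arrows C (Dom C a) (Cod C a)" using nul_arrows[OF O] .
  obtain d u w where u: "u \<in> arrows C (Cod C a) d" "w \<in> el X d" "y = w \<star> u"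
    "u \<bullet> a = u \<bullet> nul (Dom C a) (Cod C a)"
    using equalize[OF y O(2) a(1) n] act_nul[OF y O] 0 by metis
  then have "u \<bullet> a = nul (Dom C a) d" using Cmp_nul_right[OF u(1) O(1)] by simp
  then obtain t where t: "t \<in> arrows C (Cod C q) d" "t \<bullet> q = u"
    using q u(1) unfolding coker_def by blast
  then have "y = w \<star> t \<star> q" using act_act[OF u(2) t(1) a(2)] u(3) by simp
  then show ?thesis using act_el[OF u(2) t(1)] by blast
qed

text \<open>The difference of \<open>x\<close> and \<open>y\<close> is killed by \<open>e\<close>,
  and it comes from some stage \<open>u\<close> with \<open>u \<bullet> e\<close> zero; cancelling
  \<open>e\<close> in \<open>C\<close> makes \<open>u\<close> zero.\<close>

lemma el_epi:
  assumes e: "e \<in> arrows C c d" and epi: "\<And>W u. u \<in> arrows C d W ==> u \<bullet> e = nul c W ==> u = nul d W"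
    and x: "x \<in> el X d" and y: "y \<in> el X d" and eq: "x \<star> e = y \<star> e"
  shows "x = y"
proof -
  have X: "X \<in> Obj A" using A.arrows_ObjD x by blast
  have O: "c \<in> Obj C" "d \<in> Obj C" using arrows_ObjD[OF e] by auto
  let ?w = "AP.mi x y"
  have w: "?w \<in> el X d" using AP.mi_arrows[OF x y] .
  have "?w \<star> e = zer X c"
    using mi_act[OF x y e] AP.mi_eq_nul[OF act_el[OF x e] act_el[OF y e]] eq by simp
  then have "?w \<star> e = ?w \<star> nul c d" using act_nul[OF w O] by simp
  then obtain f u v where u: "u \<in> arrows C d f" "v \<in> el X f" "?w = v \<star> u" "u \<bullet> e = u \<bullet> nul c d"
    using equalize[OF w O(2) e nul_arrows[OF O]] by blast
  have "u = nul d f" using epi[OF u(1)] u(4) Cmp_nul_right[OF u(1) O(1)] by simp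
  then have "?w = zer X d" using u(3) act_nul[OF u(2) O(2)] arrows_ObjD[OF u(1)] by simp
  then show ?thesis using AP.mi_eq_nul[OF x y] by simp
qed

lemma el_coker_epi:
  assumes q: "coker a q" and "x \<in> el X (Cod C q)" "y \<in> el X (Cod C q)" "x \<star> q = y \<star> q"
  shows "x = y"
proof (rule el_epi[OF _ _ assms(2-4)])
  show qa: "q \<in> arrows C (Dom C q) (Cod C q)" using q by (simp add: coker_def arrows_iff)
  fix W u assume u: "u \<in> arrows C (Cod C q) W" "u \<bullet> q = nul (Dom C q) W"
  have W: "W \<in> Obj C" using u arrows_ObjD by blast
  show "u = nul (Cod C q) W"
    using coker_epi[OF q u(1) nul_arrows[OF arrows_ObjD(2)[OF qa] W]] u(2) Cmp_nul_left[OF qa W] by simp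
qed

text \<open>Serves where the value of an arrow on an element is pinned down by a property and no
  formula is at hand.\<close>

lemma arrow_of_rel:
  assumes X: "X \<in> Obj A" and Y: "Y \<in> Obj A"
    and R: "\<And>c x. c \<in> Obj C ==> x \<in> el X c ==> \<exists>!y. y \<in> el Y c \<and> R c x y"
    and nat: "\<And>c d x y g. g \<in> arrows C d c ==> x \<in> el X c ==> y \<in> el Y c ==> R c x y ==>
      R d (x \<star> g) (y \<star> g)"
  shows "\<exists>\<phi> \<in> arrows A X Y. \<forall>c \<in> Obj C. \<forall>x \<in> el X c. R c x (\<phi> \<cdot> x)"
proof -
  let ?\<eta> = "\<lambda>c x. THE y. y \<in> el Y c \<and> R c x y"
  have \<eta>: "?\<eta> c x \<in> el Y c \<and> R c x (?\<eta> c x)" if "c \<in> Obj C" "x \<in> el X c" for c x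
    using theI'[OF R[OF that]] .
  have "\<exists>\<phi> \<in> arrows A X Y. \<forall>c \<in> Obj C. \<forall>x \<in> el X c. \<phi> \<cdot> x = ?\<eta> c x"
  proof (rule arrow_ex[OF X Y])
    show "?\<eta> c x \<in> el Y c" if "c \<in> Obj C" "x \<in> el X c" for c x using \<eta>[OF that] by blast
    fix c d x g assume g: "g \<in> arrows C d c" and x: "x \<in> el X c"
    have O: "c \<in> Obj C" "d \<in> Obj C" using arrows_ObjD[OF g] by auto
    note \<eta>' = \<eta>[OF O(1) x]
    show "?\<eta> d (x \<star> g) = ?\<eta> c x \<star> g"
      using the1_equality[OF R[OF O(2) act_el[OF x g]]] nat[OF g x _ conjunct2[OF \<eta>']]
        act_el[OF _ g] \<eta>' by blast
  qed
  then show ?thesis using \<eta> by metis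
qed

section \<open>Limits in the completion\<close>

text \<open>
  A subfunctor of a product of objects is representable if it is additive and if membership can be
  tested after precomposition with a cokernel.
\<close>

lemma representable_subproduct:
  fixes I :: "'i set" and X :: "'i \<Rightarrow> 'O" and S :: "'o \<Rightarrow> ('i \<Rightarrow> 'M) set"
  assumes I: "small TYPE('v) I" and X: "\<And>i. i \<in> I ==> X i \<in> Obj A"
    and S: "\<And>c. c \<in> Obj C ==> S c \<subseteq> (\<Pi>\<^sub>E i \<in> I. el (X i) c)"
    and zero: "\<And>c. c \<in> Obj C ==> (\<lambda>i \<in> I. zer (X i) c) \<in> S c"
    and plus: "\<And>c x y. c \<in> Obj C ==> x \<in> S c ==> y \<in> S c ==> (\<lambda>i \<in> I. plA (x i) (y i)) \<in> S c"
    and res: "\<And>c d x g. g \<in> arrows C d c ==> x \<in> S c ==> (\<lambda>i \<in> I. x i \<star> g) \<in> S d"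
    and desc: "\<And>a q w. coker a q ==> w \<in> (\<Pi>\<^sub>E i \<in> I. el (X i) (Cod C q)) ==>
      (\<lambda>i \<in> I. w i \<star> q) \<in> S (Cod C a) ==> w \<in> S (Cod C q)"
  obtains Z pr where "Z \<in> Obj A" "\<And>i. i \<in> I ==> pr i \<in> arrows A Z (X i)"
    "\<And>c z. c \<in> Obj C ==> z \<in> el Z c ==> (\<lambda>i \<in> I. pr i \<cdot> z) \<in> S c"
    "\<And>c s. c \<in> Obj C ==> s \<in> S c ==> \<exists>!z. z \<in> el Z c \<and> (\<forall>i \<in> I. pr i \<cdot> z = s i)"
proof -
  let ?rs = "\<lambda>x g. \<lambda>i \<in> I. x i \<star> g"
  have mem: "x i \<in> el (X i) c" if "c \<in> Obj C" "x \<in> S c" "i \<in> I" for x i c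
    using S[OF that(1)] that by blast
  have ext: "x = (\<lambda>i \<in> I. y i)" if "c \<in> Obj C" "x \<in> S c" "\<And>i. i \<in> I ==> x i = y i" for x y c
    using S[OF that(1)] that by (intro ext) (auto simp: PiE_def extensional_def)
  have "\<exists>Z \<theta>. Z \<in> Obj A \<and> (\<forall>c \<in> Obj C. bij_betw (\<theta> c) (S c) (el Z c)) \<and>
    (\<forall>c d g x. g \<in> arrows C d c \<longrightarrow> x \<in> S c \<longrightarrow> \<theta> d (?rs x g) = \<theta> c x \<star> g)"
  proof (rule representable)
    fix c assume c: "c \<in> Obj C"
    show "small TYPE('v) (S c)"
      using small_subset[OF S[OF c] small_PiE[OF I small_el[OF X c]]] .
    show "?rs x (Idn C c) = x" if "x \<in> S c" for x
      by (rule ext[symmetric, OF c that]) (use act_Idn[OF c mem[OF c that]] in simp)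
  next
    fix c d e g h x assume g: "g \<in> arrows C d c" and h: "h \<in> arrows C e d" and x: "x \<in> S c"
    show "?rs (?rs x g) h = ?rs x (g \<bullet> h)"
      by (rule restrict_ext) (use act_act[OF mem[OF arrows_ObjD(2)[OF g] x] g h] in simp)
  next
    show "\<exists>c \<in> Obj C. S c \<noteq> {}" using ex_zero zero by blast
  next
    fix c d x y assume c: "c \<in> Obj C" "d \<in> Obj C" and x: "x \<in> S c" and y: "y \<in> S d"
    obtain P i j p q where P: "i \<in> arrows C c P" "j \<in> arrows C d P" "p \<in> arrows C P c" "q \<in> arrows C P d"
       "p \<bullet> i = Idn C c" "q \<bullet> j = Idn C d" "p \<bullet> j = nul d c" "q \<bullet> i = nul c d"
      using biprod[OF c] by metis
    have PO: "P \<in> Obj C" using arrows_ObjD P by blast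
    \<comment> \<open>The element of the biproduct with components \<open>x\<close> and
      \<open>y\<close>; restricting along \<open>i\<close> and \<open>j\<close> recovers them, which
      gives an upper bound.\<close>
    define z where "z = (\<lambda>k \<in> I. plA (?rs x p k) (?rs y q k))"
    have z: "z \<in> S P" unfolding z_def by (rule plus[OF PO res[OF P(3) x] res[OF P(4) y]])
    have xk: "x k \<star> p \<in> el (X k) P" "y k \<star> q \<in> el (X k) P" if "k \<in> I" for k
      using act_el mem[OF c(1) x that] mem[OF c(2) y that] P(3,4) by blast+
    have "x = ?rs z i"
    proof (rule ext[OF c(1) x])
      fix k assume k: "k \<in> I"
      note m = mem[OF c(1) x k] mem[OF c(2) y k]
      have "z k \<star> i = plA (x k \<star> (p \<bullet> i)) (y k \<star> (q \<bullet> i))"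
        using pl_act[OF xk[OF k] P(1)] act_act[OF m(1) P(3,1)] act_act[OF m(2) P(4,1)] k
        by (simp add: z_def)
      also have "\<dots> = x k"
        using act_Idn[OF c(1) m(1)] act_nul[OF m(2) c] AP.pl_nul[OF m(1)] P(5,8) by simp
      finally show "x k = z k \<star> i" by simp
    qed
    moreover have "y = ?rs z j"
    proof (rule ext[OF c(2) y])
      fix k assume k: "k \<in> I"
      note m = mem[OF c(1) x k] mem[OF c(2) y k]
      have "z k \<star> j = plA (x k \<star> (p \<bullet> j)) (y k \<star> (q \<bullet> j))"
        using pl_act[OF xk[OF k] P(2)] act_act[OF m(1) P(3,2)] act_act[OF m(2) P(4,2)] k
        by (simp add: z_def)
      also have "\<dots> = y k"
        using act_Idn[OF c(2) m(2)] act_nul[OF m(1) c(2,1)] AP.pl_nul_left[OF m(2)] P(6,7) by simp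
      finally show "y k = z k \<star> j" by simp
    qed
    ultimately show "\<exists>e\<in>Obj C. \<exists>z\<in>S e. \<exists>f\<in>arrows C c e. \<exists>g\<in>arrows C d e. x = ?rs z f \<and> y = ?rs z g"
      using PO z P(1,2) by blast
  next
    fix c d z f g assume z: "z \<in> S d" and f: "f \<in> arrows C c d" and g: "g \<in> arrows C c d"
      and eq: "?rs z f = ?rs z g"
    have O: "c \<in> Obj C" "d \<in> Obj C" using arrows_ObjD[OF f] by auto
    \<comment> \<open>Each component of \<open>z\<close> is killed by the difference of
      \<open>f\<close> and \<open>g\<close> and so descends along its cokernel \<open>q\<close>,
      which equalizes \<open>f\<close> and \<open>g\<close>. By \<open>desc\<close> the descended
      family again belongs to the subfunctor.\<close>
    let ?a = "mi f g"
    have a: "?a \<in> arrows C c d" using mi_arrows[OF f g] .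
    obtain q where q: "coker ?a q" using cok[OF a] by blast
    then have qa: "q \<in> arrows C d (Cod C q)" "Cod C ?a = d" "Dom C ?a = c"
      using a by (auto simp: coker_def arrows_iff)
    have "\<exists>w \<in> el (X k) (Cod C q). z k = w \<star> q" if k: "k \<in> I" for k
    proof (rule el_coker[OF q, unfolded qa])
      show zk: "z k \<in> el (X k) d" using mem[OF O(2) z k] .
      have "z k \<star> f = z k \<star> g" using fun_cong[OF eq, of k] k by simp
      then show "z k \<star> ?a = zer (X k) c"
        using act_mi[OF zk f g] AP.mi_eq_nul[OF act_el[OF zk f] act_el[OF zk g]] by simp
    qed
    then obtain w0 where w0: "\<And>k. k \<in> I ==> w0 k \<in> el (X k) (Cod C q)" "\<And>k. k \<in> I ==> z k = w0 k \<star> q"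
      by metis
    define w where "w = (\<lambda>k \<in> I. w0 k)"
    have zw: "z = ?rs w q" by (rule ext[OF O(2) z]) (use w0 in \<open>simp add: w_def\<close>)
    have "w \<in> S (Cod C q)"
      by (rule desc[OF q]) (use w0 zw z qa in \<open>auto simp: w_def\<close>)
    moreover have "q \<bullet> f = q \<bullet> g"
    proof -
      have "q \<bullet> ?a = nul c (Cod C q)" using q qa by (auto simp: coker_def)
      then show ?thesis
        using Cmp_mi_right[OF f g qa(1)] mi_eq_nul[OF Cmp_arrows[OF f qa(1)] Cmp_arrows[OF g qa(1)]] by simp
    qed
    ultimately show "\<exists>e u w. u \<in> arrows C d e \<and> w \<in> S e \<and> z = ?rs w u \<and> u \<bullet> f = u \<bullet> g"
      using qa(1) zw by blast
  qed (rule res)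
  then obtain Z \<theta> where Z: "Z \<in> Obj A" and \<theta>: "\<And>c. c \<in> Obj C ==> bij_betw (\<theta> c) (S c) (el Z c)"
    and nat: "\<And>c d g x. g \<in> arrows C d c ==> x \<in> S c ==> \<theta> d (?rs x g) = \<theta> c x \<star> g"
    by blast
  \<comment> \<open>Elements of \<open>Z\<close> correspond to families under the bijection
    \<open>\<theta>\<close>; the projection reads off one member of the family.\<close>
  have "\<exists>\<pi> \<in> arrows A Z (X i). \<forall>c \<in> Obj C. \<forall>z \<in> el Z c. \<exists>s \<in> S c. z = \<theta> c s \<and> \<pi> \<cdot> z = s i" if i: "i \<in> I" for i
  proof (rule arrow_of_rel[OF Z X[OF i]])
    fix c z assume c: "c \<in> Obj C" and z: "z \<in> el Z c"
    obtain s where "s \<in> S c" "z = \<theta> c s" using \<theta>[OF c] z unfolding bij_betw_def by blast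
    then show "\<exists>!y. y \<in> el (X i) c \<and> (\<exists>s \<in> S c. z = \<theta> c s \<and> y = s i)"
      using mem[OF c _ i] \<theta>[OF c] by (intro ex1I[of _ "s i"]) (auto simp: bij_betw_def inj_on_def)
  next
    fix c d x y g assume g: "g \<in> arrows C d c" and "\<exists>s \<in> S c. x = \<theta> c s \<and> y = s i"
    then obtain s where "s \<in> S c" "x = \<theta> c s" "y = s i" by blast
    then show "\<exists>s \<in> S d. x \<star> g = \<theta> d s \<and> y \<star> g = s i"
      using nat[OF g] res[OF g] i by (intro bexI[of _ "?rs s g"]) auto
  qed
  then obtain pr where pr: "\<And>i. i \<in> I ==> pr i \<in> arrows A Z (X i)"
    "\<And>i c z. i \<in> I ==> c \<in> Obj C ==> z \<in> el Z c ==> \<exists>s \<in> S c. z = \<theta> c s \<and> pr i \<cdot> z = s i"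
    by metis
  have pr': "pr i \<cdot> \<theta> c s = s i" if i: "i \<in> I" and c: "c \<in> Obj C" and s: "s \<in> S c" for i c s
  proof -
    have "\<theta> c s \<in> el Z c" using \<theta>[OF c] s by (auto simp: bij_betw_def)
    then obtain s' where "s' \<in> S c" "\<theta> c s = \<theta> c s'" "pr i \<cdot> \<theta> c s = s' i" using pr(2) i c by blast
    then show ?thesis using \<theta>[OF c] s by (auto simp: bij_betw_def inj_on_def)
  qed
  show thesis
  proof (rule that[OF Z pr(1)])
    fix c z assume c: "c \<in> Obj C" and z: "z \<in> el Z c"
    obtain s where s: "s \<in> S c" "z = \<theta> c s" using \<theta>[OF c] z unfolding bij_betw_def by blast
    have "s = (\<lambda>i \<in> I. pr i \<cdot> z)" by (rule ext[OF c s(1)]) (use pr'[OF _ c s(1)] s(2) in simp)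
    then show "(\<lambda>i \<in> I. pr i \<cdot> z) \<in> S c" using s by simp
  next
    fix c s assume c: "c \<in> Obj C" and s: "s \<in> S c"
    show "\<exists>!z. z \<in> el Z c \<and> (\<forall>i \<in> I. pr i \<cdot> z = s i)"
    proof (rule ex1I[of _ "\<theta> c s"])
      show "\<theta> c s \<in> el Z c \<and> (\<forall>i\<in>I. pr i \<cdot> \<theta> c s = s i)"
        using pr' c s \<theta>[OF c] by (auto simp: bij_betw_def)
      fix z assume z: "z \<in> el Z c \<and> (\<forall>i\<in>I. pr i \<cdot> z = s i)"
      then obtain s' where s': "s' \<in> S c" "z = \<theta> c s'" using \<theta>[OF c] unfolding bij_betw_def by blast
      have "s' = (\<lambda>i \<in> I. s i)" by (rule ext[OF c s'(1)]) (use z pr'[OF _ c s'(1)] s'(2) in simp)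
      moreover have "s = (\<lambda>i \<in> I. s i)" by (rule ext[OF c s]) simp
      ultimately show "z = \<theta> c s" using s' by simp
    qed
  qed
qed

text \<open>The whole product taken as its own subfunctor, indexed by the two truth values.\<close>

lemma product_elements:
  assumes X: "X \<in> Obj A" and Y: "Y \<in> Obj A"
  obtains P p q where "P \<in> Obj A" "p \<in> arrows A P X" "q \<in> arrows A P Y"
    "\<And>c x y. c \<in> Obj C ==> x \<in> el X c ==> y \<in> el Y c ==>
       \<exists>!z. z \<in> el P c \<and> p \<cdot> z = x \<and> q \<cdot> z = y"
proof -
  let ?X = "\<lambda>b. if b then X else Y"
  obtain P pr where P: "P \<in> Obj A" and pr: "\<And>i. i \<in> UNIV ==> pr i \<in> arrows A P (?X i)"
    and ex: "\<And>c s. c \<in> Obj C ==> s \<in> (\<Pi>\<^sub>E i \<in> UNIV. el (?X i) c) ==>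
      \<exists>!z. z \<in> el P c \<and> (\<forall>i \<in> UNIV. pr i \<cdot> z = s i)"
  proof (rule representable_subproduct[of "UNIV :: bool set" ?X "\<lambda>c. \<Pi>\<^sub>E i \<in> UNIV. el (?X i) c"])
    show "(\<lambda>i \<in> UNIV. zer (?X i) c) \<in> (\<Pi>\<^sub>E i \<in> UNIV. el (?X i) c)" if "c \<in> Obj C" for c
      using zer_el that X Y by auto
    show "(\<lambda>i \<in> UNIV. plA (x i) (y i)) \<in> (\<Pi>\<^sub>E i \<in> UNIV. el (?X i) c)"
      if "x \<in> (\<Pi>\<^sub>E i \<in> UNIV. el (?X i) c)" "y \<in> (\<Pi>\<^sub>E i \<in> UNIV. el (?X i) c)" for x y c
      using AP.pl_arrows[OF PiE_mem[OF that(1)] PiE_mem[OF that(2)]] by auto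
    show "(\<lambda>i \<in> UNIV. x i \<star> g) \<in> (\<Pi>\<^sub>E i \<in> UNIV. el (?X i) d)"
      if "g \<in> arrows C d c" "x \<in> (\<Pi>\<^sub>E i \<in> UNIV. el (?X i) c)" for x g c d
      using act_el[OF PiE_mem[OF that(2)] that(1)] by auto
  qed (use X Y in \<open>auto simp: small_finite\<close>)
  show thesis
  proof (rule that[of P "pr True" "pr False"])
    fix c x y assume c: "c \<in> Obj C" and x: "x \<in> el X c" and y: "y \<in> el Y c"
    show "\<exists>!z. z \<in> el P c \<and> pr True \<cdot> z = x \<and> pr False \<cdot> z = y"
      using ex[OF c, of "\<lambda>b. if b then x else y"] x y by (simp add: all_bool_eq PiE_def)
  qed (use P pr[of True] pr[of False] in auto)
qed

lemma product_arrow: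
  assumes P: "P \<in> Obj A" "p \<in> arrows A P X" "q \<in> arrows A P Y"
    and ex: "\<And>c x y. c \<in> Obj C ==> x \<in> el X c ==> y \<in> el Y c ==>
       \<exists>!z. z \<in> el P c \<and> p \<cdot> z = x \<and> q \<cdot> z = y"
    and f: "f \<in> arrows A W X" and g: "g \<in> arrows A W Y"
  shows "\<exists>!u. u \<in> arrows A W P \<and> p \<cdot> u = f \<and> q \<cdot> u = g"
proof -
  have W: "W \<in> Obj A" using A.arrows_ObjD f by blast
  have "\<exists>u \<in> arrows A W P. \<forall>c \<in> Obj C. \<forall>w \<in> el W c. p \<cdot> (u \<cdot> w) = f \<cdot> w \<and> q \<cdot> (u \<cdot> w) = g \<cdot> w"
  proof (rule arrow_of_rel[OF W P(1)])
    fix c w assume c: "c \<in> Obj C" and w: "w \<in> el W c"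
    show "\<exists>!y. y \<in> el P c \<and> p \<cdot> y = f \<cdot> w \<and> q \<cdot> y = g \<cdot> w"
      using ex[OF c A.Cmp_arrows[OF w f] A.Cmp_arrows[OF w g]] .
  next
    fix c d x y k assume *: "k \<in> arrows C d c" "x \<in> el W c" "y \<in> el P c" "p \<cdot> y = f \<cdot> x \<and> q \<cdot> y = g \<cdot> x"
    show "p \<cdot> (y \<star> k) = f \<cdot> (x \<star> k) \<and> q \<cdot> (y \<star> k) = g \<cdot> (x \<star> k)"
      using cmp_act[OF f *(2,1)] cmp_act[OF g *(2,1)] cmp_act[OF P(2) *(3,1)] cmp_act[OF P(3) *(3,1)] *(4)
      by simp
  qed
  then obtain u where u: "u \<in> arrows A W P"
    "\<And>c w. c \<in> Obj C ==> w \<in> el W c ==> p \<cdot> (u \<cdot> w) = f \<cdot> w \<and> q \<cdot> (u \<cdot> w) = g \<cdot> w" by blast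
  show ?thesis
  proof (rule ex1I[of _ u], intro conjI)
    show "u \<in> arrows A W P" by (rule u(1))
    show "p \<cdot> u = f"
      by (rule arrow_eqI[OF A.Cmp_arrows[OF u(1) P(2)] f]) (use A.Cmp_assoc[OF _ u(1) P(2)] u(2) in auto)
    show "q \<cdot> u = g"
      by (rule arrow_eqI[OF A.Cmp_arrows[OF u(1) P(3)] g]) (use A.Cmp_assoc[OF _ u(1) P(3)] u(2) in auto)
    fix v assume v: "v \<in> arrows A W P \<and> p \<cdot> v = f \<and> q \<cdot> v = g"
    show "v = u"
    proof (rule arrow_eqI[OF conjunct1[OF v] u(1)])
      fix c w assume c: "c \<in> Obj C" and w: "w \<in> el W c"
      have "p \<cdot> (v \<cdot> w) = f \<cdot> w \<and> q \<cdot> (v \<cdot> w) = g \<cdot> w"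
        using A.Cmp_assoc[OF w conjunct1[OF v] P(2)] A.Cmp_assoc[OF w conjunct1[OF v] P(3)] v by simp
      then show "v \<cdot> w = u \<cdot> w"
        using ex[OF c A.Cmp_arrows[OF w f] A.Cmp_arrows[OF w g]] u(2)[OF c w]
          A.Cmp_arrows[OF w u(1)] A.Cmp_arrows[OF w conjunct1[OF v]] by blast
    qed
  qed
qed

lemma ex_product:
  assumes X: "X \<in> Obj A" and Y: "Y \<in> Obj A"
  shows "\<exists>P p q. is_product A X Y P p q"
proof -
  obtain P p q where P: "P \<in> Obj A" "p \<in> arrows A P X" "q \<in> arrows A P Y"
    and ex: "\<And>c x y. c \<in> Obj C ==> x \<in> el X c ==> y \<in> el Y c ==>
       \<exists>!z. z \<in> el P c \<and> p \<cdot> z = x \<and> q \<cdot> z = y"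
    using product_elements[OF X Y] by blast
  show ?thesis
    unfolding is_product_def using product_arrow[OF P ex] P by blast
qed

text \<open>An empty product. Its single family is the function that is \<open>undefined\<close>
  everywhere, and so \<open>Z\<close> has one element over each object of \<open>C\<close>.\<close>

lemma ex_zero_obj: "\<exists>Z. zero_obj A Z"
proof -
  obtain Z pr where Z: "Z \<in> Obj A"
    and ex: "\<And>c s. c \<in> Obj C ==> s \<in> {\<lambda>i. undefined} ==>
      \<exists>!z. z \<in> el Z c \<and> (\<forall>i \<in> {} :: unit set. pr i \<cdot> z = s i)"
    by (rule representable_subproduct[of "{} :: unit set" "\<lambda>_. undefined" "\<lambda>c. {\<lambda>i. undefined}"])
      (auto simp: small_finite)
  then have el: "\<exists>!z. z \<in> el Z c" if "c \<in> Obj C" for c using that by simp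
  have "(\<exists>!f. f \<in> arrows A X Z) \<and> (\<exists>!f. f \<in> arrows A Z X)" if X: "X \<in> Obj A" for X
  proof (intro conjI ex1I)
    show "nulA X Z \<in> arrows A X Z" "nulA Z X \<in> arrows A Z X" using AP.nul_arrows X Z by auto
    show "f = nulA X Z" if f: "f \<in> arrows A X Z" for f
      by (rule arrow_eqI[OF f AP.nul_arrows[OF X Z]])
        (use el A.Cmp_arrows f AP.nul_arrows[OF X Z] in blast)
    fix f assume f: "f \<in> arrows A Z X"
    show "f = nulA Z X"
    proof (rule arrow_eqI[OF f AP.nul_arrows[OF Z X]])
      fix c x assume c: "c \<in> Obj C" and x: "x \<in> el Z c"
      have "x = zer Z c" using el[OF c] x zer_el[OF Z c] by blast
      then show "f \<cdot> x = nulA Z X \<cdot> x" using cmp_zer[OF f c] cmp_zer[OF AP.nul_arrows[OF Z X] c] by simp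
    qed
  qed
  then show ?thesis using Z unfolding zero_obj_def by blast
qed

sublocale AP: preadditive_zero A plA negA nulA
  by unfold_locales (rule ex_zero_obj)

text \<open>Arrows into \<open>Z\<close> are natural families of elements of \<open>Z\<close>, so
  the universal property of a kernel can be tested one element at a time.\<close>

lemma ker_iff:
  assumes f: "f \<in> arrows A X Y" and k: "k \<in> arrows A Z X"
  shows "AP.ker f k \<longleftrightarrow>
    (\<forall>c \<in> Obj C. \<forall>z \<in> el Z c. f \<cdot> (k \<cdot> z) = zer Y c) \<and>
    (\<forall>c \<in> Obj C. \<forall>x \<in> el X c. f \<cdot> x = zer Y c \<longrightarrow> (\<exists>!z. z \<in> el Z c \<and> k \<cdot> z = x))"
    (is "_ \<longleftrightarrow> ?R1 \<and> ?R2")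
proof
  assume K: "AP.ker f k"
  have O: "X \<in> Obj A" "Y \<in> Obj A" "Z \<in> Obj A" using A.arrows_ObjD f k by blast+
  have "f \<cdot> k = nulA Z Y" using K f k by (auto simp: AP.ker_def arrows_iff)
  then have ?R1 using A.Cmp_assoc[OF _ k f] AP.Cmp_nul_left[OF _ O(2)] by auto
  moreover have ?R2 using K f k by (auto simp: AP.ker_def arrows_iff)
  ultimately show "?R1 \<and> ?R2" by blast
next
  assume R: "?R1 \<and> ?R2"
  have O: "X \<in> Obj A" "Y \<in> Obj A" "Z \<in> Obj A" using A.arrows_ObjD f k by blast+
  have fk: "f \<cdot> k = nulA Z Y"
    by (rule arrow_eqI[OF A.Cmp_arrows[OF k f] AP.nul_arrows[OF O(3,2)]])
      (use R A.Cmp_assoc[OF _ k f] AP.Cmp_nul_left[OF _ O(2)] in auto)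
  have "\<exists>!u. u \<in> arrows A W Z \<and> k \<cdot> u = h" if h: "h \<in> arrows A W X" and fh: "f \<cdot> h = nulA W Y" for W h
  proof -
    have W: "W \<in> Obj A" using h A.arrows_ObjD by blast
    have ex: "\<exists>!z. z \<in> el Z c \<and> k \<cdot> z = h \<cdot> w" if c: "c \<in> Obj C" and w: "w \<in> el W c" for c w
    proof -
      have "f \<cdot> (h \<cdot> w) = zer Y c" using A.Cmp_assoc[OF w h f] fh AP.Cmp_nul_left[OF w O(2)] by simp
      then show ?thesis using R c A.Cmp_arrows[OF w h] by blast
    qed
    have "\<exists>u \<in> arrows A W Z. \<forall>c \<in> Obj C. \<forall>w \<in> el W c. k \<cdot> (u \<cdot> w) = h \<cdot> w"
      by (rule arrow_of_rel[OF W O(3) ex]) (use cmp_act[OF h] cmp_act[OF k] in auto)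
    then obtain u where u: "u \<in> arrows A W Z" "\<And>c w. c \<in> Obj C ==> w \<in> el W c ==> k \<cdot> (u \<cdot> w) = h \<cdot> w"
      by blast
    show ?thesis
    proof (rule ex1I[of _ u])
      show "u \<in> arrows A W Z \<and> k \<cdot> u = h"
        using u(1) arrow_eqI[OF A.Cmp_arrows[OF u(1) k] h] A.Cmp_assoc[OF _ u(1) k] u(2) by simp
      fix v assume v: "v \<in> arrows A W Z \<and> k \<cdot> v = h"
      show "v = u"
      proof (rule arrow_eqI[OF conjunct1[OF v] u(1)])
        fix c w assume c: "c \<in> Obj C" and w: "w \<in> el W c"
        show "v \<cdot> w = u \<cdot> w"
          using ex[OF c w] A.Cmp_assoc[OF w conjunct1[OF v] k] v u(2)[OF c w]
            A.Cmp_arrows[OF w u(1)] A.Cmp_arrows[OF w conjunct1[OF v]] by auto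
      qed
    qed
  qed
  moreover have D: "f \<in> Arr A" "Dom A f = X" "Cod A f = Y" "k \<in> Arr A" "Dom A k = Z" "Cod A k = X"
    using f k by (auto simp: arrows_iff)
  ultimately show "AP.ker f k" unfolding AP.ker_def D using fk by blast
qed

lemma ex_ker:
  assumes f: "f \<in> arrows A X Y"
  shows "\<exists>Z. \<exists>k \<in> arrows A Z X. AP.ker f k"
proof -
  have O: "X \<in> Obj A" "Y \<in> Obj A" using A.arrows_ObjD f by blast+
  let ?S = "\<lambda>c. {s \<in> \<Pi>\<^sub>E i \<in> {()}. el X c. f \<cdot> s () = zer Y c}"
  obtain Z pr where Z: "Z \<in> Obj A" and pr: "\<And>i. i \<in> {()} ==> pr i \<in> arrows A Z X"
    and S: "\<And>c z. c \<in> Obj C ==> z \<in> el Z c ==> (\<lambda>i \<in> {()}. pr i \<cdot> z) \<in> ?S c"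
    and ex: "\<And>c s. c \<in> Obj C ==> s \<in> ?S c ==> \<exists>!z. z \<in> el Z c \<and> (\<forall>i \<in> {()}. pr i \<cdot> z = s i)"
  proof (rule representable_subproduct[of "{()}" "\<lambda>_. X" ?S])
    show "(\<lambda>i \<in> {()}. zer X c) \<in> ?S c" if "c \<in> Obj C" for c
      using zer_el[OF O(1) that] cmp_zer[OF f that] by auto
    show "(\<lambda>i \<in> {()}. plA (x i) (y i)) \<in> ?S c" if c: "c \<in> Obj C" and "x \<in> ?S c" "y \<in> ?S c" for x y c
    proof -
      have xy: "x () \<in> el X c" "y () \<in> el X c" "f \<cdot> x () = zer Y c" "f \<cdot> y () = zer Y c"
        using that by auto
      show ?thesis
        using AP.pl_arrows[OF xy(1,2)] AP.Cmp_pl_right[OF xy(1,2) f] xy(3,4)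
          AP.pl_nul[OF zer_el[OF O(2) c]] by auto
    qed
    show "(\<lambda>i \<in> {()}. x i \<star> g) \<in> ?S d" if g: "g \<in> arrows C d c" and "x \<in> ?S c" for x g c d
    proof -
      have x: "x () \<in> el X c" "f \<cdot> x () = zer Y c" using that by auto
      show ?thesis using act_el[OF x(1) g] cmp_act[OF f x(1) g] x(2) zer_act[OF O(2) g] by auto
    qed
    show "w \<in> ?S (Cod C q)" if q: "coker a q" and w: "w \<in> (\<Pi>\<^sub>E i \<in> {()}. el X (Cod C q))"
      and wq: "(\<lambda>i \<in> {()}. w i \<star> q) \<in> ?S (Cod C a)" for a q w
    proof -
      have w0: "w () \<in> el X (Cod C q)" using w by auto
      have qa: "q \<in> arrows C (Cod C a) (Cod C q)" using q by (auto simp: coker_def arrows_iff)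
      have c: "Cod C q \<in> Obj C" using arrows_ObjD qa by blast
      \<comment> \<open>Descent holds because a cokernel can be cancelled on elements:
        \<open>f \<cdot> w ()\<close> vanishes after restriction along \<open>q\<close>.\<close>
      have "f \<cdot> w () = zer Y (Cod C q)"
        by (rule el_coker_epi[OF q A.Cmp_arrows[OF w0 f] zer_el[OF O(2) c]])
          (use cmp_act[OF f w0 qa] wq zer_act[OF O(2) qa] in simp)
      then show ?thesis using w by simp
    qed
  qed (use O in \<open>auto simp: small_finite\<close>)
  have "AP.ker f (pr ())"
  proof (subst ker_iff[OF f pr], simp, intro conjI ballI impI)
    show "f \<cdot> (pr () \<cdot> z) = zer Y c" if "c \<in> Obj C" "z \<in> el Z c" for c z using S[OF that] by simp
    show "\<exists>!z. z \<in> el Z c \<and> pr () \<cdot> z = x" if "c \<in> Obj C" "x \<in> el X c" "f \<cdot> x = zer Y c" for c x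
      using ex[OF that(1), of "\<lambda>i \<in> {()}. x"] that by simp
  qed
  then show ?thesis using pr by blast
qed

section \<open>Quotients\<close>

text \<open>One fixed cokernel of each \<open>a\<close>, so that cokernels form a diagram. The
  choice retains the factorization from \<open>cok\<close>, which the pushout of a strict
  monomorphism calls for.\<close>

definition cokC :: "'m \<Rightarrow> 'm" where
  "cokC a = (SOME q. coker a q \<and> SE q \<and>
      (\<exists>I. \<exists>e \<in> arrows C (Dom C a) I. \<exists>j \<in> arrows C I (Cod C a). j \<bullet> e = a \<and> q \<bullet> j = nul I (Cod C q) \<and>
         (\<forall>W. \<forall>u \<in> arrows C I W. u \<bullet> e = nul (Dom C a) W \<longrightarrow> u = nul I W) \<and>
         (\<forall>W. \<forall>g \<in> arrows C W (Cod C a). q \<bullet> g = nul W (Cod C q) \<longrightarrow>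
            (\<exists>g' \<in> arrows C W I. g = j \<bullet> g'))))"

lemma cokC:
  assumes "a \<in> Arr C"
  shows "coker a (cokC a)" "SE (cokC a)"
    "\<exists>I. \<exists>e \<in> arrows C (Dom C a) I. \<exists>j \<in> arrows C I (Cod C a). j \<bullet> e = a \<and>
       cokC a \<bullet> j = nul I (Cod C (cokC a)) \<and>
       (\<forall>W. \<forall>u \<in> arrows C I W. u \<bullet> e = nul (Dom C a) W \<longrightarrow> u = nul I W) \<and>
       (\<forall>W. \<forall>g \<in> arrows C W (Cod C a). cokC a \<bullet> g = nul W (Cod C (cokC a)) \<longrightarrow>
            (\<exists>g' \<in> arrows C W I. g = j \<bullet> g'))"
  using someI_ex[OF cok[OF Arr_arrows[OF assms]], folded cokC_def] by blast+

lemma cokC_arrows: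
  assumes a: "a \<in> arrows C X Y"
  shows "cokC a \<in> arrows C Y (Cod C (cokC a))" "cokC a \<bullet> a = nul X (Cod C (cokC a))"
  using cokC(1)[of a] a by (auto simp: coker_def arrows_iff)

lemma cokC_factor:
  assumes a: "a \<in> arrows C X Y" and f: "f \<in> arrows C Y Z" and 0: "f \<bullet> a = nul X Z"
  shows "\<exists>!t. t \<in> arrows C (Cod C (cokC a)) Z \<and> t \<bullet> cokC a = f"
  using cokC(1)[of a] a f 0 unfolding coker_def by (auto simp: arrows_iff)

text \<open>Since \<open>S\<close> may fail descent along cokernels, elements outside
  \<open>S\<close> can die too. Which ones do, and how elements of \<open>Q\<close> lift, is read
  off the presentation of \<open>Q\<close> by the cokernels \<open>cokC a\<close>: an equality of
  elements shows at some index, and every element comes from some index.\<close>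

lemma quotient:
  assumes G: "G \<in> Obj A"
    and S: "\<And>c. c \<in> Obj C ==> S c \<subseteq> el G c"
    and zero: "\<And>c. c \<in> Obj C ==> zer G c \<in> S c"
    and plus: "\<And>c x y. c \<in> Obj C ==> x \<in> S c ==> y \<in> S c ==> plA x y \<in> S c"
    and res: "\<And>c d x g. g \<in> arrows C d c ==> x \<in> S c ==> x \<star> g \<in> S d"
  obtains Q \<pi> where "Q \<in> Obj A" "\<pi> \<in> arrows A G Q"
    "\<And>c s. c \<in> Obj C ==> s \<in> S c ==> \<pi> \<cdot> s = zer Q c"
    "\<And>W \<psi>. \<psi> \<in> arrows A G W ==> (\<And>c s. c \<in> Obj C ==> s \<in> S c ==> \<psi> \<cdot> s = zer W c) ==>
       \<exists>!u. u \<in> arrows A Q W \<and> u \<cdot> \<pi> = \<psi>"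
    "\<And>c y. c \<in> Obj C ==> y \<in> el G c ==> \<pi> \<cdot> y = zer Q c ==>
       \<exists>a y' g. a \<in> Arr C \<and> y' \<in> el G (Cod C a) \<and> g \<in> arrows C c (Cod C a) \<and> y' \<star> a \<in> S (Dom C a) \<and>
         cokC a \<bullet> g = nul c (Cod C (cokC a)) \<and> y = y' \<star> g"
    "\<And>c q. c \<in> Obj C ==> q \<in> el Q c ==>
       \<exists>e b x. SE e \<and> e \<in> arrows C b c \<and> x \<in> el G b \<and> \<pi> \<cdot> x = q \<star> e"
proof -

  \<comment> \<open>The index category and the diagram of cokernels\<close>
  let ?Ob = "{(y, a). a \<in> Arr C \<and> y \<in> el G (Cod C a) \<and> y \<star> a \<in> S (Dom C a)}"
  \<comment> \<open>In an index \<open>(y, a)\<close> the arrow \<open>a\<close> stands for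
    relations on the stage \<open>y\<close> that lie in \<open>S\<close>. The condition on
    \<open>g\<close> says exactly that it induces an arrow between the cokernels: it may carry
    \<open>a\<close> into the kernel of \<open>cokC a'\<close> without a factorization through
    \<open>a'\<close>.\<close>
  let ?hm = "\<lambda>(y, a) (y', a'). {g \<in> arrows C (Cod C a) (Cod C a'). y = y' \<star> g \<and>
      cokC a' \<bullet> g \<bullet> a = nul (Dom C a) (Cod C (cokC a'))}"
  have a: "a \<in> arrows C (Dom C a) (Cod C a)" "Dom C a \<in> Obj C" "Cod C a \<in> Obj C"
    "cokC a \<in> arrows C (Cod C a) (Cod C (cokC a))" "Cod C (cokC a) \<in> Obj C"
    "cokC a \<bullet> a = nul (Dom C a) (Cod C (cokC a))"
    if "a \<in> Arr C" for a
  proof -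
    show a: "a \<in> arrows C (Dom C a) (Cod C a)" using Arr_arrows[OF that] .
    show "Dom C a \<in> Obj C" "Cod C a \<in> Obj C" using arrows_ObjD[OF a] by auto
    show "cokC a \<in> arrows C (Cod C a) (Cod C (cokC a))"
      "cokC a \<bullet> a = nul (Dom C a) (Cod C (cokC a))" using cokC_arrows[OF a] by auto
    then show "Cod C (cokC a) \<in> Obj C" using arrows_ObjD by blast
  qed
  have ind: "\<exists>!t. t \<in> arrows C (Cod C (cokC a)) (Cod C (cokC a')) \<and> t \<bullet> cokC a = cokC a' \<bullet> g"
    if "(y, a) \<in> ?Ob" "(y', a') \<in> ?Ob" "g \<in> ?hm (y, a) (y', a')" for y a y' a' g
    using cokC_factor[OF a(1) Cmp_arrows[OF _ a(4)[of a']]] that by auto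
  define tr where "tr = (\<lambda>((y :: 'M, a), g, (y' :: 'M, a')).
      THE t. t \<in> arrows C (Cod C (cokC a)) (Cod C (cokC a')) \<and> t \<bullet> cokC a = cokC a' \<bullet> g)"
  have tr: "tr ((y, a), g, (y', a')) \<in> arrows C (Cod C (cokC a)) (Cod C (cokC a'))"
    "tr ((y, a), g, (y', a')) \<bullet> cokC a = cokC a' \<bullet> g"
    if "(y, a) \<in> ?Ob" "(y', a') \<in> ?Ob" "g \<in> ?hm (y, a) (y', a')" for y a y' a' g
    using theI'[OF ind[OF that]] by (auto simp: tr_def)
  have comp: "h \<bullet> g \<in> ?hm k m"
    if "g \<in> ?hm k l" "h \<in> ?hm l m" "k \<in> ?Ob" "l \<in> ?Ob" "m \<in> ?Ob" for g h k l m
  proof -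
    obtain y b y' b' y'' b'' where klm[simp]: "k = (y, b)" "l = (y', b')" "m = (y'', b'')"
      by (cases k, cases l, cases m)
    have g: "g \<in> arrows C (Cod C b) (Cod C b')" "y = y' \<star> g"
      "cokC b' \<bullet> g \<bullet> b = nul (Dom C b) (Cod C (cokC b'))"
      and h: "h \<in> arrows C (Cod C b') (Cod C b'')" "y' = y'' \<star> h"
      and B: "b \<in> Arr C" "b' \<in> Arr C" "b'' \<in> Arr C" and y'': "y'' \<in> el G (Cod C b'')"
      using that by auto
    let ?t = "tr (l, h, m)"
    have t: "?t \<in> arrows C (Cod C (cokC b')) (Cod C (cokC b''))" "?t \<bullet> cokC b' = cokC b'' \<bullet> h"
      using tr[of y' b' y'' b'' h] that by auto
    have "cokC b'' \<bullet> (h \<bullet> g) \<bullet> b = cokC b'' \<bullet> h \<bullet> (g \<bullet> b)"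
      using g(1) h(1) a(4)[OF B(3)] a(1)[OF B(1)] by (simp add: cat_simps)
    also have "\<dots> = ?t \<bullet> (cokC b' \<bullet> g \<bullet> b)"
      unfolding t(2)[symmetric] using g(1) t(1) a(4)[OF B(2)] a(1)[OF B(1)] by (simp add: cat_simps)
    also have "\<dots> = nul (Dom C b) (Cod C (cokC b''))"
      using g(3) Cmp_nul_right[OF t(1) a(2)[OF B(1)]] by simp
    finally show ?thesis
      using Cmp_arrows[OF g(1) h(1)] g(2) h(2) act_act[OF y'' h(1) g(1)] by simp
  qed
  interpret T: triples ?Ob ?hm "\<lambda>(y, a). Idn C (Cod C a)" "Cmp C"
  proof
    fix k assume k: "k \<in> ?Ob"
    obtain y b where kb: "k = (y, b)" by (cases k)
    have b: "b \<in> Arr C" and y: "y \<in> el G (Cod C b)" using k kb by auto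
    show "(case k of (y, a) \<Rightarrow> Idn C (Cod C a)) \<in> ?hm k k"
      using Idn_arrows[OF a(3)[OF b]] act_Idn[OF a(3)[OF b] y] Cmp_Idn_right[OF a(4)[OF b]]
        a(6)[OF b] kb by simp
  next
    fix g h k l m assume "g \<in> ?hm k l" "h \<in> ?hm l m" "k \<in> ?Ob" "l \<in> ?Ob" "m \<in> ?Ob"
    then show "h \<bullet> g \<in> ?hm k m" by (rule comp)
  next
    fix g k l assume "g \<in> ?hm k l" "k \<in> ?Ob" "l \<in> ?Ob"
    then show "g \<bullet> (case k of (y, a) \<Rightarrow> Idn C (Cod C a)) = g \<and>
        (case l of (y, a) \<Rightarrow> Idn C (Cod C a)) \<bullet> g = g"
      using Cmp_Idn_left Cmp_Idn_right by auto
  next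
    fix g h i k l m n
    assume "g \<in> ?hm k l" "h \<in> ?hm l m" "i \<in> ?hm m n"
    then show "i \<bullet> (h \<bullet> g) = i \<bullet> h \<bullet> g"
      using Cmp_assoc by (auto split: prod.splits)
  qed
  let ?D = "\<lparr>Shape = T.T, DObj = (\<lambda>(y, a). Cod C (cokC a)), DArr = tr\<rparr> :: ('M \<times> 'm, _, 'o, 'm) diagram"
  have D: "is_diagram C ?D"
  proof (rule T.diagram_triple)
    fix k assume k: "k \<in> ?Ob"
    obtain y b where kb: "k = (y, b)" by (cases k)
    have b: "b \<in> Arr C" using k kb by auto
    show "(case k of (y, a) \<Rightarrow> Cod C (cokC a)) \<in> Obj C" using kb a(5)[OF b] by simp
    have i: "Idn C (Cod C b) \<in> ?hm k k" using T.idt[OF k] kb by simp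
    have "tr (k, Idn C (Cod C b), k) = Idn C (Cod C (cokC b))"
      using ind[of y b y b "Idn C (Cod C b)"] tr[of y b y b "Idn C (Cod C b)"] k i kb
        Cmp_Idn_left[OF a(4)[OF b]] Cmp_Idn_right[OF a(4)[OF b]] Idn_arrows[OF a(5)[OF b]] by auto
    then show "tr (k, case k of (y, a) \<Rightarrow> Idn C (Cod C a), k) =
        Idn C (case k of (y, a) \<Rightarrow> Cod C (cokC a))" using kb by simp
  next
    fix k l g assume "k \<in> ?Ob" "l \<in> ?Ob" "g \<in> ?hm k l"
    then show "tr (k, g, l) \<in> arrows C (case k of (y, a) \<Rightarrow> Cod C (cokC a)) (case l of (y, a) \<Rightarrow> Cod C (cokC a))"
      using tr(1) by (auto split: prod.splits)
  next
    fix k l m g h assume *: "k \<in> ?Ob" "l \<in> ?Ob" "m \<in> ?Ob" "g \<in> ?hm k l" "h \<in> ?hm l m"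
    obtain y b y' b' y'' b'' where klm: "k = (y, b)" "l = (y', b')" "m = (y'', b'')"
      by (cases k, cases l, cases m)
    note st = *[unfolded klm]
    have B: "b \<in> Arr C" "b' \<in> Arr C" "b'' \<in> Arr C" using st by auto
    have gh: "g \<in> arrows C (Cod C b) (Cod C b')" "h \<in> arrows C (Cod C b') (Cod C b'')"
      using st by auto
    note tg = tr[OF st(1,2,4)] and th = tr[OF st(2,3,5)]
    have hg: "h \<bullet> g \<in> ?hm (y, b) (y'', b'')" using comp[OF st(4,5,1,2,3)] .
    have "tr (l, h, m) \<bullet> tr (k, g, l) \<in> arrows C (Cod C (cokC b)) (Cod C (cokC b''))"
      using Cmp_arrows[OF tg(1) th(1)] klm by simp
    moreover have "tr (l, h, m) \<bullet> tr (k, g, l) \<bullet> cokC b = cokC b'' \<bullet> (h \<bullet> g)"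
    proof -
      have "tr (l, h, m) \<bullet> tr (k, g, l) \<bullet> cokC b = tr (l, h, m) \<bullet> (cokC b' \<bullet> g)"
        using Cmp_assoc[OF a(4)[OF B(1)] tg(1) th(1)] tg(2) klm by simp
      also have "\<dots> = cokC b'' \<bullet> h \<bullet> g"
        using Cmp_assoc[OF gh(1) a(4)[OF B(2)] th(1)] th(2) klm by simp
      also have "\<dots> = cokC b'' \<bullet> (h \<bullet> g)"
        using Cmp_assoc[OF gh(1,2) a(4)[OF B(3)]] by simp
      finally show ?thesis .
    qed
    ultimately show "tr (k, h \<bullet> g, m) = tr (l, h, m) \<bullet> tr (k, g, l)"
      using ind[OF st(1,3) hg] tr[OF st(1,3) hg] klm by auto
  qed

  \<comment> \<open>Filteredness of the index category\<close>
  have filt: "filtered (Shape ?D)"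
    unfolding diagram.simps
  proof (rule T.filtered_triple)
    obtain c where c: "c \<in> Obj C" using ex_zero by blast
    have "(zer G c, nul c c) \<in> ?Ob"
      using nul_arrows[OF c c] zer_el[OF G c] zer_act[OF G nul_arrows[OF c c]] zero[OF c]
      by (simp add: arrows_iff)
    then show "?Ob \<noteq> {}" by blast
  next
    fix k l assume kl: "k \<in> ?Ob" "l \<in> ?Ob"
    obtain y b y' b' where [simp]: "k = (y, b)" "l = (y', b')" by (cases k, cases l)
    have B: "b \<in> Arr C" "b' \<in> Arr C" and y: "y \<in> el G (Cod C b)" "y' \<in> el G (Cod C b')"
      and yS: "y \<star> b \<in> S (Dom C b)" "y' \<star> b' \<in> S (Dom C b')" using kl by auto
    obtain P i j p q where P: "i \<in> arrows C (Cod C b) P" "j \<in> arrows C (Cod C b') P"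
      "p \<in> arrows C P (Cod C b)" "q \<in> arrows C P (Cod C b')"
      "p \<bullet> i = Idn C (Cod C b)" "q \<bullet> j = Idn C (Cod C b')" "p \<bullet> j = nul (Cod C b') (Cod C b)"
      "q \<bullet> i = nul (Cod C b) (Cod C b')"
      using biprod[OF a(3)[OF B(1)] a(3)[OF B(2)]] by metis
    obtain P' i' j' p' q' where P': "i' \<in> arrows C (Dom C b) P'" "j' \<in> arrows C (Dom C b') P'"
      "p' \<in> arrows C P' (Dom C b)" "q' \<in> arrows C P' (Dom C b')"
      "p' \<bullet> i' = Idn C (Dom C b)" "q' \<bullet> j' = Idn C (Dom C b')" "p' \<bullet> j' = nul (Dom C b') (Dom C b)"
      "q' \<bullet> i' = nul (Dom C b) (Dom C b')"
      using biprod[OF a(2)[OF B(1)] a(2)[OF B(2)]] by metis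
    note b1 = a(1)[OF B(1)] and b2 = a(1)[OF B(2)]
    have O: "P \<in> Obj C" "P' \<in> Obj C" using P(1) P'(1) arrows_ObjD by blast+
    \<comment> \<open>\<open>a3\<close> is the direct sum of \<open>b\<close> and \<open>b'\<close>,
      and \<open>z\<close> is the element of the biproduct with components \<open>y\<close> and
      \<open>y'\<close>. Then \<open>z \<star> a3\<close> is a sum of restrictions of
      \<open>y \<star> b\<close> and \<open>y' \<star> b'\<close> and stays in
      \<open>S\<close>.\<close>
    define a1 where "a1 = i \<bullet> b \<bullet> p'"
    define a2 where "a2 = j \<bullet> b' \<bullet> q'"
    define a3 where "a3 = pl a1 a2"
    have ib: "i \<bullet> b \<in> arrows C (Dom C b) P" "j \<bullet> b' \<in> arrows C (Dom C b') P"
      using Cmp_arrows[OF b1 P(1)] Cmp_arrows[OF b2 P(2)] by auto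
    have a12: "a1 \<in> arrows C P' P" "a2 \<in> arrows C P' P"
      unfolding a1_def a2_def using Cmp_arrows[OF P'(3) ib(1)] Cmp_arrows[OF P'(4) ib(2)] by auto
    have a3: "a3 \<in> arrows C P' P" unfolding a3_def using pl_arrows[OF a12] .
    define z where "z = plA (y \<star> p) (y' \<star> q)"
    have yp: "y \<star> p \<in> el G P" "y' \<star> q \<in> el G P" using act_el[OF y(1) P(3)] act_el[OF y(2) P(4)] by auto
    have z: "z \<in> el G P" unfolding z_def using AP.pl_arrows[OF yp] .
    have zi: "z \<star> i = y"
      using pl_act[OF yp P(1)] act_act[OF y(1) P(3,1)] act_act[OF y(2) P(4,1)] P(5,8)
        act_Idn[OF a(3)[OF B(1)] y(1)] act_nul[OF y(2) a(3)[OF B(1)] a(3)[OF B(2)]] AP.pl_nul[OF y(1)]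
      by (simp add: z_def)
    have zj: "z \<star> j = y'"
      using pl_act[OF yp P(2)] act_act[OF y(1) P(3,2)] act_act[OF y(2) P(4,2)] P(6,7)
        act_Idn[OF a(3)[OF B(2)] y(2)] act_nul[OF y(1) a(3)[OF B(2)] a(3)[OF B(1)]] AP.pl_nul_left[OF y(2)]
      by (simp add: z_def)
    have "z \<star> a1 = y \<star> b \<star> p'"
      unfolding a1_def using act_act[OF z ib(1) P'(3)] act_act[OF z P(1) b1] zi by simp
    moreover have "z \<star> a2 = y' \<star> b' \<star> q'"
      unfolding a2_def using act_act[OF z ib(2) P'(4)] act_act[OF z P(2) b2] zj by simp
    ultimately have "z \<star> a3 \<in> S P'"
      unfolding a3_def act_pl[OF z a12] using plus[OF O(2) res[OF P'(3) yS(1)] res[OF P'(4) yS(2)]] by simp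
    then have m: "(z, a3) \<in> ?Ob" using a3 z by (auto simp: arrows_iff)
    have A3: "Dom C a3 = P'" "Cod C a3 = P" "a3 \<in> Arr C" using a3 by (auto simp: arrows_iff)
    note c3 = a(4)[OF A3(3)]
    have 1: "a3 \<bullet> i' = i \<bullet> b"
    proof -
      have "a3 \<bullet> i' = pl (i \<bullet> b \<bullet> (p' \<bullet> i')) (j \<bullet> b' \<bullet> (q' \<bullet> i'))"
        unfolding a3_def Cmp_pl_left[OF P'(1) a12]
        using Cmp_assoc[OF P'(1,3) ib(1)] Cmp_assoc[OF P'(1,4) ib(2)] by (simp add: a1_def a2_def)
      then show ?thesis
        using P'(5,8) Cmp_Idn_right[OF ib(1)] Cmp_nul_right[OF ib(2) a(2)[OF B(1)]] pl_nul[OF ib(1)] by simp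
    qed
    have 2: "a3 \<bullet> j' = j \<bullet> b'"
    proof -
      have "a3 \<bullet> j' = pl (i \<bullet> b \<bullet> (p' \<bullet> j')) (j \<bullet> b' \<bullet> (q' \<bullet> j'))"
        unfolding a3_def Cmp_pl_left[OF P'(2) a12]
        using Cmp_assoc[OF P'(2,3) ib(1)] Cmp_assoc[OF P'(2,4) ib(2)] by (simp add: a1_def a2_def)
      then show ?thesis
        using P'(6,7) Cmp_Idn_right[OF ib(2)] Cmp_nul_right[OF ib(1) a(2)[OF B(2)]] pl_nul_left[OF ib(2)] by simp
    qed
    \<comment> \<open>An arrow \<open>f\<close> respects relations as soon as
      \<open>f \<bullet> d\<close> factors through \<open>a3\<close>, because \<open>cokC a3\<close>
      kills \<open>a3\<close>.\<close>
    have kill: "cokC a3 \<bullet> f \<bullet> d = nul X (Cod C (cokC a3))"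
      if "f \<in> arrows C Y P" "d \<in> arrows C X Y" "e \<in> arrows C X P'" "a3 \<bullet> e = f \<bullet> d" for f d e X Y
    proof -
      have "cokC a3 \<bullet> f \<bullet> d = cokC a3 \<bullet> (a3 \<bullet> e)"
        using Cmp_assoc[OF that(2,1)] c3 that(4) A3 by simp
      also have "\<dots> = cokC a3 \<bullet> a3 \<bullet> e" using Cmp_assoc[OF that(3) a3] c3 A3 by simp
      also have "\<dots> = nul X (Cod C (cokC a3))"
        using a(6)[OF A3(3)] A3 Cmp_nul_left[OF that(3) a(5)[OF A3(3)]] by simp
      finally show ?thesis .
    qed
    have "i \<in> ?hm k (z, a3)" using P(1) zi kill[OF P(1) b1 P'(1) 1] A3 by simp
    moreover have "j \<in> ?hm l (z, a3)" using P(2) zj kill[OF P(2) b2 P'(2) 2] A3 by simp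
    ultimately show "\<exists>m\<in>?Ob. ?hm k m \<noteq> {} \<and> ?hm l m \<noteq> {}" using m by blast
  next
    fix k l f g assume kl: "k \<in> ?Ob" "l \<in> ?Ob" and fg: "f \<in> ?hm k l" "g \<in> ?hm k l"
    obtain y b y' b' where klb[simp]: "k = (y, b)" "l = (y', b')" by (cases k, cases l)
    have B: "b \<in> Arr C" "b' \<in> Arr C" and y': "y' \<in> el G (Cod C b')" "y' \<star> b' \<in> S (Dom C b')"
      and f: "f \<in> arrows C (Cod C b) (Cod C b')" and g: "g \<in> arrows C (Cod C b) (Cod C b')"
      and eq: "y' \<star> f = y' \<star> g" using kl fg by auto
    let ?d = "mi f g"
    have d: "?d \<in> arrows C (Cod C b) (Cod C b')" using mi_arrows[OF f g] .
    have dD: "?d \<in> Arr C" "Dom C ?d = Cod C b" "Cod C ?d = Cod C b'" using d by (auto simp: arrows_iff)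
    \<comment> \<open>Since \<open>y'\<close> does not distinguish \<open>f\<close> and
      \<open>g\<close>, it descends along the cokernel \<open>r\<close> of their difference; the
      relations \<open>b'\<close> are pushed forward along \<open>r\<close>.\<close>
    define r where "r = cokC ?d"
    have r: "r \<in> arrows C (Cod C b') (Cod C r)" "r \<bullet> ?d = nul (Cod C b) (Cod C r)"
      unfolding r_def using cokC_arrows[OF d] by auto
    have "y' \<star> ?d = zer G (Cod C b)"
      using act_mi[OF y'(1) f g] AP.mi_eq_nul[OF act_el[OF y'(1) f] act_el[OF y'(1) g]] eq by simp
    then obtain w where w: "w \<in> el G (Cod C r)" "y' = w \<star> r"
      using el_coker[OF cokC(1)[OF dD(1)], unfolded dD, OF y'(1)] r_def by blast
    let ?m = "(w, r \<bullet> b')"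
    have rb: "r \<bullet> b' \<in> arrows C (Dom C b') (Cod C r)" using Cmp_arrows[OF a(1)[OF B(2)] r(1)] .
    have rbD: "r \<bullet> b' \<in> Arr C" "Dom C (r \<bullet> b') = Dom C b'" "Cod C (r \<bullet> b') = Cod C r"
      using rb by (auto simp: arrows_iff)
    have m: "?m \<in> ?Ob"
      using rbD w act_act[OF w(1) r(1) a(1)[OF B(2)]] y'(2) by simp
    have "cokC (r \<bullet> b') \<bullet> r \<bullet> b' = nul (Dom C b') (Cod C (cokC (r \<bullet> b')))"
      using Cmp_assoc[OF a(1)[OF B(2)] r(1)] cokC_arrows[OF rb] by simp
    then have "r \<in> ?hm l ?m" using r(1) w(2) rbD by simp
    moreover have "r \<bullet> f = r \<bullet> g"
      using Cmp_mi_right[OF f g r(1)] mi_eq_nul[OF Cmp_arrows[OF f r(1)] Cmp_arrows[OF g r(1)]] r(2) by simp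
    ultimately show "\<exists>m\<in>?Ob. \<exists>h\<in>?hm l m. h \<bullet> f = h \<bullet> g" using m by blast
  qed
  have small_T: "small_cat TYPE('v) (Shape ?D)"
    unfolding diagram.simps
  proof (rule T.small_triple)
    show "universe TYPE('v)" by unfold_locales
    have "small TYPE('v) (\<Union>a \<in> Arr C. el G (Cod C a) \<times> {a})"
      using small_el[OF G a(3)] by (intro small_UN[OF small_Arr] small_Times) (auto simp: small_finite)
    then show "small TYPE('v) ?Ob" by (rule small_subset[rotated]) auto
    show "small TYPE('v) (?hm k l)" for k l
      using small_subset[OF _ small_arrows[of "Cod C (snd k)" "Cod C (snd l)"]] by (auto split: prod.splits)
  qed

  \<comment> \<open>The realized quotient and its projection\<close>
  obtain Q \<iota> where P: "presents TYPE('v) C A HO H ?D Q \<iota>" using realized[OF D filt small_T] by blast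
  have Q: "Q \<in> Obj A" using presents_Obj[OF P] .
  have \<iota>: "\<iota> (y, b) \<in> el Q (Cod C (cokC b))" if "(y, b) \<in> ?Ob" for y b
    using presents_arrows[OF P, of "(y, b)"] that by simp
  have L: "\<iota> (y, b) \<star> cokC b = \<iota> (y', b') \<star> cokC b' \<star> g"
    if k: "(y, b) \<in> ?Ob" and l: "(y', b') \<in> ?Ob" and g: "g \<in> ?hm (y, b) (y', b')" for y b y' b' g
  proof -
    have "((y, b), g, (y', b')) \<in> arrows (Shape ?D) (y, b) (y', b')"
      unfolding diagram.simps T.triple_arrows_iff using k l g by blast
    from presents_cocone[OF P this] have "\<iota> (y', b') \<star> tr ((y, b), g, (y', b')) = \<iota> (y, b)" by simp
    then show ?thesis
      using act_act[OF \<iota>[OF l] tr(1)[OF k l g] a(4)[of b]] act_act[OF \<iota>[OF l] a(4)[of b'], of g]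
        tr(2)[OF k l g] k l g by auto
  qed
  \<comment> \<open>The zero endomorphism stands for no relations at all. Every element
    \<open>y\<close> thus has an index, and by \<open>nul_hm\<close> this index maps to all other
    indices over \<open>y\<close>, so that all of them give the same value of the projection at
    \<open>y\<close>.\<close>
  have nul_Ob: "(y, nul c c) \<in> ?Ob" if "c \<in> Obj C" "y \<in> el G c" for c y
    using nul_arrows[OF that(1,1)] that act_nul[OF that(2,1,1)] zero[OF that(1)] by (simp add: arrows_iff)
  have nul_hm: "g \<in> ?hm (y \<star> g, nul d d) (y, b)"
    if "(y, b) \<in> ?Ob" "g \<in> arrows C d (Cod C b)" for y b g d
  proof -
    have b: "b \<in> Arr C" using that by auto
    have d: "d \<in> Obj C" using that arrows_ObjD by blast
    show ?thesis
      using that nul_arrows[OF d d] Cmp_nul_right[OF Cmp_arrows[OF that(2) a(4)[OF b]] d]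
      by (simp add: arrows_iff)
  qed
  have "\<exists>\<pi> \<in> arrows A G Q. \<forall>c \<in> Obj C. \<forall>y \<in> el G c.
      \<forall>b. (y, b) \<in> ?Ob \<longrightarrow> Cod C b = c \<longrightarrow> \<pi> \<cdot> y = \<iota> (y, b) \<star> cokC b"
  proof (rule arrow_of_rel[OF G Q])
    fix c y assume c: "c \<in> Obj C" and y: "y \<in> el G c"
    let ?n = "nul c c"
    have n: "?n \<in> Arr C" "Cod C ?n = c" "Dom C ?n = c" using nul_arrows[OF c c] by (auto simp: arrows_iff)
    let ?z = "\<iota> (y, ?n) \<star> cokC ?n"
    have z: "?z \<in> el Q c" using act_el[OF \<iota>[OF nul_Ob[OF c y]] a(4)[OF n(1)]] n by simp
    have "?z = \<iota> (y, b) \<star> cokC b" if b: "(y, b) \<in> ?Ob" "Cod C b = c" for b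
    proof -
      have bA: "b \<in> Arr C" using b by auto
      have i: "Idn C c \<in> arrows C c (Cod C b)" using Idn_arrows[OF c] b by simp
      have "Idn C c \<in> ?hm (y, ?n) (y, b)" using nul_hm[OF b(1) i] act_Idn[OF c y] by simp
      from L[OF nul_Ob[OF c y] b(1) this]
      show ?thesis using act_Idn[OF c act_el[OF \<iota>[OF b(1)] a(4)[OF bA, unfolded b(2)]]] by simp
    qed
    then show "\<exists>!z. z \<in> el Q c \<and> (\<forall>b. (y, b) \<in> ?Ob \<longrightarrow> Cod C b = c \<longrightarrow> z = \<iota> (y, b) \<star> cokC b)"
      using z nul_Ob[OF c y] n by (intro ex1I[of _ ?z]) blast+
  next
    fix c d y z g assume g: "g \<in> arrows C d c" and y: "y \<in> el G c" and z: "z \<in> el Q c"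
      and R: "\<forall>b. (y, b) \<in> ?Ob \<longrightarrow> Cod C b = c \<longrightarrow> z = \<iota> (y, b) \<star> cokC b"
    have O: "c \<in> Obj C" "d \<in> Obj C" using arrows_ObjD[OF g] by auto
    show "\<forall>b. (y \<star> g, b) \<in> ?Ob \<longrightarrow> Cod C b = d \<longrightarrow> z \<star> g = \<iota> (y \<star> g, b) \<star> cokC b"
    proof (intro allI impI)
      fix b assume b: "(y \<star> g, b) \<in> ?Ob" "Cod C b = d"
      have bA: "b \<in> Arr C" using b by auto
      let ?n = "nul c c" and ?n' = "nul d d"
      have n: "?n \<in> Arr C" "Cod C ?n = c" using nul_arrows[OF O(1,1)] by (auto simp: arrows_iff)
      have yO: "(y, ?n) \<in> ?Ob" using nul_Ob[OF O(1) y] .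
      have ygO: "(y \<star> g, ?n') \<in> ?Ob" using nul_Ob[OF O(2) act_el[OF y g]] .
      have g': "g \<in> ?hm (y \<star> g, ?n') (y, ?n)" using nul_hm[OF yO] g n by simp
      have i: "Idn C d \<in> arrows C d (Cod C b)" using Idn_arrows[OF O(2)] b by simp
      have "Idn C d \<in> ?hm (y \<star> g, ?n') (y \<star> g, b)"
        using nul_hm[OF b(1) i] act_Idn[OF O(2) act_el[OF y g]] by simp
      from L[OF ygO b(1) this] have "\<iota> (y \<star> g, ?n') \<star> cokC ?n' = \<iota> (y \<star> g, b) \<star> cokC b"
        using act_Idn[OF O(2) act_el[OF \<iota>[OF b(1)] a(4)[OF bA, unfolded b(2)]]] by simp
      moreover have "z \<star> g = \<iota> (y \<star> g, ?n') \<star> cokC ?n'"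
      proof -
        have "z = \<iota> (y, ?n) \<star> cokC ?n" using R yO n(2) by blast
        then show ?thesis using L[OF ygO yO g'] by simp
      qed
      ultimately show "z \<star> g = \<iota> (y \<star> g, b) \<star> cokC b" by simp
    qed
  qed
  then obtain \<pi> where \<pi>: "\<pi> \<in> arrows A G Q"
    and \<pi>_eq0: "\<forall>c \<in> Obj C. \<forall>y \<in> el G c. \<forall>b. (y, b) \<in> ?Ob \<longrightarrow> Cod C b = c \<longrightarrow> \<pi> \<cdot> y = \<iota> (y, b) \<star> cokC b"
    by blast
  have \<pi>_eq: "\<pi> \<cdot> y = \<iota> (y, b) \<star> cokC b" if "(y, b) \<in> ?Ob" for y b
  proof -
    have "b \<in> Arr C" "y \<in> el G (Cod C b)" using that by auto
    then show ?thesis using \<pi>_eq0 that a(3) by blast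
  qed

  \<comment> \<open>Universal property, kernel and local lifting\<close>
  show thesis
  proof (rule that[OF Q \<pi>])
    fix c s assume c: "c \<in> Obj C" and s: "s \<in> S c"
    have i: "Idn C c \<in> Arr C" "Dom C (Idn C c) = c" "Cod C (Idn C c) = c" using Idn_Arr[OF c] by auto
    have sG: "s \<in> el G c" using S[OF c] s by blast
    \<comment> \<open>For \<open>s\<close> in \<open>S\<close> the whole stage may be taken as
      relations: the index with the identity has a zero cokernel arrow, through which
      \<open>\<pi> \<cdot> s\<close> factors.\<close>
    have O: "(s, Idn C c) \<in> ?Ob" using i s sG act_Idn[OF c sG] by simp
    have "cokC (Idn C c) = nul c (Cod C (cokC (Idn C c)))"
      using cokC_arrows[OF Idn_arrows[OF c]] Cmp_Idn_right by metis
    then show "\<pi> \<cdot> s = zer Q c"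
      using \<pi>_eq[OF O] act_nul[OF \<iota>[OF O] c a(5)[OF i(1)]] by simp
  next
    fix W \<psi> assume \<psi>: "\<psi> \<in> arrows A G W" and kill: "\<And>c s. c \<in> Obj C ==> s \<in> S c ==> \<psi> \<cdot> s = zer W c"
    have W: "W \<in> Obj A" using \<psi> A.arrows_ObjD by blast
    \<comment> \<open>At an index \<open>(y, b)\<close> the arrow \<open>\<psi>\<close> kills
      \<open>y \<star> b\<close>, so by left exactness \<open>\<psi> \<cdot> y\<close> descends
      along \<open>cokC b\<close>. These descended elements form the cocone that induces the
      factorization.\<close>
    have "\<forall>k \<in> ?Ob. \<exists>w. w \<in> el W (Cod C (cokC (snd k))) \<and> \<psi> \<cdot> fst k = w \<star> cokC (snd k)"
    proof
      fix k assume k: "k \<in> ?Ob"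
      obtain y b where kb: "k = (y, b)" by (cases k)
      have b: "b \<in> Arr C" and y: "y \<in> el G (Cod C b)" "y \<star> b \<in> S (Dom C b)" using k kb by auto
      have "\<psi> \<cdot> y \<star> b = zer W (Dom C b)"
        using cmp_act[OF \<psi> y(1) a(1)[OF b]] kill[OF a(2)[OF b] y(2)] by simp
      then show "\<exists>w. w \<in> el W (Cod C (cokC (snd k))) \<and> \<psi> \<cdot> fst k = w \<star> cokC (snd k)"
        using el_coker[OF cokC(1)[OF b] A.Cmp_arrows[OF y(1) \<psi>]] kb by auto
    qed
    from bchoice[OF this] obtain w where
      w0: "\<forall>k \<in> ?Ob. w k \<in> el W (Cod C (cokC (snd k))) \<and> \<psi> \<cdot> fst k = w k \<star> cokC (snd k)" ..
    have w: "w k \<in> el W (Cod C (cokC (snd k)))" "\<psi> \<cdot> fst k = w k \<star> cokC (snd k)" if "k \<in> ?Ob" for k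
      using bspec[OF w0 that] by (rule conjunct1) (rule conjunct2[OF bspec[OF w0 that]])
    have univ: "\<exists>!\<phi>. \<phi> \<in> arrows A Q W \<and> (\<forall>k \<in> Obj (Shape ?D). \<phi> \<cdot> \<iota> k = w k)"
    proof (rule presents_univ[OF P W])
      show "w k \<in> el W (DObj ?D k)" if "k \<in> Obj (Shape ?D)" for k
        using w(1)[of k] that by (auto split: prod.splits)
      fix t assume "t \<in> Arr (Shape ?D)"
      then have "t \<in> arrows T.T (Dom T.T t) (Cod T.T t)" by (intro Arr_arrows) simp
      then have *: "Dom T.T t \<in> ?Ob \<and> Cod T.T t \<in> ?Ob \<and>
          (\<exists>g \<in> ?hm (Dom T.T t) (Cod T.T t). t = (Dom T.T t, g, Cod T.T t))"
        unfolding T.triple_arrows_iff .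
      define k where "k = Dom T.T t"
      define l where "l = Cod T.T t"
      obtain g where g: "g \<in> ?hm k l" "t = (k, g, l)" using * unfolding k_def l_def by (elim conjE bexE)
      have t: "t = (k, g, l)" "k \<in> ?Ob" "l \<in> ?Ob" "g \<in> ?hm k l" "Dom T.T t = k" "Cod T.T t = l"
        using * g unfolding k_def l_def by (elim conjE, assumption | simp)+
      obtain y b y' b' where kl: "k = (y, b)" "l = (y', b')" by (cases k, cases l)
      note t' = t[unfolded kl]
      have B: "b \<in> Arr C" "b' \<in> Arr C" and y': "y' \<in> el G (Cod C b')" and yg: "y = y' \<star> g"
        and g: "g \<in> arrows C (Cod C b) (Cod C b')" using t' by auto
      note trt = tr[OF t'(2-4)]
      have wl: "w l \<in> el W (Cod C (cokC b'))" using w(1)[OF t(3)] kl by simp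
      have wk: "w k \<in> el W (Cod C (cokC b))" using w(1)[OF t(2)] kl by simp
      have "w l \<star> tr (k, g, l) \<star> cokC b = w l \<star> cokC b' \<star> g"
        using act_act[OF wl trt(1) a(4)[OF B(1)]] act_act[OF wl a(4)[OF B(2)] g] trt(2) kl by simp
      also have "\<dots> = w k \<star> cokC b"
        using w(2)[OF t(3)] w(2)[OF t(2)] kl cmp_act[OF \<psi> y' g] yg by simp
      finally have "w l \<star> tr (k, g, l) = w k"
        using el_coker_epi[OF cokC(1)[OF B(1)]] act_el[OF wl trt(1)] wk kl by simp
      then show "w (Cod (Shape ?D) t) \<star> DArr ?D t = w (Dom (Shape ?D) t)"
        using t by simp
    qed
    \<comment> \<open>Translates the universal property from the cocone \<open>\<iota>\<close> to
      the single arrow \<open>\<pi>\<close>: in one direction \<open>cokC b\<close> is cancelled, in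
      the other the indices with zero relations recover \<open>\<psi>\<close>.\<close>
    have iff: "\<phi> \<cdot> \<pi> = \<psi> \<longleftrightarrow> (\<forall>k \<in> Obj (Shape ?D). \<phi> \<cdot> \<iota> k = w k)" if \<phi>: "\<phi> \<in> arrows A Q W" for \<phi>
    proof
      assume eq: "\<phi> \<cdot> \<pi> = \<psi>"
      show "\<forall>k \<in> Obj (Shape ?D). \<phi> \<cdot> \<iota> k = w k"
      proof
        fix k assume "k \<in> Obj (Shape ?D)"
        then have k: "k \<in> ?Ob" by simp
        obtain y b where kb: "k = (y, b)" by (cases k)
        have b: "b \<in> Arr C" and y: "y \<in> el G (Cod C b)" using k kb by auto
        have ik: "\<iota> k \<in> el Q (Cod C (cokC b))" using \<iota> k kb by simp
        have "\<phi> \<cdot> \<iota> k \<star> cokC b = \<phi> \<cdot> (\<pi> \<cdot> y)" using cmp_act[OF \<phi> ik a(4)[OF b]] \<pi>_eq k kb by simp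
        also have "\<dots> = w k \<star> cokC b" using A.Cmp_assoc[OF y \<pi> \<phi>] eq w(2)[OF k] kb by simp
        finally show "\<phi> \<cdot> \<iota> k = w k"
          using el_coker_epi[OF cokC(1)[OF b] A.Cmp_arrows[OF ik \<phi>]] w(1)[OF k] kb by simp
      qed
    next
      assume eq: "\<forall>k \<in> Obj (Shape ?D). \<phi> \<cdot> \<iota> k = w k"
      show "\<phi> \<cdot> \<pi> = \<psi>"
      proof (rule arrow_eqI[OF A.Cmp_arrows[OF \<pi> \<phi>] \<psi>])
        fix c y assume c: "c \<in> Obj C" and y: "y \<in> el G c"
        let ?k = "(y, nul c c)"
        have k: "?k \<in> ?Ob" using nul_Ob[OF c y] .
        have n: "nul c c \<in> Arr C" using nul_arrows[OF c c] by (simp add: arrows_iff)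
        have "\<phi> \<cdot> \<pi> \<cdot> y = \<phi> \<cdot> \<iota> ?k \<star> cokC (nul c c)"
          using A.Cmp_assoc[OF y \<pi> \<phi>] \<pi>_eq[OF k] cmp_act[OF \<phi> \<iota>[OF k] a(4)[OF n]] by simp
        also have "\<dots> = \<psi> \<cdot> y" using eq k w(2)[OF k] by simp
        finally show "\<phi> \<cdot> \<pi> \<cdot> y = \<psi> \<cdot> y" .
      qed
    qed
    show "\<exists>!u. u \<in> arrows A Q W \<and> u \<cdot> \<pi> = \<psi>"
      using univ by (simp only: iff cong: conj_cong)
  next
    fix c y assume c: "c \<in> Obj C" and y: "y \<in> el G c" and 0: "\<pi> \<cdot> y = zer Q c"
    let ?n = "nul c c"
    let ?k = "(y, ?n)"
    have k: "?k \<in> ?Ob" using nul_Ob[OF c y] .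
    have n: "?n \<in> Arr C" "Cod C ?n = c" using nul_arrows[OF c c] by (auto simp: arrows_iff)
    note q = a(4)[OF n(1), unfolded n(2)]
    \<comment> \<open>Both sides live at the index \<open>(y, nul c c)\<close>, so their equality in
      \<open>Q\<close> is witnessed at a later index \<open>m\<close>; there the transition arrows
      turn it into the vanishing of \<open>cokC b \<bullet> g1\<close>.\<close>
    have E: "\<iota> ?k \<star> cokC ?n = \<iota> ?k \<star> nul c (Cod C (cokC ?n))"
      using \<pi>_eq[OF k] 0 act_nul[OF \<iota>[OF k] c a(5)[OF n(1)]] by simp
    have K: "?k \<in> Obj (Shape ?D)" using k by simp
    have K1: "cokC ?n \<in> arrows C c (DObj ?D ?k)" "nul c (Cod C (cokC ?n)) \<in> arrows C c (DObj ?D ?k)"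
      using q nul_arrows[OF c a(5)[OF n(1)]] by auto
    obtain m t1 t2 where t: "t1 \<in> arrows (Shape ?D) ?k m" "t2 \<in> arrows (Shape ?D) ?k m"
      "DArr ?D t1 \<bullet> cokC ?n = DArr ?D t2 \<bullet> nul c (Cod C (cokC ?n))"
      by (rule presents_eq[OF P K K K1 E])
    obtain y' b where m: "m = (y', b)" by (cases m)
    obtain g1 g2 where g: "t1 = (?k, g1, m)" "g1 \<in> ?hm ?k m" "t2 = (?k, g2, m)" "g2 \<in> ?hm ?k m" "m \<in> ?Ob"
      using t(1,2) unfolding diagram.simps T.triple_arrows_iff by blast
    have b: "b \<in> Arr C" "y' \<in> el G (Cod C b)" "y' \<star> b \<in> S (Dom C b)" using g(5) m by auto
    have g1: "g1 \<in> arrows C c (Cod C b)" "y = y' \<star> g1" using g(2) m n by auto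
    have "cokC b \<bullet> g1 = nul c (Cod C (cokC b))"
      using t(3) g tr(1)[of y ?n y' b g2] tr(2)[of y ?n y' b g1] k m Cmp_nul_right[OF _ c]
      by simp
    then show "\<exists>a y' g. a \<in> Arr C \<and> y' \<in> el G (Cod C a) \<and> g \<in> arrows C c (Cod C a) \<and> y' \<star> a \<in> S (Dom C a) \<and>
         cokC a \<bullet> g = nul c (Cod C (cokC a)) \<and> y = y' \<star> g"
      using b g1 by blast
  next
    fix c q assume c: "c \<in> Obj C" and q: "q \<in> el Q c"
    obtain k f where kf: "k \<in> Obj (Shape ?D)" "f \<in> arrows C c (DObj ?D k)" "q = \<iota> k \<star> f"
      using presents_factor[OF P c q] .
    obtain y b where kb: "k = (y, b)" by (cases k)
    have k: "(y, b) \<in> ?Ob" and f: "f \<in> arrows C c (Cod C (cokC b))" using kf kb by auto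
    have b: "b \<in> Arr C" and y: "y \<in> el G (Cod C b)" using k by auto
    \<comment> \<open>An element at the index \<open>(y, b)\<close> is an arrow \<open>f\<close>
      into the cokernel of \<open>b\<close>; pulling back \<open>cokC b\<close>, which is in
      \<open>SE\<close>, along \<open>f\<close> lifts it to \<open>G\<close>.\<close>
    obtain B' e' g' where e: "SE e'" "e' \<in> arrows C B' c" "g' \<in> arrows C B' (Cod C b)"
      "cokC b \<bullet> g' = f \<bullet> e'"
      using SE_pullback[OF cokC(2)[OF b] a(4)[OF b] f] by blast
    have "\<pi> \<cdot> (y \<star> g') = q \<star> e'"
      using cmp_act[OF \<pi> y e(3)] \<pi>_eq[OF k] act_act[OF \<iota>[OF k] a(4)[OF b] e(3)]
        act_act[OF \<iota>[OF k] f e(2)] e(4) kf(3) kb by simp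
    then show "\<exists>e b x. SE e \<and> e \<in> arrows C b c \<and> x \<in> el G b \<and> \<pi> \<cdot> x = q \<star> e"
      using e(1,2) act_el[OF y e(3)] by blast
  qed
qed

section \<open>The completion is quasi-abelian\<close>

text \<open>The quotient by the elements of the form \<open>f \<cdot> x\<close>. They are closed
  under sums and restriction but in general lack descent, which accounts for \<open>a\<close> and
  \<open>g\<close> in the description of what is killed.\<close>

lemma cokernel_elements:
  assumes f: "f \<in> arrows A X Y"
  obtains Q \<pi> where "Q \<in> Obj A" "\<pi> \<in> arrows A Y Q" "AP.coker f \<pi>"
    "\<And>c y. c \<in> Obj C ==> y \<in> el Y c ==> \<pi> \<cdot> y = zer Q c ==>
       \<exists>a y' g x. a \<in> Arr C \<and> y' \<in> el Y (Cod C a) \<and> g \<in> arrows C c (Cod C a) \<and>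
         x \<in> el X (Dom C a) \<and> f \<cdot> x = y' \<star> a \<and>
         cokC a \<bullet> g = nul c (Cod C (cokC a)) \<and> y = y' \<star> g"
    "\<And>c q. c \<in> Obj C ==> q \<in> el Q c ==>
       \<exists>e b x. SE e \<and> e \<in> arrows C b c \<and> x \<in> el Y b \<and> \<pi> \<cdot> x = q \<star> e"
proof -
  have O: "X \<in> Obj A" "Y \<in> Obj A" using A.arrows_ObjD f by blast+
  let ?S = "\<lambda>c. {y. \<exists>x \<in> el X c. y = f \<cdot> x}"
  obtain Q \<pi> where Q: "Q \<in> Obj A" "\<pi> \<in> arrows A Y Q"
    and kill: "\<And>c s. c \<in> Obj C ==> s \<in> ?S c ==> \<pi> \<cdot> s = zer Q c"
    and univ: "\<And>W \<psi>. \<psi> \<in> arrows A Y W ==> (\<And>c s. c \<in> Obj C ==> s \<in> ?S c ==> \<psi> \<cdot> s = zer W c) ==>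
       \<exists>!u. u \<in> arrows A Q W \<and> u \<cdot> \<pi> = \<psi>"
    and ker: "\<And>c y. c \<in> Obj C ==> y \<in> el Y c ==> \<pi> \<cdot> y = zer Q c ==>
       \<exists>a y' g. a \<in> Arr C \<and> y' \<in> el Y (Cod C a) \<and> g \<in> arrows C c (Cod C a) \<and> y' \<star> a \<in> ?S (Dom C a) \<and>
         cokC a \<bullet> g = nul c (Cod C (cokC a)) \<and> y = y' \<star> g"
    and LL: "\<And>c q. c \<in> Obj C ==> q \<in> el Q c ==>
       \<exists>e b x. SE e \<and> e \<in> arrows C b c \<and> x \<in> el Y b \<and> \<pi> \<cdot> x = q \<star> e"
  proof (rule quotient[OF O(2), of ?S])
    show "?S c \<subseteq> el Y c" for c using A.Cmp_arrows f by blast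
    show "zer Y c \<in> ?S c" if "c \<in> Obj C" for c
      using cmp_zer[OF f that] zer_el[OF O(1) that] by force
    show "plA x y \<in> ?S c" if xy: "x \<in> ?S c" "y \<in> ?S c" for c x y
    proof -
      obtain x' y' where "x' \<in> el X c" "y' \<in> el X c" "x = f \<cdot> x'" "y = f \<cdot> y'" using xy by blast
      then show ?thesis using AP.Cmp_pl_right[OF _ _ f] AP.pl_arrows by force
    qed
    show "x \<star> g \<in> ?S d" if g: "g \<in> arrows C d c" and x: "x \<in> ?S c" for c d x g
    proof -
      obtain x' where "x' \<in> el X c" "x = f \<cdot> x'" using x by blast
      then show ?thesis using cmp_act[OF f _ g] act_el[OF _ g] by force
    qed
  qed blast
  have kill': "\<pi> \<cdot> (f \<cdot> x) = zer Q c" if "c \<in> Obj C" "x \<in> el X c" for c x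
    using kill that by blast
  have \<pi>f: "\<pi> \<cdot> f = nulA X Q"
  proof (rule arrow_eqI[OF A.Cmp_arrows[OF f Q(2)] AP.nul_arrows[OF O(1) Q(1)]])
    fix c x assume c: "c \<in> Obj C" and x: "x \<in> el X c"
    show "\<pi> \<cdot> f \<cdot> x = nulA X Q \<cdot> x"
      using kill'[OF c x] A.Cmp_assoc[OF x f Q(2)] AP.Cmp_nul_left[OF x Q(1)] by simp
  qed
  have "\<exists>!u. u \<in> arrows A Q W \<and> u \<cdot> \<pi> = h" if h: "h \<in> arrows A Y W" and 0: "h \<cdot> f = nulA X W" for h W
  proof (rule univ[OF h])
    fix c s assume c: "c \<in> Obj C" and "s \<in> ?S c"
    then obtain x where x: "x \<in> el X c" "s = f \<cdot> x" by blast
    have W: "W \<in> Obj A" using h A.arrows_ObjD by blast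
    show "h \<cdot> s = zer W c" using A.Cmp_assoc[OF x(1) f h] 0 AP.Cmp_nul_left[OF x(1) W] x(2) by simp
  qed
  moreover have D: "f \<in> Arr A" "Dom A f = X" "Cod A f = Y" "\<pi> \<in> Arr A" "Dom A \<pi> = Y" "Cod A \<pi> = Q"
    using f Q(2) by (auto simp: arrows_iff)
  ultimately have co: "AP.coker f \<pi>" unfolding AP.coker_def D using \<pi>f by blast
  show thesis
  proof (rule that[OF Q co])
    fix c y assume c: "c \<in> Obj C" and y: "y \<in> el Y c" and 0: "\<pi> \<cdot> y = zer Q c"
    obtain a y' g where *: "a \<in> Arr C" "y' \<in> el Y (Cod C a)" "g \<in> arrows C c (Cod C a)"
      "y' \<star> a \<in> ?S (Dom C a)" "cokC a \<bullet> g = nul c (Cod C (cokC a))" "y = y' \<star> g"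
      using ker[OF c y 0] by blast
    obtain x where "x \<in> el X (Dom C a)" "f \<cdot> x = y' \<star> a" using *(4) by force
    then show "\<exists>a y' g x. a \<in> Arr C \<and> y' \<in> el Y (Cod C a) \<and> g \<in> arrows C c (Cod C a) \<and>
         x \<in> el X (Dom C a) \<and> f \<cdot> x = y' \<star> a \<and>
         cokC a \<bullet> g = nul c (Cod C (cokC a)) \<and> y = y' \<star> g" using * by blast
  qed (rule LL)
qed

lemma pre_abelian: "pre_abelian A"
  unfolding pre_abelian_def additive_def
proof (intro conjI ballI)
  show "category A" by unfold_locales
  show "\<exists>pl nul. preadditive_structure A pl nul" using AP.preadditive_structure by blast
  show "\<exists>Z. zero_obj A Z" by (rule ex_zero_obj)
  show "\<exists>P p q. is_product A X Y P p q" if "X \<in> Obj A" "Y \<in> Obj A" for X Y using ex_product[OF that] .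
  fix f assume "f \<in> Arr A"
  then have f: "f \<in> arrows A (Dom A f) (Cod A f)" by (rule Arr_arrows)
  show "\<exists>k. is_kernel A f k" using ex_ker[OF f] by (auto simp: AP.is_kernel_iff)
  show "\<exists>c. is_cokernel A f c" by (rule cokernel_elements[OF f]) (auto simp: AP.is_cokernel_iff)
qed

lemma SE_epi:
  assumes "SE e" "e \<in> arrows C b c" "x \<in> el X c" "y \<in> el X c" "x \<star> e = y \<star> e"
  shows "x = y"
  using SE_coker[OF assms(1)] el_coker_epi[of _ e x X y] assms by (auto simp: arrows_iff)

text \<open>The difference of \<open>x\<close> and \<open>y\<close> comes from the kernel, which
  \<open>h\<close> kills.\<close>

lemma ker_elementD:
  assumes k: "AP.ker f k" and f: "f \<in> arrows A X Y" and h: "h \<in> arrows A X W"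
    and hk: "h \<cdot> k = nulA (Dom A k) W" and c: "c \<in> Obj C"
    and x: "x \<in> el X c" and y: "y \<in> el X c" and eq: "f \<cdot> x = f \<cdot> y"
  shows "h \<cdot> x = h \<cdot> y"
proof -
  have W: "W \<in> Obj A" using h A.arrows_ObjD by blast
  have ka: "k \<in> arrows A (Dom A k) X" using k f by (auto simp: AP.ker_def arrows_iff)
  let ?d = "AP.mi x y"
  have d: "?d \<in> el X c" using AP.mi_arrows[OF x y] .
  have "f \<cdot> ?d = zer Y c"
    using AP.Cmp_mi_right[OF x y f] AP.mi_eq_nul[OF A.Cmp_arrows[OF x f] A.Cmp_arrows[OF y f]] eq by simp
  then obtain z where z: "z \<in> el (Dom A k) c" "k \<cdot> z = ?d"
    using k ker_iff[OF f ka] c d by blast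
  have "h \<cdot> ?d = zer W c" using A.Cmp_assoc[OF z(1) ka h] z hk AP.Cmp_nul_left[OF z(1) W] by simp
  then show ?thesis
    using AP.Cmp_mi_right[OF x y h] AP.mi_eq_nul[OF A.Cmp_arrows[OF x h] A.Cmp_arrows[OF y h]] by simp
qed

text \<open>To evaluate the factorization of \<open>h\<close> at \<open>y\<close>, lift
  \<open>y \<star> e\<close> to \<open>x\<close>, apply \<open>h\<close>, and descend along
  \<open>e\<close>. The arrows in \<open>SE\<close> act as covers: being cokernels they give
  descent, and their weak pullbacks give refinements.\<close>

lemma locally_liftable_imp_coker:
  assumes f: "f \<in> arrows A X Y" and k: "AP.ker f k"
    and LL: "\<And>c y. c \<in> Obj C ==> y \<in> el Y c ==> \<exists>e b x. SE e \<and> e \<in> arrows C b c \<and> x \<in> el X b \<and> f \<cdot> x = y \<star> e"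
  shows "AP.coker k f"
proof -
  have O: "X \<in> Obj A" "Y \<in> Obj A" using A.arrows_ObjD f by blast+
  have ka: "k \<in> arrows A (Dom A k) X" "f \<cdot> k = nulA (Dom A k) Y"
    using k f by (auto simp: AP.ker_def arrows_iff)
  have "\<exists>!u. u \<in> arrows A Y W \<and> u \<cdot> f = h" if h: "h \<in> arrows A X W" and hk: "h \<cdot> k = nulA (Dom A k) W" for h W
  proof -
    have W: "W \<in> Obj A" using h A.arrows_ObjD by blast
    note kill = ker_elementD[OF k f h hk]
    let ?R = "\<lambda>c y z. \<exists>e b x. SE e \<and> e \<in> arrows C b c \<and> x \<in> el X b \<and> f \<cdot> x = y \<star> e \<and> h \<cdot> x = z \<star> e"
    have "\<exists>u \<in> arrows A Y W. \<forall>c \<in> Obj C. \<forall>y \<in> el Y c. ?R c y (u \<cdot> y)"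
    proof (rule arrow_of_rel[OF O(2) W])
      fix c y assume c: "c \<in> Obj C" and y: "y \<in> el Y c"
      obtain e b x where e: "SE e" "e \<in> arrows C b c" and x: "x \<in> el X b" "f \<cdot> x = y \<star> e"
        using LL[OF c y] by blast
      have b: "b \<in> Obj C" using e arrows_ObjD by blast
      \<comment> \<open>Descent: \<open>e\<close> is the cokernel of \<open>a\<close>, the element
        \<open>x \<star> a\<close> is killed by \<open>f\<close>, and \<open>h\<close> kills
        whatever \<open>f\<close> kills, so \<open>h \<cdot> x\<close> descends along
        \<open>e\<close>.\<close>
      obtain a where a: "coker a e" using SE_coker[OF e(1)] by blast
      have aa: "a \<in> arrows C (Dom C a) b" "Cod C a = b" "Cod C e = c" "e \<bullet> a = nul (Dom C a) c"
        using a e(2) by (auto simp: coker_def arrows_iff)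
      have d: "Dom C a \<in> Obj C" using aa(1) arrows_ObjD by blast
      have "f \<cdot> (x \<star> a) = f \<cdot> zer X (Dom C a)"
        using cmp_act[OF f x(1) aa(1)] x(2) act_act[OF y e(2) aa(1)] aa(4) act_nul[OF y d c] cmp_zer[OF f d]
        by simp
      then have "h \<cdot> (x \<star> a) = zer W (Dom C a)"
        using kill[OF d act_el[OF x(1) aa(1)] zer_el[OF O(1) d]] cmp_zer[OF h d] by simp
      then have "h \<cdot> x \<star> a = zer W (Dom C a)" using cmp_act[OF h x(1) aa(1)] by simp
      then obtain z where z: "z \<in> el W c" "h \<cdot> x = z \<star> e"
        using el_coker[OF a, of "h \<cdot> x" W] A.Cmp_arrows[OF x(1) h] aa by auto
      show "\<exists>!z. z \<in> el W c \<and> ?R c y z"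
      proof (rule ex1I[of _ z])
        show "z \<in> el W c \<and> ?R c y z" using z e x by blast
        fix z' assume "z' \<in> el W c \<and> ?R c y z'"
        then obtain e' b' x' where z': "z' \<in> el W c" "h \<cdot> x' = z' \<star> e'"
          and e': "SE e'" "e' \<in> arrows C b' c" and x': "x' \<in> el X b'" "f \<cdot> x' = y \<star> e'" by blast
        \<comment> \<open>Two lifts are compared over the common refinement \<open>p\<close>; the
          arrows in \<open>SE\<close> are then cancelled one at a time.\<close>
        obtain p r r' where r: "SE r'" "r' \<in> arrows C p b'" "r \<in> arrows C p b" "e \<bullet> r = e' \<bullet> r'"
          using SE_pullback[OF e e'(2)] by blast
        have p: "p \<in> Obj C" using r arrows_ObjD by blast
        have "f \<cdot> (x \<star> r) = f \<cdot> (x' \<star> r')"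
          using cmp_act[OF f x(1) r(3)] cmp_act[OF f x'(1) r(2)] x(2) x'(2)
            act_act[OF y e(2) r(3)] act_act[OF y e'(2) r(2)] r(4) by simp
        then have "h \<cdot> (x \<star> r) = h \<cdot> (x' \<star> r')"
          using kill[OF p act_el[OF x(1) r(3)] act_el[OF x'(1) r(2)]] by simp
        then have "z \<star> e \<star> r = z' \<star> e' \<star> r'"
          using cmp_act[OF h x(1) r(3)] cmp_act[OF h x'(1) r(2)] z(2) z'(2) by simp
        then have "z \<star> e' \<star> r' = z' \<star> e' \<star> r'"
          using act_act[OF z(1) e(2) r(3)] act_act[OF z(1) e'(2) r(2)] r(4) by simp
        then have "z \<star> e' = z' \<star> e'"
          using SE_epi[OF r(1,2) act_el[OF z(1) e'(2)] act_el[OF z'(1) e'(2)]] by simp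
        then show "z' = z" using SE_epi[OF e' z(1) z'(1)] by simp
      qed
    next
      fix c d y z g assume g: "g \<in> arrows C d c" and y: "y \<in> el Y c" and z: "z \<in> el W c" and "?R c y z"
      then obtain e b x where e: "SE e" "e \<in> arrows C b c" and x: "x \<in> el X b" "f \<cdot> x = y \<star> e" "h \<cdot> x = z \<star> e"
        by blast
      obtain p e' g' where p: "SE e'" "e' \<in> arrows C p d" "g' \<in> arrows C p b" "e \<bullet> g' = g \<bullet> e'"
        using SE_pullback[OF e g] by blast
      have "f \<cdot> (x \<star> g') = y \<star> g \<star> e'" "h \<cdot> (x \<star> g') = z \<star> g \<star> e'"
        using cmp_act[OF f x(1) p(3)] cmp_act[OF h x(1) p(3)] x(2,3) act_act[OF y e(2) p(3)]
          act_act[OF z e(2) p(3)] act_act[OF y g p(2)] act_act[OF z g p(2)] p(4) by simp_all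
      then show "?R d (y \<star> g) (z \<star> g)" using p(1,2) act_el[OF x(1) p(3)] by blast
    qed
    then obtain u where u: "u \<in> arrows A Y W" "\<And>c y. c \<in> Obj C ==> y \<in> el Y c ==> ?R c y (u \<cdot> y)" by blast
    show ?thesis
    proof (rule ex1I[of _ u])
      have "u \<cdot> f = h"
      proof (rule arrow_eqI[OF A.Cmp_arrows[OF f u(1)] h])
        fix c x assume c: "c \<in> Obj C" and x: "x \<in> el X c"
        note fx = A.Cmp_arrows[OF x f]
        obtain e b x' where e: "SE e" "e \<in> arrows C b c" and x': "x' \<in> el X b" "f \<cdot> x' = f \<cdot> x \<star> e"
          "h \<cdot> x' = u \<cdot> (f \<cdot> x) \<star> e" using u(2)[OF c fx] by blast
        have b: "b \<in> Obj C" using e arrows_ObjD by blast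
        have "h \<cdot> x' = h \<cdot> (x \<star> e)"
          using kill[OF b x'(1) act_el[OF x e(2)]] x'(2) cmp_act[OF f x e(2)] by simp
        then have "u \<cdot> (f \<cdot> x) \<star> e = h \<cdot> x \<star> e" using x'(3) cmp_act[OF h x e(2)] by simp
        then have "u \<cdot> (f \<cdot> x) = h \<cdot> x" using SE_epi[OF e A.Cmp_arrows[OF fx u(1)] A.Cmp_arrows[OF x h]] by simp
        then show "u \<cdot> f \<cdot> x = h \<cdot> x" using A.Cmp_assoc[OF x f u(1)] by simp
      qed
      then show "u \<in> arrows A Y W \<and> u \<cdot> f = h" using u(1) by blast
      fix v assume v: "v \<in> arrows A Y W \<and> v \<cdot> f = h"
      show "v = u"
      proof (rule arrow_eqI[OF conjunct1[OF v] u(1)])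
        fix c y assume c: "c \<in> Obj C" and y: "y \<in> el Y c"
        obtain e b x where e: "SE e" "e \<in> arrows C b c" and x: "x \<in> el X b" "f \<cdot> x = y \<star> e" using LL[OF c y] by blast
        have "w \<cdot> y \<star> e = h \<cdot> x" if "w \<in> arrows A Y W" "w \<cdot> f = h" for w
          using cmp_act[OF that(1) y e(2)] x(2) A.Cmp_assoc[OF x(1) f that(1)] that(2) by simp
        then have "v \<cdot> y \<star> e = u \<cdot> y \<star> e" using v u(1) \<open>u \<cdot> f = h\<close> by simp
        then show "v \<cdot> y = u \<cdot> y"
          using SE_epi[OF e A.Cmp_arrows[OF y conjunct1[OF v]] A.Cmp_arrows[OF y u(1)]] by simp
      qed
    qed
  qed
  moreover have D: "f \<in> Arr A" "Dom A f = X" "Cod A f = Y" "k \<in> Arr A" "Cod A k = X"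
    using f ka by (auto simp: arrows_iff)
  ultimately show ?thesis unfolding AP.coker_def D using ka(2) by blast
qed

text \<open>Forward, the cokernel \<open>\<pi>\<close> from \<open>cokernel_elements\<close> is a
  second cokernel of \<open>k\<close>, and its lifts are carried to \<open>f\<close> by the
  comparison arrows \<open>u\<close> and \<open>v\<close>. Backward, \<open>f\<close> is the
  cokernel of its kernel.\<close>

lemma strict_epic_iff_locally_liftable:
  assumes f: "f \<in> arrows A X Y"
  shows "strict_epic A f \<longleftrightarrow>
    (\<forall>c \<in> Obj C. \<forall>y \<in> el Y c. \<exists>e b x. SE e \<and> e \<in> arrows C b c \<and> x \<in> el X b \<and> f \<cdot> x = y \<star> e)"
proof
  assume "strict_epic A f"
  then obtain k where k: "AP.coker k f" using AP.strict_epic_imp_coker by blast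
  have ka: "k \<in> arrows A (Dom A k) X" "f \<cdot> k = nulA (Dom A k) Y" "Dom A f = X" "Cod A f = Y"
    "Cod A k = X"
    using k f by (auto simp: AP.coker_def arrows_iff)
  obtain Q \<pi> where Q: "Q \<in> Obj A" "\<pi> \<in> arrows A X Q" "AP.coker k \<pi>"
    and LL: "\<And>c q. c \<in> Obj C ==> q \<in> el Q c ==>
       \<exists>e b x. SE e \<and> e \<in> arrows C b c \<and> x \<in> el X b \<and> \<pi> \<cdot> x = q \<star> e"
    using cokernel_elements[OF ka(1)] by metis
  have Qa: "Cod A \<pi> = Q" "\<pi> \<cdot> k = nulA (Dom A k) Q"
    using Q(2,3) by (auto simp: AP.coker_def arrows_iff)
  obtain u where u: "u \<in> arrows A Q Y" "u \<cdot> \<pi> = f"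
    using Q(3) f ka unfolding AP.coker_def Qa by metis
  obtain v where v: "v \<in> arrows A Y Q" "v \<cdot> f = \<pi>"
    using k Q(2) Qa ka unfolding AP.coker_def by metis
  have Y: "Y \<in> Obj A" using A.arrows_ObjD f by blast
  have "u \<cdot> v \<cdot> f = Idn A Y \<cdot> f"
    using A.Cmp_assoc[OF f v(1) u(1)] u(2) v(2) A.Cmp_Idn_left[OF f] by simp
  then have uv: "u \<cdot> v = Idn A Y"
    using AP.coker_epi[OF k] A.Cmp_arrows[OF v(1) u(1)] A.Idn_arrows[OF Y] ka by metis
  show "\<forall>c \<in> Obj C. \<forall>y \<in> el Y c. \<exists>e b x. SE e \<and> e \<in> arrows C b c \<and> x \<in> el X b \<and> f \<cdot> x = y \<star> e"
  proof (intro ballI)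
    fix c y assume c: "c \<in> Obj C" and y: "y \<in> el Y c"
    obtain e b x where e: "SE e" "e \<in> arrows C b c" and x: "x \<in> el X b" "\<pi> \<cdot> x = v \<cdot> y \<star> e"
      using LL[OF c A.Cmp_arrows[OF y v(1)]] by blast
    have "f \<cdot> x = u \<cdot> (v \<cdot> y \<star> e)" using A.Cmp_assoc[OF x(1) Q(2) u(1)] u(2) x(2) by simp
    also have "\<dots> = y \<star> e"
      using cmp_act[OF u(1) A.Cmp_arrows[OF y v(1)] e(2)] A.Cmp_assoc[OF y v(1) u(1)] uv
        A.Cmp_Idn_left[OF y] by simp
    finally show "\<exists>e b x. SE e \<and> e \<in> arrows C b c \<and> x \<in> el X b \<and> f \<cdot> x = y \<star> e" using e x by blast
  qed
next
  assume LL: "\<forall>c \<in> Obj C. \<forall>y \<in> el Y c. \<exists>e b x. SE e \<and> e \<in> arrows C b c \<and> x \<in> el X b \<and> f \<cdot> x = y \<star> e"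
  obtain k where k: "AP.ker f k" using ex_ker[OF f] by blast
  show "strict_epic A f"
    using AP.coker_imp_strict_epic[OF locally_liftable_imp_coker[OF f k] k] LL by blast
qed

text \<open>An element of \<open>Y\<close> dies in the cokernel of \<open>f\<close> when it has the
  form \<open>y \<star> g\<close> with \<open>y \<star> a\<close> in the image of \<open>f\<close>
  and \<open>g\<close> killed by \<open>cokC a\<close>. The second condition puts such elements back
  into the image, so \<open>f\<close> is the kernel of its cokernel. It involves one arrow
  \<open>a\<close> and finitely many elements, which suits filtered colimits.\<close>

lemma strict_monic_iff:
  assumes f: "f \<in> arrows A X Y"
  shows "strict_monic A f \<longleftrightarrow>
    (\<forall>c \<in> Obj C. \<forall>x \<in> el X c. \<forall>x' \<in> el X c. f \<cdot> x = f \<cdot> x' \<longrightarrow> x = x') \<and>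
    (\<forall>a \<in> Arr C. \<forall>y \<in> el Y (Cod C a). \<forall>c. \<forall>g \<in> arrows C c (Cod C a). \<forall>x \<in> el X (Dom C a).
       cokC a \<bullet> g = nul c (Cod C (cokC a)) \<and> f \<cdot> x = y \<star> a \<longrightarrow> (\<exists>x' \<in> el X c. f \<cdot> x' = y \<star> g))"
    (is "_ \<longleftrightarrow> ?inj \<and> ?SM")
proof
  assume "strict_monic A f"
  then obtain b where b: "AP.ker b f" using AP.strict_monic_imp_ker by blast
  have ba: "b \<in> arrows A Y (Cod A b)" "b \<cdot> f = nulA X (Cod A b)" "Dom A b = Y" "Dom A f = X"
    using b f by (auto simp: AP.ker_def arrows_iff)
  note ki = b[unfolded ker_iff[OF ba(1) f]]
  have inj: ?inj
    using AP.ker_mono[OF b] ba(4) by blast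
  have ?SM
  proof (intro ballI allI impI, elim conjE)
    fix a y c g x assume a: "a \<in> Arr C" and y: "y \<in> el Y (Cod C a)" and g: "g \<in> arrows C c (Cod C a)"
      and x: "x \<in> el X (Dom C a)" and 0: "cokC a \<bullet> g = nul c (Cod C (cokC a))" and eq: "f \<cdot> x = y \<star> a"
    have aa: "a \<in> arrows C (Dom C a) (Cod C a)" using Arr_arrows[OF a] .
    note q = cokC_arrows[OF aa]
    have O: "Dom C a \<in> Obj C" "c \<in> Obj C" "Cod C (cokC a) \<in> Obj C"
      using arrows_ObjD[OF aa] arrows_ObjD[OF g] arrows_ObjD[OF q(1)] by auto
    have "b \<cdot> y \<star> a = zer (Cod A b) (Dom C a)"
      using cmp_act[OF ba(1) y aa] ki O(1) x eq by metis
    then obtain w where w: "w \<in> el (Cod A b) (Cod C (cokC a))" "b \<cdot> y = w \<star> cokC a"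
      using el_coker[OF cokC(1)[OF a] A.Cmp_arrows[OF y ba(1)]] by blast
    have "b \<cdot> (y \<star> g) = zer (Cod A b) c"
      using cmp_act[OF ba(1) y g] w(2) act_act[OF w(1) q(1) g] 0 act_nul[OF w(1) O(2,3)] by simp
    then show "\<exists>x' \<in> el X c. f \<cdot> x' = y \<star> g" using ki O(2) act_el[OF y g] by blast
  qed
  then show "?inj \<and> ?SM" using inj by blast
next
  assume R: "?inj \<and> ?SM"
  obtain Q \<pi> where Q: "Q \<in> Obj A" "\<pi> \<in> arrows A Y Q" "AP.coker f \<pi>"
    and kern: "\<And>c y. c \<in> Obj C ==> y \<in> el Y c ==> \<pi> \<cdot> y = zer Q c ==>
       \<exists>a y' g x. a \<in> Arr C \<and> y' \<in> el Y (Cod C a) \<and> g \<in> arrows C c (Cod C a) \<and>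
         x \<in> el X (Dom C a) \<and> f \<cdot> x = y' \<star> a \<and>
         cokC a \<bullet> g = nul c (Cod C (cokC a)) \<and> y = y' \<star> g"
    using cokernel_elements[OF f] by metis
  have "AP.ker \<pi> f"
    unfolding ker_iff[OF Q(2) f]
  proof (intro conjI ballI impI)
    fix c z assume c: "c \<in> Obj C" and z: "z \<in> el X c"
    have "\<pi> \<cdot> f = nulA X Q" using Q(2,3) f by (auto simp: AP.coker_def arrows_iff)
    then show "\<pi> \<cdot> (f \<cdot> z) = zer Q c" using A.Cmp_assoc[OF z f Q(2)] AP.Cmp_nul_left[OF z Q(1)] by simp
  next
    fix c y assume c: "c \<in> Obj C" and y: "y \<in> el Y c" and 0: "\<pi> \<cdot> y = zer Q c"
    obtain a y' g x where "a \<in> Arr C" "y' \<in> el Y (Cod C a)" "g \<in> arrows C c (Cod C a)"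
         "x \<in> el X (Dom C a)" "f \<cdot> x = y' \<star> a" "cokC a \<bullet> g = nul c (Cod C (cokC a))" "y = y' \<star> g"
      using kern[OF c y 0] by blast
    then obtain x' where "x' \<in> el X c" "f \<cdot> x' = y" using R by blast
    then show "\<exists>!z. z \<in> el X c \<and> f \<cdot> z = y" using R c by blast
  qed
  then show "strict_monic A f" using AP.ker_imp_strict_monic Q(3) by blast
qed

text \<open>Lift the image of \<open>y\<close> under \<open>g\<close> along \<open>f\<close> and
  pair the lift with \<open>y \<star> e\<close>; the pullback property applies to elements because
  they are arrows.\<close>

lemma strict_epic_pullback:
  assumes pb: "is_pullback A f g f' g'" and se: "strict_epic A f"
  shows "strict_epic A f'"
proof -
  obtain X Y Z P where fg: "f \<in> arrows A X Y" "g \<in> arrows A Z Y" "f' \<in> arrows A P Z" "g' \<in> arrows A P X"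
    and uni: "\<forall>W. \<forall>x \<in> arrows A W X. \<forall>y \<in> arrows A W Z. f \<cdot> x = g \<cdot> y \<longrightarrow>
        (\<exists>!u. u \<in> arrows A W P \<and> g' \<cdot> u = x \<and> f' \<cdot> u = y)"
    using pb unfolding is_pullback_def by (auto simp: arrows_iff)
  show ?thesis
    unfolding strict_epic_iff_locally_liftable[OF fg(3)]
  proof (intro ballI)
    fix c y assume c: "c \<in> Obj C" and y: "y \<in> el Z c"
    obtain e b x where e: "SE e" "e \<in> arrows C b c" and x: "x \<in> el X b" "f \<cdot> x = g \<cdot> y \<star> e"
      using se[unfolded strict_epic_iff_locally_liftable[OF fg(1)]] c A.Cmp_arrows[OF y fg(2)] by blast
    have "f \<cdot> x = g \<cdot> (y \<star> e)" using x(2) cmp_act[OF fg(2) y e(2)] by simp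
    then obtain u where "u \<in> el P b" "f' \<cdot> u = y \<star> e"
      using uni x(1) act_el[OF y e(2)] by blast
    then show "\<exists>e b x. SE e \<and> e \<in> arrows C b c \<and> x \<in> el P b \<and> f' \<cdot> x = y \<star> e" using e by blast
  qed
qed

text \<open>
  The pushout is compared with the quotient of a product, whose elements lift locally; as in Rump's
  proof that one half of the axioms of a quasi-abelian category implies the other half, \<open>f'\<close> is
  then seen to be the kernel of the arrow \<open>p'\<close> induced by a cokernel of \<open>f\<close>.
\<close>

lemma strict_monic_pushout:
  assumes po: "is_pushout A f g f' g'" and sm: "strict_monic A f"
  shows "strict_monic A f'"
proof -
  obtain X Y Z P where fg: "f \<in> arrows A X Y" "g \<in> arrows A X Z" "f' \<in> arrows A Z P" "g' \<in> arrows A Y P"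
    and comm: "g' \<cdot> f = f' \<cdot> g"
    and uni: "\<forall>W. \<forall>x \<in> arrows A Y W. \<forall>y \<in> arrows A Z W. x \<cdot> f = y \<cdot> g \<longrightarrow>
        (\<exists>!u. u \<in> arrows A P W \<and> u \<cdot> g' = x \<and> u \<cdot> f' = y)"
    using po unfolding is_pushout_def by (auto simp: arrows_iff)
  have O: "X \<in> Obj A" "Y \<in> Obj A" "Z \<in> Obj A" "P \<in> Obj A" using fg A.arrows_ObjD by blast+
  note sm' = sm[unfolded strict_monic_iff[OF fg(1)]]
  obtain B p q where B: "B \<in> Obj A" "p \<in> arrows A B Y" "q \<in> arrows A B Z"
    and ex: "\<And>c x y. c \<in> Obj C ==> x \<in> el Y c ==> y \<in> el Z c ==>
       \<exists>!z. z \<in> el B c \<and> p \<cdot> z = x \<and> q \<cdot> z = y"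
    using product_elements[OF O(2,3)] by blast

  \<comment> \<open>Comparison of the pushout with a quotient of the product\<close>
  let ?S = "\<lambda>c. {b \<in> el B c. \<exists>x \<in> el X c. p \<cdot> b = f \<cdot> x \<and> q \<cdot> b = negA (g \<cdot> x)}"
  obtain Q \<pi> where Q: "Q \<in> Obj A" "\<pi> \<in> arrows A B Q"
    and kill: "\<And>c s. c \<in> Obj C ==> s \<in> ?S c ==> \<pi> \<cdot> s = zer Q c"
    and univ: "\<And>W \<psi>. \<psi> \<in> arrows A B W ==> (\<And>c s. c \<in> Obj C ==> s \<in> ?S c ==> \<psi> \<cdot> s = zer W c) ==>
       \<exists>!u. u \<in> arrows A Q W \<and> u \<cdot> \<pi> = \<psi>"
    and kern: "\<And>c y. c \<in> Obj C ==> y \<in> el B c ==> \<pi> \<cdot> y = zer Q c ==>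
       \<exists>a y' g. a \<in> Arr C \<and> y' \<in> el B (Cod C a) \<and> g \<in> arrows C c (Cod C a) \<and> y' \<star> a \<in> ?S (Dom C a) \<and>
         cokC a \<bullet> g = nul c (Cod C (cokC a)) \<and> y = y' \<star> g"
    and LL: "\<And>c q. c \<in> Obj C ==> q \<in> el Q c ==>
       \<exists>e b x. SE e \<and> e \<in> arrows C b c \<and> x \<in> el B b \<and> \<pi> \<cdot> x = q \<star> e"
  proof (rule quotient[OF B(1), of ?S])
    show "?S c \<subseteq> el B c" for c by blast
    show "zer B c \<in> ?S c" if c: "c \<in> Obj C" for c
    proof -
      have "negA (zer Z c) = zer Z c"
        using AP.neg_unique[OF zer_el[OF O(3) c] zer_el[OF O(3) c]] AP.pl_nul[OF zer_el[OF O(3) c]] by simp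
      then show ?thesis
        using zer_el[OF B(1) c] zer_el[OF O(1) c] cmp_zer[OF B(2) c] cmp_zer[OF B(3) c]
          cmp_zer[OF fg(1) c] cmp_zer[OF fg(2) c] by (intro CollectI conjI bexI[of _ "zer X c"]) auto
    qed
    show "plA b b' \<in> ?S c" if bb: "b \<in> ?S c" "b' \<in> ?S c" for c b b'
    proof -
      obtain x x' where b: "b \<in> el B c" "b' \<in> el B c" and x: "x \<in> el X c" "x' \<in> el X c"
        "p \<cdot> b = f \<cdot> x" "q \<cdot> b = negA (g \<cdot> x)" "p \<cdot> b' = f \<cdot> x'" "q \<cdot> b' = negA (g \<cdot> x')"
        using bb by blast
      note gx = A.Cmp_arrows[OF x(1) fg(2)] A.Cmp_arrows[OF x(2) fg(2)]
      have "plA (negA (g \<cdot> x)) (negA (g \<cdot> x')) = negA (g \<cdot> plA x x')"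
      proof (rule AP.neg_unique)
        note n = AP.neg_arrows[OF gx(1)] AP.neg_arrows[OF gx(2)]
        show "g \<cdot> plA x x' \<in> el Z c" using A.Cmp_arrows[OF AP.pl_arrows[OF x(1,2)] fg(2)] .
        show nn: "plA (negA (g \<cdot> x)) (negA (g \<cdot> x')) \<in> el Z c" using AP.pl_arrows[OF n] .
        have "plA (g \<cdot> x) (plA (g \<cdot> x') (plA (negA (g \<cdot> x)) (negA (g \<cdot> x')))) = zer Z c"
          using AP.pl_comm[OF n] AP.pl_assoc[OF gx(2) n(2) n(1)] AP.pl_neg[OF gx(1)] AP.pl_neg[OF gx(2)]
            AP.pl_nul_left[OF n(1)] by simp
        then show "plA (g \<cdot> plA x x') (plA (negA (g \<cdot> x)) (negA (g \<cdot> x'))) = zer Z c"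
          using AP.Cmp_pl_right[OF x(1,2) fg(2)] AP.pl_assoc[OF gx nn] by simp
      qed
      then have "p \<cdot> plA b b' = f \<cdot> plA x x'" "q \<cdot> plA b b' = negA (g \<cdot> plA x x')"
        using AP.Cmp_pl_right[OF b B(2)] AP.Cmp_pl_right[OF b B(3)] AP.Cmp_pl_right[OF x(1,2) fg(1)] x by simp_all
      then show ?thesis using AP.pl_arrows[OF b] AP.pl_arrows[OF x(1,2)] by blast
    qed
    show "b \<star> k \<in> ?S d" if k: "k \<in> arrows C d c" and bS: "b \<in> ?S c" for c d b k
    proof -
      obtain x where b: "b \<in> el B c" and x: "x \<in> el X c" "p \<cdot> b = f \<cdot> x" "q \<cdot> b = negA (g \<cdot> x)"
        using bS by blast
      have "negA (g \<cdot> x) \<star> k = negA (g \<cdot> (x \<star> k))"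
        using AP.Cmp_neg_left[OF H_arrows[OF k] A.Cmp_arrows[OF x(1) fg(2)]] cmp_act[OF fg(2) x(1) k] by simp
      then have "p \<cdot> (b \<star> k) = f \<cdot> (x \<star> k)" "q \<cdot> (b \<star> k) = negA (g \<cdot> (x \<star> k))"
        using cmp_act[OF B(2) b k] cmp_act[OF B(3) b k] cmp_act[OF fg(1) x(1) k] x by simp_all
      then show ?thesis using act_el[OF b k] act_el[OF x(1) k] by blast
    qed
  qed blast
  obtain i1 where i1: "i1 \<in> arrows A Y B" "p \<cdot> i1 = Idn A Y" "q \<cdot> i1 = nulA Y Z"
    using product_arrow[OF B ex A.Idn_arrows[OF O(2)] AP.nul_arrows[OF O(2,3)]] by blast
  obtain i2 where i2: "i2 \<in> arrows A Z B" "p \<cdot> i2 = nulA Z Y" "q \<cdot> i2 = Idn A Z"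
    using product_arrow[OF B ex AP.nul_arrows[OF O(3,2)] A.Idn_arrows[OF O(3)]] by blast
  have i1e: "p \<cdot> (i1 \<cdot> y) = y" "q \<cdot> (i1 \<cdot> y) = zer Z c" if "y \<in> el Y c" for y c
    using A.Cmp_assoc[OF that i1(1) B(2)] A.Cmp_assoc[OF that i1(1) B(3)] i1(2,3) A.Cmp_Idn_left[OF that]
      AP.Cmp_nul_left[OF that O(3)] by simp_all
  have i2e: "p \<cdot> (i2 \<cdot> z) = zer Y c" "q \<cdot> (i2 \<cdot> z) = z" if "z \<in> el Z c" for z c
    using A.Cmp_assoc[OF that i2(1) B(2)] A.Cmp_assoc[OF that i2(1) B(3)] i2(2,3) A.Cmp_Idn_left[OF that]
      AP.Cmp_nul_left[OF that O(2)] by simp_all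
  have "\<pi> \<cdot> i1 \<cdot> f = \<pi> \<cdot> i2 \<cdot> g"
  proof (rule arrow_eqI)
    show "\<pi> \<cdot> i1 \<cdot> f \<in> arrows A X Q" "\<pi> \<cdot> i2 \<cdot> g \<in> arrows A X Q"
      using A.Cmp_arrows[OF fg(1) A.Cmp_arrows[OF i1(1) Q(2)]] A.Cmp_arrows[OF fg(2) A.Cmp_arrows[OF i2(1) Q(2)]]
      by auto
    fix c x assume c: "c \<in> Obj C" and x: "x \<in> el X c"
    note fx = A.Cmp_arrows[OF x fg(1)] and gx = A.Cmp_arrows[OF x fg(2)]
    note ifx = A.Cmp_arrows[OF fx i1(1)] and igx = A.Cmp_arrows[OF gx i2(1)]
    let ?b = "AP.mi (i1 \<cdot> (f \<cdot> x)) (i2 \<cdot> (g \<cdot> x))"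
    have b: "?b \<in> el B c" using AP.mi_arrows[OF ifx igx] .
    have "p \<cdot> ?b = AP.mi (f \<cdot> x) (zer Y c)" "q \<cdot> ?b = AP.mi (zer Z c) (g \<cdot> x)"
      using AP.Cmp_mi_right[OF ifx igx B(2)] AP.Cmp_mi_right[OF ifx igx B(3)] i1e[OF fx] i2e[OF gx] by simp_all
    moreover have "AP.mi (f \<cdot> x) (zer Y c) = f \<cdot> x"
    proof -
      have "negA (zer Y c) = zer Y c"
        using AP.neg_unique[OF zer_el[OF O(2) c] zer_el[OF O(2) c]] AP.pl_nul[OF zer_el[OF O(2) c]] by simp
      then show ?thesis using AP.pl_nul[OF fx] by (simp add: AP.mi_def)
    qed
    moreover have "AP.mi (zer Z c) (g \<cdot> x) = negA (g \<cdot> x)"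
      using AP.pl_nul_left[OF AP.neg_arrows[OF gx]] by (simp add: AP.mi_def)
    ultimately have "?b \<in> ?S c" using b x by auto
    then have "\<pi> \<cdot> ?b = zer Q c" using kill c by blast
    then have "\<pi> \<cdot> (i1 \<cdot> (f \<cdot> x)) = \<pi> \<cdot> (i2 \<cdot> (g \<cdot> x))"
      using AP.Cmp_mi_right[OF ifx igx Q(2)] AP.mi_eq_nul[OF A.Cmp_arrows[OF ifx Q(2)] A.Cmp_arrows[OF igx Q(2)]]
      by simp
    then show "\<pi> \<cdot> i1 \<cdot> f \<cdot> x = \<pi> \<cdot> i2 \<cdot> g \<cdot> x"
      using A.Cmp_assoc[OF x fg(1) A.Cmp_arrows[OF i1(1) Q(2)]] A.Cmp_assoc[OF fx i1(1) Q(2)]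
        A.Cmp_assoc[OF x fg(2) A.Cmp_arrows[OF i2(1) Q(2)]] A.Cmp_assoc[OF gx i2(1) Q(2)] by simp
  qed
  \<comment> \<open>\<open>Q\<close> is a candidate for the pushout whose elements are under
    control. The arrow \<open>u\<close> from \<open>P\<close> to \<open>Q\<close> and the arrow
    \<open>v\<close> back exhibit \<open>P\<close> as a retract of it, so that questions about
    elements of \<open>P\<close> can be settled in \<open>Q\<close>.\<close>
  then obtain u where u: "u \<in> arrows A P Q" "u \<cdot> g' = \<pi> \<cdot> i1" "u \<cdot> f' = \<pi> \<cdot> i2"
    using uni A.Cmp_arrows[OF i1(1) Q(2)] A.Cmp_arrows[OF i2(1) Q(2)] by blast
  define \<psi> where "\<psi> = plA (g' \<cdot> p) (f' \<cdot> q)"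
  note gp = A.Cmp_arrows[OF B(2) fg(4)] and fq = A.Cmp_arrows[OF B(3) fg(3)]
  have \<psi>: "\<psi> \<in> arrows A B P" unfolding \<psi>_def using AP.pl_arrows[OF gp fq] .
  have \<psi>e: "\<psi> \<cdot> b = plA (g' \<cdot> (p \<cdot> b)) (f' \<cdot> (q \<cdot> b))" if "b \<in> arrows A W B" for b W
    unfolding \<psi>_def using AP.Cmp_pl_left[OF that gp fq] A.Cmp_assoc[OF that B(2) fg(4)]
      A.Cmp_assoc[OF that B(3) fg(3)] by simp
  have "\<exists>!v. v \<in> arrows A Q P \<and> v \<cdot> \<pi> = \<psi>"
  proof (rule univ[OF \<psi>])
    fix c s assume c: "c \<in> Obj C" and "s \<in> ?S c"
    then obtain x where s: "s \<in> el B c" and x: "x \<in> el X c" "p \<cdot> s = f \<cdot> x" "q \<cdot> s = negA (g \<cdot> x)" by blast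
    note gx = A.Cmp_arrows[OF x(1) fg(2)]
    have "\<psi> \<cdot> s = plA (g' \<cdot> (f \<cdot> x)) (negA (f' \<cdot> (g \<cdot> x)))"
      using \<psi>e[OF s] x AP.Cmp_neg_right[OF gx fg(3)] by simp
    also have "g' \<cdot> (f \<cdot> x) = f' \<cdot> (g \<cdot> x)"
      using A.Cmp_assoc[OF x(1) fg(1,4)] A.Cmp_assoc[OF x(1) fg(2,3)] comm by simp
    finally show "\<psi> \<cdot> s = zer P c" using AP.pl_neg[OF A.Cmp_arrows[OF gx fg(3)]] by simp
  qed
  then obtain v where v: "v \<in> arrows A Q P" "v \<cdot> \<pi> = \<psi>" by blast
  \<comment> \<open>Tested on \<open>g'\<close> and \<open>f'\<close>, which are jointly epic in a
    pushout.\<close>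
  have vu: "v \<cdot> u = Idn A P"
  proof -
    have "v \<cdot> u \<cdot> g' = \<psi> \<cdot> i1"
      using A.Cmp_assoc[OF fg(4) u(1) v(1)] u(2) A.Cmp_assoc[OF i1(1) Q(2) v(1)] v(2) by simp
    also have "\<dots> = g'"
      using \<psi>e[OF i1(1)] i1(2,3) A.Cmp_Idn_right[OF fg(4)] AP.Cmp_nul_right[OF fg(3) O(2)]
        AP.pl_nul[OF fg(4)] by simp
    finally have 1: "v \<cdot> u \<cdot> g' = g'" .
    have "v \<cdot> u \<cdot> f' = \<psi> \<cdot> i2"
      using A.Cmp_assoc[OF fg(3) u(1) v(1)] u(3) A.Cmp_assoc[OF i2(1) Q(2) v(1)] v(2) by simp
    also have "\<dots> = f'"
      using \<psi>e[OF i2(1)] i2(2,3) A.Cmp_Idn_right[OF fg(3)] AP.Cmp_nul_right[OF fg(4) O(3)]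
        AP.pl_nul_left[OF fg(3)] by simp
    finally have 2: "v \<cdot> u \<cdot> f' = f'" .
    have "\<exists>!w. w \<in> arrows A P P \<and> w \<cdot> g' = g' \<and> w \<cdot> f' = f'"
      using uni fg(3,4) comm by blast
    then show ?thesis
      using 1 2 A.Cmp_arrows[OF u(1) v(1)] A.Idn_arrows[OF O(4)] A.Cmp_Idn_left[OF fg(3)]
        A.Cmp_Idn_left[OF fg(4)] by blast
  qed

  \<comment> \<open>Injectivity of \<open>f'\<close> on elements\<close>
  have inj0: "w = zer Z c" if c: "c \<in> Obj C" and w: "w \<in> el Z c" and 0: "f' \<cdot> w = zer P c" for w c
  proof -
    note iw = A.Cmp_arrows[OF w i2(1)]
    \<comment> \<open>The kernel of \<open>\<pi>\<close> describes \<open>i2 \<cdot> w\<close> as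
      \<open>b \<star> h\<close>, where \<open>b \<star> a\<close> is a relation given by
      \<open>x\<close> and \<open>h\<close> is killed by \<open>cokC a\<close>, but in general does
      not factor through \<open>a\<close>.\<close>
    have "\<pi> \<cdot> (i2 \<cdot> w) = zer Q c"
      using A.Cmp_assoc[OF w i2(1) Q(2)] u(3) A.Cmp_assoc[OF w fg(3) u(1)] 0 cmp_zer[OF u(1) c] by simp
    then obtain a b h where a: "a \<in> Arr C" "b \<in> el B (Cod C a)" "h \<in> arrows C c (Cod C a)"
      "b \<star> a \<in> ?S (Dom C a)" "cokC a \<bullet> h = nul c (Cod C (cokC a))" "i2 \<cdot> w = b \<star> h"
      using kern[OF c iw] by blast
    then obtain x where x: "x \<in> el X (Dom C a)" "p \<cdot> (b \<star> a) = f \<cdot> x" "q \<cdot> (b \<star> a) = negA (g \<cdot> x)" by blast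
    have aa: "a \<in> arrows C (Dom C a) (Cod C a)" using Arr_arrows[OF a(1)] .
    obtain I e j where I: "e \<in> arrows C (Dom C a) I" "j \<in> arrows C I (Cod C a)" "j \<bullet> e = a"
      "cokC a \<bullet> j = nul I (Cod C (cokC a))"
      "\<forall>W. \<forall>u \<in> arrows C I W. u \<bullet> e = nul (Dom C a) W \<longrightarrow> u = nul I W"
      "\<forall>W. \<forall>g \<in> arrows C W (Cod C a). cokC a \<bullet> g = nul W (Cod C (cokC a)) \<longrightarrow>
            (\<exists>g' \<in> arrows C W I. g = j \<bullet> g')"
      using cokC(3)[OF a(1)] by blast
    have IO: "I \<in> Obj C" "Dom C a \<in> Obj C" using I(1) arrows_ObjD by blast+
    note pb = A.Cmp_arrows[OF a(2) B(2)] and qb = A.Cmp_arrows[OF a(2) B(3)]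
    have pba: "f \<cdot> x = p \<cdot> b \<star> a" using cmp_act[OF B(2) a(2) aa] x(2) by simp
    \<comment> \<open>Strictness of \<open>f\<close> extends \<open>x\<close> from \<open>a\<close>
      to the kernel \<open>j\<close> of \<open>cokC a\<close>, through which \<open>h\<close> does
      factor.\<close>
    obtain x' where x': "x' \<in> el X I" "f \<cdot> x' = p \<cdot> b \<star> j"
      using sm' a(1) pb I(2) x(1) I(4) pba by blast
    have "f \<cdot> (x' \<star> e) = f \<cdot> x"
      using cmp_act[OF fg(1) x'(1) I(1)] x'(2) act_act[OF pb I(2,1)] I(3) pba by simp
    then have xe: "x' \<star> e = x" using sm' IO(2) act_el[OF x'(1) I(1)] x(1) by blast
    note gx' = A.Cmp_arrows[OF x'(1) fg(2)]
    \<comment> \<open>The equation holds after restriction along \<open>e\<close>, that is, on the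
      image of \<open>a\<close>; cancelling this epimorphism extends it to all of
      \<open>I\<close>.\<close>
    have "q \<cdot> b \<star> j = negA (g \<cdot> x')"
    proof (rule el_epi[OF I(1) _ act_el[OF qb I(2)] AP.neg_arrows[OF gx']])
      show "u = nul I W" if "u \<in> arrows C I W" "u \<bullet> e = nul (Dom C a) W" for u W using I(5) that by blast
      have "q \<cdot> b \<star> j \<star> e = negA (g \<cdot> x)"
        using act_act[OF qb I(2,1)] I(3) cmp_act[OF B(3) a(2) aa] x(3) by simp
      moreover have "negA (g \<cdot> x') \<star> e = negA (g \<cdot> x)"
        using AP.Cmp_neg_left[OF H_arrows[OF I(1)] gx'] cmp_act[OF fg(2) x'(1) I(1)] xe by simp
      ultimately show "q \<cdot> b \<star> j \<star> e = negA (g \<cdot> x') \<star> e" by simp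
    qed
    moreover obtain h' where h': "h' \<in> arrows C c I" "h = j \<bullet> h'" using I(6) a(3,5) by blast
    \<comment> \<open>The first component of \<open>i2 \<cdot> w\<close> is zero and
      \<open>f\<close> is injective on elements; hence \<open>x' \<star> h'\<close> vanishes, and
      with it the second component \<open>w\<close>.\<close>
    moreover have "x' \<star> h' = zer X c"
    proof -
      have "f \<cdot> (x' \<star> h') = p \<cdot> (b \<star> h)"
        using cmp_act[OF fg(1) x'(1) h'(1)] x'(2) act_act[OF pb I(2) h'(1)] h'(2) cmp_act[OF B(2) a(2,3)] by simp
      also have "\<dots> = f \<cdot> zer X c" using a(6) i2e(1)[OF w] cmp_zer[OF fg(1) c] by simp
      finally show ?thesis using sm' c act_el[OF x'(1) h'(1)] zer_el[OF O(1) c] by blast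
    qed
    moreover have "w = q \<cdot> b \<star> j \<star> h'"
      using i2e(2)[OF w] a(6) cmp_act[OF B(3) a(2,3)] h'(2) act_act[OF qb I(2) h'(1)] by simp
    ultimately have "w = negA (g \<cdot> zer X c)"
      using AP.Cmp_neg_left[OF H_arrows[OF h'(1)] gx'] cmp_act[OF fg(2) x'(1) h'(1)] by simp
    also have "\<dots> = zer Z c"
      using cmp_zer[OF fg(2) c] AP.neg_unique[OF zer_el[OF O(3) c] zer_el[OF O(3) c]]
        AP.pl_nul[OF zer_el[OF O(3) c]] by simp
    finally show ?thesis .
  qed
  have inj: "w = w'" if c: "c \<in> Obj C" and w: "w \<in> el Z c" "w' \<in> el Z c" and eq: "f' \<cdot> w = f' \<cdot> w'" for w w' c
    using inj0[OF c AP.mi_arrows[OF w]] AP.Cmp_mi_right[OF w fg(3)]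
      AP.mi_eq_nul[OF A.Cmp_arrows[OF w(1) fg(3)] A.Cmp_arrows[OF w(2) fg(3)]] AP.mi_eq_nul[OF w] eq by simp

  \<comment> \<open>\<open>f'\<close> as the kernel of \<open>p'\<close>\<close>
  obtain r0 where r0: "AP.ker r0 f" using AP.strict_monic_imp_ker[OF sm] by blast
  obtain E r where r: "r \<in> arrows A Y E" "AP.coker f r" "E \<in> Obj A"
    using cokernel_elements[OF fg(1)] by metis
  have rk: "AP.ker r f" using AP.ker_coker[OF r0 r(2)] .
  note rk' = rk[unfolded ker_iff[OF r(1) fg(1)]]
  have "r \<cdot> f = nulA Z E \<cdot> g"
    using rk fg(1) r(1) AP.Cmp_nul_left[OF fg(2) r(3)] by (auto simp: AP.ker_def arrows_iff)
  then obtain p' where p': "p' \<in> arrows A P E" "p' \<cdot> g' = r" "p' \<cdot> f' = nulA Z E"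
    using uni r(1) AP.nul_arrows[OF O(3) r(3)] by blast
  have "AP.ker p' f'"
    unfolding ker_iff[OF p'(1) fg(3)]
  proof (intro conjI ballI impI)
    show "p' \<cdot> (f' \<cdot> z) = zer E c" if "z \<in> el Z c" for c z
      using A.Cmp_assoc[OF that fg(3) p'(1)] p'(3) AP.Cmp_nul_left[OF that r(3)] by simp
    fix c t assume c: "c \<in> Obj C" and t: "t \<in> el P c" and 0: "p' \<cdot> t = zer E c"
    \<comment> \<open>The element \<open>t\<close> is lifted through \<open>\<pi>\<close> to
      \<open>s\<close>, with components in \<open>Y\<close> and \<open>Z\<close>. The component in
      \<open>Y\<close> is killed by \<open>r\<close>, hence comes from \<open>X\<close> and can be
      moved into \<open>Z\<close> by the pushout square.\<close>
    obtain e b s where e: "SE e" "e \<in> arrows C b c" and s: "s \<in> el B b" "\<pi> \<cdot> s = u \<cdot> t \<star> e"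
      using LL[OF c A.Cmp_arrows[OF t u(1)]] by blast
    have b: "b \<in> Obj C" using e arrows_ObjD by blast
    note ps = A.Cmp_arrows[OF s(1) B(2)] and qs = A.Cmp_arrows[OF s(1) B(3)]
    note gps = A.Cmp_arrows[OF ps fg(4)] and fqs = A.Cmp_arrows[OF qs fg(3)]
    have "\<psi> \<cdot> s = v \<cdot> (u \<cdot> t \<star> e)" using A.Cmp_assoc[OF s(1) Q(2) v(1)] v(2) s(2) by simp
    also have "\<dots> = t \<star> e"
      using cmp_act[OF v(1) A.Cmp_arrows[OF t u(1)] e(2)] A.Cmp_assoc[OF t u(1) v(1)] vu A.Cmp_Idn_left[OF t]
      by simp
    finally have te: "t \<star> e = plA (g' \<cdot> (p \<cdot> s)) (f' \<cdot> (q \<cdot> s))" using \<psi>e[OF s(1)] by simp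
    have "r \<cdot> (p \<cdot> s) = zer E b"
    proof -
      have "p' \<cdot> (t \<star> e) = zer E b" using cmp_act[OF p'(1) t e(2)] 0 zer_act[OF r(3) e(2)] by simp
      moreover have "p' \<cdot> (t \<star> e) = plA (p' \<cdot> (g' \<cdot> (p \<cdot> s))) (p' \<cdot> (f' \<cdot> (q \<cdot> s)))"
        unfolding te using AP.Cmp_pl_right[OF gps fqs p'(1)] .
      moreover have "p' \<cdot> (f' \<cdot> (q \<cdot> s)) = zer E b"
        using A.Cmp_assoc[OF qs fg(3) p'(1)] p'(3) AP.Cmp_nul_left[OF qs r(3)] by simp
      moreover have "p' \<cdot> (g' \<cdot> (p \<cdot> s)) = r \<cdot> (p \<cdot> s)"
        using A.Cmp_assoc[OF ps fg(4) p'(1)] p'(2) by simp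
      ultimately show ?thesis using AP.pl_nul[OF A.Cmp_arrows[OF ps r(1)]] by simp
    qed
    then obtain x where x: "x \<in> el X b" "f \<cdot> x = p \<cdot> s" using rk' b ps by blast
    note gx = A.Cmp_arrows[OF x(1) fg(2)]
    let ?w = "plA (g \<cdot> x) (q \<cdot> s)"
    have w: "?w \<in> el Z b" using AP.pl_arrows[OF gx qs] .
    have "g' \<cdot> (p \<cdot> s) = f' \<cdot> (g \<cdot> x)"
      using x(2)[symmetric] A.Cmp_assoc[OF x(1) fg(1,4)] A.Cmp_assoc[OF x(1) fg(2,3)] comm by simp
    then have tw: "t \<star> e = f' \<cdot> ?w" using te AP.Cmp_pl_right[OF gx qs fg(3)] by simp
    \<comment> \<open>What was obtained over the cover \<open>e\<close> descends: \<open>f'\<close>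
      kills \<open>?w \<star> a\<close>, and injectivity makes \<open>?w \<star> a\<close>
      zero.\<close>
    obtain a where a: "coker a e" using SE_coker[OF e(1)] by blast
    have aa: "a \<in> arrows C (Dom C a) b" "Cod C a = b" "Cod C e = c" "e \<bullet> a = nul (Dom C a) c"
      using a e(2) by (auto simp: coker_def arrows_iff)
    have d: "Dom C a \<in> Obj C" using aa(1) arrows_ObjD by blast
    have "f' \<cdot> (?w \<star> a) = zer P (Dom C a)"
      using cmp_act[OF fg(3) w aa(1)] tw[symmetric] act_act[OF t e(2) aa(1)] aa(4) act_nul[OF t d c] by simp
    then have "?w \<star> a = zer Z (Dom C a)" using inj0[OF d act_el[OF w aa(1)]] by simp
    then obtain z where z: "z \<in> el Z c" "?w = z \<star> e" using el_coker[OF a, of ?w Z] w aa by auto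
    have "f' \<cdot> z \<star> e = t \<star> e" using cmp_act[OF fg(3) z(1) e(2)] z(2) tw by simp
    then have "f' \<cdot> z = t" using SE_epi[OF e A.Cmp_arrows[OF z(1) fg(3)] t] by simp
    then show "\<exists>!z. z \<in> el Z c \<and> f' \<cdot> z = t" using z inj[OF c] by blast
  qed
  moreover obtain c where "AP.coker f' c" using cokernel_elements[OF fg(3)] by metis
  ultimately show ?thesis using AP.ker_imp_strict_monic by blast
qed

lemma quasi_abelian: "quasi_abelian A"
  unfolding quasi_abelian_def using pre_abelian strict_monic_pushout strict_epic_pullback by blast

section \<open>Colimits in the completion\<close>

text \<open>The coproduct is cut out of the product by finiteness of the support. This condition
  descends because a component that vanishes after restriction along a cokernel vanishes.\<close>

lemma coproduct_elements:
  fixes I :: "'i set"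
  assumes I: "small TYPE('v) I" and X: "\<And>i. i \<in> I ==> X i \<in> Obj A"
  obtains G incl pr where "G \<in> Obj A" "\<And>i. i \<in> I ==> incl i \<in> arrows A (X i) G"
    "\<And>i. i \<in> I ==> pr i \<in> arrows A G (X i)"
    "\<And>i j c x. i \<in> I ==> j \<in> I ==> c \<in> Obj C ==> x \<in> el (X i) c ==>
       pr j \<cdot> (incl i \<cdot> x) = (if j = i then x else zer (X j) c)"
    "\<And>c z z'. c \<in> Obj C ==> z \<in> el G c ==> z' \<in> el G c ==> (\<And>i. i \<in> I ==> pr i \<cdot> z = pr i \<cdot> z') ==> z = z'"
    "\<And>c z. c \<in> Obj C ==> z \<in> el G c ==> finite {i \<in> I. pr i \<cdot> z \<noteq> zer (X i) c}"
proof -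
  let ?S = "\<lambda>c. {x \<in> \<Pi>\<^sub>E i \<in> I. el (X i) c. finite {i \<in> I. x i \<noteq> zer (X i) c}}"
  obtain G pr where G: "G \<in> Obj A" and pr: "\<And>i. i \<in> I ==> pr i \<in> arrows A G (X i)"
    and prS: "\<And>c z. c \<in> Obj C ==> z \<in> el G c ==> (\<lambda>i \<in> I. pr i \<cdot> z) \<in> ?S c"
    and ex: "\<And>c s. c \<in> Obj C ==> s \<in> ?S c ==> \<exists>!z. z \<in> el G c \<and> (\<forall>i \<in> I. pr i \<cdot> z = s i)"
  proof (rule representable_subproduct[OF I X, where S = ?S])
    show "?S c \<subseteq> (\<Pi>\<^sub>E i \<in> I. el (X i) c)" for c by blast
    show "(\<lambda>i \<in> I. zer (X i) c) \<in> ?S c" if "c \<in> Obj C" for c using zer_el[OF X that] by simp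
  next
    fix c x y assume c: "c \<in> Obj C" and x: "x \<in> ?S c" and y: "y \<in> ?S c"
    have "{i \<in> I. plA (x i) (y i) \<noteq> zer (X i) c} \<subseteq> {i \<in> I. x i \<noteq> zer (X i) c} \<union> {i \<in> I. y i \<noteq> zer (X i) c}"
      using AP.pl_nul[OF zer_el[OF X c]] by auto
    then have "finite {i \<in> I. plA (x i) (y i) \<noteq> zer (X i) c}"
      using x y by (auto intro: finite_subset)
    moreover have "{i \<in> I. (\<lambda>i \<in> I. plA (x i) (y i)) i \<noteq> zer (X i) c} = {i \<in> I. plA (x i) (y i) \<noteq> zer (X i) c}"
      by auto
    moreover have "plA (x i) (y i) \<in> el (X i) c" if "i \<in> I" for i using AP.pl_arrows x y that by blast
    ultimately show "(\<lambda>i \<in> I. plA (x i) (y i)) \<in> ?S c" by simp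
  next
    fix c d x g assume g: "g \<in> arrows C d c" and x: "x \<in> ?S c"
    have "{i \<in> I. x i \<star> g \<noteq> zer (X i) d} \<subseteq> {i \<in> I. x i \<noteq> zer (X i) c}"
      using zer_act[OF X g] by auto
    then have "finite {i \<in> I. x i \<star> g \<noteq> zer (X i) d}" using x by (auto intro: finite_subset)
    moreover have "{i \<in> I. (\<lambda>i \<in> I. x i \<star> g) i \<noteq> zer (X i) d} = {i \<in> I. x i \<star> g \<noteq> zer (X i) d}" by auto
    moreover have "x i \<star> g \<in> el (X i) d" if "i \<in> I" for i using act_el[OF _ g] x that by blast
    ultimately show "(\<lambda>i \<in> I. x i \<star> g) \<in> ?S d" by simp
  next
    fix a q w assume q: "coker a q" and w: "w \<in> (\<Pi>\<^sub>E i \<in> I. el (X i) (Cod C q))"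
      and wq: "(\<lambda>i \<in> I. w i \<star> q) \<in> ?S (Cod C a)"
    have qa: "q \<in> arrows C (Cod C a) (Cod C q)" using q by (auto simp: coker_def arrows_iff)
    have c: "Cod C q \<in> Obj C" using arrows_ObjD qa by blast
    have "{i \<in> I. w i \<noteq> zer (X i) (Cod C q)} \<subseteq> {i \<in> I. (\<lambda>i \<in> I. w i \<star> q) i \<noteq> zer (X i) (Cod C a)}"
    proof (intro subsetI CollectI conjI notI)
      fix i assume i: "i \<in> {i \<in> I. w i \<noteq> zer (X i) (Cod C q)}"
      then show iI: "i \<in> I" by blast
      assume "(\<lambda>i \<in> I. w i \<star> q) i = zer (X i) (Cod C a)"
      then have "w i \<star> q = zer (X i) (Cod C q) \<star> q" using zer_act[OF X[OF iI] qa] iI by simp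
      then have "w i = zer (X i) (Cod C q)"
        using el_coker_epi[OF q PiE_mem[OF w iI] zer_el[OF X[OF iI] c]] by simp
      then show False using i by blast
    qed
    then show "w \<in> ?S (Cod C q)" using w wq by (auto intro: finite_subset)
  qed auto
  have jm: "z = z'" if c: "c \<in> Obj C" and z: "z \<in> el G c" "z' \<in> el G c"
    and eq: "\<And>i. i \<in> I ==> pr i \<cdot> z = pr i \<cdot> z'" for c z z'
  proof -
    have "\<exists>!w. w \<in> el G c \<and> (\<forall>i \<in> I. pr i \<cdot> w = pr i \<cdot> z)" using ex[OF c prS[OF c z(1)]] by simp
    then obtain w where w: "\<And>w'. w' \<in> el G c \<and> (\<forall>i \<in> I. pr i \<cdot> w' = pr i \<cdot> z) ==> w' = w"
      by (rule ex1E) blast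
    have "z = w" by (rule w) (use z in simp)
    moreover have "z' = w" by (rule w) (use z eq in simp)
    ultimately show ?thesis by simp
  qed
  have "\<forall>i \<in> I. \<exists>\<phi>. \<phi> \<in> arrows A (X i) G \<and> (\<forall>c \<in> Obj C. \<forall>x \<in> el (X i) c. \<forall>j \<in> I.
      pr j \<cdot> (\<phi> \<cdot> x) = (if j = i then x else zer (X j) c))"
  proof
    fix i assume i: "i \<in> I"
    have "\<exists>\<phi> \<in> arrows A (X i) G. \<forall>c \<in> Obj C. \<forall>x \<in> el (X i) c. \<forall>j \<in> I.
      pr j \<cdot> (\<phi> \<cdot> x) = (if j = i then x else zer (X j) c)"
    proof (rule arrow_of_rel[OF X[OF i] G])
      fix c x assume c: "c \<in> Obj C" and x: "x \<in> el (X i) c"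
      let ?s = "\<lambda>j \<in> I. if j = i then x else zer (X j) c"
      have "{j \<in> I. ?s j \<noteq> zer (X j) c} \<subseteq> {i}" by auto
      then have "?s \<in> ?S c" using x zer_el[OF X c] by (auto intro: finite_subset)
      from ex[OF c this]
      show "\<exists>!z. z \<in> el G c \<and> (\<forall>j \<in> I. pr j \<cdot> z = (if j = i then x else zer (X j) c))" by simp
    next
      fix c d x z g assume g: "g \<in> arrows C d c" and x: "x \<in> el (X i) c" and z: "z \<in> el G c"
        and R: "\<forall>j \<in> I. pr j \<cdot> z = (if j = i then x else zer (X j) c)"
      show "\<forall>j \<in> I. pr j \<cdot> (z \<star> g) = (if j = i then x \<star> g else zer (X j) d)"
        using R cmp_act[OF pr z g] zer_act[OF X g] by simp
    qed
    then show "\<exists>\<phi>. \<phi> \<in> arrows A (X i) G \<and> (\<forall>c \<in> Obj C. \<forall>x \<in> el (X i) c. \<forall>j \<in> I.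
      pr j \<cdot> (\<phi> \<cdot> x) = (if j = i then x else zer (X j) c))" by blast
  qed
  from bchoice[OF this] obtain incl where incl: "\<forall>i \<in> I. incl i \<in> arrows A (X i) G \<and>
    (\<forall>c \<in> Obj C. \<forall>x \<in> el (X i) c. \<forall>j \<in> I. pr j \<cdot> (incl i \<cdot> x) = (if j = i then x else zer (X j) c))" ..
  show thesis
  proof (rule that[OF G _ pr _ jm])
    show "finite {i \<in> I. pr i \<cdot> z \<noteq> zer (X i) c}" if cz: "c \<in> Obj C" "z \<in> el G c" for c z
    proof -
      have "finite {i \<in> I. (\<lambda>i \<in> I. pr i \<cdot> z) i \<noteq> zer (X i) c}" using prS[OF cz] by blast
      moreover have "{i \<in> I. (\<lambda>i \<in> I. pr i \<cdot> z) i \<noteq> zer (X i) c} = {i \<in> I. pr i \<cdot> z \<noteq> zer (X i) c}" by auto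
      ultimately show ?thesis by simp
    qed
  qed (use incl in auto)
qed

text \<open>Makes the finite products of commutative groups available as finite sums of
  elements.\<close>

abbreviation Grp where "Grp W c \<equiv> \<lparr>carrier = el W c, monoid.mult = plA, one = zer W c\<rparr>"

lemma comm_group_el: "W \<in> Obj A ==> c \<in> Obj C ==> comm_group (Grp W c)"
  using AP.preadditive_structure HO_Obj unfolding preadditive_structure_def by blast

lemma finprod_act:
  assumes W: "W \<in> Obj A" and g: "g \<in> arrows C d c" and "finite J" and t: "\<And>j. j \<in> J ==> t j \<in> el W c"
  shows "finprod (Grp W c) t J \<star> g = finprod (Grp W d) (\<lambda>j. t j \<star> g) J"
  using assms(3) t
proof (induction J rule: finite_induct)
  case empty
  have O: "c \<in> Obj C" "d \<in> Obj C" using arrows_ObjD[OF g] by auto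
  interpret c: comm_group "Grp W c" using comm_group_el W O by blast
  interpret d: comm_group "Grp W d" using comm_group_el W O by blast
  show ?case using zer_act[OF W g] by simp
next
  case (insert j J)
  have O: "c \<in> Obj C" "d \<in> Obj C" using arrows_ObjD[OF g] by auto
  interpret c: comm_group "Grp W c" using comm_group_el W O by blast
  interpret d: comm_group "Grp W d" using comm_group_el W O by blast
  have t: "t j \<in> el W c" "\<And>i. i \<in> J ==> t i \<in> el W c" using insert.prems by auto
  have f: "finprod (Grp W c) t J \<in> el W c" using c.finprod_closed[of t J] t by auto
  have "finprod (Grp W c) t (insert j J) = plA (t j) (finprod (Grp W c) t J)"
    using c.finprod_insert[OF insert.hyps, of t] t by auto
  moreover have "finprod (Grp W d) (\<lambda>j. t j \<star> g) (insert j J) =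
      plA (t j \<star> g) (finprod (Grp W d) (\<lambda>j. t j \<star> g) J)"
    using d.finprod_insert[OF insert.hyps, of "\<lambda>j. t j \<star> g"] act_el[OF _ g] t by auto
  ultimately show ?case using pl_act[OF t(1) f g] insert.IH[OF t(2)] by simp
qed

text \<open>Induction on a finite set containing the support of \<open>z\<close>: subtracting the
  component \<open>incl j \<cdot> (pr j \<cdot> z)\<close> makes it smaller.\<close>

lemma coproduct_ext:
  fixes I :: "'i set"
  assumes G: "G \<in> Obj A" and incl: "\<And>i. i \<in> I ==> incl i \<in> arrows A (X i) G"
    and pr: "\<And>i. i \<in> I ==> pr i \<in> arrows A G (X i)"
    and pr_incl: "\<And>i j c x. i \<in> I ==> j \<in> I ==> c \<in> Obj C ==> x \<in> el (X i) c ==>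
       pr j \<cdot> (incl i \<cdot> x) = (if j = i then x else zer (X j) c)"
    and jm: "\<And>c z z'. c \<in> Obj C ==> z \<in> el G c ==> z' \<in> el G c ==>
      (\<And>i. i \<in> I ==> pr i \<cdot> z = pr i \<cdot> z') ==> z = z'"
    and fin: "\<And>c z. c \<in> Obj C ==> z \<in> el G c ==> finite {i \<in> I. pr i \<cdot> z \<noteq> zer (X i) c}"
    and u: "u \<in> arrows A G W" and v: "v \<in> arrows A G W" and eq: "\<And>i. i \<in> I ==> u \<cdot> incl i = v \<cdot> incl i"
  shows "u = v"
proof (rule arrow_eqI[OF u v])
  fix c z0 assume c: "c \<in> Obj C" and z0: "z0 \<in> el G c"
  have W: "W \<in> Obj A" using u A.arrows_ObjD by blast
  have X: "X i \<in> Obj A" if "i \<in> I" for i using incl[OF that] A.arrows_ObjD by blast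
  have "u \<cdot> z = v \<cdot> z" if "finite J" "z \<in> el G c" "\<And>i. i \<in> I ==> i \<notin> J ==> pr i \<cdot> z = zer (X i) c" for J z
    using that
  proof (induction J arbitrary: z rule: finite_induct)
    case empty
    have "z = zer G c"
      by (rule jm[OF c empty(1) zer_el[OF G c]]) (use empty(2) cmp_zer[OF pr c] in simp)
    then show ?case using cmp_zer[OF u c] cmp_zer[OF v c] by simp
  next
    case (insert j J)
    show ?case
    proof (cases "j \<in> I")
      case False
      then show ?thesis using insert.IH[OF insert.prems(1)] insert.prems(2) by blast
    next
      case True
      let ?x = "pr j \<cdot> z"
      let ?y = "incl j \<cdot> ?x"
      let ?d = "AP.mi z ?y"
      have x: "?x \<in> el (X j) c" using A.Cmp_arrows[OF insert.prems(1) pr[OF True]] .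
      have y: "?y \<in> el G c" using A.Cmp_arrows[OF x incl[OF True]] .
      have d: "?d \<in> el G c" using AP.mi_arrows[OF insert.prems(1) y] .
      have eqd: "u \<cdot> ?d = v \<cdot> ?d"
      proof (rule insert.IH[OF d])
        fix i assume i: "i \<in> I" "i \<notin> J"
        have "pr i \<cdot> ?d = AP.mi (pr i \<cdot> z) (if i = j then ?x else zer (X i) c)"
          using AP.Cmp_mi_right[OF insert.prems(1) y pr[OF i(1)]] pr_incl[OF True i(1) c x] by simp
        also have "\<dots> = zer (X i) c"
          using AP.mi_eq_nul[OF x x] AP.mi_eq_nul[OF zer_el[OF X c] zer_el[OF X c]] i insert.prems(2)
          by auto
        finally show "pr i \<cdot> ?d = zer (X i) c" .
      qed
      have eqy: "u \<cdot> ?y = v \<cdot> ?y"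
        using A.Cmp_assoc[OF x incl[OF True] u] A.Cmp_assoc[OF x incl[OF True] v] eq[OF True] by simp
      have z: "z = plA ?d ?y"
        using AP.pl_assoc[OF insert.prems(1) AP.neg_arrows[OF y] y] AP.pl_neg_left[OF y]
          AP.pl_nul[OF insert.prems(1)] by (simp add: AP.mi_def)
      show ?thesis
        by (subst (1 2) z) (use AP.Cmp_pl_right[OF d y u] AP.Cmp_pl_right[OF d y v] eqd eqy in simp)
    qed
  qed
  from this[OF fin[OF c z0] z0] show "u \<cdot> z0 = v \<cdot> z0" by blast
qed

text \<open>On elements the arrow is the sum of \<open>\<psi> i \<cdot> (pr i \<cdot> z)\<close>
  over the finite support of \<open>z\<close>.\<close>

lemma coproduct_arrow:
  fixes I :: "'i set"
  assumes G: "G \<in> Obj A" and incl: "\<And>i. i \<in> I ==> incl i \<in> arrows A (X i) G"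
    and pr: "\<And>i. i \<in> I ==> pr i \<in> arrows A G (X i)"
    and pr_incl: "\<And>i j c x. i \<in> I ==> j \<in> I ==> c \<in> Obj C ==> x \<in> el (X i) c ==>
       pr j \<cdot> (incl i \<cdot> x) = (if j = i then x else zer (X j) c)"
    and fin: "\<And>c z. c \<in> Obj C ==> z \<in> el G c ==> finite {i \<in> I. pr i \<cdot> z \<noteq> zer (X i) c}"
    and W: "W \<in> Obj A" and \<psi>: "\<And>i. i \<in> I ==> \<psi> i \<in> arrows A (X i) W"
  shows "\<exists>u \<in> arrows A G W. \<forall>i \<in> I. u \<cdot> incl i = \<psi> i"
proof -
  have X: "X i \<in> Obj A" if "i \<in> I" for i using incl[OF that] A.arrows_ObjD by blast
  let ?s = "\<lambda>c z. {i \<in> I. pr i \<cdot> z \<noteq> zer (X i) c}"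
  let ?t = "\<lambda>z i. \<psi> i \<cdot> (pr i \<cdot> z)"
  have t: "?t z i \<in> el W c" if "z \<in> el G c" "i \<in> I" for z i c
    using A.Cmp_arrows[OF A.Cmp_arrows[OF that(1) pr[OF that(2)]] \<psi>[OF that(2)]] .
  have "\<exists>u \<in> arrows A G W. \<forall>c \<in> Obj C. \<forall>z \<in> el G c. u \<cdot> z = finprod (Grp W c) (?t z) (?s c z)"
  proof (rule arrow_ex[OF G W])
    fix c z assume c: "c \<in> Obj C" and z: "z \<in> el G c"
    interpret comm_group "Grp W c" using comm_group_el W c by blast
    show "finprod (Grp W c) (?t z) (?s c z) \<in> el W c"
      using finprod_closed[of "?t z" "?s c z"] t[OF z] by auto
  next
    fix c d z g assume g: "g \<in> arrows C d c" and z: "z \<in> el G c"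
    have O: "c \<in> Obj C" "d \<in> Obj C" using arrows_ObjD[OF g] by auto
    interpret d: comm_group "Grp W d" using comm_group_el W O by blast
    have tg: "?t (z \<star> g) i = ?t z i \<star> g" if "i \<in> I" for i
      using cmp_act[OF pr[OF that] z g] cmp_act[OF \<psi>[OF that] A.Cmp_arrows[OF z pr[OF that]] g] by simp
    \<comment> \<open>Restriction along \<open>g\<close> can only shrink the support, and the
      summands that are lost are zero.\<close>
    have sub: "?s d (z \<star> g) \<subseteq> ?s c z"
      using cmp_act[OF pr z g] zer_act[OF X g] by auto
    have "finprod (Grp W d) (?t (z \<star> g)) (?s d (z \<star> g)) = finprod (Grp W d) (\<lambda>i. ?t z i \<star> g) (?s c z)"
    proof (rule d.finprod_mono_neutral_cong_left[OF fin[OF O(1) z] sub])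
      fix i assume i: "i \<in> ?s c z - ?s d (z \<star> g)"
      then have iI: "i \<in> I" and 0: "pr i \<cdot> (z \<star> g) = zer (X i) d" by blast+
      have "?t z i \<star> g = ?t (z \<star> g) i" using tg[OF iI] by simp
      also have "\<dots> = zer W d" unfolding 0 using cmp_zer[OF \<psi>[OF iI] O(2)] .
      finally show "?t z i \<star> g = \<one>\<^bsub>Grp W d\<^esub>" by simp
    next
      show "?t (z \<star> g) i = ?t z i \<star> g" if "i \<in> ?s d (z \<star> g)" for i using tg that by blast
      show "(\<lambda>i. ?t z i \<star> g) \<in> ?s c z \<rightarrow> carrier (Grp W d)" using act_el[OF t[OF z] g] by auto
    qed
    also have "\<dots> = finprod (Grp W c) (?t z) (?s c z) \<star> g"
      using finprod_act[OF W g fin[OF O(1) z], of "?t z"] t[OF z] by simp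
    finally show "finprod (Grp W d) (?t (z \<star> g)) (?s d (z \<star> g)) = finprod (Grp W c) (?t z) (?s c z) \<star> g" .
  qed
  then obtain u where u: "u \<in> arrows A G W"
    "\<And>c z. c \<in> Obj C ==> z \<in> el G c ==> u \<cdot> z = finprod (Grp W c) (?t z) (?s c z)" by blast
  have "u \<cdot> incl i = \<psi> i" if i: "i \<in> I" for i
  proof (rule arrow_eqI[OF A.Cmp_arrows[OF incl[OF i] u(1)] \<psi>[OF i]])
    fix c x assume c: "c \<in> Obj C" and x: "x \<in> el (X i) c"
    interpret comm_group "Grp W c" using comm_group_el W c by blast
    let ?z = "incl i \<cdot> x"
    have z: "?z \<in> el G c" using A.Cmp_arrows[OF x incl[OF i]] .
    have \<psi>x: "\<psi> i \<cdot> x \<in> el W c" using A.Cmp_arrows[OF x \<psi>[OF i]] .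
    have "finprod (Grp W c) (?t ?z) (?s c ?z) = finprod (Grp W c) (?t ?z) {i}"
    proof (rule finprod_mono_neutral_cong_left)
      show "?s c ?z \<subseteq> {i}" using pr_incl[OF i _ c x] by (auto split: if_splits)
      show "?t ?z j = \<one>\<^bsub>Grp W c\<^esub>" if "j \<in> {i} - ?s c ?z" for j
        using that i cmp_zer[OF \<psi> c] by auto
      show "?t ?z \<in> {i} \<rightarrow> carrier (Grp W c)" using t[OF z i] by simp
    qed simp_all
    also have "\<dots> = \<psi> i \<cdot> x"
      using finprod_insert[of "{}" i "?t ?z"] pr_incl[OF i i c x] \<psi>x AP.pl_nul[OF \<psi>x] by simp
    finally show "u \<cdot> incl i \<cdot> x = \<psi> i \<cdot> x" using u(2)[OF c z] A.Cmp_assoc[OF x incl[OF i] u(1)] by simp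
  qed
  then show ?thesis using u(1) by blast
qed

text \<open>A quotient of the coproduct. The elements divided out are those killed by every arrow
  that comes from a cocone; this family is closed under sums and restriction without any description
  by generators.\<close>

lemma ex_colimit:
  fixes D :: "('i, 'a, 'O, 'M) diagram"
  assumes D: "is_diagram A D" and small: "small_cat TYPE('v) (Shape D)"
  shows "\<exists>X \<phi>. is_colimit A D X \<phi>"
proof -
  interpret S: category "Shape D" using diagram_category[OF D] .
  note DO = diagram_Obj[OF D]
  obtain G incl pr where G: "G \<in> Obj A" and incl: "\<And>i. i \<in> Obj (Shape D) ==> incl i \<in> arrows A (DObj D i) G"
    and pr: "\<And>i. i \<in> Obj (Shape D) ==> pr i \<in> arrows A G (DObj D i)"
    and co: "\<And>i j c x. i \<in> Obj (Shape D) ==> j \<in> Obj (Shape D) ==> c \<in> Obj C ==> x \<in> el (DObj D i) c ==>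
       pr j \<cdot> (incl i \<cdot> x) = (if j = i then x else zer (DObj D j) c)"
      "\<And>c z z'. c \<in> Obj C ==> z \<in> el G c ==> z' \<in> el G c ==>
        (\<And>i. i \<in> Obj (Shape D) ==> pr i \<cdot> z = pr i \<cdot> z') ==> z = z'"
      "\<And>c z. c \<in> Obj C ==> z \<in> el G c ==> finite {i \<in> Obj (Shape D). pr i \<cdot> z \<noteq> zer (DObj D i) c}"
    by (rule coproduct_elements[of "Obj (Shape D)" "DObj D"]) (use small DO in \<open>auto simp: small_cat_def\<close>)
  have ext: "u = v" if "u \<in> arrows A G W" "v \<in> arrows A G W"
    "\<And>i. i \<in> Obj (Shape D) ==> u \<cdot> incl i = v \<cdot> incl i" for u v W
    using G incl pr co that by (rule coproduct_ext)
  have arr: "\<exists>u \<in> arrows A G W. \<forall>i \<in> Obj (Shape D). u \<cdot> incl i = \<psi> i"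
    if "W \<in> Obj A" "\<And>i. i \<in> Obj (Shape D) ==> \<psi> i \<in> arrows A (DObj D i) W" for W \<psi>
    using G incl pr co(1,3) that by (rule coproduct_arrow)
  \<comment> \<open>\<open>good \<psi>\<close> says that the composites of \<open>\<psi>\<close>
    with the inclusions form a cocone over the diagram.\<close>
  define good where "good \<psi> \<longleftrightarrow> (\<forall>a i j. a \<in> arrows (Shape D) i j \<longrightarrow> \<psi> \<cdot> incl j \<cdot> DArr D a = \<psi> \<cdot> incl i)" for \<psi>
  let ?S = "\<lambda>c. {y \<in> el G c. \<forall>W \<psi>. \<psi> \<in> arrows A G W \<and> good \<psi> \<longrightarrow> \<psi> \<cdot> y = zer W c}"
  obtain Q \<pi> where Q: "Q \<in> Obj A" "\<pi> \<in> arrows A G Q"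
    and kill: "\<And>c s. c \<in> Obj C ==> s \<in> ?S c ==> \<pi> \<cdot> s = zer Q c"
    and univ: "\<And>W \<psi>. \<psi> \<in> arrows A G W ==> (\<And>c s. c \<in> Obj C ==> s \<in> ?S c ==> \<psi> \<cdot> s = zer W c) ==>
       \<exists>!u. u \<in> arrows A Q W \<and> u \<cdot> \<pi> = \<psi>"
  proof (rule quotient[OF G, of ?S])
    show "?S c \<subseteq> el G c" for c by blast
    show "zer G c \<in> ?S c" if "c \<in> Obj C" for c using zer_el[OF G that] cmp_zer[OF _ that] by blast
    show "plA x y \<in> ?S c" if c: "c \<in> Obj C" and xS: "x \<in> ?S c" and yS: "y \<in> ?S c" for c x y
    proof -
      have xy: "x \<in> el G c" "y \<in> el G c" using xS yS by auto
      have "\<psi> \<cdot> plA x y = zer W c" if \<psi>: "\<psi> \<in> arrows A G W" "good \<psi>" for \<psi> W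
      proof -
        have "\<psi> \<cdot> x = zer W c" "\<psi> \<cdot> y = zer W c" "W \<in> Obj A" using xS yS \<psi> A.arrows_ObjD by blast+
        then show ?thesis using AP.Cmp_pl_right[OF xy \<psi>(1)] AP.pl_nul[OF zer_el[OF _ c]] by simp
      qed
      then show ?thesis using AP.pl_arrows[OF xy] by blast
    qed
    show "x \<star> g \<in> ?S d" if g: "g \<in> arrows C d c" and xS: "x \<in> ?S c" for c d x g
    proof -
      have x: "x \<in> el G c" using xS by auto
      have "\<psi> \<cdot> (x \<star> g) = zer W d" if \<psi>: "\<psi> \<in> arrows A G W" "good \<psi>" for \<psi> W
      proof -
        have "\<psi> \<cdot> x = zer W c" "W \<in> Obj A" using xS \<psi> A.arrows_ObjD by blast+
        then show ?thesis using cmp_act[OF \<psi>(1) x g] zer_act[OF _ g] by simp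
      qed
      then show ?thesis using act_el[OF x g] by blast
    qed
  qed blast
  have \<pi>incl: "\<pi> \<cdot> incl i \<in> arrows A (DObj D i) Q" if "i \<in> Obj (Shape D)" for i
    using A.Cmp_arrows[OF incl[OF that] Q(2)] .
  have good_\<pi>: "\<pi> \<cdot> incl j \<cdot> DArr D a = \<pi> \<cdot> incl i" if a: "a \<in> arrows (Shape D) i j" for a i j
  proof -
    have I: "i \<in> Obj (Shape D)" "j \<in> Obj (Shape D)" using S.arrows_ObjD[OF a] by auto
    have aA: "DArr D a \<in> arrows A (DObj D i) (DObj D j)" using diagram_arrows[OF D a] .
    show ?thesis
    proof (rule arrow_eqI[OF A.Cmp_arrows[OF aA \<pi>incl[OF I(2)]] \<pi>incl[OF I(1)]])
      fix c x assume c: "c \<in> Obj C" and x: "x \<in> el (DObj D i) c"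
      note ax = A.Cmp_arrows[OF x aA]
      note jax = A.Cmp_arrows[OF ax incl[OF I(2)]] and ix = A.Cmp_arrows[OF x incl[OF I(1)]]
      let ?d = "AP.mi (incl j \<cdot> (DArr D a \<cdot> x)) (incl i \<cdot> x)"
      have "\<psi> \<cdot> ?d = zer W c" if \<psi>: "\<psi> \<in> arrows A G W" "good \<psi>" for W \<psi>
      proof -
        have "\<psi> \<cdot> incl j \<cdot> DArr D a = \<psi> \<cdot> incl i" using \<psi>(2) a unfolding good_def by blast
        then have "\<psi> \<cdot> (incl j \<cdot> (DArr D a \<cdot> x)) = \<psi> \<cdot> (incl i \<cdot> x)"
          using A.Cmp_assoc[OF ax incl[OF I(2)] \<psi>(1)] A.Cmp_assoc[OF x incl[OF I(1)] \<psi>(1)]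
            A.Cmp_assoc[OF x aA A.Cmp_arrows[OF incl[OF I(2)] \<psi>(1)]] by simp
        then show ?thesis
          using AP.Cmp_mi_right[OF jax ix \<psi>(1)]
            AP.mi_eq_nul[OF A.Cmp_arrows[OF jax \<psi>(1)] A.Cmp_arrows[OF ix \<psi>(1)]] by simp
      qed
      then have "?d \<in> ?S c" using AP.mi_arrows[OF jax ix] by blast
      from kill[OF c this] have "\<pi> \<cdot> (incl j \<cdot> (DArr D a \<cdot> x)) = \<pi> \<cdot> (incl i \<cdot> x)"
        using AP.Cmp_mi_right[OF jax ix Q(2)]
          AP.mi_eq_nul[OF A.Cmp_arrows[OF jax Q(2)] A.Cmp_arrows[OF ix Q(2)]] by simp
      then show "\<pi> \<cdot> incl j \<cdot> DArr D a \<cdot> x = \<pi> \<cdot> incl i \<cdot> x"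
        using A.Cmp_assoc[OF ax incl[OF I(2)] Q(2)] A.Cmp_assoc[OF x incl[OF I(1)] Q(2)]
            A.Cmp_assoc[OF x aA \<pi>incl[OF I(2)]] by simp
    qed
  qed
  have "is_colimit A D Q (\<lambda>i. \<pi> \<cdot> incl i)"
    unfolding is_colimit_def
  proof (intro conjI allI impI)
    show "is_cocone A D Q (\<lambda>i. \<pi> \<cdot> incl i)"
      using Q(1) \<pi>incl good_\<pi>[OF Arr_arrows] by (simp add: is_cocone_def)
    fix Y \<phi> assume "is_cocone A D Y \<phi>"
    then have Y: "Y \<in> Obj A" and \<phi>: "\<And>i. i \<in> Obj (Shape D) ==> \<phi> i \<in> arrows A (DObj D i) Y"
      and \<phi>a: "\<And>a i j. a \<in> arrows (Shape D) i j ==> \<phi> j \<cdot> DArr D a = \<phi> i"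
      unfolding is_cocone_def by (auto simp: arrows_iff)
    obtain \<psi> where \<psi>: "\<psi> \<in> arrows A G Y" "\<forall>i \<in> Obj (Shape D). \<psi> \<cdot> incl i = \<phi> i"
      using arr[where \<psi> = \<phi>, OF Y \<phi>] by blast
    have "good \<psi>" unfolding good_def using \<psi>(2) \<phi>a S.arrows_ObjD by metis
    then have "\<exists>!u. u \<in> arrows A Q Y \<and> u \<cdot> \<pi> = \<psi>" using univ[OF \<psi>(1)] \<psi>(1) by blast
    moreover have "u \<cdot> \<pi> = \<psi> \<longleftrightarrow> (\<forall>i \<in> Obj (Shape D). u \<cdot> (\<pi> \<cdot> incl i) = \<phi> i)" if u: "u \<in> arrows A Q Y" for u
    proof
      show "\<forall>i \<in> Obj (Shape D). u \<cdot> (\<pi> \<cdot> incl i) = \<phi> i" if "u \<cdot> \<pi> = \<psi>"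
        using A.Cmp_assoc[OF incl Q(2) u] \<psi>(2) that by simp
      show "u \<cdot> \<pi> = \<psi>" if "\<forall>i \<in> Obj (Shape D). u \<cdot> (\<pi> \<cdot> incl i) = \<phi> i"
        by (rule ext[OF A.Cmp_arrows[OF Q(2) u] \<psi>(1)])
          (use A.Cmp_assoc[OF incl Q(2) u] \<psi>(2) that in auto)
    qed
    ultimately show "\<exists>!u. u \<in> arrows A Q Y \<and> (\<forall>i \<in> Obj (Shape D). u \<cdot> (\<pi> \<cdot> incl i) = \<phi> i)"
      by (simp only: cong: conj_cong)
  qed
  then show ?thesis by blast
qed

end

section \<open>Filtered categories and cardinals\<close>

text \<open>The order of the natural numbers, carried into \<open>'v\<close> by an injection. Being
  smaller than it means being finite.\<close>

lemma small_regular_cardinal_exists: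
  assumes "grothendieck_universe TYPE('v)"
  shows "\<exists>r :: 'v rel. small_regular_cardinal r \<and> (\<forall>A :: 'a set. |A| <o r \<longleftrightarrow> finite A)"
proof -
  have nat: "|UNIV :: nat set| <o |UNIV :: 'v set|"
    using assms by (simp add: grothendieck_universe_def small_def)
  then obtain e :: "nat \<Rightarrow> 'v" where e: "inj e"
    using card_of_ordLeq[of "UNIV :: nat set" "UNIV :: 'v set"] ordLess_imp_ordLeq by blast
  let ?r = "dir_image natLeq e"
  have iso: "natLeq =o ?r"
    using dir_image_ordIso[OF natLeq_Well_order] e by (simp add: Field_natLeq)
  have C: "Cinfinite ?r"
    using Cinfinite_cong[OF iso natLeq_Cinfinite] .
  have "regularCard ?r" using regularCard_ordIso[OF iso natLeq_Cinfinite regularCard_natLeq] .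
  moreover have "?r <o |UNIV :: 'v set|"
    using ordIso_ordLess_trans[OF ordIso_symmetric[OF iso]]
      ordIso_ordLess_trans[OF ordIso_symmetric[OF card_of_nat] nat] by blast
  moreover have "|A| <o ?r \<longleftrightarrow> finite A" for A :: "'a set"
    using ordLess_ordIso_trans[OF _ iso] ordLess_ordIso_trans[OF _ ordIso_symmetric[OF iso]]
      finite_iff_ordLess_natLeq by blast
  ultimately show ?thesis using C unfolding small_regular_cardinal_def by blast
qed

text \<open>Two inductions: an upper bound of the finitely many objects, then an arrow out of it
  that equalizes the finitely many pairs of composites. The objects are finite in number because
  their identities are distinct arrows.\<close>

lemma filtered_finite_cocone:
  fixes I :: "('i, 'a) cat" and D :: "('j, 'b, 'i, 'a) diagram"
  assumes F: "filtered I" and D: "is_diagram I D" and fin: "finite (Arr (Shape D))"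
  shows "\<exists>i \<psi>. is_cocone I D i \<psi>"
proof -
  interpret I: category I using filtered_category[OF F] .
  interpret J: category "Shape D" using diagram_category[OF D] .
  have "inj_on (Idn (Shape D)) (Obj (Shape D))" by (metis J.Idn_Arr(2) inj_onI)
  moreover have "Idn (Shape D) ` Obj (Shape D) \<subseteq> Arr (Shape D)" using J.Idn_Arr(1) by blast
  ultimately have finO: "finite (Obj (Shape D))" using fin inj_on_finite by blast
  have "\<exists>m \<psi>. m \<in> Obj I \<and> (\<forall>i \<in> Ob. \<psi> i \<in> arrows I (DObj D i) m)"
    if "finite Ob" "Ob \<subseteq> Obj (Shape D)" for Ob
    using that
  proof (induction Ob rule: finite_induct)
    case empty
    show ?case using F by (auto simp: filtered_def)
  next
    case (insert j Ob)
    then obtain m \<psi> where m: "m \<in> Obj I" "\<forall>i \<in> Ob. \<psi> i \<in> arrows I (DObj D i) m" by auto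
    have "DObj D j \<in> Obj I" using diagram_Obj[OF D] insert.prems by blast
    then obtain l a b where ab: "a \<in> arrows I m l" "b \<in> arrows I (DObj D j) l"
      using filtered_ub[OF F m(1)] by blast
    have "\<forall>i \<in> insert j Ob. (if i = j then b else Cmp I a (\<psi> i)) \<in> arrows I (DObj D i) l"
      using m(2) ab I.Cmp_arrows by auto
    then show ?case using I.arrows_ObjD[OF ab(1)] by (intro exI[of _ l] exI[of _ "\<lambda>i. if i = j then b else Cmp I a (\<psi> i)"]) blast
  qed
  from this[OF finO] obtain m \<psi> where m: "m \<in> Obj I"
    and \<psi>: "\<And>i. i \<in> Obj (Shape D) ==> \<psi> i \<in> arrows I (DObj D i) m" by blast
  let ?p = "\<lambda>a. Cmp I (\<psi> (Cod (Shape D) a)) (DArr D a)" and ?q = "\<lambda>a. \<psi> (Dom (Shape D) a)"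
  have pq: "?p a \<in> arrows I (DObj D (Dom (Shape D) a)) m" "?q a \<in> arrows I (DObj D (Dom (Shape D) a)) m"
    if "a \<in> Arr (Shape D)" for a
    using I.Cmp_arrows[OF diagram_arrows[OF D Arr_arrows[OF that]] \<psi>[OF J.Cod_Obj[OF that]]]
      \<psi>[OF J.Dom_Obj[OF that]] by auto
  have "\<exists>n c. c \<in> arrows I m n \<and> (\<forall>a \<in> B. Cmp I c (?p a) = Cmp I c (?q a))"
    if "finite B" "B \<subseteq> Arr (Shape D)" for B
    using that
  proof (induction B rule: finite_induct)
    case empty
    show ?case using I.Idn_arrows[OF m] by blast
  next
    case (insert b B)
    then obtain n c where c: "c \<in> arrows I m n" "\<forall>a \<in> B. Cmp I c (?p a) = Cmp I c (?q a)" by auto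
    have b: "b \<in> Arr (Shape D)" using insert.prems by blast
    obtain l d where d: "d \<in> arrows I n l" "Cmp I d (Cmp I c (?p b)) = Cmp I d (Cmp I c (?q b))"
      using filtered_eq[OF F I.Cmp_arrows[OF pq(1)[OF b] c(1)] I.Cmp_arrows[OF pq(2)[OF b] c(1)]] by blast
    have "Cmp I (Cmp I d c) (?p a) = Cmp I (Cmp I d c) (?q a)" if a: "a \<in> insert b B" for a
    proof -
      have "a \<in> Arr (Shape D)" using a insert.prems by blast
      note pqa = pq[OF this]
      show ?thesis
        using I.Cmp_assoc[OF pqa(1) c(1) d(1)] I.Cmp_assoc[OF pqa(2) c(1) d(1)] c(2) d(2) a by auto
    qed
    then show ?case using I.Cmp_arrows[OF c(1) d(1)] by blast
  qed
  from this[OF fin] obtain n c where c: "c \<in> arrows I m n"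
    "\<And>a. a \<in> Arr (Shape D) ==> Cmp I c (?p a) = Cmp I c (?q a)" by blast
  have "is_cocone I D n (\<lambda>i. Cmp I c (\<psi> i))"
    unfolding is_cocone_def
  proof (intro conjI ballI)
    show "n \<in> Obj I" using I.arrows_ObjD[OF c(1)] by blast
    show "Cmp I c (\<psi> i) \<in> arrows I (DObj D i) n" if "i \<in> Obj (Shape D)" for i
      using I.Cmp_arrows[OF \<psi>[OF that] c(1)] .
    fix a assume a: "a \<in> Arr (Shape D)"
    show "Cmp I (Cmp I c (\<psi> (Cod (Shape D) a))) (DArr D a) = Cmp I c (\<psi> (Dom (Shape D) a))"
      using I.Cmp_assoc[OF diagram_arrows[OF D Arr_arrows[OF a]] \<psi>[OF J.Cod_Obj[OF a]] c(1)] c(2)[OF a]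
      by simp
  qed
  then show ?thesis by blast
qed

text \<open>Finite discrete shapes provide nonemptiness and upper bounds, and a parallel pair
  provides equalizing arrows.\<close>

lemma finite_cocones_imp_filtered:
  fixes I :: "('v, 'v) cat"
  assumes "infinite (UNIV :: 'v set)" and cat: "category I"
    and cocones: "\<And>D :: ('v, 'v, 'v, 'v) diagram. is_diagram I D ==> finite (Arr (Shape D)) ==>
      \<exists>i \<psi>. is_cocone I D i \<psi>"
  shows "filtered I"
proof -
  interpret category I by (rule cat)
  have disc: "\<exists>m. m \<in> Obj I \<and> (\<forall>i \<in> S. arrows I i m \<noteq> {})" if S: "finite S" "S \<subseteq> Obj I" for S
  proof -
    let ?J = "\<lparr>Obj = S, Arr = S, Dom = \<lambda>i. i, Cod = \<lambda>i. i, Idn = \<lambda>i. i, Cmp = \<lambda>i j. i\<rparr> :: ('v, 'v) cat"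
    let ?D = "\<lparr>Shape = ?J, DObj = \<lambda>i. i, DArr = Idn I\<rparr> :: ('v, 'v, 'v, 'v) diagram"
    have J: "category ?J" by unfold_locales (auto simp: arrows_def)
    have "is_diagram I ?D"
      using J S Idn_arrows Cmp_Idn_left[OF Idn_arrows] by (auto simp: is_diagram_def)
    then obtain i \<psi> where "is_cocone I ?D i \<psi>" using cocones[of ?D] S by auto
    then show ?thesis by (auto simp: is_cocone_def)
  qed
  show ?thesis
    unfolding filtered_def
  proof (intro conjI ballI)
    show "category I" by (rule cat)
    show "Obj I \<noteq> {}" using disc[of "{}"] by auto
    fix i j assume ij: "i \<in> Obj I" "j \<in> Obj I"
    show "\<exists>l a b. a \<in> arrows I i l \<and> b \<in> arrows I j l" using disc[of "{i, j}"] ij by auto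
    fix a b assume a: "a \<in> arrows I i j" and b: "b \<in> arrows I i j"
    obtain e :: "nat \<Rightarrow> 'v" where e: "inj e"
      using infinite_countable_subset[OF assms(1)] by blast
    have e_eq: "e m = e n \<longleftrightarrow> m = n" for m n using e by (auto dest: injD)
    \<comment> \<open>Four distinct points of \<open>'v\<close>: \<open>e 0\<close> and
      \<open>e 1\<close> are the objects and their own identities, \<open>e 2\<close> and
      \<open>e 3\<close> the parallel arrows from \<open>e 0\<close> to \<open>e 1\<close>.\<close>
    let ?dom = "\<lambda>x. if x = e 1 then e 1 else e 0"
    let ?cod = "\<lambda>x. if x = e 0 then e 0 else e 1"
    let ?J = "\<lparr>Obj = {e 0, e 1}, Arr = {e 0, e 1, e 2, e 3}, Dom = ?dom, Cod = ?cod,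
      Idn = \<lambda>x. x, Cmp = \<lambda>y x. if y = e 0 \<or> y = e 1 then x else y\<rparr> :: ('v, 'v) cat"
    let ?F = "\<lambda>x. if x = e 0 then i else j"
    let ?D = "\<lparr>Shape = ?J, DObj = ?F,
      DArr = \<lambda>x. if x = e 0 then Idn I i else if x = e 1 then Idn I j else if x = e 2 then a else b\<rparr>
      :: ('v, 'v, 'v, 'v) diagram"
    have J: "category ?J" by unfold_locales (auto simp: arrows_def e_eq split: if_splits)
    have "is_diagram I ?D"
      using J ij a b Idn_arrows Cmp_Idn_left[OF Idn_arrows] Cmp_Idn_left[OF a] Cmp_Idn_left[OF b]
        Cmp_Idn_right[OF a] Cmp_Idn_right[OF b] by (auto simp: is_diagram_def e_eq)
    then obtain l \<psi> where "is_cocone I ?D l \<psi>" using cocones[of ?D] by auto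
    then have "\<psi> (e 1) \<in> arrows I j l" "Cmp I (\<psi> (e 1)) a = \<psi> (e 0)" "Cmp I (\<psi> (e 1)) b = \<psi> (e 0)"
      by (auto simp: is_cocone_def e_eq)
    then show "\<exists>l c. c \<in> arrows I j l \<and> Cmp I c a = Cmp I c b" by metis
  qed
qed

context completion
begin

section \<open>Filtered colimits in the completion\<close>

text \<open>The elements of all the objects \<open>DObj D i\<close> together form a filtered
  category. Its realization \<open>X'\<close> has the required elements by construction, and the
  given colimit \<open>X\<close> is compared with it by arrows in both directions.\<close>

lemma filtered_colimit_elements:
  fixes D :: "('i, 'a, 'O, 'M) diagram"
  assumes D: "is_diagram A D" and F: "filtered (Shape D)" and small: "small_cat TYPE('v) (Shape D)"
    and colim: "is_colimit A D X \<phi>" and c: "c \<in> Obj C"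
  shows "x \<in> el X c ==> \<exists>i \<in> Obj (Shape D). \<exists>y \<in> el (DObj D i) c. x = \<phi> i \<cdot> y"
    and "i \<in> Obj (Shape D) ==> j \<in> Obj (Shape D) ==> y \<in> el (DObj D i) c ==> z \<in> el (DObj D j) c ==>
      \<phi> i \<cdot> y = \<phi> j \<cdot> z ==>
      \<exists>m a b. a \<in> arrows (Shape D) i m \<and> b \<in> arrows (Shape D) j m \<and> DArr D a \<cdot> y = DArr D b \<cdot> z"
proof -
  interpret S: category "Shape D" using diagram_category[OF D] .
  note DO = diagram_Obj[OF D] and DA = diagram_arrows[OF D]

  \<comment> \<open>The category of elements of a filtered diagram\<close>
  let ?Ob = "{(i, c, x). i \<in> Obj (Shape D) \<and> c \<in> Obj C \<and> x \<in> el (DObj D i) c}"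
  \<comment> \<open>An arrow consists of an arrow of the shape and a restriction in
    \<open>C\<close>, as in the Grothendieck construction applied to the categories of
    elements.\<close>
  let ?hm = "\<lambda>(i, c, x) (j, d, y). {(a, g). a \<in> arrows (Shape D) i j \<and> g \<in> arrows C c d \<and>
     DArr D a \<cdot> x = y \<star> g}"
  interpret T: triples ?Ob ?hm "\<lambda>(i, c, x). (Idn (Shape D) i, Idn C c)"
    "\<lambda>(b, h) (a, g). (Cmp (Shape D) b a, h \<bullet> g)"
  proof
    fix k assume "k \<in> ?Ob"
    then obtain i c x where k: "k = (i, c, x)" "i \<in> Obj (Shape D)" "c \<in> Obj C" "x \<in> el (DObj D i) c" by auto
    show "(case k of (i, c, x) \<Rightarrow> (Idn (Shape D) i, Idn C c)) \<in> ?hm k k"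
      using k S.Idn_arrows Idn_arrows diagram_Idn[OF D k(2)] act_Idn[OF k(3,4)] A.Cmp_Idn_left[OF k(4)]
      by simp
  next
    fix s k l t m assume s: "s \<in> ?hm k l" and t: "t \<in> ?hm l m" and "k \<in> ?Ob" "l \<in> ?Ob" "m \<in> ?Ob"
    then obtain i c x j d y n f z a g b h where [simp]: "k = (i, c, x)" "l = (j, d, y)" "m = (n, f, z)"
      "s = (a, g)" "t = (b, h)" by (cases k, cases l, cases m, cases s, cases t) blast
    have *: "a \<in> arrows (Shape D) i j" "g \<in> arrows C c d" "DArr D a \<cdot> x = y \<star> g"
      "b \<in> arrows (Shape D) j n" "h \<in> arrows C d f" "DArr D b \<cdot> y = z \<star> h"
      "x \<in> el (DObj D i) c" "y \<in> el (DObj D j) d" "z \<in> el (DObj D n) f"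
      using s t \<open>k \<in> ?Ob\<close> \<open>l \<in> ?Ob\<close> \<open>m \<in> ?Ob\<close> by auto
    have "DArr D (Cmp (Shape D) b a) \<cdot> x = DArr D b \<cdot> (y \<star> g)"
      using diagram_Cmp[OF D *(1,4)] A.Cmp_assoc[OF *(7) DA[OF *(1)] DA[OF *(4)]] *(3) by simp
    also have "\<dots> = z \<star> (h \<bullet> g)"
      using cmp_act[OF DA[OF *(4)] *(8,2)] *(6) act_act[OF *(9,5,2)] by simp
    finally show "(case t of (b, h) \<Rightarrow> \<lambda>(a, g). (Cmp (Shape D) b a, h \<bullet> g)) s \<in> ?hm k m"
      using S.Cmp_arrows[OF *(1,4)] Cmp_arrows[OF *(2,5)] by simp
  next
    fix s k l assume "s \<in> ?hm k l"
    then show "(case s of (b, h) \<Rightarrow> \<lambda>(a, g). (Cmp (Shape D) b a, h \<bullet> g))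
          (case k of (i, c, x) \<Rightarrow> (Idn (Shape D) i, Idn C c)) = s \<and>
        (case case l of (i, c, x) \<Rightarrow> (Idn (Shape D) i, Idn C c) of
          (b, h) \<Rightarrow> \<lambda>(a, g). (Cmp (Shape D) b a, h \<bullet> g)) s = s"
      using S.Cmp_Idn_left S.Cmp_Idn_right Cmp_Idn_left Cmp_Idn_right by (auto split: prod.splits)
  next
    fix s k l t m r n assume "s \<in> ?hm k l" "t \<in> ?hm l m" "r \<in> ?hm m n"
    then show "(case r of (b, h) \<Rightarrow> \<lambda>(a, g). (Cmp (Shape D) b a, h \<bullet> g))
         ((case t of (b, h) \<Rightarrow> \<lambda>(a, g). (Cmp (Shape D) b a, h \<bullet> g)) s) =
       (case (case r of (b, h) \<Rightarrow> \<lambda>(a, g). (Cmp (Shape D) b a, h \<bullet> g)) t of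
         (b, h) \<Rightarrow> \<lambda>(a, g). (Cmp (Shape D) b a, h \<bullet> g)) s"
      using S.Cmp_assoc Cmp_assoc by (auto split: prod.splits)
  qed
  let ?E = "\<lparr>Shape = T.T, DObj = (\<lambda>(i, c, x). c), DArr = (\<lambda>(_, (_, g), _). g)\<rparr>
    :: ('i \<times> 'o \<times> 'M, _, 'o, 'm) diagram"
  have E: "is_diagram C ?E" by (rule T.diagram_triple) auto
  have filt: "filtered (Shape ?E)"
    unfolding diagram.simps
  proof (rule T.filtered_triple)
    obtain i where i: "i \<in> Obj (Shape D)" using F by (auto simp: filtered_def)
    obtain c x where "c \<in> Obj C" "x \<in> el (DObj D i) c" using el_nonempty[OF DO[OF i]] .
    then have "(i, c, x) \<in> ?Ob" using i by blast
    then show "?Ob \<noteq> {}" by blast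
  next
    fix k l assume "k \<in> ?Ob" "l \<in> ?Ob"
    then obtain i c x j d y where k: "k = (i, c, x)" "i \<in> Obj (Shape D)" "c \<in> Obj C" "x \<in> el (DObj D i) c"
      and l: "l = (j, d, y)" "j \<in> Obj (Shape D)" "d \<in> Obj C" "y \<in> el (DObj D j) d" by blast
    obtain m a b where ab: "a \<in> arrows (Shape D) i m" "b \<in> arrows (Shape D) j m"
      using filtered_ub[OF F k(2) l(2)] by blast
    have m: "m \<in> Obj (Shape D)" using ab S.arrows_ObjD by blast
    obtain e w f g where e: "e \<in> Obj C" "w \<in> el (DObj D m) e" "f \<in> arrows C c e" "g \<in> arrows C d e"
      "DArr D a \<cdot> x = w \<star> f" "DArr D b \<cdot> y = w \<star> g"
      using common[OF DO[OF m] k(3) l(3) A.Cmp_arrows[OF k(4) DA[OF ab(1)]] A.Cmp_arrows[OF l(4) DA[OF ab(2)]]] .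
    have "(m, e, w) \<in> ?Ob" using m e by blast
    moreover have "(a, f) \<in> ?hm k (m, e, w)" "(b, g) \<in> ?hm l (m, e, w)" using k l ab e by auto
    ultimately show "\<exists>m\<in>?Ob. ?hm k m \<noteq> {} \<and> ?hm l m \<noteq> {}" by blast
  next
    fix k l s t assume kl: "k \<in> ?Ob" "l \<in> ?Ob" and st: "s \<in> ?hm k l" "t \<in> ?hm k l"
    obtain i c x j d y a f b g where eqs: "k = (i, c, x)" "l = (j, d, y)" "s = (a, f)" "t = (b, g)"
      by (cases k, cases l, cases s, cases t) blast
    have *: "a \<in> arrows (Shape D) i j" "f \<in> arrows C c d" "DArr D a \<cdot> x = y \<star> f"
      "b \<in> arrows (Shape D) i j" "g \<in> arrows C c d" "DArr D b \<cdot> x = y \<star> g"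
      "x \<in> el (DObj D i) c" "y \<in> el (DObj D j) d" "d \<in> Obj C" using kl st eqs by auto
    obtain n u where u: "u \<in> arrows (Shape D) j n" "Cmp (Shape D) u a = Cmp (Shape D) u b"
      using filtered_eq[OF F *(1,4)] by blast
    have n: "n \<in> Obj (Shape D)" using u S.arrows_ObjD by blast
    let ?y = "DArr D u \<cdot> y"
    have y: "?y \<in> el (DObj D n) d" using A.Cmp_arrows[OF *(8) DA[OF u(1)]] .
    have "?y \<star> f = DArr D (Cmp (Shape D) u a) \<cdot> x"
      using cmp_act[OF DA[OF u(1)] *(8,2)] *(3) A.Cmp_assoc[OF *(7) DA[OF *(1)] DA[OF u(1)]]
        diagram_Cmp[OF D *(1) u(1)] by simp
    moreover have "?y \<star> g = DArr D (Cmp (Shape D) u b) \<cdot> x"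
      using cmp_act[OF DA[OF u(1)] *(8,5)] *(6) A.Cmp_assoc[OF *(7) DA[OF *(4)] DA[OF u(1)]]
        diagram_Cmp[OF D *(4) u(1)] by simp
    ultimately have "?y \<star> f = ?y \<star> g" using u(2) by simp
    then obtain d' v w where v: "v \<in> arrows C d d'" "w \<in> el (DObj D n) d'" "?y = w \<star> v" "v \<bullet> f = v \<bullet> g"
      using equalize[OF y *(9,2,5)] by blast
    have "(n, d', w) \<in> ?Ob" using n v arrows_ObjD by blast
    moreover have "(u, v) \<in> ?hm l (n, d', w)" using u v eqs by simp
    moreover have "(case (u, v) of (b, h) \<Rightarrow> \<lambda>(a, g). (Cmp (Shape D) b a, h \<bullet> g)) s =
        (case (u, v) of (b, h) \<Rightarrow> \<lambda>(a, g). (Cmp (Shape D) b a, h \<bullet> g)) t"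
      using u(2) v(4) eqs by simp
    ultimately show "\<exists>m\<in>?Ob. \<exists>h\<in>?hm l m. (case h of (b, h) \<Rightarrow> \<lambda>(a, g). (Cmp (Shape D) b a, h \<bullet> g)) s =
        (case h of (b, h) \<Rightarrow> \<lambda>(a, g). (Cmp (Shape D) b a, h \<bullet> g)) t" by blast
  qed
  have small_T: "small_cat TYPE('v) (Shape ?E)"
    unfolding diagram.simps
  proof (rule T.small_triple)
    show "universe TYPE('v)" by unfold_locales
    have sm: "small TYPE('v) (Obj (Shape D))" "small TYPE('v) (Arr (Shape D))"
      using small by (auto simp: small_cat_def)
    have "small TYPE('v) (Sigma (Obj (Shape D)) (\<lambda>i. Sigma (Obj C) (el (DObj D i))))"
      using small_el[OF DO] by (intro small_Sigma sm small_Obj)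
    then show "small TYPE('v) ?Ob" by (rule small_subset[rotated]) auto
    show "small TYPE('v) (?hm k l)" for k l
      by (rule small_subset[OF _ small_Times[OF sm(2) small_Arr]]) (auto simp: arrows_iff split: prod.splits)
  qed
  obtain X' \<iota> where P: "presents TYPE('v) C A HO H ?E X' \<iota>" using realized[OF E filt small_T] by blast
  have X': "X' \<in> Obj A" using presents_Obj[OF P] .
  have OE: "Obj (Shape ?E) = ?Ob" by (simp only: diagram.simps T.Obj_triple)
  have \<iota>: "\<iota> (i, c, x) \<in> el X' c" if "i \<in> Obj (Shape D)" "c \<in> Obj C" "x \<in> el (DObj D i) c" for i c x
    using presents_arrows[OF P, of "(i, c, x)", unfolded OE] that by simp
  have cocone: "\<iota> (j, d, y) \<star> g = \<iota> (i, c, x)"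
    if "i \<in> Obj (Shape D)" "c \<in> Obj C" "x \<in> el (DObj D i) c" "j \<in> Obj (Shape D)" "d \<in> Obj C"
      "y \<in> el (DObj D j) d" "a \<in> arrows (Shape D) i j" "g \<in> arrows C c d" "DArr D a \<cdot> x = y \<star> g"
    for i c x j d y a g
  proof -
    have "((i, c, x), (a, g), (j, d, y)) \<in> arrows (Shape ?E) (i, c, x) (j, d, y)"
      unfolding diagram.simps T.triple_arrows_iff using that by auto
    from presents_cocone[OF P this] show ?thesis by simp
  qed
  have nat: "\<iota> (i, c, x) \<star> g = \<iota> (i, d, x \<star> g)"
    if i: "i \<in> Obj (Shape D)" and x: "x \<in> el (DObj D i) c" and g: "g \<in> arrows C d c" for i c d x g
  proof -
    have O: "c \<in> Obj C" "d \<in> Obj C" using arrows_ObjD[OF g] by auto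
    show ?thesis
      by (rule cocone[OF i O(2) act_el[OF x g] i O(1) x S.Idn_arrows[OF i] g])
        (use diagram_Idn[OF D i] A.Cmp_Idn_left[OF act_el[OF x g]] in simp)
  qed
  have "\<forall>i \<in> Obj (Shape D). \<exists>\<psi>. \<psi> \<in> arrows A (DObj D i) X' \<and>
      (\<forall>c \<in> Obj C. \<forall>x \<in> el (DObj D i) c. \<psi> \<cdot> x = \<iota> (i, c, x))"
  proof
    fix i assume i: "i \<in> Obj (Shape D)"
    have "\<exists>\<psi> \<in> arrows A (DObj D i) X'. \<forall>c \<in> Obj C. \<forall>x \<in> el (DObj D i) c. \<psi> \<cdot> x = \<iota> (i, c, x)"
      by (rule arrow_ex[OF DO[OF i] X']) (use \<iota>[OF i] nat[OF i] in auto)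
    then show "\<exists>\<psi>. \<psi> \<in> arrows A (DObj D i) X' \<and>
      (\<forall>c \<in> Obj C. \<forall>x \<in> el (DObj D i) c. \<psi> \<cdot> x = \<iota> (i, c, x))" by blast
  qed
  from bchoice[OF this] obtain \<psi> where "\<forall>i \<in> Obj (Shape D). \<psi> i \<in> arrows A (DObj D i) X' \<and>
      (\<forall>c \<in> Obj C. \<forall>x \<in> el (DObj D i) c. \<psi> i \<cdot> x = \<iota> (i, c, x))" ..
  then have \<psi>: "\<And>i. i \<in> Obj (Shape D) ==> \<psi> i \<in> arrows A (DObj D i) X'"
    and \<psi>e: "\<And>i c x. i \<in> Obj (Shape D) ==> c \<in> Obj C ==> x \<in> el (DObj D i) c ==> \<psi> i \<cdot> x = \<iota> (i, c, x)"
    by auto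
  have \<psi>_cocone: "is_cocone A D X' \<psi>"
    unfolding is_cocone_def
  proof (intro conjI ballI X' \<psi>)
    fix a assume "a \<in> Arr (Shape D)"
    then have a: "a \<in> arrows (Shape D) (Dom (Shape D) a) (Cod (Shape D) a)" by (rule Arr_arrows)
    let ?i = "Dom (Shape D) a" and ?j = "Cod (Shape D) a"
    have I: "?i \<in> Obj (Shape D)" "?j \<in> Obj (Shape D)" using S.arrows_ObjD[OF a] by auto
    show "\<psi> ?j \<cdot> DArr D a = \<psi> ?i"
    proof (rule arrow_eqI[OF A.Cmp_arrows[OF DA[OF a] \<psi>[OF I(2)]] \<psi>[OF I(1)]])
      fix c x assume c: "c \<in> Obj C" and x: "x \<in> el (DObj D ?i) c"
      have ax: "DArr D a \<cdot> x \<in> el (DObj D ?j) c" using A.Cmp_arrows[OF x DA[OF a]] .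
      have "\<iota> (?j, c, DArr D a \<cdot> x) \<star> Idn C c = \<iota> (?i, c, x)"
        by (rule cocone[OF I(1) c x I(2) c ax a Idn_arrows[OF c]]) (use act_Idn[OF c ax] in simp)
      then show "\<psi> ?j \<cdot> DArr D a \<cdot> x = \<psi> ?i \<cdot> x"
        using A.Cmp_assoc[OF x DA[OF a] \<psi>[OF I(2)]] \<psi>e[OF I(2) c ax] \<psi>e[OF I(1) c x]
          act_Idn[OF c \<iota>[OF I(2) c ax]] by simp
    qed
  qed

  \<comment> \<open>Comparison with the given colimit\<close>
  have \<phi>: "\<And>i. i \<in> Obj (Shape D) ==> \<phi> i \<in> arrows A (DObj D i) X"
    and \<phi>a: "\<And>a i j. a \<in> arrows (Shape D) i j ==> \<phi> j \<cdot> DArr D a = \<phi> i" and X: "X \<in> Obj A"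
    using colim unfolding is_colimit_def is_cocone_def by (auto simp: arrows_iff)
  obtain v where v: "v \<in> arrows A X X'" "\<And>i. i \<in> Obj (Shape D) ==> v \<cdot> \<phi> i = \<psi> i"
    using colim \<psi>_cocone unfolding is_colimit_def by blast
  have "\<exists>!u. u \<in> arrows A X' X \<and> (\<forall>k \<in> Obj (Shape ?E). u \<cdot> \<iota> k = (case k of (i, c, x) \<Rightarrow> \<phi> i \<cdot> x))"
  proof (rule presents_univ[OF P X])
    show "(case k of (i, c, x) \<Rightarrow> \<phi> i \<cdot> x) \<in> el X (DObj ?E k)" if "k \<in> Obj (Shape ?E)" for k
      using that[unfolded OE] A.Cmp_arrows[OF _ \<phi>] by auto
    fix t assume "t \<in> Arr (Shape ?E)"
    then have "t \<in> arrows T.T (Dom T.T t) (Cod T.T t)" by (intro Arr_arrows) (simp only: diagram.simps)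
    then obtain k s l where t: "t = (k, s, l)" "k \<in> ?Ob" "l \<in> ?Ob" "s \<in> ?hm k l" "Dom T.T t = k" "Cod T.T t = l"
      unfolding T.triple_arrows_iff by (metis (lifting))
    obtain i c x j d y a g where eqs: "k = (i, c, x)" "l = (j, d, y)" "s = (a, g)"
      by (cases k, cases l, cases s) blast
    have *: "i \<in> Obj (Shape D)" "x \<in> el (DObj D i) c" "j \<in> Obj (Shape D)" "y \<in> el (DObj D j) d"
      "a \<in> arrows (Shape D) i j" "g \<in> arrows C c d" "DArr D a \<cdot> x = y \<star> g" using t eqs by auto
    have "\<phi> j \<cdot> y \<star> g = \<phi> i \<cdot> x"
      using cmp_act[OF \<phi>[OF *(3)] *(4,6)] *(7) A.Cmp_assoc[OF *(2) DA[OF *(5)] \<phi>[OF *(3)]] \<phi>a[OF *(5)] by simp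
    then show "(case Cod (Shape ?E) t of (i, c, x) \<Rightarrow> \<phi> i \<cdot> x) \<star> DArr ?E t =
        (case Dom (Shape ?E) t of (i, c, x) \<Rightarrow> \<phi> i \<cdot> x)"
      using t eqs by simp
  qed
  then obtain u where u1: "u \<in> arrows A X' X"
    and U: "\<forall>k \<in> Obj (Shape ?E). u \<cdot> \<iota> k = (case k of (i, c, x) \<Rightarrow> \<phi> i \<cdot> x)" by blast
  have u2: "u \<cdot> \<iota> (i, c, x) = \<phi> i \<cdot> x"
    if "i \<in> Obj (Shape D)" "c \<in> Obj C" "x \<in> el (DObj D i) c" for i c x
    using U[unfolded OE, rule_format, of "(i, c, x)"] that by simp
  note u = u1 u2
  have u\<psi>: "u \<cdot> \<psi> i = \<phi> i" if i: "i \<in> Obj (Shape D)" for i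
  proof (rule arrow_eqI[OF A.Cmp_arrows[OF \<psi>[OF i] u(1)] \<phi>[OF i]])
    fix c x assume c: "c \<in> Obj C" and x: "x \<in> el (DObj D i) c"
    show "u \<cdot> \<psi> i \<cdot> x = \<phi> i \<cdot> x"
      using A.Cmp_assoc[OF x \<psi>[OF i] u(1)] \<psi>e[OF i c x] u(2)[OF i c x] by simp
  qed
  \<comment> \<open>By uniqueness of arrows out of \<open>X\<close>. It lets an element
    \<open>x\<close> be recovered from \<open>v \<cdot> x\<close>, whose representation in
    \<open>X'\<close> is known.\<close>
  have uv: "u \<cdot> v = Idn A X"
  proof -
    have "is_cocone A D X \<phi>" using colim by (simp add: is_colimit_def)
    then have "\<exists>!w. w \<in> arrows A X X \<and> (\<forall>i \<in> Obj (Shape D). w \<cdot> \<phi> i = \<phi> i)"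
      using colim unfolding is_colimit_def by blast
    moreover have "u \<cdot> v \<in> arrows A X X \<and> (\<forall>i \<in> Obj (Shape D). u \<cdot> v \<cdot> \<phi> i = \<phi> i)"
      using A.Cmp_arrows[OF v(1) u(1)] A.Cmp_assoc[OF \<phi> v(1) u(1)] v(2) u\<psi> by simp
    moreover have "Idn A X \<in> arrows A X X \<and> (\<forall>i \<in> Obj (Shape D). Idn A X \<cdot> \<phi> i = \<phi> i)"
      using A.Idn_arrows[OF X] A.Cmp_Idn_left[OF \<phi>] by simp
    ultimately show ?thesis by blast
  qed
  show "\<exists>i \<in> Obj (Shape D). \<exists>y \<in> el (DObj D i) c. x = \<phi> i \<cdot> y" if x: "x \<in> el X c"
  proof -
    obtain k f where kf: "k \<in> Obj (Shape ?E)" "f \<in> arrows C c (DObj ?E k)" "v \<cdot> x = \<iota> k \<star> f"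
      using presents_factor[OF P c A.Cmp_arrows[OF x v(1)]] .
    obtain i d y where k: "k = (i, d, y)" by (cases k)
    have *: "i \<in> Obj (Shape D)" "y \<in> el (DObj D i) d" "f \<in> arrows C c d"
      using kf(1,2)[unfolded OE] k by auto
    note yf = act_el[OF *(2,3)]
    have "x = u \<cdot> (v \<cdot> x)" using A.Cmp_assoc[OF x v(1) u(1)] uv A.Cmp_Idn_left[OF x] by simp
    also have "\<dots> = \<phi> i \<cdot> (y \<star> f)" using kf(3) k nat[OF *] u(2)[OF *(1) c yf] by simp
    finally show ?thesis using * yf by blast
  qed
  assume i: "i \<in> Obj (Shape D)" and j: "j \<in> Obj (Shape D)" and y: "y \<in> el (DObj D i) c"
    and z: "z \<in> el (DObj D j) c" and eq: "\<phi> i \<cdot> y = \<phi> j \<cdot> z"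
  have "\<psi> i \<cdot> y = \<psi> j \<cdot> z"
    using v(2)[OF i, symmetric] v(2)[OF j, symmetric] A.Cmp_assoc[OF y \<phi>[OF i] v(1)]
      A.Cmp_assoc[OF z \<phi>[OF j] v(1)] eq by simp
  then have E0: "\<iota> (i, c, y) \<star> Idn C c = \<iota> (j, c, z) \<star> Idn C c" using \<psi>e i j c y z by simp
  have K: "(i, c, y) \<in> Obj (Shape ?E)" "(j, c, z) \<in> Obj (Shape ?E)"
    "Idn C c \<in> arrows C c (DObj ?E (i, c, y))" "Idn C c \<in> arrows C c (DObj ?E (j, c, z))"
    unfolding OE using i j c y z Idn_arrows[OF c] by auto
  obtain m s t where st: "s \<in> arrows (Shape ?E) (i, c, y) m" "t \<in> arrows (Shape ?E) (j, c, z) m"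
    "DArr ?E s \<bullet> Idn C c = DArr ?E t \<bullet> Idn C c"
    by (rule presents_eq[OF P K E0])
  obtain l d w where m: "m = (l, d, w)" by (cases m)
  obtain a g b h where *: "s = ((i, c, y), (a, g), m)" "a \<in> arrows (Shape D) i l" "g \<in> arrows C c d"
    "DArr D a \<cdot> y = w \<star> g" "t = ((j, c, z), (b, h), m)" "b \<in> arrows (Shape D) j l" "h \<in> arrows C c d"
    "DArr D b \<cdot> z = w \<star> h"
    using st(1,2) m unfolding diagram.simps T.triple_arrows_iff by auto
  \<comment> \<open>The two labels are the same arrow of \<open>C\<close>, so the images of
    \<open>y\<close> and \<open>z\<close> in \<open>DObj D l\<close> are the same restriction of
    \<open>w\<close>.\<close>
  then have "g = h" using st(3) Cmp_Idn_right by simp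
  then show "\<exists>m a b. a \<in> arrows (Shape D) i m \<and> b \<in> arrows (Shape D) j m \<and> DArr D a \<cdot> y = DArr D b \<cdot> z"
    using * by metis
qed

text \<open>The two arrows out of \<open>i\<close> that witness the equality are equalized further
  on, which leaves a single arrow \<open>e\<close>.\<close>

lemma filtered_colimit_eq:
  assumes D: "is_diagram A D" and F: "filtered (Shape D)" and small: "small_cat TYPE('v) (Shape D)"
    and colim: "is_colimit A D X \<phi>" and c: "c \<in> Obj C"
    and i: "i \<in> Obj (Shape D)" and y: "y \<in> el (DObj D i) c" and z: "z \<in> el (DObj D i) c"
    and eq: "\<phi> i \<cdot> y = \<phi> i \<cdot> z"
  shows "\<exists>m e. e \<in> arrows (Shape D) i m \<and> DArr D e \<cdot> y = DArr D e \<cdot> z"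
proof -
  interpret S: category "Shape D" using diagram_category[OF D] .
  note DA = diagram_arrows[OF D]
  obtain m a b where ab: "a \<in> arrows (Shape D) i m" "b \<in> arrows (Shape D) i m" "DArr D a \<cdot> y = DArr D b \<cdot> z"
    using filtered_colimit_elements(2)[OF assms(1-5) i i y z eq] by blast
  obtain l d where d: "d \<in> arrows (Shape D) m l" "Cmp (Shape D) d a = Cmp (Shape D) d b"
    using filtered_eq[OF F ab(1,2)] by blast
  have "DArr D (Cmp (Shape D) d a) \<cdot> y = DArr D d \<cdot> (DArr D a \<cdot> y)"
    using diagram_Cmp[OF D ab(1) d(1)] A.Cmp_assoc[OF y DA[OF ab(1)] DA[OF d(1)]] by simp
  moreover have "DArr D (Cmp (Shape D) d b) \<cdot> z = DArr D d \<cdot> (DArr D b \<cdot> z)"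
    using diagram_Cmp[OF D ab(2) d(1)] A.Cmp_assoc[OF z DA[OF ab(2)] DA[OF d(1)]] by simp
  ultimately have "DArr D (Cmp (Shape D) d a) \<cdot> y = DArr D (Cmp (Shape D) d a) \<cdot> z" using ab(3) d(2) by simp
  then show ?thesis using S.Cmp_arrows[OF ab(1) d(1)] by blast
qed

text \<open>Both conditions in \<open>strict_monic_iff\<close> start from finitely many elements and
  equations; these appear at some index \<open>n\<close>, where strictness of \<open>t n\<close>
  applies.\<close>

lemma strict_monics_closed: "strict_monics_closed_filtered_colimits TYPE('v) A"
  unfolding strict_monics_closed_filtered_colimits_def
proof (intro allI impI, elim conjE)
  fix D E :: "('v, 'v, 'O, 'M) diagram" and t X \<phi> Y \<psi> u
  assume D: "small_diagram A D" and E: "small_diagram A E" and sh: "Shape E = Shape D"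
    and F: "filtered (Shape D)"
    and t: "\<forall>i\<in>Obj (Shape D). t i \<in> arrows A (DObj D i) (DObj E i) \<and> strict_monic A (t i)"
    and nat: "\<forall>a\<in>Arr (Shape D). t (Cod (Shape D) a) \<cdot> DArr D a = DArr E a \<cdot> t (Dom (Shape D) a)"
    and X: "is_colimit A D X \<phi>" and Y: "is_colimit A E Y \<psi>" and u: "u \<in> arrows A X Y"
    and ut: "\<forall>i\<in>Obj (Shape D). u \<cdot> \<phi> i = \<psi> i \<cdot> t i"
  have D': "is_diagram A D" "small_cat TYPE('v) (Shape D)" and E': "is_diagram A E" "small_cat TYPE('v) (Shape E)"
    using D E by (auto simp: small_diagram_def)
  interpret S: category "Shape D" using diagram_category[OF D'(1)] .
  have FE: "filtered (Shape E)" using F sh by simp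
  note Xe = filtered_colimit_elements[OF D'(1) F D'(2) X] and Ye = filtered_colimit_elements[OF E'(1) FE E'(2) Y]
  note Yq = filtered_colimit_eq[OF E'(1) FE E'(2) Y, unfolded sh]
  have \<phi>: "\<phi> i \<in> arrows A (DObj D i) X" and \<psi>: "\<psi> i \<in> arrows A (DObj E i) Y"
    if "i \<in> Obj (Shape D)" for i
    using X Y sh that unfolding is_colimit_def is_cocone_def by auto
  have \<phi>a: "\<phi> j \<cdot> DArr D a = \<phi> i" and \<psi>a: "\<psi> j \<cdot> DArr E a = \<psi> i" and ta: "t j \<cdot> DArr D a = DArr E a \<cdot> t i"
    if "a \<in> arrows (Shape D) i j" for a i j
    using X Y sh nat that unfolding is_colimit_def is_cocone_def by (auto simp: arrows_iff)
  note DA = diagram_arrows[OF D'(1)] and EA = diagram_arrows[OF E'(1), unfolded sh]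
  have tA: "t i \<in> arrows A (DObj D i) (DObj E i)" and sm: "strict_monic A (t i)"
    if "i \<in> Obj (Shape D)" for i using t that by auto
  have move\<phi>: "\<phi> i \<cdot> y = \<phi> j \<cdot> (DArr D a \<cdot> y)" if "a \<in> arrows (Shape D) i j" "y \<in> el (DObj D i) c" for a i j y c
    using A.Cmp_assoc[OF that(2) DA[OF that(1)] \<phi>] \<phi>a[OF that(1)] S.arrows_ObjD[OF that(1)] by simp
  have move\<psi>: "\<psi> i \<cdot> y = \<psi> j \<cdot> (DArr E a \<cdot> y)" if "a \<in> arrows (Shape D) i j" "y \<in> el (DObj E i) c" for a i j y c
    using A.Cmp_assoc[OF that(2) EA[OF that(1)] \<psi>] \<psi>a[OF that(1)] S.arrows_ObjD[OF that(1)] by simp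
  have u\<phi>: "u \<cdot> (\<phi> i \<cdot> y) = \<psi> i \<cdot> (t i \<cdot> y)" if "i \<in> Obj (Shape D)" "y \<in> el (DObj D i) c" for i y c
    using A.Cmp_assoc[OF that(2) \<phi> u] A.Cmp_assoc[OF that(2) tA \<psi>] ut that(1) by simp
  have tD: "t j \<cdot> (DArr D a \<cdot> y) = DArr E a \<cdot> (t i \<cdot> y)"
    if "a \<in> arrows (Shape D) i j" "y \<in> el (DObj D i) c" for a i j y c
    using A.Cmp_assoc[OF that(2) DA[OF that(1)] tA] A.Cmp_assoc[OF that(2) tA EA[OF that(1)]] ta[OF that(1)]
      S.arrows_ObjD[OF that(1)] by simp
  show "strict_monic A u"
    unfolding strict_monic_iff[OF u]
  proof (intro conjI ballI allI impI)
    fix c x x' assume c: "c \<in> Obj C" and x: "x \<in> el X c" and x': "x' \<in> el X c" and eq: "u \<cdot> x = u \<cdot> x'"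
    obtain i y where i: "i \<in> Obj (Shape D)" "y \<in> el (DObj D i) c" "x = \<phi> i \<cdot> y" using Xe(1)[OF c x] by blast
    obtain j y' where j: "j \<in> Obj (Shape D)" "y' \<in> el (DObj D j) c" "x' = \<phi> j \<cdot> y'" using Xe(1)[OF c x'] by blast
    obtain m a b where ab: "a \<in> arrows (Shape D) i m" "b \<in> arrows (Shape D) j m"
      using filtered_ub[OF F i(1) j(1)] by blast
    have m: "m \<in> Obj (Shape D)" using S.arrows_ObjD[OF ab(1)] by blast
    let ?y = "DArr D a \<cdot> y" and ?y' = "DArr D b \<cdot> y'"
    have y: "?y \<in> el (DObj D m) c" "?y' \<in> el (DObj D m) c"
      using A.Cmp_arrows[OF i(2) DA[OF ab(1)]] A.Cmp_arrows[OF j(2) DA[OF ab(2)]] by auto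
    have xm: "x = \<phi> m \<cdot> ?y" "x' = \<phi> m \<cdot> ?y'" using i(3) j(3) move\<phi>[OF ab(1) i(2)] move\<phi>[OF ab(2) j(2)] by auto
    have "\<psi> m \<cdot> (t m \<cdot> ?y) = \<psi> m \<cdot> (t m \<cdot> ?y')" using u\<phi>[OF m y(1)] u\<phi>[OF m y(2)] eq xm by simp
    then obtain n e where e: "e \<in> arrows (Shape D) m n" "DArr E e \<cdot> (t m \<cdot> ?y) = DArr E e \<cdot> (t m \<cdot> ?y')"
      using Yq[OF c m A.Cmp_arrows[OF y(1) tA[OF m]] A.Cmp_arrows[OF y(2) tA[OF m]]] by blast
    have n: "n \<in> Obj (Shape D)" using S.arrows_ObjD[OF e(1)] by blast
    have "t n \<cdot> (DArr D e \<cdot> ?y) = t n \<cdot> (DArr D e \<cdot> ?y')" using tD[OF e(1) y(1)] tD[OF e(1) y(2)] e(2) by simp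
    then have "DArr D e \<cdot> ?y = DArr D e \<cdot> ?y'"
      using sm[OF n, unfolded strict_monic_iff[OF tA[OF n]]] c A.Cmp_arrows[OF y(1) DA[OF e(1)]]
        A.Cmp_arrows[OF y(2) DA[OF e(1)]] by blast
    then show "x = x'" using xm move\<phi>[OF e(1) y(1)] move\<phi>[OF e(1) y(2)] by simp
  next
    fix a y c g x
    assume a: "a \<in> Arr C" and y: "y \<in> el Y (Cod C a)" and g: "g \<in> arrows C c (Cod C a)"
      and x: "x \<in> el X (Dom C a)" and *: "cokC a \<bullet> g = nul c (Cod C (cokC a)) \<and> u \<cdot> x = y \<star> a"
    have aa: "a \<in> arrows C (Dom C a) (Cod C a)" using Arr_arrows[OF a] .
    have O: "Dom C a \<in> Obj C" "Cod C a \<in> Obj C" using arrows_ObjD[OF aa] by auto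
    obtain i w where i: "i \<in> Obj (Shape D)" "w \<in> el (DObj D i) (Dom C a)" "x = \<phi> i \<cdot> w"
      using Xe(1)[OF O(1) x] by blast
    obtain j z where j: "j \<in> Obj (Shape D)" "z \<in> el (DObj E j) (Cod C a)" "y = \<psi> j \<cdot> z"
      using Ye(1)[OF O(2) y] sh by auto
    obtain m k l where kl: "k \<in> arrows (Shape D) i m" "l \<in> arrows (Shape D) j m"
      using filtered_ub[OF F i(1) j(1)] by blast
    have m: "m \<in> Obj (Shape D)" using S.arrows_ObjD[OF kl(1)] by blast
    let ?w = "DArr D k \<cdot> w" and ?z = "DArr E l \<cdot> z"
    have w: "?w \<in> el (DObj D m) (Dom C a)" and z: "?z \<in> el (DObj E m) (Cod C a)"
      using A.Cmp_arrows[OF i(2) DA[OF kl(1)]] A.Cmp_arrows[OF j(2) EA[OF kl(2)]] by auto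
    have xm: "x = \<phi> m \<cdot> ?w" and ym: "y = \<psi> m \<cdot> ?z"
      using i(3) j(3) move\<phi>[OF kl(1) i(2)] move\<psi>[OF kl(2) j(2)] by auto
    have "\<psi> m \<cdot> (t m \<cdot> ?w) = \<psi> m \<cdot> (?z \<star> a)"
      using u\<phi>[OF m w] * xm ym cmp_act[OF \<psi>[OF m] z aa] by simp
    then obtain n e where e: "e \<in> arrows (Shape D) m n" "DArr E e \<cdot> (t m \<cdot> ?w) = DArr E e \<cdot> (?z \<star> a)"
      using Yq[OF O(1) m A.Cmp_arrows[OF w tA[OF m]] act_el[OF z aa]] by blast
    have n: "n \<in> Obj (Shape D)" using S.arrows_ObjD[OF e(1)] by blast
    have ez: "DArr E e \<cdot> ?z \<in> el (DObj E n) (Cod C a)" using A.Cmp_arrows[OF z EA[OF e(1)]] .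
    have "t n \<cdot> (DArr D e \<cdot> ?w) = DArr E e \<cdot> ?z \<star> a"
      using tD[OF e(1) w] e(2) cmp_act[OF EA[OF e(1)] z aa] by simp
    then obtain x' where x': "x' \<in> el (DObj D n) c" "t n \<cdot> x' = DArr E e \<cdot> ?z \<star> g"
      using sm[OF n, unfolded strict_monic_iff[OF tA[OF n]]] a ez g A.Cmp_arrows[OF w DA[OF e(1)]] * by blast
    have "u \<cdot> (\<phi> n \<cdot> x') = y \<star> g"
      using u\<phi>[OF n x'(1)] x'(2) cmp_act[OF \<psi>[OF n] ez g] ym move\<psi>[OF e(1) z] by simp
    then show "\<exists>x'\<in>el X c. u \<cdot> x' = y \<star> g" using A.Cmp_arrows[OF x'(1) \<phi>[OF n]] by blast
  qed
qed

section \<open>The completion is locally presentable\<close>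

text \<open>For such \<open>r\<close> the shapes with fewer than \<open>r\<close> arrows are the
  finite ones, so an \<open>r\<close>-filtered category is filtered; what remains is that elements
  commute with filtered colimits.\<close>

lemma presentable_HO:
  fixes r :: "'v rel"
  assumes r: "\<And>S :: 'v set. |S| <o r \<longleftrightarrow> finite S" and c: "c \<in> Obj C"
  shows "presentable r A (HO c)"
  unfolding presentable_def
proof (intro conjI allI impI)
  show "HO c \<in> Obj A" using HO_Obj[OF c] .
  fix D :: "('v, 'v, 'O, 'M) diagram" and X \<phi>
  assume "small_diagram A D \<and> card_filtered r (Shape D) \<and> is_colimit A D X \<phi>"
  then have D: "small_diagram A D" and cf: "card_filtered r (Shape D)" and X: "is_colimit A D X \<phi>" by auto
  have D': "is_diagram A D" "small_cat TYPE('v) (Shape D)" using D by (auto simp: small_diagram_def)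
  interpret S: category "Shape D" using diagram_category[OF D'(1)] .
  have F: "filtered (Shape D)"
  proof (rule finite_cocones_imp_filtered[OF infinite_universe])
    show "category (Shape D)" by unfold_locales
    show "\<exists>i \<psi>. is_cocone (Shape D) E i \<psi>" if "is_diagram (Shape D) E" "finite (Arr (Shape E))"
      for E :: "('v, 'v, 'v, 'v) diagram"
      using cf that r unfolding card_filtered_def by blast
  qed
  note Xe = filtered_colimit_elements[OF D'(1) F D'(2) X c]
  have \<phi>: "\<phi> i \<in> arrows A (DObj D i) X" if "i \<in> Obj (Shape D)" for i
    using X that unfolding is_colimit_def is_cocone_def by auto
  have \<phi>a: "\<phi> j \<cdot> DArr D a = \<phi> i" if "a \<in> arrows (Shape D) i j" for a i j
    using X that unfolding is_colimit_def is_cocone_def by (auto simp: arrows_iff)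
  let ?\<theta> = "\<lambda>\<kappa>. the_elem ((\<lambda>(j, f). \<phi> j \<cdot> f) ` \<kappa>)"
  have \<theta>: "?\<theta> (germ A D (HO c) j f) = \<phi> j \<cdot> f"
    if j: "j \<in> Obj (Shape D)" and f: "f \<in> el (DObj D j) c" for j f
  proof -
    have eq: "\<phi> l \<cdot> g = \<phi> j \<cdot> f" if lg: "(l, g) \<in> germ A D (HO c) j f" for l g
    proof -
      obtain m a b where *: "l \<in> Obj (Shape D)" "g \<in> el (DObj D l) c" "a \<in> arrows (Shape D) j m"
        "b \<in> arrows (Shape D) l m" "DArr D a \<cdot> f = DArr D b \<cdot> g"
        using lg unfolding mem_germ_iff by blast
      have m: "m \<in> Obj (Shape D)" using S.arrows_ObjD[OF *(3)] by blast
      show ?thesis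
        using A.Cmp_assoc[OF *(2) diagram_arrows[OF D'(1) *(4)] \<phi>[OF m]] \<phi>a[OF *(4)]
          A.Cmp_assoc[OF f diagram_arrows[OF D'(1) *(3)] \<phi>[OF m]] \<phi>a[OF *(3)] *(5) by simp
    qed
    then have "(\<lambda>(j, f). \<phi> j \<cdot> f) ` germ A D (HO c) j f \<subseteq> {\<phi> j \<cdot> f}" by auto
    moreover have "(j, f) \<in> germ A D (HO c) j f" using A.germ_self[OF D'(1) F j f] .
    ultimately have "(\<lambda>(j, f). \<phi> j \<cdot> f) ` germ A D (HO c) j f = {\<phi> j \<cdot> f}" by force
    then show ?thesis by simp
  qed
  show "bij_betw ?\<theta> (colim_hom A D (HO c)) (el X c)"
  proof (rule bij_betwI')
    fix \<kappa> \<kappa>' assume \<kappa>: "\<kappa> \<in> colim_hom A D (HO c)" "\<kappa>' \<in> colim_hom A D (HO c)"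
    obtain j f where jf: "j \<in> Obj (Shape D)" "f \<in> el (DObj D j) c" "\<kappa> = germ A D (HO c) j f"
      using \<kappa>(1) unfolding A.colim_hom_iff by blast
    obtain l g where lg: "l \<in> Obj (Shape D)" "g \<in> el (DObj D l) c" "\<kappa>' = germ A D (HO c) l g"
      using \<kappa>(2) unfolding A.colim_hom_iff by blast
    show "?\<theta> \<kappa> = ?\<theta> \<kappa>' \<longleftrightarrow> \<kappa> = \<kappa>'"
    proof
      assume "?\<theta> \<kappa> = ?\<theta> \<kappa>'"
      then have "\<phi> j \<cdot> f = \<phi> l \<cdot> g" using \<theta> jf lg by simp
      from Xe(2)[OF jf(1) lg(1) jf(2) lg(2) this] show "\<kappa> = \<kappa>'"
        using A.germ_eq_iff[OF D'(1) F jf(1,2) lg(1,2)] jf(3) lg(3) by simp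
    qed simp
  next
    fix \<kappa> assume "\<kappa> \<in> colim_hom A D (HO c)"
    then obtain j f where "j \<in> Obj (Shape D)" "f \<in> el (DObj D j) c" "\<kappa> = germ A D (HO c) j f"
      unfolding A.colim_hom_iff by blast
    then show "?\<theta> \<kappa> \<in> el X c" using \<theta> A.Cmp_arrows[OF _ \<phi>] by simp
  next
    fix x assume "x \<in> el X c"
    from Xe(1)[OF this] obtain i y where iy: "i \<in> Obj (Shape D)" "y \<in> el (DObj D i) c" "x = \<phi> i \<cdot> y" by blast
    have "germ A D (HO c) i y \<in> colim_hom A D (HO c)" unfolding A.colim_hom_iff using iy by blast
    then show "\<exists>\<kappa> \<in> colim_hom A D (HO c). x = ?\<theta> \<kappa>" using \<theta>[OF iy(1,2)] iy(3) by (intro bexI) simp_all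
  qed
qed

text \<open>The generators are the images of the objects of \<open>C\<close>. A presentation of an
  object, pushed forward into \<open>A\<close>, is the required filtered diagram of
  generators.\<close>

lemma locally_presentable: "locally_presentable TYPE('v) A"
  unfolding locally_presentable_def
proof (intro conjI ballI allI impI)
  show "category A" by unfold_locales
  show "small TYPE('v) (arrows A X Y)" if "X \<in> Obj A" "Y \<in> Obj A" for X Y using small_hom[OF that] .
  show "\<exists>X \<psi>. is_colimit A D X \<psi>" if "small_diagram A D" for D :: "('v, 'v, 'O, 'M) diagram"
    using that ex_colimit unfolding small_diagram_def by blast
  obtain r :: "'v rel" where r: "small_regular_cardinal r" "\<forall>A :: 'v set. |A| <o r \<longleftrightarrow> finite A"
    using small_regular_cardinal_exists[OF universe] by blast
  have "\<exists>(D :: ('v, 'v, 'O, 'M) diagram) \<psi>. small_diagram A D \<and> card_filtered r (Shape D) \<and>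
      DObj D ` Obj (Shape D) \<subseteq> HO ` Obj C \<and> is_colimit A D X \<psi>" if X: "X \<in> Obj A" for X
  proof -
    obtain D :: "('v, 'v, 'o, 'm) diagram" and \<iota> where P: "presents TYPE('v) C A HO H D X \<iota>"
      using presented[OF X] by blast
    note D = presents_diagram[OF P]
    interpret S: category "Shape D" using diagram_category[OF D] .
    let ?D = "\<lparr>Shape = Shape D, DObj = \<lambda>i. HO (DObj D i), DArr = \<lambda>a. H (DArr D a)\<rparr> :: ('v, 'v, 'O, 'M) diagram"
    have "is_diagram A ?D"
      unfolding is_diagram_def diagram.simps
    proof (intro conjI ballI impI)
      show "category (Shape D)" by unfold_locales
      show "HO (DObj D i) \<in> Obj A" "H (DArr D (Idn (Shape D) i)) = Idn A (HO (DObj D i))"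
        if "i \<in> Obj (Shape D)" for i
        using HO_Obj diagram_Obj[OF D that] diagram_Idn[OF D that] H_Idn by auto
      fix a assume a: "a \<in> Arr (Shape D)"
      show "H (DArr D a) \<in> arrows A (HO (DObj D (Dom (Shape D) a))) (HO (DObj D (Cod (Shape D) a)))"
        using H_arrows[OF diagram_arrows[OF D Arr_arrows[OF a]]] .
      fix b assume b: "b \<in> Arr (Shape D)" and "Cod (Shape D) a = Dom (Shape D) b"
      then have a': "a \<in> arrows (Shape D) (Dom (Shape D) a) (Dom (Shape D) b)" using a by (simp add: arrows_iff)
      show "H (DArr D (Cmp (Shape D) b a)) = H (DArr D b) \<cdot> H (DArr D a)"
        using diagram_Cmp[OF D a' Arr_arrows[OF b]]
          H_Cmp[OF diagram_arrows[OF D a'] diagram_arrows[OF D Arr_arrows[OF b]]] by simp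
    qed
    then have "small_diagram A ?D" using presents_small[OF P] by (simp add: small_diagram_def)
    moreover have "card_filtered r (Shape ?D)"
      unfolding card_filtered_def diagram.simps
      using filtered_finite_cocone[OF presents_filtered[OF P]] r(2) S.category_axioms by blast
    moreover have "DObj ?D ` Obj (Shape ?D) \<subseteq> HO ` Obj C" using diagram_Obj[OF D] by auto
    moreover have "is_colimit A ?D X \<iota>"
      unfolding is_colimit_def
    proof (intro conjI allI impI)
      show "is_cocone A ?D X \<iota>"
        using X presents_arrows[OF P] presents_cocone[OF P Arr_arrows] by (simp add: is_cocone_def)
      fix Y \<phi> assume "is_cocone A ?D Y \<phi>"
      then show "\<exists>!u. u \<in> arrows A X Y \<and> (\<forall>i\<in>Obj (Shape ?D). u \<cdot> \<iota> i = \<phi> i)"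
        using presents_univ[OF P, of Y \<phi>] by (simp add: is_cocone_def)
    qed
    ultimately show ?thesis by blast
  qed
  then show "\<exists>(r :: 'v rel) S. small_regular_cardinal r \<and> small TYPE('v) S \<and> (\<forall>K \<in> S. presentable r A K) \<and>
      (\<forall>X \<in> Obj A. \<exists>(D :: ('v, 'v, 'O, 'M) diagram) \<psi>. small_diagram A D \<and> card_filtered r (Shape D) \<and>
        DObj D ` Obj (Shape D) \<subseteq> S \<and> is_colimit A D X \<psi>)"
    using r(1) small_image[OF small_Obj, of HO] presentable_HO r(2)
    by (intro exI[of _ r] exI[of _ "HO ` Obj C"]) auto
qed

theorem grothendieck: "grothendieck_quasi_abelian TYPE('v) A"
  unfolding grothendieck_quasi_abelian_def
  using quasi_abelian locally_presentable strict_monics_closed by blast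

end

text \<open>A small filtered diagram over \<open>'v\<close> is itself an ind-object and presents
  itself, so \<open>presents_self\<close> answers for both presentation assumptions of
  \<open>completion\<close>.\<close>

theorem (in base_category) grothendieck_quasi_abelian_Ind:
  assumes U: "grothendieck_universe TYPE('v)"
    and small: "small TYPE('v) (Obj C)" "small TYPE('v) (Arr C)"
  shows "grothendieck_quasi_abelian TYPE('v) (Ind TYPE('v) C)"
proof -
  interpret I: ind_category C "TYPE('v)" by unfold_locales (rule U)
  interpret A: category I.A by (rule category_Ind)
  interpret completion C pl neg nul SE "TYPE('v)" I.A I.K I.KA
  proof
    show "small TYPE('v) (Obj C)" "small TYPE('v) (Arr C)" by fact+
    show "I.KA f \<in> arrows I.A (I.K c) (I.K d)" if "f \<in> arrows C c d" for f c d
      using I.const_arrow_arrows[OF that] .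
    show "I.KA (Cmp C g f) = Cmp I.A (I.KA g) (I.KA f)" if "f \<in> arrows C b c" "g \<in> arrows C c d" for f g b c d
      using I.const_arrow_Cmp[OF that] .
    show "I.KA (Idn C c) = Idn I.A (I.K c)" if "c \<in> Obj C" for c
      using I.const_arrow_Idn[OF that] .
    show "\<exists>(D :: ('v, 'v, 'o, 'm) diagram) \<iota>. presents TYPE('v) C I.A I.K I.KA D X \<iota>" if "X \<in> Obj I.A" for X
      using I.presents_self[of X] that by (auto simp: Ind_simps)
    show "\<exists>X \<iota>. presents TYPE('v) C I.A I.K I.KA D X \<iota>"
      if "is_diagram C D" "filtered (Shape D)" "small_cat TYPE('v) (Shape D)"
      for D :: "('v, 'v, 'o, 'm) diagram"
      using I.presents_self[of D] that by (auto simp: ind_obj_def)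
  qed
  show ?thesis by (rule grothendieck)
qed

section \<open>Seminormed spaces\<close>

text \<open>Additive inverses come from scalar multiplication by \<open>-1\<close>, using
  distributivity and the assumption on the scalar \<open>0\<close>.\<close>

lemma seminormedI:
  fixes V :: "('k::real_normed_field, 'u) sn_space"
  assumes "\<And>x y. x \<in> carrier V ==> y \<in> carrier V ==> x \<oplus>\<^bsub>V\<^esub> y \<in> carrier V"
    and "\<zero>\<^bsub>V\<^esub> \<in> carrier V"
    and "\<And>x y z. x \<in> carrier V ==> y \<in> carrier V ==> z \<in> carrier V ==>
      (x \<oplus>\<^bsub>V\<^esub> y) \<oplus>\<^bsub>V\<^esub> z = x \<oplus>\<^bsub>V\<^esub> (y \<oplus>\<^bsub>V\<^esub> z)"
    and "\<And>x y. x \<in> carrier V ==> y \<in> carrier V ==> x \<oplus>\<^bsub>V\<^esub> y = y \<oplus>\<^bsub>V\<^esub> x"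
    and "\<And>x. x \<in> carrier V ==> \<zero>\<^bsub>V\<^esub> \<oplus>\<^bsub>V\<^esub> x = x"
    and smult: "\<And>c x. x \<in> carrier V ==> c \<odot>\<^bsub>V\<^esub> x \<in> carrier V"
    and distr: "\<And>a b x. x \<in> carrier V ==> (a + b) \<odot>\<^bsub>V\<^esub> x = a \<odot>\<^bsub>V\<^esub> x \<oplus>\<^bsub>V\<^esub> b \<odot>\<^bsub>V\<^esub> x"
    and "\<And>a x y. x \<in> carrier V ==> y \<in> carrier V ==>
      a \<odot>\<^bsub>V\<^esub> (x \<oplus>\<^bsub>V\<^esub> y) = a \<odot>\<^bsub>V\<^esub> x \<oplus>\<^bsub>V\<^esub> a \<odot>\<^bsub>V\<^esub> y"
    and "\<And>a b x. x \<in> carrier V ==> (a * b) \<odot>\<^bsub>V\<^esub> x = a \<odot>\<^bsub>V\<^esub> (b \<odot>\<^bsub>V\<^esub> x)"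
    and one: "\<And>x. x \<in> carrier V ==> 1 \<odot>\<^bsub>V\<^esub> x = x"
    and zero: "\<And>x. x \<in> carrier V ==> 0 \<odot>\<^bsub>V\<^esub> x = \<zero>\<^bsub>V\<^esub>"
    and norm1: "\<And>x. x \<in> carrier V ==> 0 \<le> seminorm V x"
    and norm2: "\<And>c x. x \<in> carrier V ==> seminorm V (c \<odot>\<^bsub>V\<^esub> x) = norm c * seminorm V x"
    and norm3: "\<And>x y. x \<in> carrier V ==> y \<in> carrier V ==>
      seminorm V (x \<oplus>\<^bsub>V\<^esub> y) \<le> seminorm V x + seminorm V y"
  shows "seminormed V"
proof -
  have inv: "\<exists>y \<in> carrier V. y \<oplus>\<^bsub>V\<^esub> x = \<zero>\<^bsub>V\<^esub>" if x: "x \<in> carrier V" for x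
    using distr[OF x, of "-1" 1] one[OF x] zero[OF x] smult[OF x] by (intro bexI[of _ "(-1) \<odot>\<^bsub>V\<^esub> x"]) auto
  have "module (ring_of_type_algebra :: 'k ring) V"
  proof (rule moduleI)
    show "cring (ring_of_type_algebra :: 'k ring)" by (rule cring_from_type_algebra)
    show "abelian_group V" by (rule abelian_groupI) (use assms inv in auto)
  qed (use assms in \<open>auto simp: ring_of_type_algebra_def\<close>)
  then show ?thesis using norm1 norm2 norm3 by (simp add: seminormed_def)
qed

locale seminormed_space =
  fixes V :: "('k::real_normed_field, 'u) sn_space"
  assumes seminormed: "seminormed V"
begin

sublocale module "ring_of_type_algebra :: 'k ring" V
  using seminormed by (simp add: seminormed_def)

lemma scalars: "carrier (ring_of_type_algebra :: 'k ring) = UNIV"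
  "add (ring_of_type_algebra :: 'k ring) = (+)" "monoid.mult (ring_of_type_algebra :: 'k ring) = (*)"
  "one (ring_of_type_algebra :: 'k ring) = 1" "zero (ring_of_type_algebra :: 'k ring) = 0"
  by (simp_all add: ring_of_type_algebra_def)

lemma smult_closed' [simp]: "x \<in> carrier V ==> c \<odot>\<^bsub>V\<^esub> x \<in> carrier V"
  using smult_closed by (simp add: scalars)

lemma smult_distr_left: "x \<in> carrier V ==> (a + b) \<odot>\<^bsub>V\<^esub> x = a \<odot>\<^bsub>V\<^esub> x \<oplus>\<^bsub>V\<^esub> b \<odot>\<^bsub>V\<^esub> x"
  using smult_l_distr[of a b x] by (simp add: scalars)

lemma smult_distr_right:
  "x \<in> carrier V ==> y \<in> carrier V ==> a \<odot>\<^bsub>V\<^esub> (x \<oplus>\<^bsub>V\<^esub> y) = a \<odot>\<^bsub>V\<^esub> x \<oplus>\<^bsub>V\<^esub> a \<odot>\<^bsub>V\<^esub> y"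
  using smult_r_distr[of a x y] by (simp add: scalars)

lemma smult_assoc: "x \<in> carrier V ==> (a * b) \<odot>\<^bsub>V\<^esub> x = a \<odot>\<^bsub>V\<^esub> (b \<odot>\<^bsub>V\<^esub> x)"
  using smult_assoc1[of a b x] by (simp add: scalars)

lemma smult_one' [simp]: "x \<in> carrier V ==> 1 \<odot>\<^bsub>V\<^esub> x = x"
  using smult_one[of x] by (simp add: scalars)

lemma smult_zero [simp]: "x \<in> carrier V ==> 0 \<odot>\<^bsub>V\<^esub> x = \<zero>\<^bsub>V\<^esub>"
  using smult_l_null[of x] by (simp add: scalars)

lemma smult_zero_right [simp]: "c \<odot>\<^bsub>V\<^esub> \<zero>\<^bsub>V\<^esub> = \<zero>\<^bsub>V\<^esub>"
  using smult_r_null[of c] by (simp add: scalars)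

lemma inv_smult: "x \<in> carrier V ==> \<ominus>\<^bsub>V\<^esub> x = (-1) \<odot>\<^bsub>V\<^esub> x"
  using smult_distr_left[of x "-1" 1] M.minus_equality[of "(-1) \<odot>\<^bsub>V\<^esub> x" x] by simp

lemma minus_smult: "x \<in> carrier V ==> y \<in> carrier V ==> x \<ominus>\<^bsub>V\<^esub> y = x \<oplus>\<^bsub>V\<^esub> (-1) \<odot>\<^bsub>V\<^esub> y"
  by (simp add: M.minus_eq inv_smult)

lemma seminorm_nonneg [simp]: "x \<in> carrier V ==> 0 \<le> seminorm V x"
  using seminormed by (simp add: seminormed_def)

lemma seminorm_smult: "x \<in> carrier V ==> seminorm V (c \<odot>\<^bsub>V\<^esub> x) = norm c * seminorm V x"
  using seminormed by (simp add: seminormed_def)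

lemma seminorm_triangle:
  "x \<in> carrier V ==> y \<in> carrier V ==> seminorm V (x \<oplus>\<^bsub>V\<^esub> y) \<le> seminorm V x + seminorm V y"
  using seminormed by (simp add: seminormed_def)

lemma seminorm_zero [simp]: "seminorm V \<zero>\<^bsub>V\<^esub> = 0"
  using seminorm_smult[of "\<zero>\<^bsub>V\<^esub>" 0] by simp

lemma seminorm_neg [simp]: "x \<in> carrier V ==> seminorm V (\<ominus>\<^bsub>V\<^esub> x) = seminorm V x"
  by (simp add: inv_smult seminorm_smult)

lemma minus_zero_iff: "x \<in> carrier V ==> y \<in> carrier V ==> x \<ominus>\<^bsub>V\<^esub> y = \<zero>\<^bsub>V\<^esub> \<longleftrightarrow> x = y"
  by (metis M.a_inv_closed M.add.inv_solve_right' M.l_zero M.minus_eq M.zero_closed)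

lemma add_minus_cancel [simp]: "x \<in> carrier V ==> y \<in> carrier V ==> (x \<ominus>\<^bsub>V\<^esub> y) \<oplus>\<^bsub>V\<^esub> y = x"
  by (simp add: M.minus_eq M.a_assoc M.l_neg)

lemma minus_add_cancel: "x \<in> carrier V ==> y \<in> carrier V ==> (y \<oplus>\<^bsub>V\<^esub> x) \<ominus>\<^bsub>V\<^esub> y = x"
  by (simp add: M.minus_eq M.a_ac M.r_neg M.r_neg1 M.r_neg2)

lemma minus_swap: "x \<in> carrier V ==> y \<in> carrier V ==> \<ominus>\<^bsub>V\<^esub> (x \<ominus>\<^bsub>V\<^esub> y) = y \<ominus>\<^bsub>V\<^esub> x"
  by (simp add: M.minus_eq M.minus_add M.a_comm)

lemma minus_trans:
  "x \<in> carrier V ==> y \<in> carrier V ==> z \<in> carrier V ==> (x \<ominus>\<^bsub>V\<^esub> y) \<oplus>\<^bsub>V\<^esub> (y \<ominus>\<^bsub>V\<^esub> z) = x \<ominus>\<^bsub>V\<^esub> z"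
  by (simp add: M.minus_eq M.a_assoc M.r_neg1 M.r_neg2)

lemma add_minus_add:
  "x \<in> carrier V ==> y \<in> carrier V ==> x' \<in> carrier V ==> y' \<in> carrier V ==>
   (x \<oplus>\<^bsub>V\<^esub> y) \<ominus>\<^bsub>V\<^esub> (x' \<oplus>\<^bsub>V\<^esub> y') = (x \<ominus>\<^bsub>V\<^esub> x') \<oplus>\<^bsub>V\<^esub> (y \<ominus>\<^bsub>V\<^esub> y')"
  by (simp add: M.minus_eq M.minus_add M.a_ac)

lemma smult_minus:
  "x \<in> carrier V ==> y \<in> carrier V ==> c \<odot>\<^bsub>V\<^esub> (x \<ominus>\<^bsub>V\<^esub> y) = c \<odot>\<^bsub>V\<^esub> x \<ominus>\<^bsub>V\<^esub> c \<odot>\<^bsub>V\<^esub> y"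
  by (simp add: minus_smult smult_distr_right flip: smult_assoc)

lemma seminorm_minus_commute:
  "x \<in> carrier V ==> y \<in> carrier V ==> seminorm V (x \<ominus>\<^bsub>V\<^esub> y) = seminorm V (y \<ominus>\<^bsub>V\<^esub> x)"
  using minus_swap seminorm_neg M.minus_closed by metis

lemma seminorm_minus_triangle:
  "x \<in> carrier V ==> y \<in> carrier V ==> z \<in> carrier V ==>
   seminorm V (x \<ominus>\<^bsub>V\<^esub> z) \<le> seminorm V (x \<ominus>\<^bsub>V\<^esub> y) + seminorm V (y \<ominus>\<^bsub>V\<^esub> z)"
  using minus_trans seminorm_triangle M.minus_closed by metis

definition subspace :: "'u set \<Rightarrow> bool" where
  "subspace N \<longleftrightarrow> N \<subseteq> carrier V \<and> \<zero>\<^bsub>V\<^esub> \<in> N \<and> (\<forall>x \<in> N. \<forall>y \<in> N. x \<oplus>\<^bsub>V\<^esub> y \<in> N) \<and>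
     (\<forall>c. \<forall>x \<in> N. c \<odot>\<^bsub>V\<^esub> x \<in> N)"

lemma seminormed_subspace:
  assumes "subspace N"
  shows "seminormed (V\<lparr>carrier := N\<rparr>)"
proof -
  have mem: "x \<in> carrier V" if "x \<in> N" for x using assms that by (auto simp: subspace_def)
  show ?thesis
    by (rule seminormedI)
      (use assms mem in \<open>auto simp: subspace_def M.a_ac smult_distr_left smult_distr_right
        smult_assoc seminorm_smult seminorm_triangle\<close>)
qed

lemma minus_subspace:
  assumes "subspace N" "x \<in> N" "y \<in> N"
  shows "x \<ominus>\<^bsub>V\<lparr>carrier := N\<rparr>\<^esub> y = x \<ominus>\<^bsub>V\<^esub> y" "x \<ominus>\<^bsub>V\<^esub> y \<in> N"
proof -
  interpret S: seminormed_space "V\<lparr>carrier := N\<rparr>" by unfold_locales (rule seminormed_subspace[OF assms(1)])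
  have mem: "x \<in> carrier V" "y \<in> carrier V" using assms by (auto simp: subspace_def)
  show "x \<ominus>\<^bsub>V\<lparr>carrier := N\<rparr>\<^esub> y = x \<ominus>\<^bsub>V\<^esub> y"
    using S.minus_smult[of x y] minus_smult[OF mem] assms by simp
  show "x \<ominus>\<^bsub>V\<^esub> y \<in> N" unfolding minus_smult[OF mem] using assms by (simp add: subspace_def)
qed

lemma norm_separated_subspace:
  "norm_separated V ==> subspace N ==> norm_separated (V\<lparr>carrier := N\<rparr>)"
  by (auto simp: norm_separated_def subspace_def)

definition closed_subset :: "'u set \<Rightarrow> bool" where
  "closed_subset N \<longleftrightarrow> (\<forall>x \<in> carrier V. (\<forall>e>0. \<exists>n \<in> N. seminorm V (x \<ominus>\<^bsub>V\<^esub> n) < e) \<longrightarrow> x \<in> N)"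

lemma norm_complete_subspace:
  assumes V: "norm_complete V" and N: "subspace N" and closed: "closed_subset N"
  shows "norm_complete (V\<lparr>carrier := N\<rparr>)"
  unfolding norm_complete_def
proof (intro allI impI, elim conjE)
  fix s :: "nat \<Rightarrow> 'u"
  assume s: "range s \<subseteq> carrier (V\<lparr>carrier := N\<rparr>)"
    and "\<forall>e>0. \<exists>M. \<forall>m\<ge>M. \<forall>n\<ge>M. seminorm (V\<lparr>carrier := N\<rparr>) (s m \<ominus>\<^bsub>V\<lparr>carrier := N\<rparr>\<^esub> s n) < e"
  then have C: "\<forall>e>0. \<exists>M. \<forall>m\<ge>M. \<forall>n\<ge>M. seminorm V (s m \<ominus>\<^bsub>V\<^esub> s n) < e"
    using minus_subspace(1)[OF N] by (simp add: image_subset_iff)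
  have sN: "range s \<subseteq> N" using s by simp
  have NV: "N \<subseteq> carrier V" using N by (simp add: subspace_def)
  with sN obtain x where x: "x \<in> carrier V" "(\<lambda>n. seminorm V (s n \<ominus>\<^bsub>V\<^esub> x)) \<longlonglongrightarrow> 0"
    using V[unfolded norm_complete_def, rule_format, of s] C by blast
  have "\<exists>n \<in> N. seminorm V (x \<ominus>\<^bsub>V\<^esub> n) < e" if e: "e > 0" for e
  proof -
    obtain n where "seminorm V (s n \<ominus>\<^bsub>V\<^esub> x) < e"
      using order_tendstoD(2)[OF x(2) e] by (auto simp: eventually_sequentially)
    moreover have "s n \<in> N" "s n \<in> carrier V" using sN NV by auto
    ultimately show ?thesis using seminorm_minus_commute[OF x(1), of "s n"] by (intro bexI[of _ "s n"]) simp_all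
  qed
  then have "x \<in> N" using closed x(1) by (simp add: closed_subset_def)
  then show "\<exists>x \<in> carrier (V\<lparr>carrier := N\<rparr>).
      (\<lambda>n. seminorm (V\<lparr>carrier := N\<rparr>) (s n \<ominus>\<^bsub>V\<lparr>carrier := N\<rparr>\<^esub> x)) \<longlonglongrightarrow> 0"
    using x(2) minus_subspace(1)[OF N _ \<open>x \<in> N\<close>] sN \<open>x \<in> N\<close>
    by (intro bexI[of _ x]) (simp_all add: image_subset_iff)
qed

end

lemma bounded_linear_mapI:
  assumes "\<And>x. x \<in> carrier V ==> f x \<in> carrier W" "f \<in> extensional (carrier V)"
    "\<And>x y. x \<in> carrier V ==> y \<in> carrier V ==> f (x \<oplus>\<^bsub>V\<^esub> y) = f x \<oplus>\<^bsub>W\<^esub> f y"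
    "\<And>c x. x \<in> carrier V ==> f (c \<odot>\<^bsub>V\<^esub> x) = c \<odot>\<^bsub>W\<^esub> f x"
    "0 \<le> K" "\<And>x. x \<in> carrier V ==> 0 \<le> seminorm V x"
    "\<And>x. x \<in> carrier V ==> seminorm W (f x) \<le> K * seminorm V x"
  shows "bounded_linear_map V W f"
proof -
  \<comment> \<open>\<open>K\<close> may be zero, whereas the definition asks for a positive
    constant.\<close>
  have "seminorm W (f x) \<le> (K + 1) * seminorm V x" if "x \<in> carrier V" for x
    using assms(6,7)[OF that] by (simp add: algebra_simps)
  then show ?thesis
    unfolding bounded_linear_map_def using assms by (auto simp: PiE_def intro!: exI[of _ "K + 1"])
qed

locale bounded_linear_maps = V: seminormed_space V + W: seminormed_space W
  for V W :: "('k::real_normed_field, 'u) sn_space" +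
  fixes f
  assumes map: "bounded_linear_map V W f"
begin

lemma closed [simp]: "x \<in> carrier V ==> f x \<in> carrier W"
  using map by (auto simp: bounded_linear_map_def)

lemma add: "x \<in> carrier V ==> y \<in> carrier V ==> f (x \<oplus>\<^bsub>V\<^esub> y) = f x \<oplus>\<^bsub>W\<^esub> f y"
  using map by (auto simp: bounded_linear_map_def)

lemma smult: "x \<in> carrier V ==> f (c \<odot>\<^bsub>V\<^esub> x) = c \<odot>\<^bsub>W\<^esub> f x"
  using map by (auto simp: bounded_linear_map_def)

lemma zero [simp]: "f \<zero>\<^bsub>V\<^esub> = \<zero>\<^bsub>W\<^esub>"
  using smult[of "\<zero>\<^bsub>V\<^esub>" 0] by simp

lemma minus: "x \<in> carrier V ==> y \<in> carrier V ==> f (x \<ominus>\<^bsub>V\<^esub> y) = f x \<ominus>\<^bsub>W\<^esub> f y"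
  by (simp add: V.minus_smult W.minus_smult add smult)

lemma bound: obtains K where "K > 0" "\<And>x. x \<in> carrier V ==> seminorm W (f x) \<le> K * seminorm V x"
  using map by (auto simp: bounded_linear_map_def)

lemma bounded_linear_map_corestrict:
  assumes N: "W.subspace N" and f: "\<And>x. x \<in> carrier V ==> f x \<in> N"
  shows "bounded_linear_map V (W\<lparr>carrier := N\<rparr>) f"
  using map f unfolding bounded_linear_map_def by (auto simp: PiE_def)

lemma subspace_kernel: "V.subspace {x \<in> carrier V. f x = \<zero>\<^bsub>W\<^esub>}"
  by (auto simp: V.subspace_def add smult)

text \<open>The bound on \<open>f\<close> makes \<open>f x\<close> arbitrarily small in seminorm
  when \<open>x\<close> is approximated by points of \<open>A\<close>; separatedness of the target
  turns seminorm zero into zero.\<close>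

lemma vanish_closure:
  assumes W: "norm_separated W" and A: "A \<subseteq> carrier V" "\<And>a. a \<in> A ==> f a = \<zero>\<^bsub>W\<^esub>"
    and x: "x \<in> carrier V" "\<forall>e>0. \<exists>a \<in> A. seminorm V (x \<ominus>\<^bsub>V\<^esub> a) < e"
  shows "f x = \<zero>\<^bsub>W\<^esub>"
proof -
  obtain K where K: "K > 0" "\<And>x. x \<in> carrier V ==> seminorm W (f x) \<le> K * seminorm V x" using bound by blast
  have "seminorm W (f x) \<le> 0 + e" if e: "e > 0" for e
  proof -
    have "e / K > 0" using e K(1) by simp
    then obtain a where a: "a \<in> A" "seminorm V (x \<ominus>\<^bsub>V\<^esub> a) < e / K" using x(2) by blast
    have aV: "a \<in> carrier V" using a A(1) by blast
    have "f (x \<ominus>\<^bsub>V\<^esub> a) = f x" using minus[OF x(1) aV] A(2)[OF a(1)] x(1) by (simp add: W.minus_smult)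
    then have "seminorm W (f x) \<le> K * seminorm V (x \<ominus>\<^bsub>V\<^esub> a)" using K(2)[of "x \<ominus>\<^bsub>V\<^esub> a"] x(1) aV by simp
    also have "\<dots> \<le> e" using a(2) K(1) by (simp add: field_simps less_imp_le)
    finally show ?thesis by simp
  qed
  then have "seminorm W (f x) \<le> 0" by (rule field_le_epsilon)
  then show ?thesis using W x W.seminorm_nonneg[OF closed[OF x(1)]] by (simp add: norm_separated_def)
qed

lemma closed_subset_kernel:
  assumes W: "norm_separated W"
  shows "V.closed_subset {x \<in> carrier V. f x = \<zero>\<^bsub>W\<^esub>}"
  unfolding V.closed_subset_def
proof (intro ballI impI)
  fix x assume x: "x \<in> carrier V" "\<forall>e>0. \<exists>n \<in> {x \<in> carrier V. f x = \<zero>\<^bsub>W\<^esub>}. seminorm V (x \<ominus>\<^bsub>V\<^esub> n) < e"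
  have "f x = \<zero>\<^bsub>W\<^esub>" by (rule vanish_closure[OF W _ _ x]) blast+
  then show "x \<in> {x \<in> carrier V. f x = \<zero>\<^bsub>W\<^esub>}" using x(1) by blast
qed

text \<open>Quantitative openness together with surjectivity. The slack \<open>e\<close> is there
  because the infimum that defines a quotient seminorm may fail to be attained.\<close>

definition open_map :: bool where
  "open_map \<longleftrightarrow> (\<exists>K>0. \<forall>y \<in> carrier W. \<forall>e>0. \<exists>x \<in> carrier V. f x = y \<and> seminorm V x \<le> K * seminorm W y + e)"

text \<open>
  A Cauchy sequence in the target has a subsequence with summable steps, which lifts step by step.
\<close>

lemma norm_complete_open_map:
  assumes op: open_map and V: "norm_complete V"
  shows "norm_complete W"
  unfolding norm_complete_def
proof (intro allI impI, elim conjE)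
  fix s :: "nat \<Rightarrow> 'u" assume "range s \<subseteq> carrier W"
    and Cauchy: "\<forall>e>0. \<exists>N. \<forall>m\<ge>N. \<forall>n\<ge>N. seminorm W (s m \<ominus>\<^bsub>W\<^esub> s n) < e"
  then have s: "s n \<in> carrier W" for n by auto
  have "\<forall>k. \<exists>N. \<forall>m\<ge>N. \<forall>n\<ge>N. seminorm W (s m \<ominus>\<^bsub>W\<^esub> s n) < (1/2)^k" using Cauchy by simp
  then obtain g where g: "\<And>k m n. m \<ge> g k ==> n \<ge> g k ==> seminorm W (s m \<ominus>\<^bsub>W\<^esub> s n) < (1/2)^k" by metis
  \<comment> \<open>Partial sums make \<open>h\<close> dominate \<open>g\<close> at the current and
    at the preceding index; the summand \<open>1\<close> makes \<open>h k\<close> at least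
    \<open>k\<close>, so that \<open>h\<close> runs to infinity.\<close>
  define h where "h k = (\<Sum>i\<le>k. g i + 1)" for k
  have hg: "h k \<ge> g k" "h (Suc k) \<ge> g k" "h k \<ge> k" for k
  proof -
    show "h k \<ge> g k" unfolding h_def using member_le_sum[of k "{..k}" "\<lambda>i. g i + 1"] by simp
    then show "h (Suc k) \<ge> g k" by (simp add: h_def)
    have "(\<Sum>i\<le>k. 1) \<le> h k" unfolding h_def by (rule sum_mono) simp
    then show "h k \<ge> k" by simp
  qed
  obtain K where K: "K > 0" "\<And>y e. y \<in> carrier W ==> e > 0 ==>
      \<exists>x \<in> carrier V. f x = y \<and> seminorm V x \<le> K * seminorm W y + e"
    using op unfolding open_map_def by blast
  \<comment> \<open>The slack \<open>(1/2)^k\<close> matches the step size, which gives the factor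
    \<open>K + 1\<close>.\<close>
  have "\<forall>k. \<exists>x. x \<in> carrier V \<and> f x = s (h (Suc k)) \<ominus>\<^bsub>W\<^esub> s (h k) \<and> seminorm V x \<le> (K + 1) * (1/2)^k"
  proof
    fix k
    let ?d = "s (h (Suc k)) \<ominus>\<^bsub>W\<^esub> s (h k)"
    obtain x where x: "x \<in> carrier V" "f x = ?d" "seminorm V x \<le> K * seminorm W ?d + (1/2)^k"
      using K(2)[of ?d "(1/2)^k"] s by auto
    have "K * seminorm W ?d \<le> K * (1/2)^k" using g[OF hg(2,1), of k] K(1) by (simp add: less_imp_le)
    then show "\<exists>x. x \<in> carrier V \<and> f x = ?d \<and> seminorm V x \<le> (K + 1) * (1/2)^k"
      using x by (intro exI[of _ x]) (auto simp: algebra_simps)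
  qed
  then obtain b where b: "\<And>k. b k \<in> carrier V" "\<And>k. f (b k) = s (h (Suc k)) \<ominus>\<^bsub>W\<^esub> s (h k)"
    "\<And>k. seminorm V (b k) \<le> (K + 1) * (1/2)^k" by metis
  obtain b0 where b0: "b0 \<in> carrier V" "f b0 = s (h 0)" using K(2)[OF s, of 1 "h 0"] by auto
  define t where "t = rec_nat b0 (\<lambda>k x. x \<oplus>\<^bsub>V\<^esub> b k)"
  have t_simps: "t 0 = b0" "t (Suc k) = t k \<oplus>\<^bsub>V\<^esub> b k" for k by (simp_all add: t_def)
  have t: "t k \<in> carrier V" for k by (induction k) (simp_all add: t_simps b0 b)
  have ft: "f (t k) = s (h k)" for k
  proof (induction k)
    case (Suc k)
    have "f (t (Suc k)) = (s (h (Suc k)) \<ominus>\<^bsub>W\<^esub> s (h k)) \<oplus>\<^bsub>W\<^esub> s (h k)"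
      using add[OF t b(1)] Suc b(2) W.M.a_comm s by (simp add: t_simps)
    then show ?case using W.add_minus_cancel s by simp
  qed (simp add: t_simps b0)
  \<comment> \<open>The right-hand side is the sum of the geometric bounds on the steps from
    \<open>k\<close> to \<open>k + j\<close>, in the closed form that the induction needs.\<close>
  have t_diff: "seminorm V (t (k + j) \<ominus>\<^bsub>V\<^esub> t k) \<le> (K + 1) * (2 * (1/2)^k - 2 * (1/2)^(k + j))" for k j
  proof (induction j)
    case 0
    then show ?case using V.minus_zero_iff[OF t t, of k k] by simp
  next
    case (Suc j)
    have "t (k + Suc j) \<ominus>\<^bsub>V\<^esub> t (k + j) = b (k + j)"
      using V.minus_add_cancel[OF b(1) t, of "k + j" "k + j"] by (simp add: t_simps)
    then have "seminorm V (t (k + Suc j) \<ominus>\<^bsub>V\<^esub> t k) \<le> (K + 1) * (1/2)^(k + j) + seminorm V (t (k + j) \<ominus>\<^bsub>V\<^esub> t k)"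
      using V.seminorm_minus_triangle[OF t t t, of "k + Suc j" k "k + j"] b(3)[of "k + j"] by simp
    then show ?case using Suc by (simp add: algebra_simps)
  qed
  have t_diff': "seminorm V (t m \<ominus>\<^bsub>V\<^esub> t n) \<le> 2 * (K + 1) * (1/2)^k" if le: "k \<le> n" "n \<le> m" for k m n
  proof -
    have "seminorm V (t m \<ominus>\<^bsub>V\<^esub> t n) \<le> (K + 1) * (2 * (1/2)^n - 2 * (1/2)^m)"
      using t_diff[of n "m - n"] le by simp
    also have "\<dots> \<le> (K + 1) * (2 * (1/2)^k)"
      using K(1) power_decreasing[OF le(1), of "1/2 :: real"]
      by (intro mult_left_mono) (auto intro: order_trans[of _ "2 * (1/2)^n"])
    finally show ?thesis by (simp add: algebra_simps)
  qed
  have lim0: "(\<lambda>k. 2 * (K + 1) * (1/2)^k) \<longlonglongrightarrow> 0"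
    using tendsto_mult_right_zero[OF LIMSEQ_power_zero[of "1/2 :: real"], of "2 * (K + 1)"] by simp
  have "\<forall>e>0. \<exists>N. \<forall>m\<ge>N. \<forall>n\<ge>N. seminorm V (t m \<ominus>\<^bsub>V\<^esub> t n) < e"
  proof (intro allI impI)
    fix e :: real assume "e > 0"
    then obtain k where "2 * (K + 1) * (1/2)^k < e"
      using order_tendstoD(2)[OF lim0] eventually_sequentially by (metis (mono_tags) order_refl)
    then have "seminorm V (t m \<ominus>\<^bsub>V\<^esub> t n) < e" if "k \<le> n" "k \<le> m" for m n
      using t_diff'[of k n m] t_diff'[of k m n] V.seminorm_minus_commute[OF t t, of m n] that
      by (cases "n \<le> m") auto
    then show "\<exists>N. \<forall>m\<ge>N. \<forall>n\<ge>N. seminorm V (t m \<ominus>\<^bsub>V\<^esub> t n) < e" by blast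
  qed
  moreover have "range t \<subseteq> carrier V" using t by blast
  ultimately obtain y where y: "y \<in> carrier V" "(\<lambda>n. seminorm V (t n \<ominus>\<^bsub>V\<^esub> y)) \<longlonglongrightarrow> 0"
    using V unfolding norm_complete_def by blast
  obtain L where L: "L > 0" "\<And>x. x \<in> carrier V ==> seminorm W (f x) \<le> L * seminorm V x" using bound by blast
  \<comment> \<open>Along \<open>h\<close> the sequence converges to \<open>f y\<close> because
    \<open>f\<close> is bounded; being Cauchy, the whole sequence has the same limit.\<close>
  have "(\<lambda>n. seminorm W (s n \<ominus>\<^bsub>W\<^esub> f y)) \<longlonglongrightarrow> 0"
  proof (rule LIMSEQ_I)
    fix e :: real assume e: "e > 0"
    obtain N where N: "\<And>m n. m \<ge> N ==> n \<ge> N ==> seminorm W (s m \<ominus>\<^bsub>W\<^esub> s n) < e / 2"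
      using Cauchy half_gt_zero[OF e] by blast
    obtain M where M: "\<And>n. n \<ge> M ==> seminorm V (t n \<ominus>\<^bsub>V\<^esub> y) < e / (2 * L)"
      using LIMSEQ_D[OF y(2), of "e / (2 * L)"] e L(1) V.seminorm_nonneg t y(1) by auto
    let ?k = "max N M"
    have "seminorm W (s (h ?k) \<ominus>\<^bsub>W\<^esub> f y) \<le> L * seminorm V (t ?k \<ominus>\<^bsub>V\<^esub> y)"
      using L(2)[of "t ?k \<ominus>\<^bsub>V\<^esub> y"] minus[OF t y(1)] ft t y(1) by simp
    also have "\<dots> < e / 2" using M[of ?k] L(1) by (simp add: field_simps)
    finally have 1: "seminorm W (s (h ?k) \<ominus>\<^bsub>W\<^esub> f y) < e / 2" .
    have hN: "h ?k \<ge> N" using hg(3)[of ?k] by simp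
    have "norm (seminorm W (s n \<ominus>\<^bsub>W\<^esub> f y) - 0) < e" if "n \<ge> N" for n
      using W.seminorm_minus_triangle[OF s s closed[OF y(1)], of n "h ?k"] N[OF that hN] 1
        W.seminorm_nonneg[of "s n \<ominus>\<^bsub>W\<^esub> f y"] s y(1) by simp
    then show "\<exists>no. \<forall>n\<ge>no. norm (seminorm W (s n \<ominus>\<^bsub>W\<^esub> f y) - 0) < e" by blast
  qed
  then show "\<exists>x \<in> carrier W. (\<lambda>n. seminorm W (s n \<ominus>\<^bsub>W\<^esub> x)) \<longlonglongrightarrow> 0" using closed[OF y(1)] by blast
qed

text \<open>The value at \<open>y\<close> is that of \<open>g\<close> at any preimage. A preimage of
  controlled seminorm bounds it by \<open>L * K\<close> times the seminorm of \<open>y\<close>, up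
  to a slack that is arbitrary and so disappears.\<close>

lemma factor_open_map:
  assumes op: open_map and X: "seminormed X" and g: "bounded_linear_map V X g"
    and kill: "\<And>x. x \<in> carrier V ==> f x = \<zero>\<^bsub>W\<^esub> ==> g x = \<zero>\<^bsub>X\<^esub>"
  shows "\<exists>u. bounded_linear_map W X u \<and> (\<forall>x \<in> carrier V. u (f x) = g x)"
proof -
  interpret g: bounded_linear_maps V X g by unfold_locales (rule X g)+
  obtain K where K: "K > 0" "\<And>y e. y \<in> carrier W ==> e > 0 ==>
      \<exists>x \<in> carrier V. f x = y \<and> seminorm V x \<le> K * seminorm W y + e"
    using op unfolding open_map_def by blast
  obtain L where L: "L > 0" "\<And>x. x \<in> carrier V ==> seminorm X (g x) \<le> L * seminorm V x" using g.bound by blast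
  have eq: "g x = g x'" if "x \<in> carrier V" "x' \<in> carrier V" "f x = f x'" for x x'
  proof -
    have "f (x \<ominus>\<^bsub>V\<^esub> x') = \<zero>\<^bsub>W\<^esub>" using minus that W.minus_zero_iff by simp
    then have "g (x \<ominus>\<^bsub>V\<^esub> x') = \<zero>\<^bsub>X\<^esub>" using kill that by simp
    then show ?thesis using g.minus that g.W.minus_zero_iff by simp
  qed
  define u where "u = (\<lambda>y \<in> carrier W. g (SOME x. x \<in> carrier V \<and> f x = y))"
  have u: "u (f x) = g x" if x: "x \<in> carrier V" for x
  proof -
    have "\<exists>x'. x' \<in> carrier V \<and> f x' = f x" using x by blast
    from someI_ex[OF this] have "g (SOME x'. x' \<in> carrier V \<and> f x' = f x) = g x" using eq x by blast
    then show ?thesis using closed[OF x] by (simp add: u_def)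
  qed
  have surj: "\<exists>x \<in> carrier V. y = f x" if "y \<in> carrier W" for y using K(2)[OF that, of 1] by auto
  have "bounded_linear_map W X u"
  proof (rule bounded_linear_mapI[where K = "L * K"])
    show "u y \<in> carrier X" if "y \<in> carrier W" for y using surj[OF that] u by auto
    show "u \<in> extensional (carrier W)" by (simp add: u_def)
    show "u (y \<oplus>\<^bsub>W\<^esub> z) = u y \<oplus>\<^bsub>X\<^esub> u z" if yz: "y \<in> carrier W" "z \<in> carrier W" for y z
    proof -
      obtain x x' where x: "x \<in> carrier V" "y = f x" "x' \<in> carrier V" "z = f x'" using surj yz by metis
      show ?thesis using u[of "x \<oplus>\<^bsub>V\<^esub> x'"] add[OF x(1,3)] g.add[OF x(1,3)] u x by simp
    qed
    show "u (c \<odot>\<^bsub>W\<^esub> y) = c \<odot>\<^bsub>X\<^esub> u y" if y: "y \<in> carrier W" for c y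
    proof -
      obtain x where x: "x \<in> carrier V" "y = f x" using surj y by metis
      show ?thesis using u[of "c \<odot>\<^bsub>V\<^esub> x"] smult[OF x(1)] g.smult[OF x(1)] u x by simp
    qed
    show "seminorm X (u y) \<le> L * K * seminorm W y" if y: "y \<in> carrier W" for y
    proof (rule field_le_epsilon)
      fix e :: real assume e: "e > 0"
      \<comment> \<open>The slack is divided by \<open>L\<close> since \<open>g\<close> can enlarge
        it by that factor.\<close>
      obtain x where x: "x \<in> carrier V" "f x = y" "seminorm V x \<le> K * seminorm W y + e / L"
        using K(2)[OF y, of "e / L"] e L(1) by auto
      have "seminorm X (u y) \<le> L * seminorm V x" using L(2)[OF x(1)] u[OF x(1)] x(2) by simp
      also have "\<dots> \<le> L * (K * seminorm W y + e / L)" using x(3) L(1) by (intro mult_left_mono) auto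
      finally show "seminorm X (u y) \<le> L * K * seminorm W y + e" using L(1) by (simp add: algebra_simps)
    qed
  qed (use K(1) L(1) in auto)
  then show ?thesis using u by blast
qed

end

section \<open>Quotients of seminormed spaces\<close>

locale quotient_space = seminormed_space V for V :: "('k::real_normed_field, 'u) sn_space" +
  fixes N :: "'u set"
  assumes N: "subspace N"
begin

lemma N_carrier: "n \<in> N ==> n \<in> carrier V"
  using N by (auto simp: subspace_def)

lemma N_ops:
  "\<zero>\<^bsub>V\<^esub> \<in> N" "m \<in> N ==> n \<in> N ==> m \<oplus>\<^bsub>V\<^esub> n \<in> N" "n \<in> N ==> c \<odot>\<^bsub>V\<^esub> n \<in> N"
  "n \<in> N ==> \<ominus>\<^bsub>V\<^esub> n \<in> N"
  using N N_carrier by (auto simp: subspace_def inv_smult)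

lemma minus_commute_N: "x \<in> carrier V ==> y \<in> carrier V ==> x \<ominus>\<^bsub>V\<^esub> y \<in> N ==> y \<ominus>\<^bsub>V\<^esub> x \<in> N"
  using N_ops(4) minus_swap by metis

lemma minus_trans_N:
  "x \<in> carrier V ==> y \<in> carrier V ==> z \<in> carrier V ==> x \<ominus>\<^bsub>V\<^esub> y \<in> N ==> y \<ominus>\<^bsub>V\<^esub> z \<in> N ==> x \<ominus>\<^bsub>V\<^esub> z \<in> N"
  using N_ops(2) minus_trans by metis

lemma minus_self_N: "x \<in> carrier V ==> x \<ominus>\<^bsub>V\<^esub> x \<in> N"
  using N_ops(1) minus_zero_iff[of x x] by simp

text \<open>Cosets of \<open>N\<close> are represented by chosen elements, so that the quotient lives on the same type.\<close>

definition rep :: "'u \<Rightarrow> 'u" where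
  "rep x = (SOME y. y \<in> carrier V \<and> y \<ominus>\<^bsub>V\<^esub> x \<in> N)"

lemma rep: "x \<in> carrier V ==> rep x \<in> carrier V \<and> rep x \<ominus>\<^bsub>V\<^esub> x \<in> N"
  unfolding rep_def by (rule someI[of _ x]) (simp add: minus_self_N)

lemma rep_eq_iff:
  assumes x: "x \<in> carrier V" and y: "y \<in> carrier V"
  shows "rep x = rep y \<longleftrightarrow> x \<ominus>\<^bsub>V\<^esub> y \<in> N"
proof
  assume "rep x = rep y"
  then show "x \<ominus>\<^bsub>V\<^esub> y \<in> N"
    using minus_trans_N[OF x _ y, of "rep x"] minus_commute_N[OF _ x, of "rep x"] rep[OF x] rep[OF y] by simp
next
  assume "x \<ominus>\<^bsub>V\<^esub> y \<in> N"
  then have "z \<in> carrier V \<and> z \<ominus>\<^bsub>V\<^esub> x \<in> N \<longleftrightarrow> z \<in> carrier V \<and> z \<ominus>\<^bsub>V\<^esub> y \<in> N" for z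
    using minus_trans_N[OF _ x y, of z] minus_trans_N[OF _ y x, of z] minus_commute_N[OF x y] by blast
  then show "rep x = rep y" by (simp add: rep_def)
qed

lemma rep_closed [simp]: "x \<in> carrier V ==> rep x \<in> carrier V"
  using rep by blast

lemma rep_rep [simp]: "x \<in> carrier V ==> rep (rep x) = rep x"
  using rep rep_eq_iff by simp

lemma rep_add_left [simp]:
  assumes "x \<in> carrier V" "y \<in> carrier V"
  shows "rep (rep x \<oplus>\<^bsub>V\<^esub> y) = rep (x \<oplus>\<^bsub>V\<^esub> y)"
  using assms rep[OF assms(1)] N_ops(2) minus_self_N add_minus_add by (simp add: rep_eq_iff)

lemma rep_add_right [simp]:
  assumes "x \<in> carrier V" "y \<in> carrier V"
  shows "rep (x \<oplus>\<^bsub>V\<^esub> rep y) = rep (x \<oplus>\<^bsub>V\<^esub> y)"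
  using assms rep[OF assms(2)] N_ops(2) minus_self_N add_minus_add by (simp add: rep_eq_iff)

lemma rep_smult [simp]:
  assumes "x \<in> carrier V"
  shows "rep (c \<odot>\<^bsub>V\<^esub> rep x) = rep (c \<odot>\<^bsub>V\<^esub> x)"
  using assms rep[OF assms] N_ops(3)[of "rep x \<ominus>\<^bsub>V\<^esub> x" c] smult_minus[of "rep x" x c] by (simp add: rep_eq_iff)

definition qn :: "'u \<Rightarrow> real" where
  "qn x = (INF n\<in>N. seminorm V (x \<oplus>\<^bsub>V\<^esub> n))"

lemma bdd: "x \<in> carrier V ==> bdd_below ((\<lambda>n. seminorm V (x \<oplus>\<^bsub>V\<^esub> n)) ` N)"
  by (rule bdd_belowI[of _ 0]) (auto simp: N_carrier)

lemma qn_less: "x \<in> carrier V ==> qn x < r \<longleftrightarrow> (\<exists>n \<in> N. seminorm V (x \<oplus>\<^bsub>V\<^esub> n) < r)"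
  unfolding qn_def using N_ops(1) by (subst cInf_less_iff) (auto simp: bdd)

lemma qn_le: "x \<in> carrier V ==> n \<in> N ==> qn x \<le> seminorm V (x \<oplus>\<^bsub>V\<^esub> n)"
  unfolding qn_def by (rule cINF_lower[OF bdd])

lemma qn_nonneg: "x \<in> carrier V ==> 0 \<le> qn x"
  unfolding qn_def using N_ops(1) by (intro cINF_greatest) (auto simp: N_carrier)

lemma qn_le_seminorm: "x \<in> carrier V ==> qn x \<le> seminorm V x"
  using qn_le[of x "\<zero>\<^bsub>V\<^esub>"] N_ops(1) by simp

lemma qn_cong_le:
  assumes x: "x \<in> carrier V" and y: "y \<in> carrier V" and "x \<ominus>\<^bsub>V\<^esub> y \<in> N"
  shows "qn x \<le> qn y"
proof (rule dense_ge)
  fix r assume "qn y < r"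
  then obtain n where n: "n \<in> N" "seminorm V (y \<oplus>\<^bsub>V\<^esub> n) < r" using qn_less y by blast
  have yx: "y \<ominus>\<^bsub>V\<^esub> x \<in> N" using minus_commute_N assms by blast
  have "x \<oplus>\<^bsub>V\<^esub> ((y \<ominus>\<^bsub>V\<^esub> x) \<oplus>\<^bsub>V\<^esub> n) = y \<oplus>\<^bsub>V\<^esub> n"
    using add_minus_cancel[OF y x] M.a_assoc[OF x M.minus_closed[OF y x] N_carrier[OF n(1)]]
      M.a_comm[OF x M.minus_closed[OF y x]] by metis
  then show "qn x \<le> r" using qn_le[OF x N_ops(2)[OF yx n(1)]] n(2) by simp
qed

lemma qn_rep [simp]:
  assumes x: "x \<in> carrier V"
  shows "qn (rep x) = qn x"
proof (rule antisym)
  have d: "rep x \<ominus>\<^bsub>V\<^esub> x \<in> N" using rep[OF x] by blast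
  show "qn (rep x) \<le> qn x" by (rule qn_cong_le[OF rep_closed[OF x] x d])
  show "qn x \<le> qn (rep x)"
    by (rule qn_cong_le[OF x rep_closed[OF x] minus_commute_N[OF rep_closed[OF x] x d]])
qed

lemma qn_triangle:
  assumes x: "x \<in> carrier V" and y: "y \<in> carrier V"
  shows "qn (x \<oplus>\<^bsub>V\<^esub> y) \<le> qn x + qn y"
proof (rule field_le_epsilon)
  fix e :: real assume e: "e > 0"
  obtain n where n: "n \<in> N" "seminorm V (x \<oplus>\<^bsub>V\<^esub> n) < qn x + e / 2" using qn_less[OF x, of "qn x + e / 2"] e by auto
  obtain m where m: "m \<in> N" "seminorm V (y \<oplus>\<^bsub>V\<^esub> m) < qn y + e / 2" using qn_less[OF y, of "qn y + e / 2"] e by auto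
  have "(x \<oplus>\<^bsub>V\<^esub> y) \<oplus>\<^bsub>V\<^esub> (n \<oplus>\<^bsub>V\<^esub> m) = (x \<oplus>\<^bsub>V\<^esub> n) \<oplus>\<^bsub>V\<^esub> (y \<oplus>\<^bsub>V\<^esub> m)"
    using x y n m N_carrier by (simp add: M.a_ac)
  then show "qn (x \<oplus>\<^bsub>V\<^esub> y) \<le> qn x + qn y + e"
    using qn_le[of "x \<oplus>\<^bsub>V\<^esub> y" "n \<oplus>\<^bsub>V\<^esub> m"] N_ops(2)[OF n(1) m(1)] x y n m N_carrier
      seminorm_triangle[of "x \<oplus>\<^bsub>V\<^esub> n" "y \<oplus>\<^bsub>V\<^esub> m"] by simp
qed

lemma qn_smult_le:
  assumes x: "x \<in> carrier V"
  shows "qn (c \<odot>\<^bsub>V\<^esub> x) \<le> norm c * qn x"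
proof (rule field_le_epsilon)
  fix e :: real assume e: "e > 0"
  \<comment> \<open>Adding \<open>1\<close> avoids a division by zero when \<open>c\<close> is
    zero.\<close>
  let ?d = "e / (norm c + 1)"
  have d: "?d > 0" using e by (simp add: add_nonneg_pos)
  obtain n where n: "n \<in> N" "seminorm V (x \<oplus>\<^bsub>V\<^esub> n) < qn x + ?d"
    using qn_less[OF x, of "qn x + ?d"] d by auto
  have "qn (c \<odot>\<^bsub>V\<^esub> x) \<le> seminorm V (c \<odot>\<^bsub>V\<^esub> (x \<oplus>\<^bsub>V\<^esub> n))"
    using qn_le[OF smult_closed'[OF x] N_ops(3)[OF n(1)]] smult_distr_right[OF x N_carrier[OF n(1)]] by simp
  also have "\<dots> \<le> norm c * (qn x + ?d)"
    using n x N_carrier by (simp add: seminorm_smult mult_left_mono)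
  also have "\<dots> \<le> norm c * qn x + e"
  proof -
    have "norm c * ?d \<le> (norm c + 1) * ?d" using d by (intro mult_right_mono) auto
    also have "\<dots> = e" by (simp add: add_nonneg_eq_0_iff)
    finally show ?thesis by (simp add: distrib_left)
  qed
  finally show "qn (c \<odot>\<^bsub>V\<^esub> x) \<le> norm c * qn x + e" .
qed

text \<open>For nonzero \<open>c\<close> the reverse inequality is \<open>qn_smult_le\<close>
  applied to the scalar \<open>inverse c\<close> and the vector \<open>c\<close> times
  \<open>x\<close>.\<close>

lemma qn_smult:
  assumes x: "x \<in> carrier V"
  shows "qn (c \<odot>\<^bsub>V\<^esub> x) = norm c * qn x"
proof (cases "c = 0")
  case True
  then show ?thesis using qn_smult_le[OF x, of c] qn_nonneg[of "c \<odot>\<^bsub>V\<^esub> x"] x by simp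
next
  case False
  have "qn x \<le> norm (inverse c) * qn (c \<odot>\<^bsub>V\<^esub> x)"
    using qn_smult_le[of "c \<odot>\<^bsub>V\<^esub> x" "inverse c"] x False by (simp flip: smult_assoc)
  then have "norm c * qn x \<le> norm c * (norm (inverse c) * qn (c \<odot>\<^bsub>V\<^esub> x))"
    by (rule mult_left_mono) simp
  also have "\<dots> = qn (c \<odot>\<^bsub>V\<^esub> x)" using False by (simp add: norm_inverse)
  finally have "norm c * qn x \<le> qn (c \<odot>\<^bsub>V\<^esub> x)" .
  then show ?thesis using qn_smult_le[OF x, of c] by simp
qed

definition quo :: "('k, 'u) sn_space" where
  "quo = \<lparr>carrier = rep ` carrier V, monoid.mult = undefined, one = undefined, zero = rep \<zero>\<^bsub>V\<^esub>,
     add = \<lambda>x y. rep (x \<oplus>\<^bsub>V\<^esub> y), module.smult = \<lambda>c x. rep (c \<odot>\<^bsub>V\<^esub> x), seminorm = qn\<rparr>"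

lemma quo_simps:
  "carrier quo = rep ` carrier V" "\<zero>\<^bsub>quo\<^esub> = rep \<zero>\<^bsub>V\<^esub>" "x \<oplus>\<^bsub>quo\<^esub> y = rep (x \<oplus>\<^bsub>V\<^esub> y)"
  "c \<odot>\<^bsub>quo\<^esub> x = rep (c \<odot>\<^bsub>V\<^esub> x)" "seminorm quo = qn"
  by (simp_all add: quo_def)

lemma carrier_quo_iff: "x \<in> carrier quo \<longleftrightarrow> x \<in> carrier V \<and> rep x = x"
  by (auto simp: quo_simps) (metis imageI)

lemma seminormed_quo: "seminormed quo"
  by (rule seminormedI)
    (simp_all add: carrier_quo_iff quo_simps(2-5) qn_nonneg qn_smult qn_triangle M.a_assoc
      smult_distr_left smult_distr_right smult_assoc, simp add: M.a_comm)

definition proj :: "'u \<Rightarrow> 'u" where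
  "proj = (\<lambda>x \<in> carrier V. rep x)"

lemma bounded_linear_proj: "bounded_linear_map V quo proj"
  by (rule bounded_linear_mapI[where K = 1]) (auto simp: proj_def quo_simps qn_le_seminorm)

sublocale Q: bounded_linear_maps V quo proj
  using seminormed_quo bounded_linear_proj by unfold_locales

lemma open_map_proj: "Q.open_map"
  unfolding Q.open_map_def
proof (intro exI[of _ 1] conjI ballI allI impI)
  fix y and e :: real assume "y \<in> carrier quo" and e: "e > 0"
  then have y: "y \<in> carrier V" "rep y = y" by (auto simp: quo_simps)
  obtain n where n: "n \<in> N" "seminorm V (y \<oplus>\<^bsub>V\<^esub> n) < qn y + e" using qn_less[OF y(1), of "qn y + e"] e by auto
  have "rep (y \<oplus>\<^bsub>V\<^esub> n) = rep y"
    using minus_add_cancel[OF N_carrier[OF n(1)] y(1)] y(1) N_carrier[OF n(1)] n(1) by (simp add: rep_eq_iff)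
  then show "\<exists>x\<in>carrier V. proj x = y \<and> seminorm V x \<le> 1 * seminorm quo y + e"
    using n y N_carrier by (intro bexI[of _ "y \<oplus>\<^bsub>V\<^esub> n"]) (auto simp: proj_def quo_simps)
qed simp

lemma proj_zero_iff: "x \<in> carrier V ==> proj x = \<zero>\<^bsub>quo\<^esub> \<longleftrightarrow> x \<in> N"
  by (simp add: proj_def quo_simps rep_eq_iff minus_smult)

text \<open>Seminorm zero in the quotient means that \<open>y\<close> is approximated by points of
  \<open>N\<close>; the sign is absorbed by the subspace.\<close>

lemma norm_separated_quo:
  assumes closed: "closed_subset N"
  shows "norm_separated quo"
  unfolding norm_separated_def
proof (intro ballI impI)
  fix y assume "y \<in> carrier quo" and 0: "seminorm quo y = 0"
  then have y: "y \<in> carrier V" "rep y = y" by (auto simp: quo_simps)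
  have "y \<in> N"
  proof (rule closed[unfolded closed_subset_def, rule_format, OF y(1)])
    fix e :: real assume "e > 0"
    then obtain n where "n \<in> N" "seminorm V (y \<oplus>\<^bsub>V\<^esub> n) < e"
      using qn_less[OF y(1), of e] 0 by (auto simp: quo_simps)
    then show "\<exists>n \<in> N. seminorm V (y \<ominus>\<^bsub>V\<^esub> n) < e"
      using N_ops(4) N_carrier by (intro bexI[of _ "\<ominus>\<^bsub>V\<^esub> n"]) (auto simp: M.minus_eq)
  qed
  then show "y = \<zero>\<^bsub>quo\<^esub>" using proj_zero_iff[OF y(1)] y by (simp add: proj_def)
qed

end

section \<open>Products of seminormed spaces\<close>

text \<open>Products have to live on the type \<open>'u\<close> again. On an infinite type there is
  an injection of the pairs, and any one of them serves.\<close>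

definition pair_enc :: "'u \<times> 'u \<Rightarrow> 'u" where
  "pair_enc = (SOME e. inj e)"

definition prod_space ::
    "('k::real_normed_field, 'u) sn_space \<Rightarrow> ('k, 'u) sn_space \<Rightarrow> ('k, 'u) sn_space" where
  "prod_space V W = (let f = \<lambda>z. fst (inv_into UNIV pair_enc z); s = \<lambda>z. snd (inv_into UNIV pair_enc z) in
     \<lparr>carrier = pair_enc ` (carrier V \<times> carrier W), monoid.mult = undefined, one = undefined,
      zero = pair_enc (\<zero>\<^bsub>V\<^esub>, \<zero>\<^bsub>W\<^esub>), add = \<lambda>x y. pair_enc (f x \<oplus>\<^bsub>V\<^esub> f y, s x \<oplus>\<^bsub>W\<^esub> s y),
      module.smult = \<lambda>c x. pair_enc (c \<odot>\<^bsub>V\<^esub> f x, c \<odot>\<^bsub>W\<^esub> s x), seminorm = \<lambda>x. seminorm V (f x) + seminorm W (s x)\<rparr>)"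

locale product_space = universe U + V: seminormed_space V + W: seminormed_space W
  for U :: "'u itself" and V W :: "('k::real_normed_field, 'u) sn_space"
begin

lemma inj_pair_enc: "inj (pair_enc :: 'u \<times> 'u \<Rightarrow> 'u)"
proof -
  have "|UNIV \<times> UNIV :: ('u \<times> 'u) set| \<le>o |UNIV :: 'u set|"
    using card_of_Times_same_infinite[OF infinite_universe] ordIso_imp_ordLeq by blast
  then have "\<exists>e :: 'u \<times> 'u \<Rightarrow> 'u. inj e" unfolding card_of_ordLeq[symmetric] by auto
  then show ?thesis unfolding pair_enc_def by (rule someI_ex)
qed

abbreviation "P \<equiv> prod_space V W"

lemma prod_simps:
  "carrier P = pair_enc ` (carrier V \<times> carrier W)" "\<zero>\<^bsub>P\<^esub> = pair_enc (\<zero>\<^bsub>V\<^esub>, \<zero>\<^bsub>W\<^esub>)"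
  "pair_enc (x, y) \<oplus>\<^bsub>P\<^esub> pair_enc (x', y') = pair_enc (x \<oplus>\<^bsub>V\<^esub> x', y \<oplus>\<^bsub>W\<^esub> y')"
  "c \<odot>\<^bsub>P\<^esub> pair_enc (x, y) = pair_enc (c \<odot>\<^bsub>V\<^esub> x, c \<odot>\<^bsub>W\<^esub> y)"
  "seminorm P (pair_enc (x, y)) = seminorm V x + seminorm W y"
  by (simp_all add: prod_space_def Let_def inj_pair_enc)

lemma pair_eq_iff: "(pair_enc p = (pair_enc q :: 'u)) \<longleftrightarrow> p = q"
  using inj_pair_enc by (auto dest: injD)

lemma seminormed_prod: "seminormed P"
  by (rule seminormedI)
    (auto simp: prod_simps pair_eq_iff V.M.a_ac W.M.a_ac V.smult_distr_left W.smult_distr_left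
      V.smult_distr_right W.smult_distr_right V.smult_assoc W.smult_assoc V.seminorm_smult W.seminorm_smult
      distrib_left intro!: add_mono[OF V.seminorm_triangle W.seminorm_triangle, THEN order_trans])

sublocale P: seminormed_space P
  by unfold_locales (rule seminormed_prod)

lemma prod_minus:
  "x \<in> carrier V ==> y \<in> carrier W ==> x' \<in> carrier V ==> y' \<in> carrier W ==>
   pair_enc (x, y) \<ominus>\<^bsub>P\<^esub> pair_enc (x', y') = pair_enc (x \<ominus>\<^bsub>V\<^esub> x', y \<ominus>\<^bsub>W\<^esub> y')"
  by (subst P.minus_smult) (auto simp: prod_simps V.minus_smult W.minus_smult)

lemma small_prod:
  assumes "small TYPE('u) (carrier V)" "small TYPE('u) (carrier W)"
  shows "small TYPE('u) (carrier P)"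
  unfolding prod_simps by (intro small_image small_Times assms)

lemma separated_prod: "norm_separated V ==> norm_separated W ==> norm_separated P"
  by (auto simp: norm_separated_def prod_simps pair_eq_iff add_nonneg_eq_0_iff)

lemma complete_prod:
  assumes V: "norm_complete V" and W: "norm_complete W"
  shows "norm_complete P"
  unfolding norm_complete_def
proof (intro allI impI, elim conjE)
  fix s :: "nat \<Rightarrow> 'u" assume "range s \<subseteq> carrier P"
    and C: "\<forall>e>0. \<exists>N. \<forall>m\<ge>N. \<forall>n\<ge>N. seminorm P (s m \<ominus>\<^bsub>P\<^esub> s n) < e"
  then have "\<forall>n. s n \<in> pair_enc ` (carrier V \<times> carrier W)" by (simp add: prod_simps image_subset_iff)
  then have "\<forall>n. \<exists>x y. x \<in> carrier V \<and> y \<in> carrier W \<and> s n = pair_enc (x, y)" by fast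
  then obtain x y where xy: "\<And>n. x n \<in> carrier V" "\<And>n. y n \<in> carrier W" "\<And>n. s n = pair_enc (x n, y n)"
    by metis
  have sm: "seminorm P (s m \<ominus>\<^bsub>P\<^esub> s n) = seminorm V (x m \<ominus>\<^bsub>V\<^esub> x n) + seminorm W (y m \<ominus>\<^bsub>W\<^esub> y n)" for m n
    using xy by (simp add: prod_minus prod_simps)
  have le: "seminorm V (x m \<ominus>\<^bsub>V\<^esub> x n) \<le> seminorm P (s m \<ominus>\<^bsub>P\<^esub> s n)"
    "seminorm W (y m \<ominus>\<^bsub>W\<^esub> y n) \<le> seminorm P (s m \<ominus>\<^bsub>P\<^esub> s n)" for m n
    unfolding sm using xy by auto
  have "\<forall>e>0. \<exists>N. \<forall>m\<ge>N. \<forall>n\<ge>N. seminorm V (x m \<ominus>\<^bsub>V\<^esub> x n) < e" using C le(1) le_less_trans by meson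
  moreover have "range x \<subseteq> carrier V" using xy by blast
  ultimately obtain a where a: "a \<in> carrier V" "(\<lambda>n. seminorm V (x n \<ominus>\<^bsub>V\<^esub> a)) \<longlonglongrightarrow> 0"
    using V unfolding norm_complete_def by blast
  have "\<forall>e>0. \<exists>N. \<forall>m\<ge>N. \<forall>n\<ge>N. seminorm W (y m \<ominus>\<^bsub>W\<^esub> y n) < e" using C le(2) le_less_trans by meson
  moreover have "range y \<subseteq> carrier W" using xy by blast
  ultimately obtain b where b: "b \<in> carrier W" "(\<lambda>n. seminorm W (y n \<ominus>\<^bsub>W\<^esub> b)) \<longlonglongrightarrow> 0"
    using W unfolding norm_complete_def by blast
  have "(\<lambda>n. seminorm P (s n \<ominus>\<^bsub>P\<^esub> pair_enc (a, b))) \<longlonglongrightarrow> 0"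
    using tendsto_add[OF a(2) b(2)] xy a b by (simp add: prod_minus prod_simps)
  then show "\<exists>z\<in>carrier P. (\<lambda>n. seminorm P (s n \<ominus>\<^bsub>P\<^esub> z)) \<longlonglongrightarrow> 0"
    using a b by (intro bexI[of _ "pair_enc (a, b)"]) (auto simp: prod_simps)
qed

definition "inl = (\<lambda>x \<in> carrier V. pair_enc (x, \<zero>\<^bsub>W\<^esub>))"
definition "inr = (\<lambda>y \<in> carrier W. pair_enc (\<zero>\<^bsub>V\<^esub>, y))"
definition "prl = (\<lambda>z \<in> carrier P. fst (inv_into UNIV pair_enc z))"
definition "prr = (\<lambda>z \<in> carrier P. snd (inv_into UNIV pair_enc z))"

lemma prod_map_simps:
  "x \<in> carrier V ==> inl x = pair_enc (x, \<zero>\<^bsub>W\<^esub>)" "y \<in> carrier W ==> inr y = pair_enc (\<zero>\<^bsub>V\<^esub>, y)"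
  "x \<in> carrier V ==> y \<in> carrier W ==> prl (pair_enc (x, y)) = x"
  "x \<in> carrier V ==> y \<in> carrier W ==> prr (pair_enc (x, y)) = y"
  by (simp_all add: inl_def inr_def prl_def prr_def prod_simps inj_pair_enc)

lemma prod_maps:
  "bounded_linear_map V P inl" "bounded_linear_map W P inr"
  "bounded_linear_map P V prl" "bounded_linear_map P W prr"
proof -
  show "bounded_linear_map V P inl"
    by (rule bounded_linear_mapI[where K = 1]) (auto simp: prod_map_simps prod_simps, simp add: inl_def)
  show "bounded_linear_map W P inr"
    by (rule bounded_linear_mapI[where K = 1]) (auto simp: prod_map_simps prod_simps, simp add: inr_def)
  show "bounded_linear_map P V prl"
  proof (rule bounded_linear_mapI[where K = 1], goal_cases)
    case 2 show ?case by (simp add: prl_def)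
  qed (auto simp: prod_map_simps prod_simps)
  show "bounded_linear_map P W prr"
  proof (rule bounded_linear_mapI[where K = 1], goal_cases)
    case 2 show ?case by (simp add: prr_def)
  qed (auto simp: prod_map_simps prod_simps)
qed

end

section \<open>Categories of seminormed spaces\<close>

lemma bounded_linear_map_ext:
  "bounded_linear_map V W f ==> bounded_linear_map V W' g ==> (\<And>x. x \<in> carrier V ==> f x = g x) ==> f = g"
  by (rule extensionalityI[of _ "carrier V"]) (auto simp: bounded_linear_map_def PiE_def)

context universe
begin

lemma small_UNIV_fun:
  assumes "small TYPE('v) (UNIV :: 'a set)" "small TYPE('v) (UNIV :: 'b set)"
  shows "small TYPE('v) (UNIV :: ('a \<Rightarrow> 'b) set)"
  using small_PiE[of "UNIV :: 'a set" "\<lambda>_. UNIV :: 'b set"] assms by (simp add: PiE_UNIV_domain)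

lemma small_UNIV_prod:
  assumes "small TYPE('v) (UNIV :: 'a set)" "small TYPE('v) (UNIV :: 'b set)"
  shows "small TYPE('v) (UNIV :: ('a \<times> 'b) set)"
  using small_Times[OF assms] by simp

lemma small_UNIV_set: "small TYPE('v) (UNIV :: 'a set) ==> small TYPE('v) (UNIV :: 'a set set)"
  using small_Pow[of "UNIV :: 'a set"] by simp

text \<open>Dedekind cuts, with the rationals enumerated by \<open>from_nat\<close>, embed the reals
  into the sets of natural numbers.\<close>

lemma small_real: "small TYPE('v) (UNIV :: real set)"
proof (rule small_inj_on)
  let ?F = "\<lambda>x :: real. {n :: nat. real_of_rat (from_nat n) < x}"
  have "x < y ==> ?F x \<noteq> ?F y" for x y :: real
  proof -
    assume "x < y"
    then obtain z where "x < of_rat z" "of_rat z < y" using of_rat_dense by blast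
    then have "to_nat z \<in> ?F y" "to_nat z \<notin> ?F x" by auto
    then show "?F x \<noteq> ?F y" by blast
  qed
  then show "inj_on ?F UNIV" by (rule linorder_injI)
  show "small TYPE('v) (UNIV :: nat set set)"
    by (rule small_UNIV_set) (use universe in \<open>simp add: grothendieck_universe_def\<close>)
qed simp

lemma small_complex: "small TYPE('v) (UNIV :: complex set)"
proof (rule small_inj_on)
  show "inj_on (\<lambda>z. (Re z, Im z)) UNIV" by (auto intro: injI complex_eqI)
  show "small TYPE('v) (UNIV :: (real \<times> real) set)" by (rule small_UNIV_prod[OF small_real small_real])
qed simp

text \<open>Already the type of all such records is small in \<open>'v\<close>, because each field
  ranges over a type built from small ones. This makes the base category small one universe
  up.\<close>

lemma small_sn_spaces:
  assumes u: "small TYPE('v) (UNIV :: 'u set)" and k: "small TYPE('v) (UNIV :: 'k set)"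
  shows "small TYPE('v) (UNIV :: ('k, 'u) sn_space set)"
proof (rule small_inj_on)
  let ?F = "\<lambda>V :: ('k, 'u) sn_space. (carrier V, monoid.mult V, monoid.one V, ring.zero V, ring.add V,
    module.smult V, seminorm V)"
  show "inj_on ?F UNIV" by (auto intro!: injI sn_space.equality)
  show "small TYPE('v) (UNIV :: ('u set \<times> ('u \<Rightarrow> 'u \<Rightarrow> 'u) \<times> 'u \<times> 'u \<times> ('u \<Rightarrow> 'u \<Rightarrow> 'u) \<times>
      ('k \<Rightarrow> 'u \<Rightarrow> 'u) \<times> ('u \<Rightarrow> real)) set)"
    by (intro small_UNIV_prod small_UNIV_fun small_UNIV_set small_real u k)
qed simp

end

context bounded_linear_maps
begin

lemma bounded_linear_map_compose:
  assumes X: "seminormed X" and g: "bounded_linear_map W X g"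
  shows "bounded_linear_map V X (compose (carrier V) g f)"
proof -
  interpret g: bounded_linear_maps W X g by unfold_locales (rule X g)+
  obtain K where K: "K > 0" "\<And>x. x \<in> carrier V ==> seminorm W (f x) \<le> K * seminorm V x" using bound by blast
  obtain L where L: "L > 0" "\<And>x. x \<in> carrier W ==> seminorm X (g x) \<le> L * seminorm W x" using g.bound by blast
  show ?thesis
  proof (rule bounded_linear_mapI[where K = "L * K"])
    fix x assume x: "x \<in> carrier V"
    have "seminorm X (g (f x)) \<le> L * seminorm W (f x)" using L(2)[OF closed[OF x]] .
    also have "\<dots> \<le> L * (K * seminorm V x)" using K(2)[OF x] L(1) by (intro mult_left_mono) auto
    finally show "seminorm X (compose (carrier V) g f x) \<le> L * K * seminorm V x"
      using x by (simp add: compose_def)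
  qed (use K(1) L(1) in \<open>auto simp: compose_def add smult g.add g.smult\<close>)
qed

lemma bounded_linear_map_add:
  assumes g: "bounded_linear_map V W g"
  shows "bounded_linear_map V W (\<lambda>x \<in> carrier V. f x \<oplus>\<^bsub>W\<^esub> g x)"
proof -
  interpret g: bounded_linear_maps V W g by unfold_locales (rule g)
  obtain K where K: "K > 0" "\<And>x. x \<in> carrier V ==> seminorm W (f x) \<le> K * seminorm V x" using bound by blast
  obtain L where L: "L > 0" "\<And>x. x \<in> carrier V ==> seminorm W (g x) \<le> L * seminorm V x" using g.bound by blast
  show ?thesis
  proof (rule bounded_linear_mapI[where K = "K + L"])
    fix x assume x: "x \<in> carrier V"
    show "seminorm W ((\<lambda>x \<in> carrier V. f x \<oplus>\<^bsub>W\<^esub> g x) x) \<le> (K + L) * seminorm V x"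
      using W.seminorm_triangle[of "f x" "g x"] K(2)[OF x] L(2)[OF x] x by (simp add: distrib_right)
  qed (use K(1) L(1) in \<open>auto simp: add smult g.add g.smult W.M.a_ac W.smult_distr_right\<close>)
qed

lemma bounded_linear_map_smult:
  "bounded_linear_map V W (\<lambda>x \<in> carrier V. c \<odot>\<^bsub>W\<^esub> f x)"
proof -
  obtain K where K: "K > 0" "\<And>x. x \<in> carrier V ==> seminorm W (f x) \<le> K * seminorm V x" using bound by blast
  show ?thesis
  proof (rule bounded_linear_mapI[where K = "norm c * K"])
    fix x assume x: "x \<in> carrier V"
    show "seminorm W ((\<lambda>x \<in> carrier V. c \<odot>\<^bsub>W\<^esub> f x) x) \<le> norm c * K * seminorm V x"
      using mult_left_mono[OF K(2)[OF x], of "norm c"] x by (simp add: W.seminorm_smult mult.assoc)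
  qed (use K(1) in \<open>auto simp: add smult W.smult_distr_right mult.commute simp flip: W.smult_assoc\<close>)
qed

end

text \<open>Two switches cover the three categories: both off for semi-normed spaces,
  \<open>sep\<close> alone for normed spaces, both on for Banach spaces. The assumption excludes
  completeness without separatedness, where kernels can fail to be closed and hence to be
  complete.\<close>

locale seminormed_category = universe U for U :: "'u itself" +
  fixes K :: "'k::real_normed_field itself" and sep cmpl :: bool
  assumes sep: "cmpl ==> sep"
begin

definition good :: "('k, 'u) sn_space \<Rightarrow> bool" where
  "good V \<longleftrightarrow> (sep \<longrightarrow> norm_separated V) \<and> (cmpl \<longrightarrow> norm_complete V)"

definition ob :: "('k, 'u) sn_space \<Rightarrow> bool" where
  "ob V \<longleftrightarrow> seminormed V \<and> small TYPE('u) (carrier V) \<and> good V"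

abbreviation "C \<equiv> full_subcat (SNorm TYPE('k) TYPE('u)) good"

lemma Obj_iff: "V \<in> Obj C \<longleftrightarrow> ob V"
  by (auto simp: full_subcat_def SNorm_def Let_def ob_def)

lemma sn_arrows_iff:
  "t \<in> arrows C V W \<longleftrightarrow> ob V \<and> ob W \<and> (\<exists>f. t = (V, f, W) \<and> bounded_linear_map V W f)"
  by (cases t) (auto simp: full_subcat_def SNorm_def Let_def ob_def arrows_def)

lemma sn_simps:
  "Dom C (V, f, W) = V" "Cod C (V, f, W) = W" "Idn C V = (V, \<lambda>x \<in> carrier V. x, V)"
  "Cmp C (W', g, X) (V, f, W) = (V, compose (carrier V) g f, X)"
  by (simp_all add: full_subcat_def SNorm_def Let_def)

lemma ob_space: "ob V ==> seminormed_space V"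
  by (simp add: ob_def seminormed_space_def)

lemma ob_maps: "ob V ==> ob W ==> bounded_linear_map V W f ==> bounded_linear_maps V W f"
  by (simp add: ob_def seminormed_space_def bounded_linear_maps_def bounded_linear_maps_axioms_def)

lemma ob_seminormed: "ob V ==> seminormed V"
  by (simp add: ob_def)

lemma bounded_linear_map_id:
  assumes "ob V"
  shows "bounded_linear_map V V (\<lambda>x \<in> carrier V. x)"
proof -
  interpret seminormed_space V by (rule ob_space) fact
  show ?thesis by (rule bounded_linear_mapI[where K = 1]) auto
qed

lemma category: "category C"
proof
  show "f \<in> Arr C ==> Dom C f \<in> Obj C" "f \<in> Arr C ==> Cod C f \<in> Obj C" for f
    using sn_arrows_iff[of f "Dom C f" "Cod C f"] Arr_arrows[of f C] unfolding Obj_iff by blast+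
  show "Idn C V \<in> arrows C V V" if "V \<in> Obj C" for V
    using that bounded_linear_map_id unfolding Obj_iff sn_arrows_iff sn_simps by blast
  show "Cmp C g f \<in> arrows C X Z" if "f \<in> arrows C X Y" "g \<in> arrows C Y Z" for f g X Y Z
    using that bounded_linear_maps.bounded_linear_map_compose[OF ob_maps] ob_seminormed
    unfolding sn_arrows_iff by (auto simp: sn_simps)
  show "Cmp C (Idn C Y) f = f" "Cmp C f (Idn C X) = f" if "f \<in> arrows C X Y" for f X Y
    using that unfolding sn_arrows_iff
    by (auto simp: sn_simps fun_eq_iff bounded_linear_map_def compose_def PiE_def extensional_def Pi_def) metis
  show "Cmp C h (Cmp C g f) = Cmp C (Cmp C h g) f"
    if "f \<in> arrows C W X" "g \<in> arrows C X Y" "h \<in> arrows C Y Z" for f g h W X Y Z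
    using that unfolding sn_arrows_iff
    by (auto simp: sn_simps fun_eq_iff bounded_linear_map_def compose_def PiE_def extensional_def Pi_def)
qed

definition pl :: "('k, 'u) sn_arr \<Rightarrow> ('k, 'u) sn_arr \<Rightarrow> ('k, 'u) sn_arr" where
  "pl = (\<lambda>(V, f, W) (_, g, _). (V, \<lambda>x \<in> carrier V. f x \<oplus>\<^bsub>W\<^esub> g x, W))"

definition neg :: "('k, 'u) sn_arr \<Rightarrow> ('k, 'u) sn_arr" where
  "neg = (\<lambda>(V, f, W). (V, \<lambda>x \<in> carrier V. (-1) \<odot>\<^bsub>W\<^esub> f x, W))"

definition nul :: "('k, 'u) sn_space \<Rightarrow> ('k, 'u) sn_space \<Rightarrow> ('k, 'u) sn_arr" where
  "nul V W = (V, \<lambda>x \<in> carrier V. \<zero>\<^bsub>W\<^esub>, W)"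

definition SE :: "('k, 'u) sn_arr \<Rightarrow> bool" where
  "SE = (\<lambda>(V, f, W). ob V \<and> ob W \<and> bounded_linear_map V W f \<and> bounded_linear_maps.open_map V W f)"

sublocale preadditive C pl neg nul
proof (intro preadditive.intro category preadditive_axioms.intro)
  fix X Y assume "X \<in> Obj C" "Y \<in> Obj C"
  then have ob: "ob X" "ob Y" by (simp_all add: Obj_iff)
  interpret X: seminormed_space X by (rule ob_space[OF ob(1)])
  interpret Y: seminormed_space Y by (rule ob_space[OF ob(2)])
  have "bounded_linear_map X Y (\<lambda>x \<in> carrier X. \<zero>\<^bsub>Y\<^esub>)"
    by (rule bounded_linear_mapI[where K = 0]) auto
  then show "nul X Y \<in> arrows C X Y" using ob by (auto simp: sn_arrows_iff nul_def)
next
  fix f g h X Y assume f: "f \<in> arrows C X Y"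
  obtain f' where f': "ob X" "ob Y" "f = (X, f', Y)" "bounded_linear_map X Y f'" using f unfolding sn_arrows_iff by blast
  interpret f: bounded_linear_maps X Y f' by (rule ob_maps[OF f'(1,2,4)])
  show "neg f \<in> arrows C X Y" using f' f.bounded_linear_map_smult by (auto simp: sn_arrows_iff neg_def)
  have e: "x \<notin> carrier X ==> f' x = undefined" for x using f'(4) by (auto simp: bounded_linear_map_def)
  show "pl f (nul X Y) = f"
    using f' e by (auto simp: pl_def nul_def fun_eq_iff)
  show "pl f (neg f) = nul X Y"
    using f' by (auto simp: pl_def nul_def neg_def fun_eq_iff f.W.M.r_neg simp flip: f.W.inv_smult)
  assume g: "g \<in> arrows C X Y"
  obtain g' where g': "g = (X, g', Y)" "bounded_linear_map X Y g'" using g unfolding sn_arrows_iff by blast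
  interpret g: bounded_linear_maps X Y g' by (rule ob_maps[OF f'(1,2) g'(2)])
  show "pl f g \<in> arrows C X Y" using f' g' f.bounded_linear_map_add by (auto simp: sn_arrows_iff pl_def)
  show "pl f g = pl g f" using f' g' by (auto simp: pl_def fun_eq_iff f.W.M.a_comm)
  assume h: "h \<in> arrows C X Y"
  obtain h' where h': "h = (X, h', Y)" "bounded_linear_map X Y h'" using h unfolding sn_arrows_iff by blast
  interpret h: bounded_linear_maps X Y h' by (rule ob_maps[OF f'(1,2) h'(2)])
  show "pl (pl f g) h = pl f (pl g h)"
    using f' g' h' by (auto simp: pl_def fun_eq_iff f.W.M.a_assoc)
next
  fix f f' g X Y Z assume "f \<in> arrows C X Y" "f' \<in> arrows C X Y" "g \<in> arrows C Y Z"
  then obtain F F' G where *: "ob X" "ob Y" "ob Z" "f = (X, F, Y)" "bounded_linear_map X Y F"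
    "f' = (X, F', Y)" "bounded_linear_map X Y F'" "g = (Y, G, Z)" "bounded_linear_map Y Z G"
    unfolding sn_arrows_iff by blast
  interpret F: bounded_linear_maps X Y F by (rule ob_maps) fact+
  interpret F': bounded_linear_maps X Y F' by (rule ob_maps) fact+
  interpret G: bounded_linear_maps Y Z G by (rule ob_maps) fact+
  show "Cmp C g (pl f f') = pl (Cmp C g f) (Cmp C g f')"
    using * by (auto simp: pl_def sn_simps compose_def fun_eq_iff G.add)
next
  fix f g g' X Y Z assume "f \<in> arrows C X Y" "g \<in> arrows C Y Z" "g' \<in> arrows C Y Z"
  then obtain F G G' where *: "ob X" "ob Y" "ob Z" "f = (X, F, Y)" "bounded_linear_map X Y F"
    "g = (Y, G, Z)" "g' = (Y, G', Z)"
    unfolding sn_arrows_iff by blast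
  interpret F: bounded_linear_maps X Y F by (rule ob_maps) fact+
  show "Cmp C (pl g g') f = pl (Cmp C g f) (Cmp C g' f)"
    using * by (auto simp: pl_def sn_simps compose_def fun_eq_iff)
qed

lemma ob_subspace:
  assumes V: "ob V" and N: "seminormed_space.subspace V N"
    and closed: "cmpl ==> seminormed_space.closed_subset V N"
  shows "ob (V\<lparr>carrier := N\<rparr>)"
proof -
  interpret V: seminormed_space V by (rule ob_space[OF V])
  have "N \<subseteq> carrier V" using N by (simp add: V.subspace_def)
  then show ?thesis
    using V V.seminormed_subspace[OF N] V.norm_separated_subspace[OF _ N] V.norm_complete_subspace[OF _ N closed]
      small_subset by (auto simp: ob_def good_def)
qed

text \<open>Closedness of \<open>N\<close> gives separatedness; completeness passes along the
  projection because it is an open surjection.\<close>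

lemma ob_quo:
  assumes V: "ob V" and N: "seminormed_space.subspace V N"
    and closed: "sep ==> seminormed_space.closed_subset V N"
  shows "ob (quotient_space.quo V N)"
proof -
  interpret V: seminormed_space V by (rule ob_space[OF V])
  interpret quotient_space V N by unfold_locales (rule N)
  show ?thesis
    using V seminormed_quo norm_separated_quo[OF closed] Q.norm_complete_open_map[OF open_map_proj] small_image
    by (auto simp: ob_def good_def quo_simps(1))
qed

lemma ob_prod:
  assumes "ob V" "ob W"
  shows "ob (prod_space V W)"
proof -
  interpret V: seminormed_space V by (rule ob_space) fact
  interpret W: seminormed_space W by (rule ob_space) fact
  interpret product_space U V W ..
  show ?thesis
    using assms seminormed_prod small_prod separated_prod complete_prod by (auto simp: ob_def good_def)
qed

lemma bounded_linear_map_inclusion: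
  assumes "ob V" "seminormed_space.subspace V N"
  shows "bounded_linear_map (V\<lparr>carrier := N\<rparr>) V (\<lambda>x \<in> N. x)"
proof -
  interpret V: seminormed_space V by (rule ob_space) fact
  show ?thesis
    using assms(2) unfolding V.subspace_def
    by (intro bounded_linear_mapI[where K = 1]) auto
qed

text \<open>Completeness of the kernel is obtained from its being closed, which follows from
  separatedness of \<open>W\<close>; this uses that \<open>cmpl\<close> implies
  \<open>sep\<close>.\<close>

lemma ob_kernel:
  assumes "ob V" "ob W" "bounded_linear_map V W f"
  shows "ob (V\<lparr>carrier := {x \<in> carrier V. f x = \<zero>\<^bsub>W\<^esub>}\<rparr>)"
proof -
  interpret bounded_linear_maps V W f by (rule ob_maps) fact+
  show ?thesis
    using ob_subspace[OF assms(1) subspace_kernel] closed_subset_kernel sep assms(2) by (auto simp: ob_def good_def)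
qed

text \<open>By \<open>factor_open_map\<close> a map descends along \<open>f\<close> as soon as it
  kills the kernel of \<open>f\<close>. The assumption \<open>kill\<close> supplies this for maps
  that are only known to vanish on the image of \<open>a\<close>; in the separated categories it
  will be met by a closure argument.\<close>

lemma coker_open_map:
  assumes ob: "ob X" "ob V" "ob W" and maps: "bounded_linear_map X V a" "bounded_linear_map V W f"
    and op: "bounded_linear_maps.open_map V W f"
    and 0: "\<And>x. x \<in> carrier X ==> f (a x) = \<zero>\<^bsub>W\<^esub>"
    and kill: "\<And>Z g v. ob Z ==> bounded_linear_map V Z g ==> (\<And>x. x \<in> carrier X ==> g (a x) = \<zero>\<^bsub>Z\<^esub>) ==>
      v \<in> carrier V ==> f v = \<zero>\<^bsub>W\<^esub> ==> g v = \<zero>\<^bsub>Z\<^esub>"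
  shows "coker (X, a, V) (V, f, W)"
proof -
  interpret a: bounded_linear_maps X V a by (rule ob_maps) fact+
  interpret f: bounded_linear_maps V W f by (rule ob_maps) fact+
  have arr: "(X, a, V) \<in> arrows C X V" "(V, f, W) \<in> arrows C V W" using ob maps by (simp_all add: sn_arrows_iff)
  have univ: "\<exists>!u. u \<in> arrows C W Z \<and> Cmp C u (V, f, W) = h"
    if "h \<in> arrows C V Z" and ha: "Cmp C h (X, a, V) = nul X Z" for Z h
  proof -
    obtain g where g: "ob Z" "h = (V, g, Z)" "bounded_linear_map V Z g" using \<open>h \<in> arrows C V Z\<close> unfolding sn_arrows_iff by blast
    have ga: "g (a x) = \<zero>\<^bsub>Z\<^esub>" if "x \<in> carrier X" for x
      using ha that g(2) by (auto simp: sn_simps nul_def compose_def fun_eq_iff split: if_splits)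
    obtain u where u: "bounded_linear_map W Z u" "\<And>x. x \<in> carrier V ==> u (f x) = g x"
      using f.factor_open_map[OF op ob_seminormed[OF g(1)] g(3) kill[OF g(1,3) ga]] by blast
    show ?thesis
    proof (rule ex1I[of _ "(W, u, Z)"], intro conjI)
      show "(W, u, Z) \<in> arrows C W Z" using ob g u by (simp add: sn_arrows_iff)
      show "Cmp C (W, u, Z) (V, f, W) = h"
        using g u by (auto simp: sn_simps compose_def fun_eq_iff bounded_linear_map_def)
    next
      fix w assume w: "w \<in> arrows C W Z \<and> Cmp C w (V, f, W) = h"
      then obtain w' where w': "w = (W, w', Z)" "bounded_linear_map W Z w'" unfolding sn_arrows_iff by blast
      have "w' y = u y" if y: "y \<in> carrier W" for y
      proof -
        obtain x where x: "x \<in> carrier V" "f x = y"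
          using op y unfolding f.open_map_def by (metis zero_less_one)
        have "compose (carrier V) w' f x = g x" using w w' g(2) by (simp add: sn_simps)
        then show ?thesis using u(2)[OF x(1)] x by (simp add: compose_def)
      qed
      then show "w = (W, u, Z)" using bounded_linear_map_ext[OF w'(2) u(1)] w'(1) by simp
    qed
  qed
  have fa: "Cmp C (V, f, W) (X, a, V) = nul X W"
    using 0 by (auto simp: sn_simps nul_def compose_def fun_eq_iff)
  show ?thesis
    unfolding coker_def sn_simps(1,2)
  proof (intro conjI allI ballI impI)
    show "(X, a, V) \<in> Arr C" "(V, f, W) \<in> Arr C" using arr by (simp_all add: arrows_def)
  qed (use fa univ in simp_all)
qed

text \<open>The set of points where every map vanishing on \<open>A\<close> must vanish.\<close>

definition vanishing_hull :: "('k, 'u) sn_space \<Rightarrow> 'u set \<Rightarrow> 'u set" where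
  "vanishing_hull V A = (if sep then {x \<in> carrier V. \<forall>e>0. \<exists>a \<in> A. seminorm V (x \<ominus>\<^bsub>V\<^esub> a) < e} else A)"

lemma vanishing_hull_sep:
  assumes sep
  shows "vanishing_hull V A = {x \<in> carrier V. \<forall>e>0. \<exists>a \<in> A. seminorm V (x \<ominus>\<^bsub>V\<^esub> a) < e}"
  unfolding vanishing_hull_def using assms by simp

lemma vanishing_hull_not_sep: "\<not> sep ==> vanishing_hull V A = A"
  unfolding vanishing_hull_def by simp

lemma vanish_hull:
  assumes "ob V" "ob W" "bounded_linear_map V W f" "A \<subseteq> carrier V" "\<And>a. a \<in> A ==> f a = \<zero>\<^bsub>W\<^esub>"
    and "x \<in> vanishing_hull V A"
  shows "f x = \<zero>\<^bsub>W\<^esub>"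
proof (cases sep)
  case True
  interpret bounded_linear_maps V W f by (rule ob_maps) fact+
  have "norm_separated W" using True assms(2) unfolding ob_def good_def by blast
  moreover have "x \<in> carrier V" "\<forall>e>0. \<exists>a \<in> A. seminorm V (x \<ominus>\<^bsub>V\<^esub> a) < e"
    using assms(6) by (simp_all add: vanishing_hull_sep[OF True])
  ultimately show ?thesis using vanish_closure[OF _ assms(4,5)] by blast
qed (use assms(5,6) vanishing_hull_not_sep in blast)

lemma subset_hull:
  assumes "ob V" "A \<subseteq> carrier V"
  shows "A \<subseteq> vanishing_hull V A"
proof -
  interpret seminormed_space V by (rule ob_space) fact
  have "seminorm V (x \<ominus>\<^bsub>V\<^esub> x) = 0" if "x \<in> carrier V" for x
    using minus_zero_iff[OF that that] by simp
  then have "\<exists>a \<in> A. seminorm V (x \<ominus>\<^bsub>V\<^esub> a) < e" if "x \<in> A" "e > 0" for x e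
    using that assms(2) by (intro bexI[of _ x]) auto
  then show ?thesis using assms(2) unfolding vanishing_hull_def by auto
qed

lemma subspace_hull:
  assumes "ob V" and A: "seminormed_space.subspace V A"
  shows "seminormed_space.subspace V (vanishing_hull V A)"
proof (cases sep)
  case True
  interpret seminormed_space V by (rule ob_space) fact
  have AV: "A \<subseteq> carrier V" using A by (simp add: subspace_def)
  show ?thesis
    unfolding subspace_def
  proof (intro conjI ballI allI)
    show "vanishing_hull V A \<subseteq> carrier V" by (auto simp: vanishing_hull_sep[OF True])
    show "\<zero>\<^bsub>V\<^esub> \<in> vanishing_hull V A" using subset_hull[OF assms(1) AV] A by (auto simp: subspace_def)
    fix x assume "x \<in> vanishing_hull V A"
    then have x: "x \<in> carrier V" "\<And>e. e > 0 ==> \<exists>a \<in> A. seminorm V (x \<ominus>\<^bsub>V\<^esub> a) < e"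
      by (auto simp: vanishing_hull_sep[OF True])
    show "c \<odot>\<^bsub>V\<^esub> x \<in> vanishing_hull V A" for c
    proof -
      have "\<exists>a \<in> A. seminorm V (c \<odot>\<^bsub>V\<^esub> x \<ominus>\<^bsub>V\<^esub> a) < e" if e: "e > 0" for e
      proof -
        have "e / (norm c + 1) > 0" using e by (simp add: add_nonneg_pos)
        from x(2)[OF this] obtain a where a: "a \<in> A" "seminorm V (x \<ominus>\<^bsub>V\<^esub> a) < e / (norm c + 1)" by blast
        have aV: "a \<in> carrier V" using a AV by blast
        have "seminorm V (c \<odot>\<^bsub>V\<^esub> x \<ominus>\<^bsub>V\<^esub> c \<odot>\<^bsub>V\<^esub> a) = norm c * seminorm V (x \<ominus>\<^bsub>V\<^esub> a)"
          using x(1) aV by (simp add: seminorm_smult flip: smult_minus)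
        also have "\<dots> \<le> (norm c + 1) * seminorm V (x \<ominus>\<^bsub>V\<^esub> a)"
          using x(1) aV by (intro mult_right_mono) auto
        also have "\<dots> < e" using a(2) by (simp add: less_divide_eq add_nonneg_pos mult.commute)
        finally show ?thesis using a(1) A by (auto simp: subspace_def)
      qed
      then show ?thesis using x(1) by (simp add: vanishing_hull_sep[OF True])
    qed
    fix y assume "y \<in> vanishing_hull V A"
    then have y: "y \<in> carrier V" "\<And>e. e > 0 ==> \<exists>a \<in> A. seminorm V (y \<ominus>\<^bsub>V\<^esub> a) < e"
      by (auto simp: vanishing_hull_sep[OF True])
    have "\<exists>a \<in> A. seminorm V ((x \<oplus>\<^bsub>V\<^esub> y) \<ominus>\<^bsub>V\<^esub> a) < e" if e: "e > 0" for e
    proof -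
      obtain a b where a: "a \<in> A" "seminorm V (x \<ominus>\<^bsub>V\<^esub> a) < e / 2" and b: "b \<in> A" "seminorm V (y \<ominus>\<^bsub>V\<^esub> b) < e / 2"
        using x(2)[of "e / 2"] y(2)[of "e / 2"] e by auto
      have "a \<in> carrier V" "b \<in> carrier V" using a b AV by auto
      then have "seminorm V ((x \<oplus>\<^bsub>V\<^esub> y) \<ominus>\<^bsub>V\<^esub> (a \<oplus>\<^bsub>V\<^esub> b)) < e"
        using a(2) b(2) x(1) y(1) seminorm_triangle[of "x \<ominus>\<^bsub>V\<^esub> a" "y \<ominus>\<^bsub>V\<^esub> b"] by (simp add: add_minus_add)
      then show ?thesis using a(1) b(1) A by (auto simp: subspace_def)
    qed
    then show "x \<oplus>\<^bsub>V\<^esub> y \<in> vanishing_hull V A" using x(1) y(1) by (simp add: vanishing_hull_sep[OF True])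
  qed
qed (metis A vanishing_hull_not_sep)

text \<open>Half of \<open>e\<close> is spent on reaching the hull and the other half on reaching
  \<open>A\<close> from there.\<close>

lemma closed_subset_hull:
  assumes "ob V" and A: "A \<subseteq> carrier V" and sep
  shows "seminormed_space.closed_subset V (vanishing_hull V A)"
proof -
  interpret seminormed_space V by (rule ob_space) fact
  show ?thesis
    unfolding closed_subset_def
  proof (intro ballI impI)
    fix x assume x: "x \<in> carrier V" "\<forall>e>0. \<exists>n \<in> vanishing_hull V A. seminorm V (x \<ominus>\<^bsub>V\<^esub> n) < e"
    have "\<exists>a \<in> A. seminorm V (x \<ominus>\<^bsub>V\<^esub> a) < e" if e: "e > 0" for e
    proof -
      obtain n where n: "n \<in> vanishing_hull V A" "seminorm V (x \<ominus>\<^bsub>V\<^esub> n) < e / 2" using x(2) e half_gt_zero by blast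
      have nV: "n \<in> carrier V" using n by (simp add: vanishing_hull_sep[OF \<open>sep\<close>])
      obtain a where a: "a \<in> A" "seminorm V (n \<ominus>\<^bsub>V\<^esub> a) < e / 2"
        using n(1) half_gt_zero[OF e] unfolding vanishing_hull_sep[OF \<open>sep\<close>] by blast
      have "seminorm V (x \<ominus>\<^bsub>V\<^esub> a) < e"
        using seminorm_minus_triangle[OF x(1) nV, of a] n(2) a A by auto
      then show ?thesis using a(1) by blast
    qed
    then show "x \<in> vanishing_hull V A" using x(1) by (simp add: vanishing_hull_sep[OF \<open>sep\<close>])
  qed
qed

lemma ex_zero_space: "\<exists>Z \<in> Obj C. Idn C Z = nul Z Z"
proof
  let ?Z = "\<lparr>carrier = {undefined}, monoid.mult = undefined, one = undefined, zero = undefined,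
    add = \<lambda>x y. undefined, module.smult = \<lambda>c x. undefined, seminorm = \<lambda>x. 0\<rparr> :: ('k, 'u) sn_space"
  have "ob ?Z"
    unfolding ob_def good_def
    by (auto intro!: seminormedI small_finite simp: norm_separated_def norm_complete_def)
  then show "?Z \<in> Obj C" by (simp add: Obj_iff)
  show "Idn C ?Z = nul ?Z ?Z" by (auto simp: sn_simps nul_def fun_eq_iff)
qed

lemma ex_biproduct:
  assumes "X \<in> Obj C" "Y \<in> Obj C"
  shows "\<exists>P. \<exists>i \<in> arrows C X P. \<exists>j \<in> arrows C Y P. \<exists>p \<in> arrows C P X. \<exists>q \<in> arrows C P Y.
    Cmp C p i = Idn C X \<and> Cmp C q j = Idn C Y \<and> Cmp C p j = nul Y X \<and> Cmp C q i = nul X Y"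
proof -
  have ob: "ob X" "ob Y" using assms by (simp_all add: Obj_iff)
  interpret X: seminormed_space X by (rule ob_space) fact
  interpret Y: seminormed_space Y by (rule ob_space) fact
  interpret product_space U X Y ..
  have P: "ob P" using ob_prod[OF ob] .
  show ?thesis
  proof (intro exI[of _ P] bexI conjI)
    show "(X, inl, P) \<in> arrows C X P" "(Y, inr, P) \<in> arrows C Y P"
      "(P, prl, X) \<in> arrows C P X" "(P, prr, Y) \<in> arrows C P Y"
      using ob P prod_maps by (simp_all add: sn_arrows_iff)
  qed (auto simp: sn_simps nul_def compose_def fun_eq_iff prod_map_simps)
qed

text \<open>The inclusion of the kernel of \<open>f\<close> is taken for \<open>a\<close>; a map
  that kills it trivially kills the kernel of \<open>f\<close>.\<close>

lemma SE_coker: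
  assumes "SE e"
  shows "\<exists>a. coker a e"
proof -
  obtain V f W where e: "e = (V, f, W)" "ob V" "ob W" "bounded_linear_map V W f"
    "bounded_linear_maps.open_map V W f"
    using assms by (cases e) (auto simp: SE_def)
  interpret bounded_linear_maps V W f by (rule ob_maps) fact+
  let ?N = "{x \<in> carrier V. f x = \<zero>\<^bsub>W\<^esub>}"
  have "coker (V\<lparr>carrier := ?N\<rparr>, \<lambda>x \<in> ?N. x, V) (V, f, W)"
  proof (rule coker_open_map)
    show "g v = \<zero>\<^bsub>Z\<^esub>" if g: "\<And>x. x \<in> carrier (V\<lparr>carrier := ?N\<rparr>) ==> g ((\<lambda>x \<in> ?N. x) x) = \<zero>\<^bsub>Z\<^esub>"
      and v: "v \<in> carrier V" "f v = \<zero>\<^bsub>W\<^esub>" for Z g v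
      using g[of v] v by simp
  qed (use e ob_kernel bounded_linear_map_inclusion[OF _ subspace_kernel] in auto)
  then show ?thesis using e(1) by blast
qed

text \<open>The cokernel is the quotient by the hull \<open>N\<close> of the image, and
  \<open>I\<close> is \<open>N\<close> with the restricted seminorm. In the separated cases the
  image is merely dense in \<open>I\<close>, which still makes \<open>e\<close> epic because the
  targets are separated.\<close>

lemma cok_image:
  assumes "t \<in> arrows C X Y"
  shows "\<exists>q. coker t q \<and> SE q \<and>
      (\<exists>I. \<exists>e \<in> arrows C X I. \<exists>j \<in> arrows C I Y. Cmp C j e = t \<and> Cmp C q j = nul I (Cod C q) \<and>
         (\<forall>W. \<forall>u \<in> arrows C I W. Cmp C u e = nul X W \<longrightarrow> u = nul I W) \<and>
         (\<forall>W. \<forall>g \<in> arrows C W Y. Cmp C q g = nul W (Cod C q) \<longrightarrow>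
            (\<exists>g' \<in> arrows C W I. g = Cmp C j g')))"
proof -
  obtain a where a: "ob X" "ob Y" "t = (X, a, Y)" "bounded_linear_map X Y a"
    using assms unfolding sn_arrows_iff by blast
  interpret a: bounded_linear_maps X Y a by (rule ob_maps) fact+
  define A where "A = a ` carrier X"
  have A: "a.W.subspace A"
    unfolding a.W.subspace_def
  proof (intro conjI ballI allI)
    show "\<zero>\<^bsub>Y\<^esub> \<in> A" unfolding A_def using a.zero by (metis imageI a.V.M.zero_closed)
    show "x \<oplus>\<^bsub>Y\<^esub> y \<in> A" if "x \<in> A" "y \<in> A" for x y
      using that unfolding A_def by (auto simp flip: a.add)
    show "c \<odot>\<^bsub>Y\<^esub> x \<in> A" if "x \<in> A" for c x
      using that unfolding A_def by (auto simp flip: a.smult)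
  qed (auto simp: A_def)
  then have AY: "A \<subseteq> carrier Y" by (simp add: a.W.subspace_def)
  define N where "N = vanishing_hull Y A"
  have N: "a.W.subspace N" unfolding N_def by (rule subspace_hull[OF a(2) A])
  have NY: "N \<subseteq> carrier Y" using N by (simp add: a.W.subspace_def)
  have AN: "A \<subseteq> N" unfolding N_def by (rule subset_hull[OF a(2) AY])
  have closed: "sep ==> a.W.closed_subset N" unfolding N_def by (rule closed_subset_hull[OF a(2) AY])
  interpret quotient_space Y N by unfold_locales (rule N)
  define I where "I = Y\<lparr>carrier := N\<rparr>"
  have I: "ob I" unfolding I_def by (rule ob_subspace[OF a(2) N]) (use sep closed in blast)
  have Q: "ob quo" by (rule ob_quo[OF a(2) N closed])
  have aN: "a x \<in> N" if "x \<in> carrier X" for x using that AN by (auto simp: A_def)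
  define q where "q = (Y, proj, quo)"
  define e where "e = (X, a, I)"
  define j where "j = (I, \<lambda>x \<in> N. x, Y)"
  have e: "e \<in> arrows C X I"
    using a I a.bounded_linear_map_corestrict[OF N aN] by (simp add: e_def sn_arrows_iff I_def)
  have j: "j \<in> arrows C I Y"
    using a I bounded_linear_map_inclusion[OF a(2) N] by (simp add: j_def sn_arrows_iff I_def)
  have vanish: "g v = \<zero>\<^bsub>Z\<^esub>" if "ob Z" "bounded_linear_map Y Z g" "\<And>x. x \<in> carrier X ==> g (a x) = \<zero>\<^bsub>Z\<^esub>" "v \<in> N"
    for Z g v
    by (rule vanish_hull[OF a(2) that(1,2) AY _ that(4)[unfolded N_def]]) (use that(3) A_def in auto)
  have coker: "coker t q"
    unfolding a(3) q_def
  proof (rule coker_open_map[OF a(1,2) Q a(4) bounded_linear_proj open_map_proj])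
    show "proj (a x) = \<zero>\<^bsub>quo\<^esub>" if "x \<in> carrier X" for x using aN[OF that] that by (simp add: proj_zero_iff)
    show "g v = \<zero>\<^bsub>Z\<^esub>" if "ob Z" "bounded_linear_map Y Z g" "\<And>x. x \<in> carrier X ==> g (a x) = \<zero>\<^bsub>Z\<^esub>"
      "v \<in> carrier Y" "proj v = \<zero>\<^bsub>quo\<^esub>" for Z g v
      by (rule vanish[OF that(1,2)]) (use that proj_zero_iff in auto)
  qed
  have SE: "SE q" unfolding q_def SE_def using a Q bounded_linear_proj open_map_proj by simp
  have je: "Cmp C j e = t"
    using aN a(4) unfolding a(3) e_def j_def sn_simps
    by (auto simp: compose_def fun_eq_iff bounded_linear_map_def)
  have qj: "Cmp C q j = nul I (Cod C q)"
    unfolding q_def j_def sn_simps nul_def I_def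
    using proj_zero_iff NY by (auto simp: compose_def fun_eq_iff)
  have epi: "u = nul I W" if u: "u \<in> arrows C I W" and ue: "Cmp C u e = nul X W" for u W
  proof -
    obtain u' where u': "ob W" "u = (I, u', W)" "bounded_linear_map I W u'" using u unfolding sn_arrows_iff by blast
    have 0: "u' (a x) = \<zero>\<^bsub>W\<^esub>" if "x \<in> carrier X" for x
      using ue that by (auto simp: u' e_def sn_simps nul_def compose_def fun_eq_iff split: if_splits)
    \<comment> \<open>Distances in \<open>I\<close> are those of \<open>Y\<close>, so the hull of
      \<open>A\<close> formed inside \<open>I\<close> is still all of \<open>N\<close>, and a map
      vanishing on \<open>A\<close> vanishes on \<open>I\<close>.\<close>
    have "u' y = \<zero>\<^bsub>W\<^esub>" if y: "y \<in> N" for y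
    proof (rule vanish_hull[OF I u'(1,3)])
      show "A \<subseteq> carrier I" using AN by (simp add: I_def)
      show "u' b = \<zero>\<^bsub>W\<^esub>" if "b \<in> A" for b using that 0 by (auto simp: A_def)
      have "y \<ominus>\<^bsub>I\<^esub> b = y \<ominus>\<^bsub>Y\<^esub> b" if "b \<in> A" for b
        unfolding I_def by (rule a.W.minus_subspace(1)[OF N y]) (use AN that in blast)
      moreover have "seminorm I = seminorm Y" "y \<in> carrier I" using y by (simp_all add: I_def)
      ultimately show "y \<in> vanishing_hull I A"
        using y unfolding N_def vanishing_hull_def by (simp split: if_splits)
    qed
    then show ?thesis using u'(2,3) by (auto simp: nul_def I_def fun_eq_iff bounded_linear_map_def)
  qed
  have factor: "\<exists>g' \<in> arrows C W I. g = Cmp C j g'"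
    if g: "g \<in> arrows C W Y" and qg: "Cmp C q g = nul W (Cod C q)" for g W
  proof -
    obtain h where h: "ob W" "g = (W, h, Y)" "bounded_linear_map W Y h" using g unfolding sn_arrows_iff by blast
    interpret h: bounded_linear_maps W Y h by (rule ob_maps) fact+
    have hN: "h w \<in> N" if w: "w \<in> carrier W" for w
    proof -
      have "proj (h w) = \<zero>\<^bsub>quo\<^esub>"
        using qg w by (auto simp: h q_def sn_simps nul_def compose_def fun_eq_iff split: if_splits)
      then show ?thesis using proj_zero_iff h.closed[OF w] by simp
    qed
    have "(W, h, I) \<in> arrows C W I"
      using h I h.bounded_linear_map_corestrict[OF N hN] by (simp add: sn_arrows_iff I_def)
    moreover have "g = Cmp C j (W, h, I)"
      using hN h(3) unfolding h(2) j_def sn_simps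
      by (auto simp: compose_def fun_eq_iff bounded_linear_map_def)
    ultimately show ?thesis by blast
  qed
  show ?thesis using coker SE e j je qj epi factor by blast
qed

text \<open>The fibre product, realized as the kernel of the difference \<open>k\<close> of the two
  composites on the product space. A point \<open>y\<close> lifts to the pair \<open>(x, y)\<close>,
  where \<open>x\<close> is a preimage of \<open>h y\<close> of controlled seminorm.\<close>

lemma SE_pullback:
  assumes "SE e" "e \<in> arrows C B D" "g \<in> arrows C D' D"
  shows "\<exists>B' e' g'. SE e' \<and> e' \<in> arrows C B' D' \<and> g' \<in> arrows C B' B \<and> Cmp C e g' = Cmp C g e'"
proof -
  obtain f where f: "ob B" "ob D" "e = (B, f, D)" "bounded_linear_map B D f"
    using assms(2) unfolding sn_arrows_iff by blast
  obtain h where h: "ob D'" "g = (D', h, D)" "bounded_linear_map D' D h"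
    using assms(3) unfolding sn_arrows_iff by blast
  interpret f: bounded_linear_maps B D f by (rule ob_maps) fact+
  interpret h: bounded_linear_maps D' D h by (rule ob_maps) fact+
  have op: f.open_map using assms(1) f(3) by (simp add: SE_def)
  interpret product_space U B D' ..
  have P: "ob P" using ob_prod[OF f(1) h(1)] .
  interpret prl: bounded_linear_maps P B prl by (rule ob_maps[OF P f(1) prod_maps(3)])
  interpret prr: bounded_linear_maps P D' prr by (rule ob_maps[OF P h(1) prod_maps(4)])
  define k where "k = (\<lambda>z \<in> carrier P. compose (carrier P) f prl z \<oplus>\<^bsub>D\<^esub>
    (\<lambda>z \<in> carrier P. (-1) \<odot>\<^bsub>D\<^esub> compose (carrier P) h prr z) z)"
  have fl: "bounded_linear_map P D (compose (carrier P) f prl)"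
    by (rule prl.bounded_linear_map_compose[OF f.W.seminormed f(4)])
  have hr: "bounded_linear_map P D (compose (carrier P) h prr)"
    by (rule prr.bounded_linear_map_compose[OF f.W.seminormed h(3)])
  have k: "bounded_linear_map P D k"
    unfolding k_def
    by (rule bounded_linear_maps.bounded_linear_map_add[OF ob_maps[OF P f(2) fl]])
      (rule bounded_linear_maps.bounded_linear_map_smult[OF ob_maps[OF P f(2) hr]])
  interpret k: bounded_linear_maps P D k by (rule ob_maps[OF P f(2) k])
  define S where "S = {z \<in> carrier P. k z = \<zero>\<^bsub>D\<^esub>}"
  have k0: "k z = \<zero>\<^bsub>D\<^esub> \<longleftrightarrow> f (prl z) = h (prr z)" if z: "z \<in> carrier P" for z
    using f.W.minus_zero_iff[of "f (prl z)" "h (prr z)"] f.W.minus_smult[of "f (prl z)" "h (prr z)"] z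
    by (simp add: k_def compose_def)
  define B' where "B' = P\<lparr>carrier := S\<rparr>"
  have B': "ob B'" unfolding B'_def S_def by (rule ob_kernel[OF P f(2) k])
  interpret i: bounded_linear_maps B' P "\<lambda>x \<in> S. x"
    unfolding B'_def S_def by (rule ob_maps[OF ob_kernel[OF P f(2) k] P bounded_linear_map_inclusion[OF P k.subspace_kernel]])
  define l where "l = compose (carrier B') prl (\<lambda>x \<in> S. x)"
  define r where "r = compose (carrier B') prr (\<lambda>x \<in> S. x)"
  have l: "bounded_linear_map B' B l" unfolding l_def
    by (rule i.bounded_linear_map_compose[OF f.V.seminormed prod_maps(3)])
  have r: "bounded_linear_map B' D' r" unfolding r_def
    by (rule i.bounded_linear_map_compose[OF h.V.seminormed prod_maps(4)])
  have lr: "l z = prl z" "r z = prr z" if "z \<in> S" for z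
    using that by (simp_all add: l_def r_def B'_def compose_def)
  interpret r: bounded_linear_maps B' D' r by (rule ob_maps[OF B' h(1) r])
  have "r.open_map"
  proof -
    obtain K where K: "K > 0" "\<And>y e. y \<in> carrier D ==> e > 0 ==>
        \<exists>x \<in> carrier B. f x = y \<and> seminorm B x \<le> K * seminorm D y + e"
      using op unfolding f.open_map_def by blast
    obtain L where L: "L > 0" "\<And>y. y \<in> carrier D' ==> seminorm D (h y) \<le> L * seminorm D' y" using h.bound by blast
    \<comment> \<open>The seminorm of a pair is a sum: \<open>K * L\<close> bounds the first
      component through \<open>h\<close> and \<open>f\<close>, and \<open>1\<close> accounts for
      \<open>y\<close> itself.\<close>
    have "\<exists>z \<in> carrier B'. r z = y \<and> seminorm B' z \<le> (K * L + 1) * seminorm D' y + e"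
      if y: "y \<in> carrier D'" and e: "e > 0" for y e
    proof -
      obtain x where x: "x \<in> carrier B" "f x = h y" "seminorm B x \<le> K * seminorm D (h y) + e"
        using K(2)[OF h.closed[OF y] e] by blast
      have zP: "pair_enc (x, y) \<in> carrier P" using x(1) y by (simp add: prod_simps)
      then have z: "pair_enc (x, y) \<in> S" using k0[OF zP] x y by (simp add: S_def prod_map_simps)
      have "K * seminorm D (h y) \<le> K * (L * seminorm D' y)" using L(2)[OF y] K(1) by (intro mult_left_mono) auto
      then have "seminorm P (pair_enc (x, y)) \<le> (K * L + 1) * seminorm D' y + e"
        using x(3) by (simp add: prod_simps algebra_simps)
      then show ?thesis
        using z x y by (intro bexI[of _ "pair_enc (x, y)"]) (simp_all add: B'_def lr prod_map_simps)
    qed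
    moreover have "K * L + 1 > 0" using K(1) L(1) by (simp add: add_pos_pos)
    ultimately show ?thesis unfolding r.open_map_def by blast
  qed
  then have "SE (B', r, D')" using B' h r by (simp add: SE_def)
  moreover have "(B', r, D') \<in> arrows C B' D'" "(B', l, B) \<in> arrows C B' B"
    using B' h f l r by (simp_all add: sn_arrows_iff)
  moreover have "Cmp C e (B', l, B) = Cmp C g (B', r, D')"
    using k0 lr by (auto simp: f(3) h(2) sn_simps compose_def fun_eq_iff B'_def S_def)
  ultimately show ?thesis by blast
qed

sublocale base_category C pl neg nul SE
  by unfold_locales (fact ex_zero_space ex_biproduct cok_image SE_coker SE_pullback)+

theorem grothendieck_quasi_abelian_Ind_spaces:
  assumes V: "grothendieck_universe TYPE('v)" and u: "small TYPE('v) (UNIV :: 'u set)"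
    and k: "small TYPE('v) (UNIV :: 'k set)"
  shows "grothendieck_quasi_abelian TYPE('v) (Ind TYPE('v) C)"
proof (rule grothendieck_quasi_abelian_Ind[OF V])
  interpret v: universe "TYPE('v)" by unfold_locales (rule V)
  have S: "small TYPE('v) (UNIV :: ('k, 'u) sn_space set)" by (rule v.small_sn_spaces[OF u k])
  show "small TYPE('v) (Obj C)" by (rule small_subset[OF _ S]) simp
  show "small TYPE('v) (Arr C)"
    by (rule small_subset[OF _ v.small_UNIV_prod[OF S v.small_UNIV_prod[OF v.small_UNIV_fun[OF u u] S]]]) simp
qed

end

theorem proposition1p8:
  assumes "grothendieck_universe TYPE('u)"
    and "grothendieck_universe TYPE('v)"
    and "small TYPE('v) (UNIV :: 'u set)"
  shows "grothendieck_quasi_abelian TYPE('v) (Ind TYPE('v) (SNorm TYPE(real) TYPE('u)))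
    \<and> grothendieck_quasi_abelian TYPE('v) (Ind TYPE('v) (Norm TYPE(real) TYPE('u)))
    \<and> grothendieck_quasi_abelian TYPE('v) (Ind TYPE('v) (Ban TYPE(real) TYPE('u)))
    \<and> grothendieck_quasi_abelian TYPE('v) (Ind TYPE('v) (SNorm TYPE(complex) TYPE('u)))
    \<and> grothendieck_quasi_abelian TYPE('v) (Ind TYPE('v) (Norm TYPE(complex) TYPE('u)))
    \<and> grothendieck_quasi_abelian TYPE('v) (Ind TYPE('v) (Ban TYPE(complex) TYPE('u)))"
proof -
  interpret v: universe "TYPE('v)" by unfold_locales fact
  interpret u: universe "TYPE('u)" by unfold_locales fact
  have *: "seminormed_category TYPE('u) False False" "seminormed_category TYPE('u) True False"
    "seminormed_category TYPE('u) True True"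
    by unfold_locales auto
  \<comment> \<open>With both switches off the predicate \<open>good\<close> is constantly true, and
    the full subcategory is \<open>SNorm\<close> itself.\<close>
  have all: "full_subcat (SNorm TYPE('k::real_normed_field) TYPE('u)) (\<lambda>_. True) = SNorm TYPE('k) TYPE('u)"
    by (simp add: full_subcat_def)
  note good = seminormed_category.good_def[OF *(1), abs_def] seminormed_category.good_def[OF *(2), abs_def]
    seminormed_category.good_def[OF *(3), abs_def]
  note main = seminormed_category.grothendieck_quasi_abelian_Ind_spaces[OF _ assms(2,3)]
  show ?thesis
    using main[OF *(1) v.small_real] main[OF *(2) v.small_real] main[OF *(3) v.small_real]
      main[OF *(1) v.small_complex] main[OF *(2) v.small_complex] main[OF *(3) v.small_complex]
    by (simp add: good Norm_def Ban_def full_subcat_def)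
qed

end
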